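(* Let $n,r\ge1$, $A_{-1}\in\mathbb{R}^{n\times n}$, $B\in\mathbb{R}^{n\times r}$, and let $A_2,A_3$ be $n\times n$ matrix functions on $[-1,0]$ with entries in $L_2([-1,0],\mathbb{C})$. Consider the neutral type system $$\dot z(t)=A_{-1}\dot z(t-1)+\int_{-1}^0A_2(\theta)\dot z(t+\theta)\,d\theta+\int_{-1}^0A_3(\theta)z(t+\theta)\,d\theta+Bu(t)$$ with operator model $\dot x=\mathcal Ax+\mathcal Bu$ on $M_2$ as in the context, and let $\Delta_{\mathcal A}(\lambda)=\lambda I-\lambda e^{-\lambda}A_{-1}-\lambda\int_{-1}^0e^{\lambda s}A_2(s)\,ds-\int_{-1}^0e^{\lambda s}A_3(s)\,ds$. Assume (i) $\operatorname{rank}(\Delta_{\mathcal A}(\lambda)\ \ B)=n$ for every $\lambda\in\mathbb{C}$, and (ii) $\operatorname{rank}(B\ \ A_{-1}B\ \cdots\ A_{-1}^{n-1}B)=n$. Then the system is exactly controllable and its critical time of controllability is $T_0=n_1$, where $n_1$ is the first controllability index of $(A_{-1},B)$: that is, $\mathcal R_T=\mathcal D(\mathcal A)$ for every $T>n_1$ and $\mathcal R_T\neq\mathcal D(\mathcal A)$ for every $T<n_1$.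
   Context: The state space is $M_2=\mathbb{C}^n\times L_2(-1,0;\mathbb{C}^n)$. The operator $\mathcal A$ is defined by $\mathcal A(y,z(\cdot))=\big(Lz,\ \tfrac{d}{d\theta}z\big)$, where $Lz=\int_{-1}^0A_2(\theta)z'(\theta)\,d\theta+\int_{-1}^0A_3(\theta)z(\theta)\,d\theta$, on the domain $\mathcal D(\mathcal A)=\{(y,z(\cdot))\in M_2: z\in H^1(-1,0;\mathbb{C}^n),\ y=z(0)-A_{-1}z(-1)\}$; $\mathcal A$ generates a $C_0$-semigroup $e^{\mathcal At}$ on $M_2$. The control operator is $\mathcal Bu=(Bu,0)$ for $u\in\mathbb{C}^r$. The reachability set from $0$ at time $T$ is $\mathcal R_T=\{\int_0^Te^{\mathcal At}\mathcal Bu(t)\,dt: u\in L_2(0,T;\mathbb{C}^r)\}$. The system is called exactly controllable with critical time $T_0$ if $\mathcal R_T=\mathcal D(\mathcal A)$ for all $T>T_0$ and $\mathcal R_T\neq\mathcal D(\mathcal A)$ for all $T<T_0$. The first controllability index $n_1$ of $(A_{-1},B)$ is the smallest integer $\nu$ with $\operatorname{rank}(B\ \ A_{-1}B\ \cdots\ A_{-1}^{\nu-1}B)=n$. *)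

theory Defs
  imports "HOL-Analysis.Analysis"
begin

section \<open>The state space M2 = C^n x L2(-1,0;C^n), represented by representatives\<close>

type_synonym 'n m2 = "(complex^'n) \<times> (real \<Rightarrow> complex^'n)"

definition L2on :: "real set \<Rightarrow> (real \<Rightarrow> 'a::{banach,second_countable_topology}) \<Rightarrow> bool" where
  "L2on S f \<longleftrightarrow> set_borel_measurable lborel S f \<and> set_integrable lborel S (\<lambda>t. (norm (f t))^2)"

definition M2 :: "'n::finite m2 set" where
  "M2 = {x. L2on {-1..0} (snd x)}"

definition m2_equiv :: "'n::finite m2 \<Rightarrow> 'n m2 \<Rightarrow> bool" where
  "m2_equiv x x' \<longleftrightarrow> fst x = fst x' \<and> (AE \<theta> in lborel. \<theta> \<in> {-1..0} \<longrightarrow> snd x \<theta> = snd x' \<theta>)"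

definition cinner :: "complex^'n::finite \<Rightarrow> complex^'n \<Rightarrow> complex" where
  "cinner v w = (\<Sum>i\<in>UNIV. v$i * cnj (w$i))"

definition m2_inner :: "'n::finite m2 \<Rightarrow> 'n m2 \<Rightarrow> complex" where
  "m2_inner x w = cinner (fst x) (fst w) + (LINT \<theta>:{-1..0}|lborel. cinner (snd x \<theta>) (snd w \<theta>))"

definition m2_norm :: "'n::finite m2 \<Rightarrow> real" where
  "m2_norm x = sqrt ((norm (fst x))^2 + (LINT \<theta>:{-1..0}|lborel. (norm (snd x \<theta>))^2))"

definition m2_add :: "'n::finite m2 \<Rightarrow> 'n m2 \<Rightarrow> 'n m2" where
  "m2_add x w = (fst x + fst w, \<lambda>\<theta>. snd x \<theta> + snd w \<theta>)"

definition m2_smult :: "complex \<Rightarrow> 'n::finite m2 \<Rightarrow> 'n m2" where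
  "m2_smult c x = (c *s fst x, \<lambda>\<theta>. c *s snd x \<theta>)"

definition m2_sub :: "'n::finite m2 \<Rightarrow> 'n m2 \<Rightarrow> 'n m2" where
  "m2_sub x w = m2_add x (m2_smult (-1) w)"

text \<open>H1 data: z = c + int_{-1}^theta g a.e. with g in L2 (the absolutely continuous
  representative of z has z(-1) = c, z(0) = c + int_{-1}^0 g, z' = g), and y = z(0) - A_{-1} z(-1).\<close>
definition dom_data :: "complex^'n^'n \<Rightarrow> 'n::finite m2 \<Rightarrow> complex^'n \<Rightarrow> (real \<Rightarrow> complex^'n) \<Rightarrow> bool" where
  "dom_data Am1 x c g \<longleftrightarrow>
     L2on {-1..0} g \<and>
     (AE \<theta> in lborel. \<theta> \<in> {-1..0} \<longrightarrow> snd x \<theta> = c + (LINT s:{-1..\<theta>}|lborel. g s)) \<and>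
     fst x = (c + (LINT s:{-1..0}|lborel. g s)) - Am1 *v c"

definition domA :: "complex^'n^'n \<Rightarrow> 'n::finite m2 set" where
  "domA Am1 = {x \<in> M2. \<exists>c g. dom_data Am1 x c g}"

text \<open>L z = int A2(theta) z'(theta) + int A3(theta) z(theta).\<close>
definition Lop :: "(real \<Rightarrow> complex^'n^'n) \<Rightarrow> (real \<Rightarrow> complex^'n^'n) \<Rightarrow> (real \<Rightarrow> complex^'n) \<Rightarrow> (real \<Rightarrow> complex^'n) \<Rightarrow> complex^'n::finite" where
  "Lop A2 A3 g z = (LINT \<theta>:{-1..0}|lborel. A2 \<theta> *v g \<theta>) + (LINT \<theta>:{-1..0}|lborel. A3 \<theta> *v z \<theta>)"

definition gen_rel :: "complex^'n^'n \<Rightarrow> (real \<Rightarrow> complex^'n^'n) \<Rightarrow> (real \<Rightarrow> complex^'n^'n) \<Rightarrow> 'n::finite m2 \<Rightarrow> 'n m2 \<Rightarrow> bool" where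
  "gen_rel Am1 A2 A3 x v \<longleftrightarrow> x \<in> M2 \<and> (\<exists>c g. dom_data Am1 x c g \<and> m2_equiv v (Lop A2 A3 g (snd x), g))"

definition is_semigroup_of :: "(real \<Rightarrow> 'n::finite m2 \<Rightarrow> 'n m2) \<Rightarrow> complex^'n^'n \<Rightarrow> (real \<Rightarrow> complex^'n^'n) \<Rightarrow> (real \<Rightarrow> complex^'n^'n) \<Rightarrow> bool" where
  "is_semigroup_of S Am1 A2 A3 \<longleftrightarrow>
     (\<forall>t\<ge>0. \<forall>x\<in>M2. S t x \<in> M2) \<and>
     (\<forall>t\<ge>0. \<forall>x\<in>M2. \<forall>x'. m2_equiv x x' \<longrightarrow> m2_equiv (S t x) (S t x')) \<and>
     (\<forall>t\<ge>0. \<forall>x\<in>M2. \<forall>w\<in>M2. \<forall>a b. m2_equiv (S t (m2_add (m2_smult a x) (m2_smult b w)))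
                                      (m2_add (m2_smult a (S t x)) (m2_smult b (S t w)))) \<and>
     (\<forall>t\<ge>0. \<exists>M. \<forall>x\<in>M2. m2_norm (S t x) \<le> M * m2_norm x) \<and>
     (\<forall>x\<in>M2. m2_equiv (S 0 x) x) \<and>
     (\<forall>t\<ge>0. \<forall>s\<ge>0. \<forall>x\<in>M2. m2_equiv (S (t + s) x) (S t (S s x))) \<and>
     (\<forall>x\<in>M2. \<forall>t0\<ge>0. ((\<lambda>t. m2_norm (m2_sub (S t x) (S t0 x))) \<longlongrightarrow> 0) (at t0 within {0..})) \<and>
     (\<forall>x\<in>M2. \<forall>v\<in>M2.
        ((\<lambda>h. m2_norm (m2_sub (m2_smult (complex_of_real (1 / h)) (m2_sub (S h x) x)) v)) \<longlongrightarrow> 0) (at_right 0)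
        \<longleftrightarrow> gen_rel Am1 A2 A3 x v)"

text \<open>R_T = { int_0^T e^{At} \<B> u(t) dt : u in L2(0,T;C^r) }; the (Bochner) integral in M2 is
  characterised by its pairings with all elements of M2.\<close>
definition reach_set :: "(real \<Rightarrow> 'n::finite m2 \<Rightarrow> 'n m2) \<Rightarrow> complex^'r::finite^'n \<Rightarrow> real \<Rightarrow> 'n m2 set" where
  "reach_set S B T = {x \<in> M2. \<exists>u :: real \<Rightarrow> complex^'r. L2on {0..T} u \<and>
      (\<forall>w\<in>M2. m2_inner x w = (LINT t:{0..T}|lborel. m2_inner (S t (B *v u t, \<lambda>_. 0)) w))}"

definition Delta :: "complex^'n^'n \<Rightarrow> (real \<Rightarrow> complex^'n^'n) \<Rightarrow> (real \<Rightarrow> complex^'n^'n) \<Rightarrow> complex \<Rightarrow> complex^'n::finite^'n" where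
  "Delta Am1 A2 A3 lam = (\<chi> i j. (if i = j then lam else 0) - lam * exp (- lam) * Am1 $ i $ j
      - lam * (LINT s:{-1..0}|lborel. exp (lam * complex_of_real s) * A2 s $ i $ j)
      - (LINT s:{-1..0}|lborel. exp (lam * complex_of_real s) * A3 s $ i $ j))"

definition hcat :: "complex^'n^'m \<Rightarrow> complex^'r^'m \<Rightarrow> complex^('n::finite + 'r::finite)^'m::finite" where
  "hcat M B = (\<chi> i k. case k of Inl j \<Rightarrow> M $ i $ j | Inr j \<Rightarrow> B $ i $ j)"

definition mpow :: "complex^'n^'n \<Rightarrow> nat \<Rightarrow> complex^'n::finite^'n" where
  "mpow A k = ((\<lambda>M. A ** M) ^^ k) (mat 1)"

definition krylov_rank :: "complex^'n^'n \<Rightarrow> complex^'r^'n \<Rightarrow> nat \<Rightarrow> nat" where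
  "krylov_rank A B \<nu> = vec.dim {column j (mpow A k ** B) | k j. k < \<nu>}"

definition ctrb_index :: "complex^'n::finite^'n \<Rightarrow> complex^'r::finite^'n \<Rightarrow> nat" where
  "ctrb_index A B = (LEAST \<nu>. krylov_rank A B \<nu> = CARD('n))"

end

theory Submission
  imports Defs "HOL-Computational_Algebra.Fundamental_Theorem_Algebra"
begin

text \<open>Put \<open>f = z'\<close>, with \<open>f = 0\<close> on negative times. Both distributed delays then merge into one convolution and the controlled
system becomes \<open>f(t) - A f(t - 1) - (K * f)(t) = B u(t)\<close>; the Duhamel formula, proved for smooth \<open>f\<close> directly from the
generator and extended by density, shows that the reachable states are exactly the final history segments of such solutions.

If \<open>T < n\<^sub>1\<close>, some \<open>q \<noteq> 0\<close> is orthogonal to \<open>A^k B\<close> for all \<open>k < n\<^sub>1 - 1\<close>. Iterating the equation expresses \<open>q \<bullet> f\<close> up to time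
\<open>n\<^sub>1 - 1\<close> through convolutions only, so \<open>q \<bullet> z\<close> is \<open>C\<^sup>1\<close> there and a target with a kink in direction \<open>q\<close> is missed.

If \<open>T > n\<^sub>1\<close>, the Krylov condition gives an explicit bounded right inverse for the equation without the convolution.
Approximating \<open>K\<close> by polynomials makes the full map a small perturbation of this one up to finite rank. Hence a linear functional
vanishing on its range, even if only algebraic, is bounded, and by Riesz representation a target that is missed produces
a nonzero \<open>r\<close> with \<open>B\<^sup>T r = 0\<close> on \<open>[0, T]\<close> and \<open>r(t) = A\<^sup>T r(t - 1) + (K\<^sup>T * r)(t) + const\<close> on \<open>[1, T]\<close>.
Since \<open>T > n\<^sub>1\<close>, the modulus of continuity of such an \<open>r\<close> is controlled by its norm, so these functions are determined by their values
on a finite grid. Integral means of \<open>r\<close> solve the same equation on a slightly shorter interval and their derivatives are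
linearly dependent, which produces a solution \<open>e^(\<lambda>t) q\<close>. For it the equation says \<open>\<Delta>(\<lambda>)\<^sup>T q = 0\<close> and \<open>B\<^sup>T q = 0\<close>,
contradicting (i).\<close>

section \<open>Square integrable functions modulo null sets\<close>

text \<open>The statement asks for equality with the domain, not for density. The range of the
  trajectory map is not known to be closed, so a missed target can only be separated from it by an
  algebraic functional; the right inverse, correct up to a small operator and finite rank, is what
  forces that functional to be continuous. A target is encoded as a triple: defect of the controlled
  equation, the value z(T - 1), and z' on [T - 1, T]; the last two determine a state of the domain.
  The multiplier of z(T - 1) becomes the constant of the adjoint equation. That constant has to be
  carried along: the A3 term sees z and not z', so the merged kernel is constant after time 1, and
  shifting a solution changes the constant. It disappears only when the equation for an exponential
  is differenced in time, which also covers \<lambda> = 0. The slack T - n_1 > 0 bounds the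
  admissible shifts in the modulus estimate and pays for the interval length lost in smoothing; the
  finite grid fixes the number of smoothings before their length is chosen.\<close>

definition l2f :: "(real \<Rightarrow> 'a::euclidean_space) \<Rightarrow> bool" where
  "l2f f \<longleftrightarrow> f \<in> borel_measurable borel \<and> integrable lborel (\<lambda>x. (norm (f x))^2)"

lemma l2f_meas: "l2f f \<Longrightarrow> f \<in> borel_measurable borel"
  by (simp add: l2f_def)

lemma l2f_int: "l2f f \<Longrightarrow> integrable lborel (\<lambda>x. (norm (f x))^2)"
  by (simp add: l2f_def)

lemma l2f_bound:
  assumes f: "f \<in> borel_measurable borel" and g: "integrable lborel g"
    and le: "\<And>x. (norm (f x))^2 \<le> g x"
  shows "l2f f"
  unfolding l2f_def
proof
  show "f \<in> borel_measurable borel" by fact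
  show "integrable lborel (\<lambda>x. (norm (f x))^2)"
    by (rule Bochner_Integration.integrable_bound[OF g]) (use f le in \<open>auto intro: order_trans[OF _ abs_ge_self]\<close>)
qed

lemma l2f_add:
  assumes "l2f f" "l2f g" shows "l2f (\<lambda>x. f x + g x)"
proof (rule l2f_bound)
  show "integrable lborel (\<lambda>x. 2 * (norm (f x))^2 + 2 * (norm (g x))^2)"
    using assms by (simp add: l2f_def)
  show "(norm (f x + g x))^2 \<le> 2 * (norm (f x))^2 + 2 * (norm (g x))^2" for x
  proof -
    have "(norm (f x + g x))^2 \<le> (norm (f x) + norm (g x))^2"
      by (intro power_mono norm_triangle_ineq norm_ge_zero)
    also have "\<dots> \<le> 2 * (norm (f x))^2 + 2 * (norm (g x))^2"
      using sum_squares_bound[of "norm (f x)" "norm (g x)"] by (simp add: power2_sum)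
    finally show ?thesis .
  qed
qed (use assms in \<open>auto simp: l2f_def\<close>)

lemma l2f_scaleR: "l2f f \<Longrightarrow> l2f (\<lambda>x. c *\<^sub>R f x)"
  by (auto simp: l2f_def power_mult_distrib)

lemma l2f_zero: "l2f (\<lambda>x. 0)"
  by (simp add: l2f_def)

lemma l2f_uminus: "l2f f \<Longrightarrow> l2f (\<lambda>x. - f x)"
  by (auto simp: l2f_def)

lemma l2f_diff: "l2f f \<Longrightarrow> l2f g \<Longrightarrow> l2f (\<lambda>x. f x - g x)"
  using l2f_add[OF _ l2f_uminus] by fastforce

lemma l2f_norm_mult_integrable:
  assumes "l2f f" "l2f g" shows "integrable lborel (\<lambda>x. norm (f x) * norm (g x))"
proof (rule Bochner_Integration.integrable_bound)
  show "integrable lborel (\<lambda>x. (norm (f x))^2 + (norm (g x))^2)"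
    using assms by (simp add: l2f_def)
  show "AE x in lborel. norm (norm (f x) * norm (g x)) \<le> norm ((norm (f x))^2 + (norm (g x))^2)"
  proof (rule AE_I2)
    fix x
    have "2 * norm (f x) * norm (g x) \<le> (norm (f x))^2 + (norm (g x))^2"
      by (rule sum_squares_bound)
    then have "norm (f x) * norm (g x) \<le> (norm (f x))^2 + (norm (g x))^2"
      using mult_nonneg_nonneg[OF norm_ge_zero[of "f x"] norm_ge_zero[of "g x"]] by linarith
    then show "norm (norm (f x) * norm (g x)) \<le> norm ((norm (f x))^2 + (norm (g x))^2)"
      by simp
  qed
qed (use assms in \<open>auto simp: l2f_def\<close>)

lemma l2f_bilinear_integrable:
  fixes b :: "'a::euclidean_space \<Rightarrow> 'b::euclidean_space \<Rightarrow> 'c::{banach,second_countable_topology}"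
  assumes "l2f f" "l2f g" and m: "(\<lambda>x. b (f x) (g x)) \<in> borel_measurable borel"
    and le: "\<And>x y. norm (b x y) \<le> norm x * norm y"
  shows "integrable lborel (\<lambda>x. b (f x) (g x))"
proof (rule Bochner_Integration.integrable_bound[OF l2f_norm_mult_integrable[OF assms(1,2)]])
  show "AE x in lborel. norm (b (f x) (g x)) \<le> norm (norm (f x) * norm (g x))"
    using le by (auto simp: abs_mult)
qed (use m in simp)

lemma l2f_inner_integrable:
  assumes "l2f f" "l2f g" shows "integrable lborel (\<lambda>x. f x \<bullet> g x)"
  by (rule l2f_bilinear_integrable[OF assms, where b=inner])
     (use assms in \<open>auto simp: l2f_def Cauchy_Schwarz_ineq2\<close>)

lemma l2f_cmul_indicator:
  assumes f: "l2f f" and S: "S \<in> sets borel" shows "l2f (\<lambda>x. indicator S x *\<^sub>R f x)"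
  by (rule l2f_bound[OF _ l2f_int[OF f]]) (use f S in \<open>auto simp: l2f_def indicator_def\<close>)

section \<open>Square integrable functions as a real Hilbert space\<close>

definition l2_rel :: "(real \<Rightarrow> 'a::euclidean_space) \<Rightarrow> (real \<Rightarrow> 'a) \<Rightarrow> bool" where
  "l2_rel f g \<longleftrightarrow> l2f f \<and> l2f g \<and> (AE x in lborel. f x = g x)"

\<comment> \<open>Classes live on the whole line and an interval enters only through an indicator
  factor. One type then serves all time intervals, and translation acts on it as an isometry. The
  quotient is partial because functions failing \<open>l2f\<close> are related to nothing.\<close>
quotient_type (overloaded) 'a l2 = "real \<Rightarrow> 'a::euclidean_space" / partial: l2_rel
  morphisms l2_rep l2_class
proof (rule part_equivpI)
  show "\<exists>x. l2_rel x (x :: real \<Rightarrow> 'a)"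
    by (rule exI[of _ "\<lambda>x. 0"]) (simp add: l2_rel_def l2f_zero)
  show "symp (l2_rel :: (real \<Rightarrow> 'a) \<Rightarrow> _)"
    by (auto simp: symp_def l2_rel_def eq_commute)
  show "transp (l2_rel :: (real \<Rightarrow> 'a) \<Rightarrow> _)"
    unfolding transp_def l2_rel_def by (auto elim: AE_mp)
qed

lemma l2_class_eq_iff: "l2f f \<Longrightarrow> l2f g \<Longrightarrow> l2_class f = l2_class g \<longleftrightarrow> (AE x in lborel. f x = g x)"
  using Quotient3_rel[OF Quotient3_l2, of f g] by (auto simp: l2_rel_def)

lemma l2f_l2_rep[simp]: "l2f (l2_rep x)"
  using Quotient3_rep_reflp[OF Quotient3_l2, of x] by (simp add: l2_rel_def)

lemma l2_class_l2_rep[simp]: "l2_class (l2_rep x) = x"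
  using Quotient3_abs_rep[OF Quotient3_l2] .

lemma AE_l2_rep_l2_class: "l2f f \<Longrightarrow> AE x in lborel. l2_rep (l2_class f) x = f x"
  using l2_class_eq_iff[of "l2_rep (l2_class f)" f] by simp

lemma l2_rep_meas[measurable]: "l2_rep x \<in> borel_measurable borel"
  using l2f_l2_rep[of x] by (simp add: l2f_def)

lemma l2_eqI: "(AE t in lborel. l2_rep x t = l2_rep y t) \<Longrightarrow> x = y"
  using l2_class_eq_iff[of "l2_rep x" "l2_rep y"] by simp

lemma inner_cong_AE:
  assumes "l2f f" "l2f f'" "l2f g" "l2f g'" "AE x in lborel. f x = f' x" "AE x in lborel. g x = g' x"
  shows "(LINT x|lborel. f x \<bullet> g x) = (LINT x|lborel. f' x \<bullet> g' x)"
proof (rule integral_cong_AE)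
  show "AE x in lborel. f x \<bullet> g x = f' x \<bullet> g' x"
    using assms(5,6) by eventually_elim simp
qed (use assms in \<open>auto simp: l2f_def\<close>)

text \<open>The scalar field is the reals: for complex vectors the inner product is the real part of
  the Hermitian one. Functionals obtained from it are real linear, and imaginary parts are recovered
  by pairing with i times a vector.\<close>

instantiation l2 :: (euclidean_space) real_inner
begin

lift_definition zero_l2 :: "'a l2" is "\<lambda>x. 0" by (simp add: l2_rel_def l2f_zero)
lift_definition plus_l2 :: "'a l2 \<Rightarrow> 'a l2 \<Rightarrow> 'a l2" is "\<lambda>f g x. f x + g x"
  unfolding l2_rel_def by (auto intro!: l2f_add elim: AE_mp)
lift_definition minus_l2 :: "'a l2 \<Rightarrow> 'a l2 \<Rightarrow> 'a l2" is "\<lambda>f g x. f x - g x"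
  unfolding l2_rel_def by (auto intro!: l2f_diff elim: AE_mp)
lift_definition uminus_l2 :: "'a l2 \<Rightarrow> 'a l2" is "\<lambda>f x. - f x"
  unfolding l2_rel_def by (auto intro!: l2f_uminus elim: AE_mp)
lift_definition scaleR_l2 :: "real \<Rightarrow> 'a l2 \<Rightarrow> 'a l2" is "\<lambda>c f x. c *\<^sub>R f x"
  unfolding l2_rel_def by (auto intro!: l2f_scaleR elim: AE_mp)
lift_definition inner_l2 :: "'a l2 \<Rightarrow> 'a l2 \<Rightarrow> real" is "\<lambda>f g. LINT x|lborel. f x \<bullet> g x"
  unfolding l2_rel_def by (intro inner_cong_AE) auto

definition norm_l2 :: "'a l2 \<Rightarrow> real" where "norm_l2 x = sqrt (inner x x)"
definition dist_l2 :: "'a l2 \<Rightarrow> 'a l2 \<Rightarrow> real" where "dist_l2 x y = norm (x - y)"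
definition sgn_l2 :: "'a l2 \<Rightarrow> 'a l2" where "sgn_l2 x = scaleR (inverse (norm x)) x"
definition uniformity_l2 :: "('a l2 \<times> 'a l2) filter"
  where "uniformity_l2 = (INF e\<in>{0 <..}. principal {(x, y). dist x y < e})"
definition open_l2 :: "'a l2 set \<Rightarrow> bool"
  where "open_l2 U = (\<forall>x\<in>U. \<forall>\<^sub>F (x', y) in uniformity. x' = x \<longrightarrow> y \<in> U)"

instance
proof
  fix x y z :: "'a l2" and a b :: real
  show "x + y + z = x + (y + z)"
    by transfer (simp add: l2_rel_def add.assoc l2f_add)
  show "x + y = y + x"
    by transfer (simp add: l2_rel_def add.commute l2f_add)
  show "0 + x = x"
    by transfer (simp add: l2_rel_def )
  show "- x + x = 0"
    by transfer (simp add: l2_rel_def l2f_zero)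
  show "x - y = x + - y"
    by transfer (simp add: l2_rel_def l2f_diff)
  show "a *\<^sub>R (x + y) = a *\<^sub>R x + a *\<^sub>R y"
    by transfer (simp add: l2_rel_def scaleR_add_right l2f_add l2f_scaleR)
  show "(a + b) *\<^sub>R x = a *\<^sub>R x + b *\<^sub>R x"
    by transfer (simp add: l2_rel_def scaleR_add_left l2f_add l2f_scaleR)
  show "a *\<^sub>R b *\<^sub>R x = (a * b) *\<^sub>R x"
    by transfer (simp add: l2_rel_def l2f_scaleR)
  show "1 *\<^sub>R x = x"
    by transfer (simp add: l2_rel_def )
  show "dist x y = norm (x - y)" by (rule dist_l2_def)
  show "sgn x = scaleR (inverse (norm x)) x" by (rule sgn_l2_def)
  show "uniformity = (INF e\<in>{0 <..}. principal {(x::'a l2, y). dist x y < e})" by (rule uniformity_l2_def)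
  show "open U = (\<forall>x\<in>U. \<forall>\<^sub>F (x', y) in uniformity. x' = x \<longrightarrow> y \<in> U)" for U :: "'a l2 set"
    by (rule open_l2_def)
  show "inner x y = inner y x"
  proof (transfer, rule Bochner_Integration.integral_cong[OF refl])
    fix f g :: "real \<Rightarrow> 'a" and t :: real
    show "f t \<bullet> g t = g t \<bullet> f t" by (rule inner_commute)
  qed
  show "inner (x + y) z = inner x z + inner y z"
  proof transfer
    fix f g h :: "real \<Rightarrow> 'a"
    assume "l2_rel f f" "l2_rel g g" "l2_rel h h"
    then show "(LINT t|lborel. (f t + g t) \<bullet> h t) = (LINT t|lborel. f t \<bullet> h t) + (LINT t|lborel. g t \<bullet> h t)"
      by (simp add: l2_rel_def inner_add_left l2f_inner_integrable)
  qed
  show "inner (a *\<^sub>R x) y = a * inner x y"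
    by (transfer, unfold inner_scaleR_left, rule integral_mult_right_zero)
  show "0 \<le> inner x x" 
    by (transfer, rule Bochner_Integration.integral_nonneg, rule inner_ge_zero)
  show "(inner x x = 0) = (x = 0)"
  proof transfer
    fix f :: "real \<Rightarrow> 'a"
    assume "l2_rel f f"
    then have f: "l2f f" by (simp add: l2_rel_def)
    have "(LINT t|lborel. f t \<bullet> f t) = 0 \<longleftrightarrow> (AE t in lborel. f t \<bullet> f t = 0)"
      by (rule integral_nonneg_eq_0_iff_AE[OF l2f_inner_integrable[OF f f]]) simp
    then show "((LINT t|lborel. f t \<bullet> f t) = 0) = l2_rel f (\<lambda>x. 0)"
      by (simp add: l2_rel_def l2f_zero f)
  qed
  show "norm x = sqrt (inner x x)" by (rule norm_l2_def)
qed

end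

lemma l2_class_add: "l2f f \<Longrightarrow> l2f g \<Longrightarrow> l2_class f + l2_class g = l2_class (\<lambda>x. f x + g x)"
  by (rule plus_l2.abs_eq) (auto simp: l2_rel_def)
lemma l2_class_diff: "l2f f \<Longrightarrow> l2f g \<Longrightarrow> l2_class f - l2_class g = l2_class (\<lambda>x. f x - g x)"
  by (rule minus_l2.abs_eq) (auto simp: l2_rel_def)
lemma l2_class_scaleR: "l2f f \<Longrightarrow> c *\<^sub>R l2_class f = l2_class (\<lambda>x. c *\<^sub>R f x)"
  by (rule scaleR_l2.abs_eq) (auto simp: l2_rel_def)
lemma inner_l2_class: "l2f f \<Longrightarrow> l2f g \<Longrightarrow> inner (l2_class f) (l2_class g) = (LINT x|lborel. f x \<bullet> g x)"
  by (rule inner_l2.abs_eq) (auto simp: l2_rel_def)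
lemma norm_l2_class_sq: "l2f f \<Longrightarrow> (norm (l2_class f))\<^sup>2 = (LINT x|lborel. (norm (f x))\<^sup>2)"
  by (simp add: power2_norm_eq_inner inner_l2_class)
lemma norm_l2_class: "l2f f \<Longrightarrow> norm (l2_class f) = sqrt (LINT x|lborel. (norm (f x))\<^sup>2)"
  using norm_l2_class_sq real_sqrt_unique by (metis norm_ge_zero)
lemma zero_l2_l2_class: "0 = l2_class (\<lambda>x. 0)"
  by (rule zero_l2.abs_eq)

lemma l2_rep_add: "AE t in lborel. l2_rep (x + y) t = l2_rep x t + l2_rep y t"
  using AE_l2_rep_l2_class[OF l2f_add[OF l2f_l2_rep l2f_l2_rep], of x y] l2_class_add[of "l2_rep x" "l2_rep y"] by simp
lemma l2_rep_scaleR: "AE t in lborel. l2_rep (c *\<^sub>R x) t = c *\<^sub>R l2_rep x t"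
  using AE_l2_rep_l2_class[OF l2f_scaleR[OF l2f_l2_rep], of c x] l2_class_scaleR[of "l2_rep x" c] by simp
lemma norm_l2_class_le:
  assumes "l2f f" "l2f g" "AE x in lborel. norm (f x) \<le> norm (g x)"
  shows "norm (l2_class f) \<le> norm (l2_class g)"
  unfolding norm_l2_class[OF assms(1)] norm_l2_class[OF assms(2)]
  by (intro real_sqrt_le_mono integral_mono_AE l2f_int assms) (use assms(3) in \<open>auto intro: power_mono elim!: eventually_mono\<close>)

section \<open>Cauchy-Schwarz and completeness\<close>

lemma l2_Cauchy_Schwarz:
  assumes f: "l2f f" and g: "l2f g"
  shows "(LINT x|lborel. norm (f x) * norm (g x)) \<le> norm (l2_class f) * norm (l2_class g)"
proof -
  have f': "l2f (\<lambda>x. norm (f x))" and g': "l2f (\<lambda>x. norm (g x))"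
    using f g by (auto simp: l2f_def)
  have "(LINT x|lborel. norm (f x) * norm (g x)) = inner (l2_class (\<lambda>x. norm (f x))) (l2_class (\<lambda>x. norm (g x)))"
    using f' g' by (simp add: inner_l2_class)
  also have "\<dots> \<le> norm (l2_class (\<lambda>x. norm (f x))) * norm (l2_class (\<lambda>x. norm (g x)))"
    by (rule norm_cauchy_schwarz)
  also have "\<dots> = norm (l2_class f) * norm (l2_class g)"
    using f g f' g' by (simp add: norm_l2_class)
  finally show ?thesis .
qed

text \<open>Weighting by a strictly positive integrable \<open>h\<close> turns an L2 Cauchy sequence
  into an L1 Cauchy sequence, for which a subsequence converges almost everywhere. Dividing by
  \<open>h\<close> gives the pointwise limit, and Fatou's lemma upgrades it to convergence in
  norm.\<close>

lemma l2_complete: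
  fixes X :: "nat \<Rightarrow> 'a::euclidean_space l2"
  assumes C: "Cauchy X"
  shows "convergent X"
proof -
  have sf: "sigma_finite_measure (lborel :: real measure)" by (rule lborel.sigma_finite_measure_axioms)
  obtain h :: "real \<Rightarrow> real" where h: "h \<in> borel_measurable lborel" "\<And>x. 0 < h x" "\<And>x. h x \<le> 1" "integrable lborel h"
    using sigma_finite_measure.obtain_positive_integrable_function[OF sf, of thesis] by blast
  \<comment> \<open>From 0 < h \<le> 1 the square is dominated by \<open>h\<close>, so
    \<open>h\<close> can serve as a factor in Cauchy-Schwarz.\<close>
  have hl: "l2f h"
  proof (rule l2f_bound[OF _ h(4)])
    show "(norm (h x))\<^sup>2 \<le> h x" for x
      using h(2)[of x] h(3)[of x] by (simp add: power2_eq_square mult_left_le)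
  qed (use h in simp)
  have si: "integrable lborel (\<lambda>x. h x *\<^sub>R l2_rep (X n) x)" for n
    by (rule l2f_bilinear_integrable[OF hl l2f_l2_rep, where b=scaleR]) (use h in auto)
  have "\<exists>N. \<forall>i\<ge>N. \<forall>j\<ge>N. (LINT x|lborel. norm (h x *\<^sub>R l2_rep (X i) x - h x *\<^sub>R l2_rep (X j) x)) < e" if e: "e > 0" for e
  proof -
    define e' where "e' = e / (norm (l2_class h) + 1)"
    have e': "e' > 0" using e by (simp add: e'_def add_nonneg_pos)
    obtain N where N: "\<And>i j. i \<ge> N \<Longrightarrow> j \<ge> N \<Longrightarrow> norm (X i - X j) < e'"
      using CauchyD[OF C e'] by blast
    have "(LINT x|lborel. norm (h x *\<^sub>R l2_rep (X i) x - h x *\<^sub>R l2_rep (X j) x)) < e" if ij: "i \<ge> N" "j \<ge> N" for i j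
    proof -
      have "(LINT x|lborel. norm (h x *\<^sub>R l2_rep (X i) x - h x *\<^sub>R l2_rep (X j) x))
          = (LINT x|lborel. norm (h x) * norm (l2_rep (X i) x - l2_rep (X j) x))"
        by (simp add: scaleR_right_diff_distrib[symmetric] del: scaleR_right_diff_distrib)
      also have "\<dots> \<le> norm (l2_class h) * norm (l2_class (\<lambda>x. l2_rep (X i) x - l2_rep (X j) x))"
        by (rule l2_Cauchy_Schwarz[OF hl l2f_diff]) auto
      also have "l2_class (\<lambda>x. l2_rep (X i) x - l2_rep (X j) x) = X i - X j"
        using l2_class_diff[of "l2_rep (X i)" "l2_rep (X j)"] by simp
      also have "norm (l2_class h) * norm (X i - X j) \<le> norm (l2_class h) * e'"
        using N[OF ij] by (intro mult_left_mono) auto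
      also have "\<dots> < (norm (l2_class h) + 1) * e'" using e' by (simp add: algebra_simps)
      also have "\<dots> = e" unfolding e'_def using norm_ge_zero[of "l2_class h"] by (simp add: add_nonneg_eq_0_iff)
      finally show ?thesis .
    qed
    then show ?thesis by blast
  qed
  note cau = this
  obtain r where r: "strict_mono r" and ae: "AE x in lborel. Cauchy (\<lambda>i. h x *\<^sub>R l2_rep (X (r i)) x)"
    by (rule cauchy_L1_AE_cauchy_subseq[of lborel "\<lambda>n x. h x *\<^sub>R l2_rep (X n) x"]) (rule si, rule cau, assumption, blast)
  define f where "f x = lim (\<lambda>i. l2_rep (X (r i)) x)" for x
  have fm[measurable]: "f \<in> borel_measurable borel"
    unfolding f_def by (intro borel_measurable_lim_metric l2_rep_meas)
  have conv: "AE x in lborel. (\<lambda>i. l2_rep (X (r i)) x) \<longlonglongrightarrow> f x"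
    using ae
  proof eventually_elim
    case (elim x)
    have "convergent (\<lambda>i. h x *\<^sub>R l2_rep (X (r i)) x)" using elim by (simp add: Cauchy_convergent)
    then obtain l where "(\<lambda>i. h x *\<^sub>R l2_rep (X (r i)) x) \<longlonglongrightarrow> l" by (auto simp: convergent_def)
    then have "(\<lambda>i. (1 / h x) *\<^sub>R h x *\<^sub>R l2_rep (X (r i)) x) \<longlonglongrightarrow> (1 / h x) *\<^sub>R l"
      by (intro tendsto_intros)
    then have "(\<lambda>i. l2_rep (X (r i)) x) \<longlonglongrightarrow> (1 / h x) *\<^sub>R l" using h(2)[of x] by simp
    then show ?case unfolding f_def using limI by metis
  qed
  \<comment> \<open>Fatou along the subsequence: \<open>f - X n\<close> inherits every norm bound
    that holds for \<open>X i - X n\<close> with all later i.\<close>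
  have key: "l2f (\<lambda>x. f x - l2_rep (X n) x) \<and> norm (l2_class (\<lambda>x. f x - l2_rep (X n) x)) \<le> e"
    if e: "e > 0" and n: "\<And>i. i \<ge> n \<Longrightarrow> norm (X i - X n) \<le> e" for n e
  proof -
    have "(\<integral>\<^sup>+x. ennreal ((norm (f x - l2_rep (X n) x))\<^sup>2) \<partial>lborel)
        = (\<integral>\<^sup>+x. liminf (\<lambda>i. ennreal ((norm (l2_rep (X (r i)) x - l2_rep (X n) x))\<^sup>2)) \<partial>lborel)"
    proof (rule nn_integral_cong_AE)
      show "AE x in lborel. ennreal ((norm (f x - l2_rep (X n) x))\<^sup>2)
         = liminf (\<lambda>i. ennreal ((norm (l2_rep (X (r i)) x - l2_rep (X n) x))\<^sup>2))"
        using conv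
      proof eventually_elim
        case (elim x)
        have "(\<lambda>i. ennreal ((norm (l2_rep (X (r i)) x - l2_rep (X n) x))\<^sup>2)) \<longlonglongrightarrow> ennreal ((norm (f x - l2_rep (X n) x))\<^sup>2)"
          by (intro tendsto_intros elim)
        then show ?case using lim_imp_Liminf[OF trivial_limit_sequentially] by metis
      qed
    qed
    also have "\<dots> \<le> liminf (\<lambda>i. \<integral>\<^sup>+x. ennreal ((norm (l2_rep (X (r i)) x - l2_rep (X n) x))\<^sup>2) \<partial>lborel)"
      by (intro nn_integral_liminf) auto
    also have "\<dots> \<le> ennreal (e\<^sup>2)"
    proof (rule Liminf_le)
      show "\<forall>\<^sub>F i in sequentially. (\<integral>\<^sup>+x. ennreal ((norm (l2_rep (X (r i)) x - l2_rep (X n) x))\<^sup>2) \<partial>lborel) \<le> ennreal (e\<^sup>2)"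
        using eventually_ge_at_top[of n]
      proof eventually_elim
        case (elim i)
        have ri: "r i \<ge> n" using seq_suble[OF r, of i] elim by linarith
        have l: "l2f (\<lambda>x. l2_rep (X (r i)) x - l2_rep (X n) x)" by (simp add: l2f_diff)
        have "(\<integral>\<^sup>+x. ennreal ((norm (l2_rep (X (r i)) x - l2_rep (X n) x))\<^sup>2) \<partial>lborel)
            = ennreal ((norm (l2_class (\<lambda>x. l2_rep (X (r i)) x - l2_rep (X n) x)))\<^sup>2)"
          unfolding norm_l2_class_sq[OF l] by (intro nn_integral_eq_integral l2f_int l) auto
        also have "l2_class (\<lambda>x. l2_rep (X (r i)) x - l2_rep (X n) x) = X (r i) - X n"
          using l2_class_diff[of "l2_rep (X (r i))" "l2_rep (X n)"] by simp
        also have "ennreal ((norm (X (r i) - X n))\<^sup>2) \<le> ennreal (e\<^sup>2)"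
          using n[OF ri] by (intro ennreal_leI power_mono) auto
        finally show ?case .
      qed
    qed simp
    finally have fin: "(\<integral>\<^sup>+x. ennreal ((norm (f x - l2_rep (X n) x))\<^sup>2) \<partial>lborel) \<le> ennreal (e\<^sup>2)" .
    have l: "l2f (\<lambda>x. f x - l2_rep (X n) x)"
      unfolding l2f_def
    proof
      show "integrable lborel (\<lambda>x. (norm (f x - l2_rep (X n) x))\<^sup>2)"
        using fin by (intro integrableI_bounded) (auto simp: top_unique intro: le_less_trans)
    qed auto
    have "ennreal ((norm (l2_class (\<lambda>x. f x - l2_rep (X n) x)))\<^sup>2) \<le> ennreal (e\<^sup>2)"
      unfolding norm_l2_class_sq[OF l] using fin nn_integral_eq_integral[OF l2f_int[OF l]] by simp
    then have "(norm (l2_class (\<lambda>x. f x - l2_rep (X n) x)))\<^sup>2 \<le> e\<^sup>2" by (simp add: ennreal_le_iff)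
    then have "norm (l2_class (\<lambda>x. f x - l2_rep (X n) x)) \<le> e" using e by (simp add: power2_le_iff_abs_le)
    then show ?thesis using l by blast
  qed
  obtain N0 where N0: "\<And>i j. i \<ge> N0 \<Longrightarrow> j \<ge> N0 \<Longrightarrow> norm (X i - X j) < 1"
    using CauchyD[OF C, of 1] by auto
  have "l2f (\<lambda>x. f x - l2_rep (X N0) x)" using key[of 1 N0] N0 by (simp add: less_imp_le)
  from l2f_add[OF this l2f_l2_rep[of "X N0"]] have lf: "l2f f" by simp
  have "X \<longlonglongrightarrow> l2_class f"
  proof (rule LIMSEQ_I)
    fix e :: real assume e: "e > 0"
    obtain N where N: "\<And>i j. i \<ge> N \<Longrightarrow> j \<ge> N \<Longrightarrow> norm (X i - X j) < e / 2"
      using CauchyD[OF C, of "e/2"] e by auto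
    have "norm (X n - l2_class f) < e" if "n \<ge> N" for n
    proof -
      have "norm (l2_class (\<lambda>x. f x - l2_rep (X n) x)) \<le> e / 2"
        using key[of "e/2" n] N that e by (simp add: less_imp_le)
      also have "l2_class (\<lambda>x. f x - l2_rep (X n) x) = l2_class f - X n"
        using l2_class_diff[OF lf, of "l2_rep (X n)"] by simp
      finally show ?thesis using e by (simp add: norm_minus_commute)
    qed
    then show "\<exists>N. \<forall>n\<ge>N. norm (X n - l2_class f) < e" by blast
  qed
  then show "convergent X" by (auto simp: convergent_def)
qed

instance l2 :: (euclidean_space) complete_space
  by standard (rule l2_complete)

section \<open>Riesz representation, uniform boundedness, operators on functions\<close>

text \<open>The representing vector minimises the energy \<open>J\<close>. The parallelogram
  identity makes minimising sequences Cauchy, and at a minimiser the first variation in direction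
  \<open>x\<close> identifies \<open>f x\<close> with the inner product.\<close>

theorem l2_riesz:
  fixes f :: "'a::{real_inner,complete_space} \<Rightarrow> real"
  assumes f: "bounded_linear f"
  shows "\<exists>y. \<forall>x. f x = inner y x"
proof -
  interpret bounded_linear f by fact
  obtain C where C: "\<And>x. \<bar>f x\<bar> \<le> norm x * C" using bounded by auto
  define J where "J x = (norm x)\<^sup>2 - 2 * f x" for x
  define m where "m = Inf (range J)"
  have lb: "- (C\<^sup>2) \<le> J x" for x
  proof -
    have "0 \<le> (norm x - C)\<^sup>2" by simp
    then show ?thesis using C[of x] unfolding J_def by (simp add: power2_diff)
  qed
  have bdd: "bdd_below (range J)" by (rule bdd_belowI[of _ "- (C\<^sup>2)"]) (use lb in auto)
  have mle: "m \<le> J x" for x unfolding m_def by (rule cInf_lower[OF _ bdd]) simp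
  have par: "(norm (x - y))\<^sup>2 \<le> 2 * (J x + J y) - 4 * m" for x y
  proof -
    have "J ((1/2) *\<^sub>R (x + y)) = (J x + J y) / 2 - (norm (x - y))\<^sup>2 / 4"
      unfolding J_def by (simp add: scaleR add power2_norm_eq_inner algebra_simps inner_commute add_divide_distrib diff_divide_distrib)
    then show ?thesis using mle[of "(1/2) *\<^sub>R (x + y)"] by (simp add: field_simps)
  qed
  have "\<exists>x. J x < m + 1 / real (Suc n)" for n
  proof -
    have "Inf (range J) < m + 1 / real (Suc n)" unfolding m_def by simp
    then show ?thesis using cInf_less_iff[OF _ bdd] by auto
  qed
  then obtain X where X: "\<And>n. J (X n) < m + 1 / real (Suc n)" by metis
  have "Cauchy X"
  proof (rule CauchyI)
    fix e :: real assume e: "e > 0"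
    obtain N :: nat where N: "real N > 4 / e\<^sup>2" using reals_Archimedean2 by blast
    have "norm (X i - X j) < e" if ij: "i \<ge> N" "j \<ge> N" for i j
    proof -
      have b: "J (X k) < m + e\<^sup>2 / 4" if "k \<ge> N" for k
      proof -
        have "4 / e\<^sup>2 < real (Suc k)" using N that by simp
        then have "1 / real (Suc k) < e\<^sup>2 / 4" using e by (simp add: field_simps del: of_nat_Suc)
        then show ?thesis using X[of k] by (simp del: of_nat_Suc)
      qed
      have "(norm (X i - X j))\<^sup>2 < e\<^sup>2"
        using par[of "X i" "X j"] add_strict_mono[OF b[OF ij(1)] b[OF ij(2)]] by argo
      then show ?thesis using e by (simp add: power2_less_imp_less)
    qed
    then show "\<exists>M. \<forall>m\<ge>M. \<forall>n\<ge>M. norm (X m - X n) < e" by blast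
  qed
  then obtain y where y: "X \<longlonglongrightarrow> y" using Cauchy_convergent by (auto simp: convergent_def)
  have "(\<lambda>n. J (X n)) \<longlonglongrightarrow> J y" unfolding J_def by (intro tendsto_intros y tendsto)
  moreover have "(\<lambda>n. m + 1 / real (Suc n)) \<longlonglongrightarrow> m + 0"
    by (intro tendsto_intros LIMSEQ_Suc lim_const_over_n)
  ultimately have Jy: "J y \<le> m"
    using X by (auto intro: LIMSEQ_le[where X="\<lambda>n. J (X n)"] less_imp_le)
  have "f x = inner y x" for x
  proof (cases "x = 0")
    case False
    define d where "d = inner y x - f x"
    \<comment> \<open>The minimiser of the quadratic 2 t d + t^2 |x|^2. Its value there is -d^2 /
      |x|^2, which forces d = 0.\<close>
    define t where "t = - d / (norm x)\<^sup>2"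
    have n: "(norm x)\<^sup>2 > 0" using False by simp
    have "J y \<le> J (y + t *\<^sub>R x)" using Jy mle order_trans by blast
    also have "\<dots> = J y + 2 * t * d + t\<^sup>2 * (norm x)\<^sup>2"
      unfolding J_def d_def power2_norm_eq_inner
      by (simp add: scaleR add inner_add_left inner_add_right algebra_simps power2_eq_square inner_commute)
    finally have "0 \<le> 2 * t * d + t\<^sup>2 * (norm x)\<^sup>2" by simp
    also have "\<dots> = - (d\<^sup>2) / (norm x)\<^sup>2"
      unfolding t_def using n by (simp add: field_simps power2_eq_square)
    finally have "d\<^sup>2 / (norm x)\<^sup>2 \<le> 0" by simp
    then have "d\<^sup>2 \<le> 0" using n by (simp add: divide_le_0_iff)
    then show ?thesis by (simp add: d_def)
  qed simp
  then show ?thesis by blast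
qed

text \<open>Baire category: if all the open sets \<open>U n\<close> were dense, a common point would
  contradict pointwise boundedness. A ball missed by the closure of some \<open>U n\<close> bounds
  the family on that ball, and rescaling gives the norm bound.\<close>

theorem banach_steinhaus:
  fixes T :: "'i \<Rightarrow> 'a::{real_normed_vector,complete_space} \<Rightarrow> 'b::real_normed_vector"
  assumes lin: "\<And>i. i \<in> I \<Longrightarrow> bounded_linear (T i)"
    and pt: "\<And>x. \<exists>M. \<forall>i\<in>I. norm (T i x) \<le> M"
  shows "\<exists>C\<ge>0. \<forall>i\<in>I. \<forall>x. norm (T i x) \<le> C * norm x"
proof -
  define U where "U n = (\<Union>i\<in>I. {x. norm (T i x) > real n})" for n :: nat
  have opn: "open (U n)" for n
    unfolding U_def
    by (intro open_UN ballI open_Collect_less continuous_intros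
        linear_continuous_on lin)
  have "\<exists>n. closure (U n) \<noteq> UNIV"
  proof (rule ccontr)
    assume "\<not> ?thesis"
    then have cl: "closure (U n) = UNIV" for n by blast
    have "euclidean closure_of \<Inter>(range U) = topspace euclidean"
      by (rule Baire_category) (auto simp: completely_metrizable_space_euclidean opn cl)
    then have "closure (\<Inter>(range U)) = UNIV" by simp
    then have "\<Inter>(range U) \<noteq> {}" by auto
    then obtain x where x: "\<And>n. x \<in> U n" by blast
    obtain M where M: "\<forall>i\<in>I. norm (T i x) \<le> M" using pt by blast
    obtain n :: nat where "M < real n" using reals_Archimedean2 by blast
    with x[of n] M show False by (force simp: U_def)
  qed
  then obtain n x0 where "x0 \<notin> closure (U n)" by blast
  then have "x0 \<in> - closure (U n)" "open (- closure (U n))" by auto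
  then obtain r where "r > 0" "ball x0 r \<subseteq> - closure (U n)"
    using open_contains_ball by blast
  then have r: "r > 0" "ball x0 r \<inter> U n = {}" using closure_subset[of "U n"] by auto
  have "norm (T i x) \<le> (4 * real n / r) * norm x" if i: "i \<in> I" for i x
  proof (cases "x = 0")
    case True
    interpret bounded_linear "T i" by (rule lin[OF i])
    show ?thesis using True zero by simp
  next
    case False
    interpret bounded_linear "T i" by (rule lin[OF i])
    \<comment> \<open>Scaled to norm r / 2, so x0 + y stays in the ball. The difference of two
      values bounded by n costs 2 n, whence the constant 4 n / r.\<close>
    define y where "y = (r / (2 * norm x)) *\<^sub>R x"
    have ny: "norm y = r / 2" using False r by (simp add: y_def)
    have "x0 + y \<in> ball x0 r" "x0 \<in> ball x0 r" using ny r by (auto simp: dist_norm)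
    then have b: "norm (T i (x0 + y)) \<le> n" "norm (T i x0) \<le> n"
      using r(2) i by (auto simp: U_def disjoint_iff not_less)
    have "norm (T i y) = norm (T i (x0 + y) - T i x0)" by (simp add: add)
    also have "\<dots> \<le> 2 * n" using norm_triangle_ineq4[of "T i (x0 + y)" "T i x0"] b by simp
    finally have "(r / (2 * norm x)) * norm (T i x) \<le> 2 * n"
      unfolding y_def scaleR using r by simp
    then show ?thesis using False r by (simp add: field_simps)
  qed
  moreover have "4 * real n / r \<ge> 0" using r by simp
  ultimately show ?thesis by blast
qed

section \<open>Translation, reflection and restriction on the line\<close>

lemma AE_shift: "(AE t in lborel. P t) \<Longrightarrow> (AE t in lborel. P (t + a :: real))"
proof -
  assume "AE t in lborel. P t"
  then have "AE t in distr lborel borel ((+) a). P t" by (subst lborel_distr_plus)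
  from AE_distrD[OF _ this] show ?thesis by (simp add: add.commute)
qed

lemma AE_reflect: "(AE t in lborel. P t) \<Longrightarrow> (AE t in lborel. P (a - t :: real))"
proof -
  assume "AE t in lborel. P t"
  then have "AE t in lborel. P (t + a)" by (rule AE_shift)
  then have "AE t in distr lborel borel uminus. P (t + a)" by (subst lborel_distr_uminus)
  from AE_distrD[OF _ this] show ?thesis by (simp add: add.commute)
qed

lemma lint_shift:
  fixes f :: "real \<Rightarrow> 'a::euclidean_space"
  shows "(LINT t|lborel. f (t + a)) = (LINT t|lborel. f t)"
  using lborel_integral_real_affine[of 1 f a] by (simp add: add.commute)

lemma lint_reflect:
  fixes f :: "real \<Rightarrow> 'a::euclidean_space"
  shows "(LINT t|lborel. f (a - t)) = (LINT t|lborel. f t)"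
  using lborel_integral_real_affine[of "-1" f a] by simp

lemma int_shift:
  fixes f :: "real \<Rightarrow> 'a::euclidean_space"
  shows "integrable lborel f \<Longrightarrow> integrable lborel (\<lambda>t. f (t + a))"
  using lborel_integrable_real_affine_iff[of 1 f a] by (simp add: add.commute)

lemma int_reflect:
  fixes f :: "real \<Rightarrow> 'a::euclidean_space"
  shows "integrable lborel f \<Longrightarrow> integrable lborel (\<lambda>t. f (a - t))"
  using lborel_integrable_real_affine_iff[of "-1" f a] by simp

lemma l2f_shift: "l2f f \<Longrightarrow> l2f (\<lambda>t. f (t + a))"
  unfolding l2f_def using int_shift[of "\<lambda>x. (norm (f x))\<^sup>2" a] by auto

lemma l2f_shift': "l2f f \<Longrightarrow> l2f (\<lambda>t. f (t - a))"
  using l2f_shift[of f "-a"] by simp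

lemma l2f_reflect: "l2f f \<Longrightarrow> l2f (\<lambda>t. f (a - t))"
  unfolding l2f_def using int_reflect[of "\<lambda>x. (norm (f x))\<^sup>2" a] by auto

lemma l2f_blin:
  assumes f: "l2f f" and L: "bounded_linear L" shows "l2f (\<lambda>t. L (f t))"
proof -
  obtain K where K: "K > 0" "\<And>x. norm (L x) \<le> norm x * K" using bounded_linear.pos_bounded[OF L] by blast
  show ?thesis
  proof (rule l2f_bound)
    show "integrable lborel (\<lambda>t. K\<^sup>2 * (norm (f t))\<^sup>2)" using l2f_int[OF f] by simp
    show "(norm (L (f t)))\<^sup>2 \<le> K\<^sup>2 * (norm (f t))\<^sup>2" for t
      using power_mono[OF K(2)[of "f t"] norm_ge_zero, of 2] by (simp add: power_mult_distrib mult.commute)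
    show "(\<lambda>t. L (f t)) \<in> borel_measurable borel"
      by (rule borel_measurable_continuous_on[OF linear_continuous_on[OF L] l2f_meas[OF f]])
  qed
qed

definition shift_l2 :: "real \<Rightarrow> 'a::euclidean_space l2 \<Rightarrow> 'a l2" where
  "shift_l2 a x = l2_class (\<lambda>t. l2_rep x (t - a))"
definition restrict_l2 :: "real set \<Rightarrow> 'a::euclidean_space l2 \<Rightarrow> 'a l2" where
  "restrict_l2 S x = l2_class (\<lambda>t. indicator S t *\<^sub>R l2_rep x t)"
lemma l2_rep_shift_l2: "AE t in lborel. l2_rep (shift_l2 a x) t = l2_rep x (t - a)"
  unfolding shift_l2_def by (rule AE_l2_rep_l2_class[OF l2f_shift'[OF l2f_l2_rep]])
lemma l2_rep_restrict_l2: "S \<in> sets borel \<Longrightarrow> AE t in lborel. l2_rep (restrict_l2 S x) t = indicator S t *\<^sub>R l2_rep x t"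
  unfolding restrict_l2_def by (intro AE_l2_rep_l2_class l2f_cmul_indicator l2f_l2_rep)
lemma shift_l2_l2_class: assumes "l2f f" shows "shift_l2 a (l2_class f) = l2_class (\<lambda>t. f (t - a))"
proof -
  have "AE t in lborel. l2_rep (l2_class f) (t - a) = f (t - a)" using AE_shift[OF AE_l2_rep_l2_class[OF assms], of "-a"] by simp
  then show ?thesis unfolding shift_l2_def using assms by (subst l2_class_eq_iff) (auto intro: l2f_shift')
qed
lemma restrict_l2_l2_class: assumes "l2f f" "S \<in> sets borel" shows "restrict_l2 S (l2_class f) = l2_class (\<lambda>t. indicator S t *\<^sub>R f t)"
  unfolding restrict_l2_def using AE_l2_rep_l2_class[OF assms(1)] assms by (subst l2_class_eq_iff) (auto intro: l2f_cmul_indicator)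
lemma norm_l2_rep: "(norm x)\<^sup>2 = (LINT t|lborel. (norm (l2_rep x t))\<^sup>2)"
  using norm_l2_class_sq[OF l2f_l2_rep, of x] by simp

lemma norm_shift_l2[simp]: "norm (shift_l2 a x) = norm x"
proof -
  have "(norm (shift_l2 a x))\<^sup>2 = (LINT t|lborel. (norm (l2_rep x (t - a)))\<^sup>2)"
    unfolding shift_l2_def by (rule norm_l2_class_sq) (simp add: l2f_shift')
  also have "\<dots> = (norm x)\<^sup>2"
    unfolding norm_l2_rep using lint_shift[of "\<lambda>t. (norm (l2_rep x t))\<^sup>2" "-a"] by simp
  finally show ?thesis by simp
qed

lemma bounded_linear_shift_l2: "bounded_linear (shift_l2 a)"
proof (rule bounded_linear_intro)
  fix x y :: "'a l2" and c :: real
  show "shift_l2 a (x + y) = shift_l2 a x + shift_l2 a y"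
  proof (rule l2_eqI)
    show "AE t in lborel. l2_rep (shift_l2 a (x + y)) t = l2_rep (shift_l2 a x + shift_l2 a y) t"
      using l2_rep_shift_l2[of a "x + y"] l2_rep_shift_l2[of a x] l2_rep_shift_l2[of a y] l2_rep_add[of "shift_l2 a x" "shift_l2 a y"] AE_shift[OF l2_rep_add[of x y], of "-a"]
      by eventually_elim simp
  qed
  show "shift_l2 a (c *\<^sub>R x) = c *\<^sub>R shift_l2 a x"
  proof (rule l2_eqI)
    show "AE t in lborel. l2_rep (shift_l2 a (c *\<^sub>R x)) t = l2_rep (c *\<^sub>R shift_l2 a x) t"
      using l2_rep_shift_l2[of a "c *\<^sub>R x"] l2_rep_shift_l2[of a x] l2_rep_scaleR[of c "shift_l2 a x"] AE_shift[OF l2_rep_scaleR[of c x], of "-a"]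
      by eventually_elim simp
  qed
  show "norm (shift_l2 a x) \<le> norm x * 1" by simp
qed

lemma norm_restrict_l2_le: "S \<in> sets borel \<Longrightarrow> norm (restrict_l2 S x) \<le> norm x"
  using norm_l2_class_le[OF l2f_cmul_indicator[OF l2f_l2_rep] l2f_l2_rep, of S x x]
  by (simp add: restrict_l2_def) (simp add: indicator_def)

lemma bounded_linear_restrict_l2:
  assumes S: "S \<in> sets borel" shows "bounded_linear (restrict_l2 S)"
proof (rule bounded_linear_intro)
  fix x y :: "'a l2" and c :: real
  show "restrict_l2 S (x + y) = restrict_l2 S x + restrict_l2 S y"
  proof (rule l2_eqI)
    show "AE t in lborel. l2_rep (restrict_l2 S (x + y)) t = l2_rep (restrict_l2 S x + restrict_l2 S y) t"
      using l2_rep_restrict_l2[OF S, of "x + y"] l2_rep_restrict_l2[OF S, of x] l2_rep_restrict_l2[OF S, of y] l2_rep_add[of "restrict_l2 S x" "restrict_l2 S y"] l2_rep_add[of x y]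
      by eventually_elim (simp add: scaleR_add_right)
  qed
  show "restrict_l2 S (c *\<^sub>R x) = c *\<^sub>R restrict_l2 S x"
  proof (rule l2_eqI)
    show "AE t in lborel. l2_rep (restrict_l2 S (c *\<^sub>R x)) t = l2_rep (c *\<^sub>R restrict_l2 S x) t"
      using l2_rep_restrict_l2[OF S, of "c *\<^sub>R x"] l2_rep_restrict_l2[OF S, of x] l2_rep_scaleR[of c "restrict_l2 S x"] l2_rep_scaleR[of c x]
      by eventually_elim simp
  qed
  show "norm (restrict_l2 S x) \<le> norm x * 1" using norm_restrict_l2_le[OF S] by simp
qed

text \<open>The limit obeys the same bound \<open>w\<close> almost everywhere, so the squared
  difference is dominated by 4 times the square of \<open>w\<close> and dominated convergence
  applies to it.\<close>

lemma l2_dominated: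
  fixes f :: "nat \<Rightarrow> real \<Rightarrow> 'a::euclidean_space"
  assumes w: "l2f w" and fm: "\<And>n. f n \<in> borel_measurable borel" and gm: "g \<in> borel_measurable borel"
    and b: "\<And>n x. norm (f n x) \<le> norm (w x)"
    and lim: "AE x in lborel. (\<lambda>n. f n x) \<longlonglongrightarrow> g x"
  shows "l2f (f n)" "l2f g" "(\<lambda>n. l2_class (f n)) \<longlonglongrightarrow> l2_class g"
proof -
  show lf: "l2f (f n)" for n
    by (rule l2f_bound[OF fm l2f_int[OF w]]) (use b in \<open>auto intro: power_mono\<close>)
  have bg: "AE x in lborel. norm (g x) \<le> norm (w x)"
    using lim
  proof eventually_elim
    case (elim x)
    show ?case by (rule LIMSEQ_le_const2[OF tendsto_norm[OF elim]]) (use b in auto)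
  qed
  show lg: "l2f g"
    unfolding l2f_def
  proof
    show "integrable lborel (\<lambda>x. (norm (g x))\<^sup>2)"
    proof (rule Bochner_Integration.integrable_bound[OF l2f_int[OF w]])
      show "AE x in lborel. norm ((norm (g x))\<^sup>2) \<le> norm ((norm (w x))\<^sup>2)"
        using bg by eventually_elim (simp add: power_mono)
    qed (use gm in auto)
  qed (rule gm)
  have "(\<lambda>n. LINT x|lborel. (norm (f n x - g x))\<^sup>2) \<longlonglongrightarrow> (LINT x|(lborel::real measure). (norm (0::'a))\<^sup>2)"
  proof (rule integral_dominated_convergence[where w="\<lambda>x. 4 * (norm (w x))\<^sup>2"])
    show "integrable lborel (\<lambda>x. 4 * (norm (w x))\<^sup>2)" using l2f_int[OF w] by simp
    show "AE x in lborel. (\<lambda>n. (norm (f n x - g x))\<^sup>2) \<longlonglongrightarrow> (norm (0::'a))\<^sup>2"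
      using lim
    proof eventually_elim
      case (elim x)
      have "(\<lambda>n. (norm (f n x - g x))\<^sup>2) \<longlonglongrightarrow> (norm (g x - g x))\<^sup>2" by (intro tendsto_intros elim)
      then show ?case by simp
    qed
    show "AE x in lborel. norm ((norm (f n x - g x))\<^sup>2) \<le> 4 * (norm (w x))\<^sup>2" for n
      using bg
    proof eventually_elim
      case (elim x)
      have "norm (f n x - g x) \<le> 2 * norm (w x)"
        using norm_triangle_ineq4[of "f n x" "g x"] b[of n x] elim by simp
      from power_mono[OF this norm_ge_zero, of 2] show ?case by simp
    qed
  qed (use fm gm in auto)
  then have "(\<lambda>n. (norm (l2_class (f n) - l2_class g))\<^sup>2) \<longlonglongrightarrow> 0"
    by (simp add: l2_class_diff[OF lf lg] norm_l2_class_sq[OF l2f_diff[OF lf lg]])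
  then have "(\<lambda>n. norm (l2_class (f n) - l2_class g)) \<longlonglongrightarrow> 0"
    using tendsto_real_sqrt[of "\<lambda>n. (norm (l2_class (f n) - l2_class g))\<^sup>2" 0] by simp
  then show "(\<lambda>n. l2_class (f n)) \<longlonglongrightarrow> l2_class g" by (simp add: LIM_zero_iff tendsto_norm_zero_iff)
qed

section \<open>Density of polynomials and continuity of translations\<close>

text \<open>The radial retraction onto the ball of radius M. Being continuous, it makes approximants
  bounded without destroying their continuity.\<close>

definition truncate_norm :: "real \<Rightarrow> 'a::real_normed_vector \<Rightarrow> 'a" where
  "truncate_norm M y = (M / max M (norm y)) *\<^sub>R y"

lemma truncate_norm_props:
  fixes y :: "'a::real_normed_vector"
  assumes "M > 0"
  shows "continuous_on UNIV (truncate_norm M :: 'a \<Rightarrow> 'a)" "norm (truncate_norm M y) \<le> M" "norm (truncate_norm M y) \<le> norm y" "norm y \<le> M \<Longrightarrow> truncate_norm M y = y"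
proof -
  have p: "max M (norm y) > 0" for y :: 'a using assms by (simp add: less_max_iff_disj)
  show "continuous_on UNIV (truncate_norm M :: 'a \<Rightarrow> 'a)"
    unfolding truncate_norm_def using p by (intro continuous_intros) (metis less_irrefl)
  show "norm y \<le> M \<Longrightarrow> truncate_norm M y = y" using assms by (simp add: truncate_norm_def max_def)
  have n: "norm (truncate_norm M y) = M / max M (norm y) * norm y" using assms p[of y] by (simp add: truncate_norm_def)
  show "norm (truncate_norm M y) \<le> norm y"
    unfolding n using assms p[of y] by (intro mult_left_le_one_le) (auto simp: divide_le_eq_1)
  show "norm (truncate_norm M y) \<le> M"
  proof -
    have "M / max M (norm y) * norm y \<le> M / max M (norm y) * max M (norm y)"
      using assms p[of y] by (intro mult_left_mono) auto
    then show ?thesis unfolding n using p[of y] by simp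
  qed
qed

text \<open>\<open>measurable_on\<close> is by definition a limit of continuous functions off a
  negligible set. The approximants carry no bound, which is why they are composed with
  \<open>truncate_norm\<close> afterwards.\<close>

lemma borel_pointwise_limit_continuous:
  fixes f :: "real \<Rightarrow> 'a::euclidean_space"
  assumes "f \<in> borel_measurable borel"
  shows "\<exists>g. (\<forall>n::nat. continuous_on UNIV (g n)) \<and> (AE x in lborel. (\<lambda>n. g n x) \<longlonglongrightarrow> f x)"
proof -
  have "f \<in> borel_measurable (lebesgue_on UNIV)"
    using measurable_completion[of f lborel borel] assms by simp
  then have "f measurable_on UNIV" by (subst measurable_on_iff_borel_measurable) auto
  then obtain N g where N: "negligible N" and g: "\<And>n. continuous_on UNIV (g n)"
    "\<And>x. x \<notin> N \<Longrightarrow> (\<lambda>n. g n x) \<longlonglongrightarrow> f x"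
    unfolding measurable_on_def by auto
  have "N \<in> null_sets lebesgue" using N by (simp add: negligible_iff_null_sets)
  then have "AE x in lebesgue. x \<notin> N" by (rule AE_not_in)
  then have "AE x in lborel. x \<notin> N" by (simp only: AE_completion_iff)
  then have "AE x in lborel. (\<lambda>n. g n x) \<longlonglongrightarrow> f x" by eventually_elim (rule g)
  then show ?thesis using g by blast
qed

lemma l2f_bounded_interval:
  fixes f :: "real \<Rightarrow> 'a::euclidean_space"
  assumes "f \<in> borel_measurable borel" "\<And>t. t \<in> {a..b} \<Longrightarrow> norm (f t) \<le> M"
  shows "l2f (\<lambda>t. indicator {a..b} t *\<^sub>R f t)"
proof (rule l2f_bound)
  show "integrable lborel (\<lambda>t. M\<^sup>2 * indicator {a..b} t)"
    by (intro integrable_mult_right integrable_real_indicator) (auto simp: emeasure_lborel_Icc_eq)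
  show "(norm (indicator {a..b} t *\<^sub>R f t))\<^sup>2 \<le> M\<^sup>2 * indicator {a..b} t" for t
    using assms(2)[of t] by (auto simp: indicator_def intro: power_mono)
qed (use assms in auto)

lemma l2f_indicator_const: "l2f (\<lambda>t. indicator {a..b::real} t *\<^sub>R (v::'a::euclidean_space))"
  by (rule l2f_bounded_interval) auto

lemma continuous_borel: "continuous_on UNIV (f::real\<Rightarrow>'a::euclidean_space) \<Longrightarrow> f \<in> borel_measurable borel"
  by (rule borel_measurable_continuous_onI)

lemma l2f_continuous_interval:
  fixes f :: "real \<Rightarrow> 'a::euclidean_space"
  assumes "continuous_on UNIV f" shows "l2f (\<lambda>t. indicator {a..b} t *\<^sub>R f t)"
proof -
  have "bounded (f ` {a..b})"
    by (intro compact_imp_bounded compact_continuous_image continuous_on_subset[OF assms]) auto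
  then obtain M where "\<forall>x\<in>f ` {a..b}. norm x \<le> M" unfolding bounded_iff by blast
  then have "\<And>t. t \<in> {a..b} \<Longrightarrow> norm (f t) \<le> M" by blast
  then show ?thesis by (intro l2f_bounded_interval continuous_borel assms) auto
qed

lemma norm_l2_class_indicator_bound:
  fixes f :: "real \<Rightarrow> 'a::euclidean_space"
  assumes "f \<in> borel_measurable borel" "\<And>t. t \<in> {a..b} \<Longrightarrow> norm (f t) \<le> M" "a \<le> b" "M \<ge> 0"
  shows "norm (l2_class (\<lambda>t. indicator {a..b} t *\<^sub>R f t)) \<le> M * sqrt (b - a)"
proof -
  have "norm (l2_class (\<lambda>t. indicator {a..b} t *\<^sub>R f t)) \<le> norm (l2_class (\<lambda>t. indicator {a..b} t *\<^sub>R M))"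
    using assms by (intro norm_l2_class_le l2f_bounded_interval[where M=M] AE_I2) (auto simp: indicator_def)
  also have "(norm (l2_class (\<lambda>t. indicator {a..b} t *\<^sub>R M)))\<^sup>2 = (LINT t|lborel. M\<^sup>2 * indicator {a..b} t)"
    using assms by (subst norm_l2_class_sq[OF l2f_bounded_interval[where M=M]])
      (auto simp: power_mult_distrib indicator_def intro!: Bochner_Integration.integral_cong)
  then have "norm (l2_class (\<lambda>t. indicator {a..b} t *\<^sub>R M)) = sqrt (M\<^sup>2 * (b - a))"
    using assms by (intro real_sqrt_unique[symmetric]) auto
  also have "\<dots> = M * sqrt (b - a)" using assms by (simp add: real_sqrt_mult)
  finally show ?thesis .
qed

lemma real_poly_sum_of_polynomial_function:
  fixes p :: "real \<Rightarrow> 'a::euclidean_space"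
  assumes "polynomial_function p"
  shows "\<exists>n c. p = (\<lambda>t. \<Sum>i\<le>n. t ^ i *\<^sub>R c i)"
proof -
  have "real_polynomial_function (\<lambda>t. p t \<bullet> b)" for b
    using assms polynomial_function_inner[of p b] real_polynomial_function_eq by (auto simp: inner_commute)
  then have "\<exists>a n. (\<lambda>t. p t \<bullet> b) = (\<lambda>t. \<Sum>i\<le>n. a i * t ^ i)" for b
    by (simp add: real_polynomial_function_iff_sum)
  then obtain a n where an: "\<And>b. (\<lambda>t. p t \<bullet> b) = (\<lambda>t. \<Sum>i\<le>n b. a b i * t ^ i)" by metis
  define m where "m = Max (n ` Basis)"
  have nm: "n b \<le> m" if "b \<in> Basis" for b unfolding m_def using that by simp
  define c where "c i = (\<Sum>b\<in>Basis. (if i \<le> n b then a b i else 0) *\<^sub>R b)" for i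
  have "p t = (\<Sum>i\<le>m. t ^ i *\<^sub>R c i)" for t
  proof -
    have "(\<Sum>i\<le>m. t ^ i *\<^sub>R c i) = (\<Sum>b\<in>Basis. (\<Sum>i\<le>m. (if i \<le> n b then a b i * t ^ i else 0)) *\<^sub>R b)"
      unfolding c_def scaleR_sum_right scaleR_sum_left
      by (subst sum.swap) (auto intro!: sum.cong simp: mult.commute)
    also have "\<dots> = (\<Sum>b\<in>Basis. (p t \<bullet> b) *\<^sub>R b)"
    proof (rule sum.cong[OF refl])
      fix b :: 'a assume b: "b \<in> Basis"
      have "(\<Sum>i\<le>m. (if i \<le> n b then a b i * t ^ i else 0)) = (\<Sum>i\<in>{..m} \<inter> {i. i \<le> n b}. a b i * t ^ i)"
        by (simp add: sum.inter_restrict)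
      also have "{..m} \<inter> {i. i \<le> n b} = {..n b}" using nm[OF b] by auto
      also have "(\<Sum>i\<le>n b. a b i * t ^ i) = p t \<bullet> b" using fun_cong[OF an[of b], of t] by simp
      finally show "(\<Sum>i\<le>m. (if i \<le> n b then a b i * t ^ i else 0)) *\<^sub>R b = (p t \<bullet> b) *\<^sub>R b" by simp
    qed
    finally show ?thesis by (simp add: euclidean_representation)
  qed
  then show ?thesis by blast
qed

lemma continuous_poly_sum: "continuous_on UNIV (\<lambda>t::real. \<Sum>i\<le>n. t ^ i *\<^sub>R (c i :: 'a::real_normed_vector))"
  by (intro continuous_intros)

text \<open>Three approximations of cost e / 3 each: truncation to bounded values, continuous
  functions by dominated convergence, polynomials by Stone-Weierstrass.\<close>

lemma l2_poly_approx:
  fixes f :: "'a::euclidean_space l2"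
  assumes e: "e > 0" and ab: "a \<le> b"
  shows "\<exists>n c. norm (restrict_l2 {a..b} f - l2_class (\<lambda>t. indicator {a..b} t *\<^sub>R (\<Sum>i\<le>n. t ^ i *\<^sub>R c i))) < e"
proof -
  let ?I = "\<lambda>t. indicat_real {a..b} t"
  define F where "F n t = ?I t *\<^sub>R truncate_norm (real (Suc n)) (l2_rep f t)" for n t
  have cut_eq: "restrict_l2 {a..b} f = l2_class (\<lambda>t. ?I t *\<^sub>R l2_rep f t)" by (simp add: restrict_l2_def)
  have Fm: "F n \<in> borel_measurable borel" for n
    unfolding F_def by (intro borel_measurable_scaleR borel_measurable_continuous_on[OF truncate_norm_props(1)]) auto
  have "AE t in lborel. (\<lambda>n. F n t) \<longlonglongrightarrow> ?I t *\<^sub>R l2_rep f t"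
  proof (rule AE_I2)
    fix t
    obtain N :: nat where N: "norm (l2_rep f t) \<le> real N" using real_arch_simple by blast
    have "\<forall>\<^sub>F n in sequentially. F n t = ?I t *\<^sub>R l2_rep f t"
      using eventually_ge_at_top[of N]
    proof eventually_elim
      case (elim n)
      then have "truncate_norm (real (Suc n)) (l2_rep f t) = l2_rep f t" using N by (intro truncate_norm_props) auto
      then show ?case by (simp add: F_def)
    qed
    then show "(\<lambda>n. F n t) \<longlonglongrightarrow> ?I t *\<^sub>R l2_rep f t" by (rule tendsto_eventually)
  qed
  note domF = l2_dominated[OF l2f_l2_rep[of f] Fm _ _ this]
  have bF: "norm (F n t) \<le> norm (l2_rep f t)" for n t
    using truncate_norm_props(3)[of "real (Suc n)" "l2_rep f t"] by (auto simp: F_def indicator_def)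
  have "(\<lambda>n. l2_class (F n)) \<longlonglongrightarrow> restrict_l2 {a..b} f"
    unfolding cut_eq by (rule domF) (use bF in auto)
  from LIMSEQ_D[OF this, of "e/3"] e obtain n where n: "norm (l2_class (F n) - restrict_l2 {a..b} f) < e / 3" by auto
  define M where "M = real (Suc n)"
  have M: "M > 0" by (simp add: M_def)
  obtain g where g: "\<And>k::nat. continuous_on UNIV (g k)" "AE x in lborel. (\<lambda>k. g k x) \<longlonglongrightarrow> l2_rep f x"
    using borel_pointwise_limit_continuous[OF l2_rep_meas] by blast
  define h where "h k t = truncate_norm M (g k t)" for k t
  have hc: "continuous_on UNIV (h k)" for k
    unfolding h_def by (rule continuous_on_compose2[OF truncate_norm_props(1)[OF M] g(1)]) simp
  have hM: "norm (h k t) \<le> M" for k t unfolding h_def by (rule truncate_norm_props[OF M])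
  have "AE x in lborel. (\<lambda>k. ?I x *\<^sub>R h k x) \<longlonglongrightarrow> F n x"
    using g(2)
  proof eventually_elim
    case (elim x)
    have "isCont (truncate_norm M) (l2_rep f x)" using truncate_norm_props(1)[OF M, where 'a='a] by (simp add: continuous_on_eq_continuous_at)
    from isCont_tendsto_compose[OF this elim] show ?case
      unfolding F_def h_def M_def by (intro tendsto_intros)
  qed
  note domh = l2_dominated[OF l2f_indicator_const[of a b M] _ Fm _ this]
  have "(\<lambda>k. l2_class (\<lambda>x. ?I x *\<^sub>R h k x)) \<longlonglongrightarrow> l2_class (F n)"
  proof (rule domh)
    show "(\<lambda>x. ?I x *\<^sub>R h k x) \<in> borel_measurable borel" for k using continuous_borel[OF hc[of k]] by simp
    show "norm (?I x *\<^sub>R h k x) \<le> norm (?I x *\<^sub>R M)" for k x using hM[of k x] M by (auto simp: indicator_def)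
  qed
  from LIMSEQ_D[OF this, of "e/3"] e obtain k where k: "norm (l2_class (\<lambda>x. ?I x *\<^sub>R h k x) - l2_class (F n)) < e / 3" by auto
  \<comment> \<open>A uniform error d on the interval has norm at most d sqrt(b - a); the added 1
    keeps the quotient meaningful when a = b.\<close>
  define d where "d = e / (3 * (sqrt (b - a) + 1))"
  have sq: "sqrt (b - a) \<ge> 0" using ab by simp
  have sq1: "sqrt (b - a) + 1 > 0" using sq by linarith
  have d: "d > 0" unfolding d_def using e sq1 by (intro divide_pos_pos mult_pos_pos) auto
  obtain p where p: "polynomial_function p" "\<And>x. x \<in> {a..b} \<Longrightarrow> norm (h k x - p x) < d"
    using Stone_Weierstrass_polynomial_function[of "{a..b}" "h k", OF _ continuous_on_subset[OF hc] d] by auto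
  obtain m c where pc: "p = (\<lambda>t. \<Sum>i\<le>m. t ^ i *\<^sub>R c i)"
    using real_poly_sum_of_polynomial_function[OF p(1)] by blast
  have pcont: "continuous_on UNIV p" unfolding pc by (rule continuous_poly_sum)
  have "l2_class (\<lambda>x. ?I x *\<^sub>R h k x) - l2_class (\<lambda>x. ?I x *\<^sub>R p x) = l2_class (\<lambda>x. ?I x *\<^sub>R (h k x - p x))"
    by (subst l2_class_diff) (auto intro!: l2f_continuous_interval hc pcont simp: scaleR_diff_right)
  also have "norm \<dots> \<le> d * sqrt (b - a)"
    by (rule norm_l2_class_indicator_bound)
       (use p(2) ab d in \<open>auto intro!: continuous_borel continuous_intros hc pcont simp: less_imp_le\<close>)
  also have "\<dots> < d * (sqrt (b - a) + 1)" using d by simp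
  also have "\<dots> = e / 3" unfolding d_def using sq1 by (simp add: divide_simps del: distrib_left_numeral)
  finally have pe: "norm (l2_class (\<lambda>x. ?I x *\<^sub>R h k x) - l2_class (\<lambda>x. ?I x *\<^sub>R p x)) < e / 3" .
  have "norm (restrict_l2 {a..b} f - l2_class (\<lambda>x. ?I x *\<^sub>R p x)) < e"
    using n k pe norm_triangle_ineq[of "restrict_l2 {a..b} f - l2_class (F n)" "l2_class (F n) - l2_class (\<lambda>x. ?I x *\<^sub>R h k x)"]
      norm_triangle_ineq[of "restrict_l2 {a..b} f - l2_class (\<lambda>x. ?I x *\<^sub>R h k x)" "l2_class (\<lambda>x. ?I x *\<^sub>R h k x) - l2_class (\<lambda>x. ?I x *\<^sub>R p x)"]
    by (simp add: norm_minus_commute)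
  then show ?thesis unfolding pc by blast
qed

lemma restrict_l2_exhaust: "(\<lambda>n. restrict_l2 {-real n..real n} f) \<longlonglongrightarrow> (f :: 'a::euclidean_space l2)"
proof -
  have ae: "AE t in lborel. (\<lambda>n. indicat_real {-real n..real n} t *\<^sub>R l2_rep f t) \<longlonglongrightarrow> l2_rep f t"
  proof (rule AE_I2)
    fix t
    obtain N :: nat where N: "\<bar>t\<bar> \<le> real N" using real_arch_simple by blast
    have "\<forall>\<^sub>F n in sequentially. indicat_real {-real n..real n} t *\<^sub>R l2_rep f t = l2_rep f t"
      using eventually_ge_at_top[of N] by eventually_elim (use N in \<open>auto simp: indicator_def\<close>)
    then show "(\<lambda>n. indicat_real {-real n..real n} t *\<^sub>R l2_rep f t) \<longlonglongrightarrow> l2_rep f t" by (rule tendsto_eventually)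
  qed
  have "(\<lambda>n. l2_class (\<lambda>t. indicat_real {-real n..real n} t *\<^sub>R l2_rep f t)) \<longlonglongrightarrow> l2_class (l2_rep f)"
    by (rule l2_dominated[OF l2f_l2_rep[of f] _ _ _ ae]) (auto simp: indicator_def)
  then show ?thesis by (simp add: restrict_l2_def)
qed

text \<open>Translations are isometries, so continuity at 0 only has to be checked on a dense set.
  Polynomials cut to an interval serve; their cut-off is discontinuous only at the two end points, a
  null set.\<close>

lemma l2_shift_continuous:
  fixes f :: "'a::euclidean_space l2"
  assumes e: "e > 0"
  shows "\<exists>d>0. \<forall>a. \<bar>a\<bar> < d \<longrightarrow> norm (shift_l2 a f - f) < e"
proof -
  obtain m where m: "norm (restrict_l2 {-real m..real m} f - f) < e / 4"
    using LIMSEQ_D[OF restrict_l2_exhaust[of f], of "e/4"] e by auto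
  obtain n c where p: "norm (restrict_l2 {-real m..real m} f - l2_class (\<lambda>t. indicator {-real m..real m} t *\<^sub>R (\<Sum>i\<le>n. t ^ i *\<^sub>R c i))) < e / 4"
    using l2_poly_approx[of "e/4" "-real m" "real m" f] e by auto
  define P where "P t = (\<Sum>i\<le>n. t ^ i *\<^sub>R c i)" for t :: real
  let ?I = "\<lambda>t. indicat_real {-real m..real m} t"
  define g where "g = l2_class (\<lambda>t. ?I t *\<^sub>R P t)"
  have pc: "continuous_on UNIV P" unfolding P_def by (rule continuous_poly_sum)
  have l: "l2f (\<lambda>t. ?I t *\<^sub>R P t)" by (rule l2f_continuous_interval[OF pc])
  have fg: "norm (f - g) < e / 2"
    using m p norm_triangle_ineq[of "f - restrict_l2 {-real m..real m} f" "restrict_l2 {-real m..real m} f - g"]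
    unfolding g_def P_def by (simp add: norm_minus_commute)
  have "bounded (P ` {-real m..real m})"
    by (intro compact_imp_bounded compact_continuous_image continuous_on_subset[OF pc]) auto
  then obtain B where "\<forall>x\<in>P ` {-real m..real m}. norm x \<le> B" unfolding bounded_iff by blast
  then have B: "\<And>t. t \<in> {-real m..real m} \<Longrightarrow> norm (P t) \<le> B" by blast
  have B0: "B \<ge> 0" using order_trans[OF norm_ge_zero B[of 0]] by simp
  have lim: "((\<lambda>a. norm (shift_l2 a g - g)) \<longlongrightarrow> 0) (at 0)"
    unfolding tendsto_at_iff_sequentially comp_def
  proof (intro allI impI)
    fix X :: "nat \<Rightarrow> real" assume X: "\<forall>i. X i \<in> UNIV - {0}" "X \<longlonglongrightarrow> 0"
    obtain N where N: "\<And>i. i \<ge> N \<Longrightarrow> \<bar>X i\<bar> < 1" using LIMSEQ_D[OF X(2), of 1] by auto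
    define Y where "Y i = X (i + N)" for i
    have Y: "Y \<longlonglongrightarrow> 0" "\<And>i. \<bar>Y i\<bar> < 1" unfolding Y_def using LIMSEQ_ignore_initial_segment[OF X(2)] N by auto
    have ae: "AE t in lborel. (\<lambda>i. ?I (t - Y i) *\<^sub>R P (t - Y i)) \<longlonglongrightarrow> ?I t *\<^sub>R P t"
      using AE_lborel_singleton[of "real m"] AE_lborel_singleton[of "- real m"]
    proof eventually_elim
      case (elim t)
      have tY: "(\<lambda>i. t - Y i) \<longlonglongrightarrow> t" using tendsto_diff[OF tendsto_const Y(1), of t] by simp
      have "isCont P t" using pc by (simp add: continuous_on_eq_continuous_at)
      from isCont_tendsto_compose[OF this tY] have PP: "(\<lambda>i. P (t - Y i)) \<longlonglongrightarrow> P t" .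
      have "\<forall>\<^sub>F i in sequentially. ?I (t - Y i) = ?I t"
      proof (cases "t \<in> {-real m..real m}")
        case True
        then have "t \<in> {-real m<..<real m}" using elim by auto
        from topological_tendstoD[OF tY open_greaterThanLessThan this]
        show ?thesis by eventually_elim (use True in \<open>auto simp: indicator_def\<close>)
      next
        case False
        have "t \<in> - {-real m..real m}" using False by auto
        from topological_tendstoD[OF tY _ this] have "\<forall>\<^sub>F i in sequentially. t - Y i \<in> - {-real m..real m}" 
          by (simp add: open_Compl)
        then show ?thesis by eventually_elim (use False in \<open>auto simp: indicator_def\<close>)
      qed
      then have "(\<lambda>i. ?I (t - Y i)) \<longlonglongrightarrow> ?I t" by (rule tendsto_eventually)
      then show ?case by (intro tendsto_intros PP)
    qed
    \<comment> \<open>Shifts shorter than 1 stay inside the interval enlarged by 1, where the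
      constant B dominates.\<close>
    have "(\<lambda>i. l2_class (\<lambda>t. ?I (t - Y i) *\<^sub>R P (t - Y i))) \<longlonglongrightarrow> l2_class (\<lambda>t. ?I t *\<^sub>R P t)"
    proof (rule l2_dominated[OF l2f_indicator_const[of "-real m - 1" "real m + 1" B] _ _ _ ae])
      show "(\<lambda>t. ?I (t - Y i) *\<^sub>R P (t - Y i)) \<in> borel_measurable borel" for i
        using l2f_meas[OF l2f_shift'[OF l]] .
      show "(\<lambda>t. ?I t *\<^sub>R P t) \<in> borel_measurable borel" by (rule l2f_meas[OF l])
      show "norm (?I (x - Y i) *\<^sub>R P (x - Y i)) \<le> norm (indicat_real {-real m - 1..real m + 1} x *\<^sub>R B)" for i x
        using B[of "x - Y i"] B0 Y(2)[of i] by (auto simp: indicator_def)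
    qed
    then have "(\<lambda>i. shift_l2 (Y i) g) \<longlonglongrightarrow> g" unfolding g_def by (simp add: shift_l2_l2_class[OF l])
    then have "(\<lambda>i. norm (shift_l2 (Y i) g - g)) \<longlonglongrightarrow> 0" by (simp add: LIM_zero tendsto_norm_zero)
    then show "(\<lambda>i. norm (shift_l2 (X i) g - g)) \<longlonglongrightarrow> 0"
      unfolding Y_def by (rule LIMSEQ_offset)
  qed
  \<comment> \<open>Replacing \<open>f\<close> by \<open>g\<close> before and after the shift costs
    the norm of \<open>f - g\<close> twice; the rest of e is left for \<open>g\<close>.\<close>
  define D where "D = e - 2 * norm (f - g)"
  have D: "D > 0" using fg by (simp add: D_def)
  from tendstoD[OF lim D] obtain d where d: "d > 0" "\<And>a. a \<noteq> 0 \<Longrightarrow> \<bar>a\<bar> < d \<Longrightarrow> norm (shift_l2 a g - g) < D"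
    unfolding eventually_at by (auto simp: dist_norm)
  have "norm (shift_l2 a f - f) < e" if a: "\<bar>a\<bar> < d" for a
  proof (cases "a = 0")
    case True
    have "shift_l2 0 f = f" by (simp add: shift_l2_def)
    then show ?thesis using True e by simp
  next
    case False
    interpret bounded_linear "shift_l2 a :: 'a l2 \<Rightarrow> _" by (rule bounded_linear_shift_l2)
    have "norm (shift_l2 a f - f) \<le> norm (shift_l2 a f - shift_l2 a g) + norm (shift_l2 a g - g) + norm (g - f)"
      using norm_triangle_ineq[of "shift_l2 a f - shift_l2 a g" "shift_l2 a g - f"] norm_triangle_ineq[of "shift_l2 a g - g" "g - f"] by simp
    also have "norm (shift_l2 a f - shift_l2 a g) = norm (f - g)" using norm_shift_l2[of a "f - g"] by (simp add: diff)
    finally show ?thesis using d(2)[OF False a] unfolding D_def by (simp add: norm_minus_commute)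
  qed
  then show ?thesis using d(1) by blast
qed

section \<open>Matrix valued convolutions\<close>

text \<open>The norm of a matrix is the Euclidean norm of its entries; Cauchy-Schwarz in each row
  gives the constant 1.\<close>

lemma norm_mv_le:
  fixes A :: "complex^'n^'m"
  shows "norm (A *v x) \<le> norm A * norm x"
proof -
  have c: "norm ((A *v x) $ i) \<le> norm (A $ i) * norm x" for i
  proof -
    have "norm ((A *v x) $ i) \<le> (\<Sum>j\<in>UNIV. norm (A$i$j) * norm (x$j))"
      unfolding matrix_vector_mult_def by (simp add: norm_mult[symmetric] norm_sum)
    also have "\<dots> \<le> L2_set (\<lambda>j. norm (A$i$j)) UNIV * L2_set (\<lambda>j. norm (x$j)) UNIV"
      using L2_set_mult_ineq[where A=UNIV and f="\<lambda>j. norm (A$i$j)" and g="\<lambda>j. norm (x$j)"] by simp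
    finally show ?thesis by (simp add: norm_vec_def)
  qed
  have "norm (A *v x) = L2_set (\<lambda>i. norm ((A *v x) $ i)) UNIV" by (simp add: norm_vec_def)
  also have "\<dots> \<le> L2_set (\<lambda>i. norm x * norm (A $ i)) UNIV"
    by (rule L2_set_mono) (use c in \<open>auto simp: mult.commute\<close>)
  also have "\<dots> = norm x * norm A" by (simp add: L2_set_right_distrib norm_vec_def)
  finally show ?thesis by (simp add: mult.commute)
qed

lemma bounded_bilinear_mv: "bounded_bilinear ((*v) :: complex^'n^'m \<Rightarrow> complex^'n \<Rightarrow> complex^'m)"
proof
  show "\<exists>K. \<forall>a b. norm ((a :: complex^'n^'m) *v b) \<le> norm a * norm b * K"
    by (rule exI[of _ 1]) (simp add: norm_mv_le)
qed (auto simp: vec_eq_iff matrix_vector_mult_def sum.distrib algebra_simps scaleR_sum_right)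

interpretation mv: bounded_bilinear "(*v) :: complex^'n^'m \<Rightarrow> complex^'n \<Rightarrow> complex^'m"
  by (rule bounded_bilinear_mv)

lemma blin_mv: "bounded_linear ((*v) (A :: complex^'n^'m))"
  by (rule mv.bounded_linear_right)

lemma mv_scaleC: "(A :: complex^'n^'m) *v (c *s x) = c *s (A *v x)"
  by (simp add: vec_eq_iff matrix_vector_mult_def sum_distrib_left algebra_simps)

lemma mv_meas[measurable (raw)]:
  fixes f :: "'a \<Rightarrow> complex^'n^'m"
  assumes "f \<in> borel_measurable M" "g \<in> borel_measurable M"
  shows "(\<lambda>x. f x *v g x) \<in> borel_measurable M"
  by (rule borel_measurable_continuous_Pair[OF assms mv.continuous_on[OF continuous_on_fst[OF continuous_on_id] continuous_on_snd[OF continuous_on_id]]])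

definition convol :: "(real \<Rightarrow> complex^'n^'m) \<Rightarrow> (real \<Rightarrow> complex^'n) \<Rightarrow> real \<Rightarrow> complex^'m" where
  "convol k r x = (LINT s|lborel. k (x - s) *v r s)"

lemma mv_integrable:
  assumes "l2f k" "l2f r"
  shows "integrable lborel (\<lambda>s. (k s :: complex^'n^'m) *v r s)"
  using assms by (intro l2f_bilinear_integrable[where b="(*v)"]) (auto simp: l2f_def norm_mv_le)

lemma mv_lint_bound:
  assumes "l2f k" "l2f r"
  shows "norm (LINT s|lborel. (k s :: complex^'n^'m) *v r s) \<le> norm (l2_class k) * norm (l2_class r)"
proof -
  have "norm (LINT s|lborel. k s *v r s) \<le> (LINT s|lborel. norm (k s) * norm (r s))"
    by (rule Bochner_Integration.integral_norm_bound_integral[OF mv_integrable[OF assms] l2f_norm_mult_integrable[OF assms]]) (rule norm_mv_le)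
  also have "\<dots> \<le> norm (l2_class k) * norm (l2_class r)" by (rule l2_Cauchy_Schwarz[OF assms])
  finally show ?thesis .
qed

lemma convol_integrable: "l2f k \<Longrightarrow> l2f r \<Longrightarrow> integrable lborel (\<lambda>s. (k (x - s) :: complex^'n^'m) *v r s)"
  by (intro mv_integrable l2f_reflect)

lemma norm_l2_class_reflect: "l2f f \<Longrightarrow> norm (l2_class (\<lambda>s. f (x - s))) = norm (l2_class f)"
  using lint_reflect[of "\<lambda>s. (norm (f s))\<^sup>2" x] by (simp add: norm_l2_class l2f_reflect)

lemma convol_bound:
  assumes "l2f k" "l2f r"
  shows "norm (convol k r x) \<le> norm (l2_class k) * norm (l2_class r)"
  using mv_lint_bound[OF l2f_reflect[OF assms(1)] assms(2), of x] assms(1) by (simp add: convol_def norm_l2_class_reflect)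

text \<open>Differencing in the argument falls on the kernel alone. Hence the modulus of continuity
  of the convolution depends on \<open>r\<close> only through its norm, which is the equicontinuity
  used for the adjoint equation.\<close>

lemma convol_diff_bound:
  assumes k: "l2f k" and r: "l2f r"
  shows "norm (convol k r x - convol k r y) \<le> norm (shift_l2 (x - y) (l2_class k) - l2_class k) * norm (l2_class r)"
proof -
  define d where "d t = k t - k (t - (x - y))" for t
  have d: "l2f d" unfolding d_def by (intro l2f_diff l2f_shift' k)
  have "convol k r x - convol k r y = (LINT s|lborel. d (x - s) *v r s)"
    unfolding convol_def d_def
    by (subst Bochner_Integration.integral_diff[symmetric, OF convol_integrable[OF k r] convol_integrable[OF k r]])
       (simp add: mv.diff_left algebra_simps)
  also have "norm \<dots> \<le> norm (l2_class d) * norm (l2_class r)" using convol_bound[OF d r, of x] by (simp add: convol_def)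
  also have "l2_class d = l2_class k - shift_l2 (x - y) (l2_class k)"
    unfolding d_def shift_l2_l2_class[OF k] by (rule l2_class_diff[symmetric, OF k l2f_shift'[OF k]])
  finally show ?thesis by (simp add: norm_minus_commute)
qed

lemma convol_continuous:
  assumes k: "l2f k" and r: "l2f r"
  shows "continuous_on UNIV (convol k r)"
  unfolding continuous_on_iff
proof (intro ballI allI impI)
  fix x e :: real assume e: "e > 0"
  have n: "norm (l2_class r) + 1 > 0" by (simp add: add_nonneg_pos)
  obtain d where d: "d > 0" "\<And>a. \<bar>a\<bar> < d \<Longrightarrow> norm (shift_l2 a (l2_class k) - l2_class k) < e / (norm (l2_class r) + 1)"
    using l2_shift_continuous[of "e / (norm (l2_class r) + 1)" "l2_class k"] e n by auto
  have "dist (convol k r y) (convol k r x) < e" if "dist y x < d" for y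
  proof -
    have "norm (convol k r y - convol k r x) \<le> norm (shift_l2 (y - x) (l2_class k) - l2_class k) * norm (l2_class r)" by (rule convol_diff_bound[OF k r])
    also have "\<dots> \<le> e / (norm (l2_class r) + 1) * norm (l2_class r)"
      using d(2)[of "y - x"] that by (intro mult_right_mono) (auto simp: dist_norm less_imp_le)
    also have "\<dots> < e" using e n by (simp add: pos_divide_less_eq algebra_simps)
    finally show ?thesis by (simp add: dist_norm)
  qed
  then show "\<exists>d>0. \<forall>x'\<in>UNIV. dist x' x < d \<longrightarrow> dist (convol k r x') (convol k r x) < e" using d(1) by blast
qed

lemma convol_meas: "l2f k \<Longrightarrow> l2f r \<Longrightarrow> convol k r \<in> borel_measurable borel"
  by (rule continuous_borel[OF convol_continuous])

lemma convol_add: "l2f k \<Longrightarrow> l2f r \<Longrightarrow> l2f r' \<Longrightarrow> convol k (\<lambda>s. r s + r' s) x = convol k r x + convol k r' x"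
  unfolding convol_def by (simp add: mv.add_right convol_integrable)
lemma convol_diff: "l2f k \<Longrightarrow> l2f r \<Longrightarrow> l2f r' \<Longrightarrow> convol k (\<lambda>s. r s - r' s) x = convol k r x - convol k r' x"
  unfolding convol_def by (simp add: mv.diff_right convol_integrable)
lemma convol_scaleR: "convol k (\<lambda>s. c *\<^sub>R r s) x = c *\<^sub>R convol k r x"
  unfolding convol_def by (simp add: mv.scaleR_right)
lemma convol_diff_left: "l2f k \<Longrightarrow> l2f k' \<Longrightarrow> l2f r \<Longrightarrow> convol (\<lambda>s. k s - k' s) r x = convol k r x - convol k' r x"
  unfolding convol_def by (simp add: mv.diff_left convol_integrable)

lemma convol_cong:
  assumes "l2f k" "l2f k'" "l2f r" "l2f r'" "AE s in lborel. k (x - s) *v r s = k' (x - s) *v r' s"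
  shows "convol k r x = convol k' r' x"
  unfolding convol_def
  by (rule integral_cong_AE[OF _ _ assms(5)])
     (rule borel_measurable_integrable[OF convol_integrable[OF assms(1,3)]],
      rule borel_measurable_integrable[OF convol_integrable[OF assms(2,4)]])

lemma convol_cong_right:
  assumes "l2f k" "l2f r" "l2f r'" "AE s in lborel. r s = r' s"
  shows "convol k r x = convol k r' x"
  by (rule convol_cong[OF assms(1,1,2,3)]) (use assms(4) in eventually_elim, simp)

text \<open>Integrability on the product is reduced to integrable sections and one integrable bound
  in the outer variable.\<close>

lemma fubini_gen:
  fixes F :: "real \<Rightarrow> real \<Rightarrow> 'a::euclidean_space"
  assumes m: "(\<lambda>z. F (fst z) (snd z)) \<in> borel_measurable borel"
    and i: "\<And>y. integrable lborel (\<lambda>x. F x y)"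
    and b: "\<And>y. (LINT x|lborel. norm (F x y)) \<le> G y" and G: "integrable lborel G"
  shows "(LINT y|lborel. LINT x|lborel. F x y) = (LINT x|lborel. LINT y|lborel. F x y)"
    and "integrable lborel (\<lambda>y. LINT x|lborel. F x y)"
    and "integrable lborel (\<lambda>x. LINT y|lborel. F x y)"
proof -
  have m': "case_prod F \<in> borel_measurable (lborel \<Otimes>\<^sub>M lborel)"
    using m by (simp add: case_prod_beta' lborel_prod borel_prod)
  have m2: "(\<lambda>(y, x). F x y) \<in> borel_measurable (lborel \<Otimes>\<^sub>M lborel)"
    using m' measurable_pair_swap_iff[of "case_prod F" lborel lborel borel] by (simp add: case_prod_beta')
  have "integrable (lborel \<Otimes>\<^sub>M lborel) (\<lambda>(y, x). F x y)"
  proof (rule lborel_pair.Fubini_integrable[OF m2])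
    show "integrable lborel (\<lambda>y. LINT x|lborel. norm (case (y, x) of (y, x) \<Rightarrow> F x y))"
    proof (rule Bochner_Integration.integrable_bound[OF G])
      show "(\<lambda>y. LINT x|lborel. norm (case (y, x) of (y, x) \<Rightarrow> F x y)) \<in> borel_measurable lborel"
        using m2 by (intro lborel.borel_measurable_lebesgue_integral) (auto simp: case_prod_beta')
      show "AE y in lborel. norm (LINT x|lborel. norm (case (y, x) of (y, x) \<Rightarrow> F x y)) \<le> norm (G y)"
        using b by (auto intro: order_trans[OF _ abs_ge_self])
    qed
    show "AE y in lborel. integrable lborel (\<lambda>x. case (y, x) of (y, x) \<Rightarrow> F x y)" using i by simp
  qed
  note I = this
  from lborel_pair.integrable_fst'[OF I] show "integrable lborel (\<lambda>y. LINT x|lborel. F x y)" by simp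
  from lborel_pair.Fubini_integral[OF I]
  show "(LINT y|lborel. LINT x|lborel. F x y) = (LINT x|lborel. LINT y|lborel. F x y)" by simp
  have "integrable (lborel \<Otimes>\<^sub>M lborel) (\<lambda>(x, y). F x y)"
    using lborel_pair.integrable_product_swap[OF I] by (simp add: case_prod_beta')
  from lborel_pair.integrable_fst'[OF this] show "integrable lborel (\<lambda>x. LINT y|lborel. F x y)" by simp
qed

text \<open>This is the adjoint also for the real inner product, since that is the real part of the
  Hermitian one.\<close>

definition ctranspose :: "complex^'n^'m \<Rightarrow> complex^'m^'n" where "ctranspose M = (\<chi> i j. cnj (M $ j $ i))"

lemma complex_inner_Re: "(x::complex) \<bullet> y = Re (x * cnj y)" by (simp add: inner_complex_def)

lemma inner_ctranspose: "y \<bullet> (M *v x) = (ctranspose M *v y) \<bullet> x"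
  unfolding inner_vec_def matrix_vector_mult_def ctranspose_def complex_inner_Re
  by (simp add: sum_distrib_left sum_distrib_right flip: Re_sum)
     (subst sum.swap, simp add: mult_ac)

lemma norm_ctranspose: "norm (ctranspose M) = norm (M :: complex^'n^'m)"
proof -
  have "(norm (ctranspose M))\<^sup>2 = (norm M)\<^sup>2"
    by (simp add: power2_norm_eq_inner inner_vec_def ctranspose_def complex_inner_Re)
       (subst sum.swap, simp add: mult.commute)
  then show ?thesis by simp
qed

lemma blin_ctranspose: "bounded_linear (ctranspose :: complex^'n^'m \<Rightarrow> _)"
  by (rule bounded_linear_intro[where K=1]) (auto simp: norm_ctranspose, auto simp: ctranspose_def vec_eq_iff)

text \<open>Fubini moves the convolution onto the other factor, with the kernel reflected and
  conjugate transposed. Integrability of \<open>f\<close> itself supplies the dominating function in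
  the outer variable.\<close>

lemma convol_adjoint:
  fixes k :: "real \<Rightarrow> complex^'n^'m"
  assumes k: "l2f k" and f: "l2f f" "integrable lborel f" and \<rho>: "l2f \<rho>"
  shows "(LINT t|lborel. \<rho> t \<bullet> convol k f t) = (LINT s|lborel. convol (\<lambda>x. ctranspose (k (- x))) \<rho> s \<bullet> f s)"
proof -
  note [measurable] = l2f_meas[OF k] l2f_meas[OF f(1)] l2f_meas[OF \<rho>]
  have kt: "l2f (\<lambda>t. k (t - s))" for s by (rule l2f_shift'[OF k])
  have h: "l2f (\<lambda>x. ctranspose (k (- x)))" using l2f_blin[OF l2f_reflect[OF k, of 0] blin_ctranspose] by simp
  define F where "F t s = \<rho> t \<bullet> (k (t - s) *v f s)" for t s
  have Fb: "norm (F t s) \<le> norm (f s) * (norm (\<rho> t) * norm (k (t - s)))" for t s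
  proof -
    have "norm (F t s) \<le> norm (\<rho> t) * norm (k (t - s) *v f s)" unfolding F_def by (simp add: Cauchy_Schwarz_ineq2)
    also have "\<dots> \<le> norm (\<rho> t) * (norm (k (t - s)) * norm (f s))" by (intro mult_left_mono norm_mv_le) simp
    finally show ?thesis by (simp add: mult_ac)
  qed
  have Fi: "integrable lborel (\<lambda>t. F t s)" for s
    by (rule Bochner_Integration.integrable_bound[OF integrable_mult_right[OF l2f_norm_mult_integrable[OF \<rho> kt], of "norm (f s)" s]])
       (use Fb in \<open>auto simp: F_def abs_mult\<close>)
  have "(LINT s|lborel. LINT t|lborel. F t s) = (LINT t|lborel. LINT s|lborel. F t s)"
  proof (rule fubini_gen(1)[where G="\<lambda>s. norm (f s) * (norm (l2_class \<rho>) * norm (l2_class k))"])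
    show "(LINT t|lborel. norm (F t s)) \<le> norm (f s) * (norm (l2_class \<rho>) * norm (l2_class k))" for s
    proof -
      have "(LINT t|lborel. norm (F t s)) \<le> (LINT t|lborel. norm (f s) * (norm (\<rho> t) * norm (k (t - s))))"
        by (intro integral_mono integrable_norm Fi integrable_mult_right l2f_norm_mult_integrable \<rho> kt Fb)
      also have "\<dots> = norm (f s) * (LINT t|lborel. norm (\<rho> t) * norm (k (t - s)))" by simp
      also have "\<dots> \<le> norm (f s) * (norm (l2_class \<rho>) * norm (l2_class (\<lambda>t. k (t - s))))"
        by (intro mult_left_mono l2_Cauchy_Schwarz \<rho> kt) simp
      also have "norm (l2_class (\<lambda>t. k (t - s))) = norm (l2_class k)" using shift_l2_l2_class[OF k, of s] norm_shift_l2[of s "l2_class k"] by simp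
      finally show ?thesis .
    qed
    show "integrable lborel (\<lambda>s. norm (f s) * (norm (l2_class \<rho>) * norm (l2_class k)))"
      by (intro integrable_mult_left integrable_norm f)
    show "(\<lambda>z. F (fst z) (snd z)) \<in> borel_measurable borel"
      unfolding F_def borel_prod[symmetric] by measurable
  qed (rule Fi)
  moreover have "(LINT s|lborel. F t s) = \<rho> t \<bullet> convol k f t" for t
    unfolding F_def convol_def by (rule integral_inner_right) (use convol_integrable[OF k f(1)] in simp)
  moreover have "(LINT t|lborel. F t s) = convol (\<lambda>x. ctranspose (k (- x))) \<rho> s \<bullet> f s" for s
    unfolding F_def convol_def inner_ctranspose
    by (subst integral_inner_left) (use convol_integrable[OF h \<rho>, of s] in simp_all)
  ultimately show ?thesis by simp
qed

section \<open>Evolution in the state space\<close>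

text \<open>The quotient form lets the two one-sided limits be treated separately in the Duhamel
  formula.\<close>

lemma has_vector_derivative_quotient:
  fixes f :: "real \<Rightarrow> 'a::real_normed_vector"
  shows "(f has_vector_derivative d) (at x within S) \<longleftrightarrow> ((\<lambda>y. (1 / (y - x)) *\<^sub>R (f y - f x)) \<longlongrightarrow> d) (at x within S)"
proof -
  have eq: "norm ((1 / (y - x)) *\<^sub>R (f y - f x) - d) = norm (f y - f x - (y - x) *\<^sub>R d) / norm (y - x)" if "y \<noteq> x" for y
  proof -
    have "(1 / (y - x)) *\<^sub>R (f y - f x) - d = (1 / (y - x)) *\<^sub>R (f y - f x - (y - x) *\<^sub>R d)"
      using that by (simp add: scaleR_diff_right)
    then show ?thesis using that by (simp add: divide_simps)
  qed
  have "(f has_vector_derivative d) (at x within S) \<longleftrightarrow>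
      ((\<lambda>y. norm (f y - f x - (y - x) *\<^sub>R d) / norm (y - x)) \<longlongrightarrow> 0) (at x within S)"
    unfolding has_vector_derivative_def has_derivative_iff_norm by (simp add: bounded_linear_scaleR_left)
  also have "\<dots> \<longleftrightarrow> ((\<lambda>y. norm ((1 / (y - x)) *\<^sub>R (f y - f x) - d)) \<longlongrightarrow> 0) (at x within S)"
    by (rule filterlim_cong[OF refl refl]) (auto simp: eventually_at_filter eq)
  also have "\<dots> \<longleftrightarrow> ((\<lambda>y. (1 / (y - x)) *\<^sub>R (f y - f x)) \<longlongrightarrow> d) (at x within S)"
    by (simp add: tendsto_norm_zero_iff LIM_zero_iff)
  finally show ?thesis .
qed

section \<open>Strongly continuous families and the Duhamel formula\<close>

instance l2 :: (euclidean_space) banach ..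

text \<open>The operator at time 0 is not assumed to be the identity. The operators built below act
  on classes over the whole line, and at time 0 they cut a history to [-1, 0]; so
  \<open>duhamel\<close> asks for \<open>SX\<close> and \<open>SU\<close> at the points where the
  identity is used.\<close>

locale c0_family =
  fixes St :: "real \<Rightarrow> 'a::banach \<Rightarrow> 'a"
  assumes blin: "t \<ge> 0 \<Longrightarrow> bounded_linear (St t)"
    and semi: "t \<ge> 0 \<Longrightarrow> s \<ge> 0 \<Longrightarrow> St (t + s) p = St t (St s p)"
    and cont: "continuous_on {0..} (\<lambda>t. St t p)"
begin

text \<open>Orbits are bounded on compact time intervals by continuity, and uniform boundedness
  makes the bound uniform over all vectors.\<close>

lemma St_bound: "\<exists>C\<ge>0. \<forall>t\<in>{0..T}. \<forall>x. norm (St t x) \<le> C * norm x"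
proof (rule banach_steinhaus)
  show "\<exists>M. \<forall>t\<in>{0..T}. norm (St t x) \<le> M" for x
  proof -
    have "compact ((\<lambda>t. St t x) ` {0..T})"
      by (intro compact_continuous_image continuous_on_subset[OF cont]) auto
    from compact_imp_bounded[OF this] obtain M where "\<forall>y\<in>(\<lambda>t. St t x) ` {0..T}. norm y \<le> M"
      unfolding bounded_iff by blast
    then show ?thesis by blast
  qed
qed (simp add: blin)

text \<open>Joint continuity in time and vector: strong continuity handles the fixed vector, the
  uniform bound the moving one.\<close>

lemma St_tendsto:
  assumes t: "(t \<longlongrightarrow> t0) F" and x: "(x \<longlongrightarrow> x0) F" and nn: "\<forall>\<^sub>F y in F. t y \<in> {0..T}" and t0: "t0 \<in> {0..T}"
  shows "((\<lambda>y. St (t y) (x y)) \<longlongrightarrow> St t0 x0) F"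
proof -
  obtain C where C: "C \<ge> 0" "\<And>t x. t \<in> {0..T} \<Longrightarrow> norm (St t x) \<le> C * norm x" using St_bound by blast
  have 1: "((\<lambda>y. St (t y) x0) \<longlongrightarrow> St t0 x0) F"
    by (rule continuous_on_tendsto_compose[OF cont t]) (use t0 nn in \<open>auto elim: eventually_mono\<close>)
  have 2: "((\<lambda>y. St (t y) (x y) - St (t y) x0) \<longlongrightarrow> 0) F"
  proof (rule Lim_null_comparison)
    show "\<forall>\<^sub>F y in F. norm (St (t y) (x y) - St (t y) x0) \<le> C * norm (x y - x0)"
      using nn
    proof eventually_elim
      case (elim y)
      then interpret bounded_linear "St (t y)" by (intro blin) simp
      show ?case using C(2)[OF elim, of "x y - x0"] by (simp add: diff)
    qed
    have "((\<lambda>y. C * norm (x y - x0)) \<longlongrightarrow> C * norm (x0 - x0)) F" by (intro tendsto_intros x)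
    then show "((\<lambda>y. C * norm (x y - x0)) \<longlongrightarrow> 0) F" by simp
  qed
  from tendsto_add[OF 1 2] show ?thesis by simp
qed

text \<open>Product rule for s \<mapsto> \<open>St (T - s) (X s)\<close>: the motion of
  \<open>X\<close> contributes \<open>U\<close>, the semigroup contributes \<open>- V\<close>. The
  generator limit is one-sided, so right and left difference quotients call for different
  factorisations.\<close>

lemma duhamel:
  assumes T: "T \<ge> 0"
    and dX: "\<And>s. s \<in> {0..T} \<Longrightarrow> (X has_vector_derivative U s) (at s within {0..T})"
    and gV: "\<And>s. s \<in> {0..T} \<Longrightarrow> ((\<lambda>h. (1 / h) *\<^sub>R (St h (X s) - X s)) \<longlongrightarrow> V s) (at_right 0)"
    and X0: "X 0 = 0" and SX: "\<And>s. s \<in> {0..T} \<Longrightarrow> St 0 (X s) = X s"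
    and SU: "\<And>s. s \<in> {0..T} \<Longrightarrow> St 0 (U s) = U s"
  shows "((\<lambda>s. St (T - s) (U s - V s)) has_integral X T) {0..T}"
proof -
  define \<phi> where "\<phi> s = St (T - s) (X s)" for s
  have "(\<phi> has_vector_derivative St (T - s) (U s - V s)) (at s within {0..T})" if s: "s \<in> {0..T}" for s
  proof -
    have q: "((\<lambda>y. (1 / (y - s)) *\<^sub>R (X y - X s)) \<longlongrightarrow> U s) (at s within {0..T})"
      using dX[OF s] by (simp add: has_vector_derivative_quotient)
    have eq: "{0..T} = {0..s} \<union> {s..T}" using s by auto
    have qR: "((\<lambda>y. (1 / (y - s)) *\<^sub>R (X y - X s)) \<longlongrightarrow> U s) (at s within {s..T})"
      and qL: "((\<lambda>y. (1 / (y - s)) *\<^sub>R (X y - X s)) \<longlongrightarrow> U s) (at s within {0..s})"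
      using q s by (auto elim!: tendsto_within_subset)
    \<comment> \<open>For y > s the common factor is \<open>St (T - y)\<close>, and the semigroup
      acts on the fixed vector \<open>X s\<close> over the time y - s.\<close>
    have R: "((\<lambda>y. (1 / (y - s)) *\<^sub>R (\<phi> y - \<phi> s)) \<longlongrightarrow> St (T - s) (U s - V s)) (at s within {s..T})"
    proof -
      have f: "filterlim (\<lambda>y. y - s) (at_right 0) (at s within {s..T})"
        unfolding filterlim_at
        by (auto simp: eventually_at_filter intro!: tendsto_eq_intros)
      have "((\<lambda>y. (1 / (y - s)) *\<^sub>R (St (y - s) (X s) - X s)) \<longlongrightarrow> V s) (at s within {s..T})"
        using filterlim_compose[OF gV[OF s] f] .
      from tendsto_diff[OF qR this]
      have d: "((\<lambda>y. (1 / (y - s)) *\<^sub>R (X y - St (y - s) (X s))) \<longlongrightarrow> U s - V s) (at s within {s..T})"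
        by (simp add: scaleR_diff_right)
      have "((\<lambda>y. St (T - y) ((1 / (y - s)) *\<^sub>R (X y - St (y - s) (X s)))) \<longlongrightarrow> St (T - s) (U s - V s)) (at s within {s..T})"
        by (rule St_tendsto[OF _ d, where T=T]) (use s in \<open>auto simp: eventually_at_filter intro!: tendsto_intros\<close>)
      then show ?thesis
      proof (rule Lim_transform_eventually)
        show "\<forall>\<^sub>F y in at s within {s..T}. St (T - y) ((1 / (y - s)) *\<^sub>R (X y - St (y - s) (X s))) = (1 / (y - s)) *\<^sub>R (\<phi> y - \<phi> s)"
          unfolding eventually_at_filter
        proof (rule always_eventually, intro allI impI)
          fix y assume y: "y \<noteq> s" "y \<in> {s..T}"
          then interpret bounded_linear "St (T - y)" by (intro blin) simp
          have "St (T - s) (X s) = St (T - y) (St (y - s) (X s))" using semi[of "T - y" "y - s" "X s"] y by simp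
          then show "St (T - y) ((1 / (y - s)) *\<^sub>R (X y - St (y - s) (X s))) = (1 / (y - s)) *\<^sub>R (\<phi> y - \<phi> s)"
            unfolding \<phi>_def by (simp add: scaleR diff)
        qed
      qed
    qed
    \<comment> \<open>For y < s the factor \<open>St (T - s)\<close> comes out. The remaining
      \<open>St (s - y)\<close> acts on the quotient of \<open>X\<close>, which converges, and on
      the fixed vector \<open>X s\<close>.\<close>
    have L: "((\<lambda>y. (1 / (y - s)) *\<^sub>R (\<phi> y - \<phi> s)) \<longlongrightarrow> St (T - s) (U s - V s)) (at s within {0..s})"
    proof -
      have f: "filterlim (\<lambda>y. s - y) (at_right 0) (at s within {0..s})"
        unfolding filterlim_at
        by (auto simp: eventually_at_filter intro!: tendsto_eq_intros)
      have v: "((\<lambda>y. (1 / (s - y)) *\<^sub>R (St (s - y) (X s) - X s)) \<longlongrightarrow> V s) (at s within {0..s})"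
        using filterlim_compose[OF gV[OF s] f] .
      have w: "((\<lambda>y. St (s - y) ((1 / (y - s)) *\<^sub>R (X y - X s))) \<longlongrightarrow> U s) (at s within {0..s})"
      proof -
        have "((\<lambda>y. s - y) \<longlongrightarrow> 0) (at s within {0..s})" by (auto intro!: tendsto_eq_intros)
        from St_tendsto[OF this qL, where T=T] show ?thesis
          using s SU[OF s] by (auto simp: eventually_at_filter)
      qed
      have lim: "((\<lambda>y. St (s - y) ((1 / (y - s)) *\<^sub>R (X y - X s)) - (1 / (s - y)) *\<^sub>R (St (s - y) (X s) - X s)) \<longlongrightarrow> U s - V s) (at s within {0..s})"
        by (rule tendsto_diff[OF w v])
      interpret bounded_linear "St (T - s)" using s by (intro blin) simp
      from tendsto[OF lim] show ?thesis
      proof (rule Lim_transform_eventually)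
        show "\<forall>\<^sub>F y in at s within {0..s}. St (T - s) (St (s - y) ((1 / (y - s)) *\<^sub>R (X y - X s)) - (1 / (s - y)) *\<^sub>R (St (s - y) (X s) - X s)) = (1 / (y - s)) *\<^sub>R (\<phi> y - \<phi> s)"
          unfolding eventually_at_filter
        proof (rule always_eventually, intro allI impI)
          fix y assume y: "y \<noteq> s" "y \<in> {0..s}"
          interpret S2: bounded_linear "St (s - y)" using y by (intro blin) simp
          have e1: "1 / (s - y) = - (1 / (y - s))" using y by (simp add: divide_simps)
          have "St (s - y) ((1 / (y - s)) *\<^sub>R (X y - X s)) - (1 / (s - y)) *\<^sub>R (St (s - y) (X s) - X s)
              = (1 / (y - s)) *\<^sub>R (St (s - y) (X y) - X s)"
            unfolding e1 by (simp add: S2.scaleR S2.diff scaleR_diff_right)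
          moreover have "St (T - y) (X y) = St (T - s) (St (s - y) (X y))" using semi[of "T - s" "s - y" "X y"] y s by simp
          ultimately show "St (T - s) (St (s - y) ((1 / (y - s)) *\<^sub>R (X y - X s)) - (1 / (s - y)) *\<^sub>R (St (s - y) (X s) - X s)) = (1 / (y - s)) *\<^sub>R (\<phi> y - \<phi> s)"
            unfolding \<phi>_def by (simp add: scaleR diff)
        qed
      qed
    qed
    show ?thesis
      unfolding has_vector_derivative_quotient
      by (subst eq) (use L R in \<open>simp add: Lim_within_Un\<close>)
  qed
  then have "((\<lambda>s. St (T - s) (U s - V s)) has_integral \<phi> T - \<phi> 0) {0..T}"
    by (intro fundamental_theorem_of_calculus[OF T])
  moreover have "\<phi> 0 = 0"
  proof -
    interpret bounded_linear "St T" using T by (rule blin)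
    show ?thesis unfolding \<phi>_def X0 using zero by simp
  qed
  moreover have "\<phi> T = X T" using SX[of T] T by (simp add: \<phi>_def)
  ultimately show ?thesis by simp
qed

end

section \<open>From representatives of states to classes\<close>

type_synonym 'n m2_class = "(complex^'n) \<times> (complex^'n) l2"

definition class_of :: "'n::finite m2 \<Rightarrow> 'n m2_class" where
  "class_of x = (fst x, l2_class (\<lambda>\<theta>. indicator {-1..0} \<theta> *\<^sub>R snd x \<theta>))"
definition rep_of :: "'n::finite m2_class \<Rightarrow> 'n m2" where
  "rep_of p = (fst p, l2_rep (snd p))"

lemma L2on_iff_l2f:
  fixes f :: "real \<Rightarrow> 'a::euclidean_space"
  shows "L2on S f \<longleftrightarrow> l2f (\<lambda>t. indicator S t *\<^sub>R f t)"
proof -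
  have "(\<lambda>t. indicat_real S t *\<^sub>R (norm (f t))\<^sup>2) = (\<lambda>t. (norm (indicat_real S t *\<^sub>R f t))\<^sup>2)"
    by (auto simp: indicator_def)
  then show ?thesis by (simp add: L2on_def l2f_def set_borel_measurable_def set_integrable_def)
qed

lemma M2_iff: "x \<in> M2 \<longleftrightarrow> l2f (\<lambda>\<theta>. indicator {-1..0} \<theta> *\<^sub>R snd x \<theta>)"
  by (simp add: M2_def L2on_iff_l2f)

lemma rep_of_M2[simp]: "rep_of p \<in> M2"
  by (simp add: M2_iff rep_of_def l2f_cmul_indicator)

lemma class_of_rep_of: "class_of (rep_of p) = (fst p, restrict_l2 {-1..0} (snd p))"
  by (simp add: class_of_def rep_of_def restrict_l2_def)

lemma norm_class_of: "x \<in> M2 \<Longrightarrow> norm (class_of x) = m2_norm x"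
proof -
  assume "x \<in> M2"
  then have l: "l2f (\<lambda>\<theta>. indicator {-1..0} \<theta> *\<^sub>R snd x \<theta>)" by (simp add: M2_iff)
  have "(LINT \<theta>:{-1..0}|lborel. (norm (snd x \<theta>))\<^sup>2) = (LINT \<theta>|lborel. (norm (indicat_real {-1..0} \<theta> *\<^sub>R snd x \<theta>))\<^sup>2)"
    unfolding set_lebesgue_integral_def by (rule Bochner_Integration.integral_cong) (auto simp: indicator_def)
  then show ?thesis
    by (simp add: class_of_def m2_norm_def norm_Pair norm_l2_class_sq[OF l])
qed

lemma class_of_eq_iff:
  assumes "x \<in> M2" "x' \<in> M2"
  shows "class_of x = class_of x' \<longleftrightarrow> m2_equiv x x'"
proof -
  have "(AE \<theta> in lborel. indicat_real {-1..0} \<theta> *\<^sub>R snd x \<theta> = indicat_real {-1..0} \<theta> *\<^sub>R snd x' \<theta>)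
    \<longleftrightarrow> (AE \<theta> in lborel. \<theta> \<in> {-1..0} \<longrightarrow> snd x \<theta> = snd x' \<theta>)"
    by (intro iffI; erule eventually_mono) (auto simp: indicator_def)
  then show ?thesis
    using assms by (auto simp: class_of_def m2_equiv_def M2_iff l2_class_eq_iff)
qed

lemma vsmul_blin: "bounded_linear (\<lambda>v :: complex^'n. c *s v)"
proof -
  have "(\<lambda>v :: complex^'n. c *s v) = (*v) (mat c)"
    by (auto simp: fun_eq_iff vec_eq_iff matrix_vector_mult_def mat_def if_distrib if_distribR cong: if_cong)
  then show ?thesis by (simp add: blin_mv)
qed

lemma indicator_smul: "indicat_real S t *\<^sub>R (c *s (v :: complex^'n)) = c *s (indicat_real S t *\<^sub>R v)"
  by (auto simp: indicator_def)

lemma of_real_smul: "complex_of_real a *s (v :: complex^'n) = a *\<^sub>R v"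
  by (simp add: vec_eq_iff scaleR_conv_of_real[where 'a=complex])

lemma m2_smult_M2: "x \<in> M2 \<Longrightarrow> m2_smult c x \<in> M2"
  unfolding M2_iff m2_smult_def snd_conv indicator_smul by (rule l2f_blin[OF _ vsmul_blin])

lemma m2_add_M2: "x \<in> M2 \<Longrightarrow> w \<in> M2 \<Longrightarrow> m2_add x w \<in> M2"
  unfolding M2_iff m2_add_def snd_conv scaleR_add_right by (rule l2f_add)

lemma class_of_add: "x \<in> M2 \<Longrightarrow> w \<in> M2 \<Longrightarrow> class_of (m2_add x w) = class_of x + class_of w"
  by (simp add: class_of_def m2_add_def M2_iff l2_class_add scaleR_add_right)

lemma class_of_smult: "x \<in> M2 \<Longrightarrow> class_of (m2_smult (complex_of_real a) x) = a *\<^sub>R class_of x"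
  by (simp add: class_of_def m2_smult_def M2_iff l2_class_scaleR of_real_smul mult.commute)

lemma class_of_sub: "x \<in> M2 \<Longrightarrow> w \<in> M2 \<Longrightarrow> class_of (m2_sub x w) = class_of x - class_of w"
  using class_of_smult[of w "-1"] by (simp add: m2_sub_def class_of_add m2_smult_M2)

text \<open>The imaginary part of the Hermitian pairing with \<open>w\<close> is the real part of
  the pairing with i w, so complex pairings reduce to two real inner products.\<close>

lemma m2_inner_class_of:
  assumes "x \<in> M2" "w \<in> M2"
  shows "m2_inner x w = Complex (inner (class_of x) (class_of w)) (inner (class_of x) (class_of (m2_smult \<i> w)))"
proof -
  have re: "Re (cinner v u) = v \<bullet> u" for v u :: "complex^'n"
    by (simp add: cinner_def inner_vec_def complex_inner_Re)
  have im: "Im (cinner v u) = v \<bullet> (\<i> *s u)" for v u :: "complex^'n"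
    by (simp add: cinner_def inner_vec_def complex_inner_Re)
  let ?I = "indicat_real {-1..0}"
  have lx: "l2f (\<lambda>\<theta>. ?I \<theta> *\<^sub>R snd x \<theta>)" and lw: "l2f (\<lambda>\<theta>. ?I \<theta> *\<^sub>R snd w \<theta>)"
    using assms by (auto simp: M2_iff)
  have liw: "l2f (\<lambda>\<theta>. ?I \<theta> *\<^sub>R (\<i> *s snd w \<theta>))"
    unfolding indicator_smul by (rule l2f_blin[OF lw vsmul_blin])
  have cm: "continuous_on UNIV (\<lambda>p :: (complex^'n) \<times> (complex^'n). cinner (fst p) (snd p))"
    unfolding cinner_def by (intro continuous_intros)
  define G where "G \<theta> = cinner (?I \<theta> *\<^sub>R snd x \<theta>) (?I \<theta> *\<^sub>R snd w \<theta>)" for \<theta>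
  have Gm: "G \<in> borel_measurable lborel" unfolding G_def
    using borel_measurable_continuous_Pair[OF l2f_meas[OF lx] l2f_meas[OF lw] cm] by simp
  have GR: "Re (G \<theta>) = (?I \<theta> *\<^sub>R snd x \<theta>) \<bullet> (?I \<theta> *\<^sub>R snd w \<theta>)" 
   and GI: "Im (G \<theta>) = (?I \<theta> *\<^sub>R snd x \<theta>) \<bullet> (?I \<theta> *\<^sub>R (\<i> *s snd w \<theta>))" for \<theta>
    unfolding G_def re im indicator_smul by simp_all
  have Gi: "integrable lborel G"
  proof -
    have "integrable lborel (\<lambda>\<theta>. complex_of_real (Re (G \<theta>)) + \<i> * complex_of_real (Im (G \<theta>)))"
      unfolding GR GI
      by (intro Bochner_Integration.integrable_add integrable_mult_right integrable_of_real l2f_inner_integrable lx lw liw)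
    then show ?thesis by (simp add: complex_eq[symmetric])
  qed
  have G: "(LINT \<theta>:{-1..0}|lborel. cinner (snd x \<theta>) (snd w \<theta>)) = (LINT \<theta>|lborel. G \<theta>)"
    unfolding set_lebesgue_integral_def G_def by (rule Bochner_Integration.integral_cong) (auto simp: indicator_def cinner_def)
  have "Re (LINT \<theta>|lborel. G \<theta>) = (LINT \<theta>|lborel. Re (G \<theta>))" "Im (LINT \<theta>|lborel. G \<theta>) = (LINT \<theta>|lborel. Im (G \<theta>))"
    using Gi by simp_all
  then show ?thesis
    unfolding m2_inner_def G
    by (intro complex_eqI) (simp_all add: re im class_of_def inner_prod_def inner_l2_class[OF lx lw] inner_l2_class[OF lx liw] GR GI m2_smult_def)
qed

section \<open>History states and the delay kernel\<close>

text \<open>The trajectory with derivative \<open>f\<close> and zero past: for t < 0 the interval is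
  empty and the value is 0.\<close>

definition primitive :: "(real \<Rightarrow> 'a::euclidean_space) \<Rightarrow> real \<Rightarrow> 'a" where
  "primitive f t = (LINT s|lborel. indicator {0..t} s *\<^sub>R f s)"

definition locally_integrable :: "(real \<Rightarrow> 'a::euclidean_space) \<Rightarrow> bool" where
  "locally_integrable f \<longleftrightarrow> (\<forall>a b. integrable lborel (\<lambda>s. indicator {a..b} s *\<^sub>R f s)) \<and> (\<forall>t<0. f t = 0)"

lemma l2f_integrable_interval:
  assumes "l2f f" shows "integrable lborel (\<lambda>s. indicator {a..b::real} s *\<^sub>R f s)"
  using l2f_bilinear_integrable[OF l2f_indicator_const[of a b "1::real"] assms, where b=scaleR] l2f_meas[OF assms]
  by simp

lemma locally_integrable_l2f: "l2f f \<Longrightarrow> (\<And>t. t < 0 \<Longrightarrow> f t = 0) \<Longrightarrow> locally_integrable f"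
  by (simp add: locally_integrable_def l2f_integrable_interval)

lemma locally_integrable_continuous:
  assumes "continuous_on UNIV f" "\<And>t. t < 0 \<Longrightarrow> f t = 0" shows "locally_integrable f"
proof -
  have "integrable lborel (\<lambda>s. indicator {a..b} s *\<^sub>R f s)" for a b
  proof -
    have eq: "(\<lambda>s. indicat_real {a..b} s *\<^sub>R indicat_real {a..b} s *\<^sub>R f s) = (\<lambda>s. indicat_real {a..b} s *\<^sub>R f s)"
      by (auto simp: indicator_def)
    show ?thesis using l2f_integrable_interval[OF l2f_continuous_interval[OF assms(1)], of a b a b] unfolding eq .
  qed
  then show ?thesis using assms(2) by (simp add: locally_integrable_def)
qed

lemma primitive_split:
  assumes f: "locally_integrable f" and ab: "a \<le> b"
  shows "primitive f b = primitive f a + (LINT s|lborel. indicator {a..b} s *\<^sub>R f s)"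
proof -
  have i: "integrable lborel (\<lambda>s. indicator {c..d} s *\<^sub>R f s)" for c d using f by (simp add: locally_integrable_def)
  have "primitive f b = (LINT s|lborel. indicator {0..a} s *\<^sub>R f s + indicator {a..b} s *\<^sub>R f s)"
    unfolding primitive_def
  proof (rule integral_cong_AE)
    show "AE s in lborel. indicat_real {0..b} s *\<^sub>R f s = indicator {0..a} s *\<^sub>R f s + indicator {a..b} s *\<^sub>R f s"
      using AE_lborel_singleton[of a]
    proof eventually_elim
      case (elim s)
      show ?case using elim f ab by (cases "s < 0") (auto simp: indicator_def locally_integrable_def)
    qed
    show "(\<lambda>s. indicator {0..a} s *\<^sub>R f s + indicator {a..b} s *\<^sub>R f s) \<in> borel_measurable lborel"
      by (intro borel_measurable_integrable Bochner_Integration.integrable_add i)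
  qed (intro borel_measurable_integrable i)
  also have "\<dots> = primitive f a + (LINT s|lborel. indicator {a..b} s *\<^sub>R f s)"
    unfolding primitive_def by (rule Bochner_Integration.integral_add[OF i i])
  finally show ?thesis .
qed

lemma primitive_neg: "t < 0 \<Longrightarrow> primitive f t = 0"
  by (simp add: primitive_def)

lemma primitive_deriv:
  assumes c: "continuous_on UNIV f" and 0: "\<And>t. t < 0 \<Longrightarrow> f t = 0"
  shows "(primitive f has_vector_derivative f t) (at t)"
proof -
  define k where "k = \<bar>t\<bar> + 1"
  have k: "t \<in> {-k<..<k}" "k > 0" by (auto simp: k_def)
  have li: "locally_integrable f" by (rule locally_integrable_continuous[OF c 0])
  have eq: "integral {-k..u} f = primitive f u" if "u \<in> {-k..k}" for u
  proof -
    have "(LINT s:{-k..u}|lborel. f s) = integral {-k..u} f"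
      using li by (intro set_borel_integral_eq_integral) (simp add: set_integrable_def locally_integrable_def)
    then show ?thesis using primitive_split[OF li, of "-k" u] primitive_neg[of "-k" f] that k by (simp add: set_lebesgue_integral_def)
  qed
  have "((\<lambda>u. integral {-k..u} f) has_vector_derivative f t) (at t within {-k..k})"
    by (rule integral_has_vector_derivative[OF continuous_on_subset[OF c]]) (use k in auto)
  then have "(primitive f has_vector_derivative f t) (at t within {-k..k})"
    by (rule has_vector_derivative_transform[rotated 2]) (use k eq in auto)
  then show ?thesis using k at_within_Icc_at[of "-k" t k] by simp
qed

definition state_of :: "complex^'n^'n \<Rightarrow> (real \<Rightarrow> complex^'n) \<Rightarrow> real \<Rightarrow> 'n::finite m2" where
  "state_of A f s = (primitive f s - A *v primitive f (s - 1), \<lambda>\<theta>. primitive f (s + \<theta>))"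

lemma primitive_bound:
  assumes "l2f f" "t \<le> T" "T \<ge> 0"
  shows "norm (primitive f t) \<le> sqrt T * norm (l2_class f)"
proof -
  have "norm (primitive f t) \<le> (LINT s|lborel. norm (indicat_real {0..t} s) * norm (f s))"
    unfolding primitive_def using integral_norm_bound[of lborel "\<lambda>s. indicat_real {0..t} s *\<^sub>R f s"] by simp
  also have "\<dots> \<le> norm (l2_class (indicat_real {0..t})) * norm (l2_class f)"
    using l2_Cauchy_Schwarz[OF l2f_indicator_const[of 0 t "1::real"] assms(1)] by simp
  also have "\<dots> \<le> sqrt T * norm (l2_class f)"
  proof (rule mult_right_mono)
    show "norm (l2_class (indicat_real {0..t})) \<le> sqrt T"
    proof (cases "t \<ge> 0")
      case True
      have "norm (l2_class (indicat_real {0..t})) \<le> 1 * sqrt (t - 0)"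
        using norm_l2_class_indicator_bound[of "\<lambda>_. 1::real" 0 t 1] True by simp
      also have "\<dots> \<le> sqrt T" using assms by simp
      finally show ?thesis .
    next
      case False
      have "indicat_real {0..t} = (\<lambda>x. 0)" using False by auto
      then show ?thesis using assms by (simp add: zero_l2_l2_class[symmetric])
    qed
  qed simp
  finally show ?thesis .
qed

text \<open>Cauchy-Schwarz on [a, b] gives Hoelder continuity with exponent 1/2.\<close>

lemma primitive_continuous: assumes "l2f f" "\<And>t. t < 0 \<Longrightarrow> f t = 0" shows "continuous_on UNIV (primitive f)"
proof -
  have li: "locally_integrable f" by (rule locally_integrable_l2f[OF assms])
  have c: "norm (primitive f b - primitive f a) \<le> sqrt (b - a) * norm (l2_class f)" if "a \<le> b" for a b
  proof -
    have "primitive f b - primitive f a = (LINT s|lborel. indicator {a..b} s *\<^sub>R f s)" using primitive_split[OF li that] by simp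
    also have "\<dots> = (LINT s|lborel. indicator {a..b} (s + a) *\<^sub>R f (s + a))"
      using lint_shift[of "\<lambda>s. indicator {a..b} s *\<^sub>R f s" a] by simp
    also have "\<dots> = primitive (\<lambda>s. f (s + a)) (b - a)"
      unfolding primitive_def by (rule Bochner_Integration.integral_cong) (auto simp: indicator_def)
    also have "norm \<dots> \<le> sqrt (b - a) * norm (l2_class (\<lambda>s. f (s + a)))"
      by (rule primitive_bound) (use that in \<open>auto intro: l2f_shift assms\<close>)
    also have "norm (l2_class (\<lambda>s. f (s + a))) = norm (l2_class f)" using shift_l2_l2_class[OF assms(1), of "-a"] norm_shift_l2[of "-a" "l2_class f"] by simp
    finally show ?thesis .
  qed
  have c': "norm (primitive f y - primitive f x) \<le> sqrt \<bar>y - x\<bar> * norm (l2_class f)" for x y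
    using c[of x y] c[of y x] by (cases "x \<le> y") (auto simp: norm_minus_commute)
  have "isCont (primitive f) x" for x
    unfolding isCont_def
  proof (rule LIM_zero_cancel, rule Lim_null_comparison)
    show "\<forall>\<^sub>F y in at x. norm (primitive f y - primitive f x) \<le> sqrt \<bar>y - x\<bar> * norm (l2_class f)" using c' by simp
    have "((\<lambda>y. sqrt \<bar>y - x\<bar> * norm (l2_class f)) \<longlongrightarrow> sqrt \<bar>x - x\<bar> * norm (l2_class f)) (at x)" by (intro tendsto_intros)
    then show "((\<lambda>y. sqrt \<bar>y - x\<bar> * norm (l2_class f)) \<longlongrightarrow> 0) (at x)" by simp
  qed
  then show ?thesis by (simp add: continuous_on_eq_continuous_at)
qed

lemma state_of_dom:
  assumes f: "locally_integrable f" and l: "\<And>s. l2f (\<lambda>\<theta>. indicator {-1..0} \<theta> *\<^sub>R f (s + \<theta>))"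
    and c: "continuous_on UNIV (primitive f)"
  shows "dom_data A (state_of A f s) (primitive f (s - 1)) (\<lambda>\<theta>. f (s + \<theta>))" "state_of A f s \<in> M2"
proof -
  have e: "primitive f (s + \<theta>) = primitive f (s - 1) + (LINT \<sigma>:{-1..\<theta>}|lborel. f (s + \<sigma>))" if "\<theta> \<ge> -1" for \<theta>
  proof -
    have "(LINT \<sigma>:{-1..\<theta>}|lborel. f (s + \<sigma>)) = (LINT \<sigma>|lborel. indicator {s - 1..s + \<theta>} (\<sigma> + s) *\<^sub>R f (\<sigma> + s))"
      unfolding set_lebesgue_integral_def
      by (rule Bochner_Integration.integral_cong) (auto simp: indicator_def add.commute)
    also have "\<dots> = (LINT \<sigma>|lborel. indicator {s - 1..s + \<theta>} \<sigma> *\<^sub>R f \<sigma>)"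
      by (rule lint_shift)
    finally show ?thesis using primitive_split[OF f, of "s - 1" "s + \<theta>"] that by simp
  qed
  show "dom_data A (state_of A f s) (primitive f (s - 1)) (\<lambda>\<theta>. f (s + \<theta>))"
    unfolding dom_data_def L2on_iff_l2f using l e e[of 0] by (auto simp: state_of_def)
  have "continuous_on UNIV (\<lambda>\<theta>. primitive f (s + \<theta>))"
    by (rule continuous_on_compose2[OF c]) (auto intro!: continuous_intros)
  then show "state_of A f s \<in> M2"
    by (simp add: M2_iff state_of_def l2f_continuous_interval)
qed

section \<open>The convolution kernel of the two distributed delays\<close>

locale delay_kernels =
  fixes A2 A3 :: "real \<Rightarrow> complex^'n^'n"
  assumes A2: "l2f (\<lambda>\<theta>. indicator {-1..0} \<theta> *\<^sub>R A2 \<theta>)" and A3: "l2f (\<lambda>\<theta>. indicator {-1..0} \<theta> *\<^sub>R A3 \<theta>)"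
begin

definition a2 where "a2 \<theta> = indicator {-1..0} \<theta> *\<^sub>R A2 \<theta>"
definition a3 where "a3 \<theta> = indicator {-1..0} \<theta> *\<^sub>R A3 \<theta>"
text \<open>\<open>delay_kernel\<close> is the kernel of \<open>f \<mapsto> Lop A2 A3 f z\<close> for \<open>z\<close> the primitive of \<open>f\<close>: the part \<open>K3\<close> comes from
exchanging the order of integration in the \<open>A3\<close> term.\<close>

definition K2 where "K2 t = (if 0 \<le> t \<and> t < 1 then a2 (- t) else 0)"
definition K3 where "K3 x = (LINT \<theta>|lborel. (if - x \<le> \<theta> then a3 \<theta> else 0))"
definition delay_kernel where "delay_kernel t = K2 t + K3 t"
text \<open>The uncut kernel stays constant after time 1 and is in general not square integrable.
  Cutting at \<open>T\<close> leaves the convolution with functions vanishing on negative times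
  unchanged up to time \<open>T\<close>.\<close>

definition delay_kernel_on where "delay_kernel_on T t = indicator {0..T} t *\<^sub>R delay_kernel t" for T t

lemma l2f_a2: "l2f a2" using A2 by (simp add: a2_def[abs_def])
lemma l2f_a3: "l2f a3" using A3 by (simp add: a3_def[abs_def])
lemma a3_meas[measurable]: "a3 \<in> borel_measurable borel" by (rule l2f_meas[OF l2f_a3])
lemma a3_int: "integrable lborel a3"
proof -
  have eq: "(\<lambda>s. indicat_real {-1..0} s *\<^sub>R a3 s) = a3" by (auto simp: indicator_def a3_def)
  show ?thesis using l2f_integrable_interval[OF l2f_a3, of "-1" 0] unfolding eq .
qed

lemma K3_int: "integrable lborel (\<lambda>\<theta>. (if - x \<le> \<theta> then a3 \<theta> else 0))"
  by (rule Bochner_Integration.integrable_bound[OF a3_int]) auto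

lemma K3_meas: "K3 \<in> borel_measurable borel"
proof -
  have "(\<lambda>x. LINT \<theta>|lborel. (if - x \<le> \<theta> then a3 \<theta> else 0)) \<in> borel_measurable borel"
    by (intro lborel.borel_measurable_lebesgue_integral) measurable
  then show ?thesis by (simp add: K3_def[abs_def])
qed

lemma K3_bound: "norm (K3 x) \<le> (LINT \<theta>|lborel. norm (a3 \<theta>))"
  unfolding K3_def
  by (rule Bochner_Integration.integral_norm_bound_integral[OF K3_int integrable_norm[OF a3_int]]) simp

lemma K3_neg: "x < 0 \<Longrightarrow> K3 x = 0"
  unfolding K3_def by (rule integral_eq_zero_AE) (auto simp: a3_def indicator_def)

text \<open>From x = 1 on the whole interval [-1, 0] is covered. The kernel does not die out because
  the A3 term sees z and not z'; this value is the source of the additive constants that time shifts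
  produce in the adjoint equation.\<close>

lemma K3_const: "x \<ge> 1 \<Longrightarrow> K3 x = (LINT \<theta>|lborel. a3 \<theta>)"
  unfolding K3_def by (rule Bochner_Integration.integral_cong) (auto simp: a3_def indicator_def)

lemma delay_kernel_neg: "x < 0 \<Longrightarrow> delay_kernel x = 0" by (simp add: delay_kernel_def K2_def K3_neg)
lemma delay_kernel_const: "x \<ge> 1 \<Longrightarrow> delay_kernel x = (LINT \<theta>|lborel. a3 \<theta>)" by (simp add: delay_kernel_def K2_def K3_const)

lemma l2f_K2: "l2f K2"
proof -
  have "l2f (\<lambda>t. indicator {0..<1} t *\<^sub>R a2 (0 - t))" by (intro l2f_cmul_indicator l2f_reflect l2f_a2) simp
  moreover have "K2 = (\<lambda>t. indicator {0..<1} t *\<^sub>R a2 (0 - t))" by (auto simp: K2_def indicator_def)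
  ultimately show ?thesis by simp
qed

lemma l2f_K3: "l2f (\<lambda>t. indicator {0..T} t *\<^sub>R K3 t)"
  by (rule l2f_bounded_interval[OF K3_meas K3_bound])

lemma l2f_delay_kernel_on: "l2f (delay_kernel_on T)"
  unfolding delay_kernel_on_def[abs_def] delay_kernel_def scaleR_add_right
  by (intro l2f_add l2f_K3 l2f_cmul_indicator l2f_K2) simp

lemma Lop_kernel:
  assumes f: "l2f f" and sf: "\<And>t. t \<notin> {0..T} \<Longrightarrow> f t = 0" and t: "t \<le> T"
  shows "Lop A2 A3 (\<lambda>\<theta>. f (t + \<theta>)) (\<lambda>\<theta>. primitive f (t + \<theta>)) = convol (delay_kernel_on T) f t"
proof -
  note [measurable] = l2f_meas[OF f]
  have fi: "integrable lborel f"
    using l2f_integrable_interval[OF f, of 0 T] by (rule Bochner_Integration.integrable_bound) (use sf in \<open>auto simp: indicator_def\<close>)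
  have 2: "(LINT \<theta>:{-1..0}|lborel. A2 \<theta> *v f (t + \<theta>)) = (LINT s|lborel. K2 (t - s) *v f s)"
  proof -
    have "(LINT \<theta>:{-1..0}|lborel. A2 \<theta> *v f (t + \<theta>)) = (LINT \<theta>|lborel. a2 ((\<theta> + t) - t) *v f (\<theta> + t))"
      unfolding set_lebesgue_integral_def a2_def by (rule Bochner_Integration.integral_cong) (auto simp: mv.scaleR_left add.commute)
    also have "\<dots> = (LINT s|lborel. a2 (s - t) *v f s)" by (rule lint_shift)
    also have "\<dots> = (LINT s|lborel. K2 (t - s) *v f s)"
    proof (rule integral_cong_AE)
      \<comment> \<open>At s = t - 1 the half-open cut in \<open>K2\<close> may disagree with
        \<open>a2\<close>.\<close>
      show "AE s in lborel. a2 (s - t) *v f s = K2 (t - s) *v f s"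
        using AE_lborel_singleton[of "t - 1"] by eventually_elim (auto simp: K2_def a2_def indicator_def)
    qed (intro borel_measurable_integrable mv_integrable f l2f_shift' l2f_a2 l2f_reflect[OF l2f_K2])+
    finally show ?thesis .
  qed
  \<comment> \<open>Integrand of the A3 term as a double integral. As z(t + \<theta>) integrates
    \<open>f\<close> up to t + \<theta>, the constraint s \<le> t + \<theta> becomes the lower limit
    of \<theta> in \<open>K3\<close>.\<close>
  define F where "F \<theta> s = (if s - t \<le> \<theta> then a3 \<theta> *v f s else 0)" for \<theta> s
  have Fi: "integrable lborel (\<lambda>\<theta>. F \<theta> s)" for s
  proof (rule Bochner_Integration.integrable_bound[OF integrable_mult_left[OF integrable_norm[OF a3_int], of "norm (f s)"]])
    show "(\<lambda>\<theta>. F \<theta> s) \<in> borel_measurable lborel" unfolding F_def by measurable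
    show "AE \<theta> in lborel. norm (F \<theta> s) \<le> norm (norm (a3 \<theta>) * norm (f s))"
      using norm_mv_le by (auto simp: F_def)
  qed
  have sw: "(LINT s|lborel. LINT \<theta>|lborel. F \<theta> s) = (LINT \<theta>|lborel. LINT s|lborel. F \<theta> s)"
   and swi: "integrable lborel (\<lambda>s. LINT \<theta>|lborel. F \<theta> s)"
  proof -
    have m: "(\<lambda>z. F (fst z) (snd z)) \<in> borel_measurable borel"
      unfolding F_def borel_prod[symmetric] by measurable
    have b: "(LINT \<theta>|lborel. norm (F \<theta> s)) \<le> (LINT \<theta>|lborel. norm (a3 \<theta>)) * norm (f s)" for s
    proof -
      have "(LINT \<theta>|lborel. norm (F \<theta> s)) \<le> (LINT \<theta>|lborel. norm (a3 \<theta>) * norm (f s))"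
        by (intro integral_mono integrable_norm Fi integrable_mult_left a3_int) (use norm_mv_le in \<open>auto simp: F_def\<close>)
      then show ?thesis by simp
    qed
    have g: "integrable lborel (\<lambda>s. (LINT \<theta>|lborel. norm (a3 \<theta>)) * norm (f s))"
      by (intro integrable_mult_right integrable_norm fi)
    show "(LINT s|lborel. LINT \<theta>|lborel. F \<theta> s) = (LINT \<theta>|lborel. LINT s|lborel. F \<theta> s)"
      by (rule fubini_gen(1)[OF m Fi b g])
    show "integrable lborel (\<lambda>s. LINT \<theta>|lborel. F \<theta> s)"
      by (rule fubini_gen(2)[OF m Fi b g])
  qed
  have F3: "(LINT \<theta>|lborel. F \<theta> s) = K3 (t - s) *v f s" for s
  proof -
    have "(LINT \<theta>|lborel. F \<theta> s) = (LINT \<theta>|lborel. (if - (t - s) \<le> \<theta> then a3 \<theta> else 0) *v f s)"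
      unfolding F_def by (rule Bochner_Integration.integral_cong) auto
    also have "\<dots> = K3 (t - s) *v f s"
      unfolding K3_def by (rule integral_bounded_linear[OF mv.bounded_linear_left K3_int])
    finally show ?thesis .
  qed
  have 3: "(LINT \<theta>:{-1..0}|lborel. A3 \<theta> *v primitive f (t + \<theta>)) = (LINT s|lborel. K3 (t - s) *v f s)"
  proof -
    have "(LINT \<theta>:{-1..0}|lborel. A3 \<theta> *v primitive f (t + \<theta>)) = (LINT \<theta>|lborel. LINT s|lborel. F \<theta> s)"
      unfolding set_lebesgue_integral_def
    proof (rule Bochner_Integration.integral_cong[OF refl])
      fix \<theta>
      have i: "integrable lborel (\<lambda>s. indicat_real {0..t+\<theta>} s *\<^sub>R f s)" by (rule l2f_integrable_interval[OF f])
      have "indicat_real {-1..0} \<theta> *\<^sub>R (A3 \<theta> *v primitive f (t + \<theta>)) = a3 \<theta> *v primitive f (t + \<theta>)" by (simp add: a3_def mv.scaleR_left)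
      also have "\<dots> = (LINT s|lborel. a3 \<theta> *v (indicat_real {0..t+\<theta>} s *\<^sub>R f s))"
        unfolding primitive_def by (rule integral_bounded_linear[OF blin_mv i, symmetric])
      also have "\<dots> = (LINT s|lborel. F \<theta> s)"
        by (rule Bochner_Integration.integral_cong[OF refl]) (use sf in \<open>auto simp: F_def indicator_def\<close>)
      finally show "indicat_real {-1..0} \<theta> *\<^sub>R (A3 \<theta> *v primitive f (t + \<theta>)) = (LINT s|lborel. F \<theta> s)" .
    qed
    then show ?thesis using sw F3 by simp
  qed
  have i2: "integrable lborel (\<lambda>s. K2 (t - s) *v f s)" by (rule mv_integrable[OF l2f_reflect[OF l2f_K2] f])
  have i3: "integrable lborel (\<lambda>s. K3 (t - s) *v f s)" using swi F3 by simp
  have "(LINT s|lborel. K2 (t - s) *v f s) + (LINT s|lborel. K3 (t - s) *v f s) = convol (delay_kernel_on T) f t"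
    unfolding convol_def Bochner_Integration.integral_add[OF i2 i3, symmetric]
  proof (rule Bochner_Integration.integral_cong[OF refl])
    fix s
    \<comment> \<open>For s in [0, T] and t \<le> T the argument t - s is at most T, so the cut acts
      only at negative arguments, where the kernel is 0.\<close>
    show "K2 (t - s) *v f s + K3 (t - s) *v f s = delay_kernel_on T (t - s) *v f s"
    proof (cases "s \<in> {0..T}")
      case True
      then show ?thesis
        using delay_kernel_neg[of "t - s"] t by (cases "t - s < 0") (auto simp: delay_kernel_on_def delay_kernel_def mv.add_left K3_neg K2_def)
    qed (simp add: sf)
  qed
  then show ?thesis by (simp add: Lop_def 2 3)
qed

end

section \<open>The given semigroup as operators on classes\<close>

locale neutral = delay_kernels A2 A3 for A2 A3 :: "real \<Rightarrow> complex^'n::finite^'n" +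
  fixes A :: "complex^'n^'n" and S :: "real \<Rightarrow> 'n m2 \<Rightarrow> 'n m2"
  assumes S_gen: "is_semigroup_of S A A2 A3"
begin

definition St :: "real \<Rightarrow> 'n m2_class \<Rightarrow> 'n m2_class" where "St t p = class_of (S t (rep_of p))"

lemma S_M2: "t \<ge> 0 \<Longrightarrow> x \<in> M2 \<Longrightarrow> S t x \<in> M2"
  using S_gen by (simp add: is_semigroup_of_def)

lemma S_cong: "t \<ge> 0 \<Longrightarrow> x \<in> M2 \<Longrightarrow> x' \<in> M2 \<Longrightarrow> class_of x = class_of x' \<Longrightarrow> class_of (S t x) = class_of (S t x')"
proof -
  assume *: "t \<ge> 0" "x \<in> M2" "x' \<in> M2" "class_of x = class_of x'"
  then have "m2_equiv x x'" by (simp add: class_of_eq_iff)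
  then have "m2_equiv (S t x) (S t x')" using *(1,2)
    by (intro S_gen[unfolded is_semigroup_of_def, THEN conjunct2, THEN conjunct1, rule_format])
  then show ?thesis using * by (simp add: class_of_eq_iff S_M2)
qed

lemma class_of_rep_of_class_of: assumes "x \<in> M2" shows "class_of (rep_of (class_of x)) = class_of x"
proof -
  have l: "l2f (\<lambda>\<theta>. indicat_real {-1..0} \<theta> *\<^sub>R snd x \<theta>)" using assms by (simp add: M2_iff)
  have eq: "(\<lambda>t. indicat_real {- 1..0} t *\<^sub>R indicat_real {- 1..0} t *\<^sub>R snd x t) = (\<lambda>t. indicat_real {- 1..0} t *\<^sub>R snd x t)"
    by (auto simp: indicator_def)
  show ?thesis unfolding class_of_rep_of unfolding class_of_def snd_conv by (subst restrict_l2_l2_class[OF l]) (simp_all only: eq, simp_all)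
qed

lemma St_class_of: "t \<ge> 0 \<Longrightarrow> x \<in> M2 \<Longrightarrow> St t (class_of x) = class_of (S t x)"
  unfolding St_def by (rule S_cong) (simp_all add: class_of_rep_of_class_of)

lemma S_lin:
  assumes "t \<ge> 0" "x \<in> M2" "w \<in> M2"
  shows "class_of (S t (m2_add (m2_smult (complex_of_real a) x) (m2_smult (complex_of_real b) w))) = a *\<^sub>R class_of (S t x) + b *\<^sub>R class_of (S t w)"
proof -
  have "m2_equiv (S t (m2_add (m2_smult (complex_of_real a) x) (m2_smult (complex_of_real b) w)))
      (m2_add (m2_smult (complex_of_real a) (S t x)) (m2_smult (complex_of_real b) (S t w)))"
    using S_gen assms by (simp add: is_semigroup_of_def)
  then show ?thesis
    using assms by (subst (asm) class_of_eq_iff[symmetric]) (simp_all add: S_M2 m2_add_M2 m2_smult_M2 class_of_add class_of_smult)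
qed

lemma pr_lin: fixes p q :: "'n m2_class" shows "class_of (rep_of (a *\<^sub>R p + b *\<^sub>R q)) = a *\<^sub>R class_of (rep_of p) + b *\<^sub>R class_of (rep_of q)"
proof -
  interpret bounded_linear "restrict_l2 {-1..0} :: (complex^'n) l2 \<Rightarrow> _" by (rule bounded_linear_restrict_l2) simp
  show ?thesis by (simp add: class_of_rep_of prod_eq_iff) (simp only: add scaleR)
qed

lemma St_lin:
  assumes "t \<ge> 0" shows "St t (a *\<^sub>R p + b *\<^sub>R q) = a *\<^sub>R St t p + b *\<^sub>R St t q"
proof -
  have "St t (a *\<^sub>R p + b *\<^sub>R q) = class_of (S t (m2_add (m2_smult (complex_of_real a) (rep_of p)) (m2_smult (complex_of_real b) (rep_of q))))"
    unfolding St_def by (rule S_cong[OF assms]) (simp_all add: m2_add_M2 m2_smult_M2 class_of_add class_of_smult pr_lin)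
  then show ?thesis by (simp add: S_lin[OF assms] St_def)
qed

lemma norm_pr: "norm (class_of (rep_of p)) \<le> norm p"
  unfolding class_of_rep_of norm_prod_def using norm_restrict_l2_le[of "{-1..0}" "snd p"]
  by (auto intro!: real_sqrt_le_mono power_mono)

lemma St_blin: assumes t: "t \<ge> 0" shows "bounded_linear (St t)"
proof -
  obtain M where M: "\<And>x. x \<in> M2 \<Longrightarrow> m2_norm (S t x) \<le> M * m2_norm x"
    using S_gen[unfolded is_semigroup_of_def, THEN conjunct2, THEN conjunct2, THEN conjunct2, THEN conjunct1, rule_format, OF t]
    by blast
  show ?thesis
  proof (rule bounded_linear_intro)
    show "St t (p + q) = St t p + St t q" for p q using St_lin[OF t, of 1 p 1 q] by simp
    show "St t (r *\<^sub>R p) = r *\<^sub>R St t p" for r p using St_lin[OF t, of r p 0 p] by simp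
    show "norm (St t p) \<le> norm p * \<bar>M\<bar>" for p
    proof -
      have "norm (St t p) \<le> M * norm (class_of (rep_of p))"
        using M[of "rep_of p"] by (simp add: St_def norm_class_of S_M2 t)
      also have "\<dots> \<le> \<bar>M\<bar> * norm p" by (intro mult_mono norm_pr) auto
      finally show ?thesis by (simp add: mult.commute)
    qed
  qed
qed

lemma St_semi: "t \<ge> 0 \<Longrightarrow> s \<ge> 0 \<Longrightarrow> St (t + s) p = St t (St s p)"
proof -
  assume t: "t \<ge> 0" "s \<ge> 0"
  have "m2_equiv (S (t + s) (rep_of p)) (S t (S s (rep_of p)))"
    using S_gen t by (simp add: is_semigroup_of_def)
  then have "St (t + s) p = class_of (S t (S s (rep_of p)))" using t by (simp add: St_def class_of_eq_iff S_M2)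
  also have "\<dots> = St t (class_of (S s (rep_of p)))" using t by (simp add: St_class_of S_M2)
  finally show ?thesis by (simp add: St_def)
qed

lemma St_0: "x \<in> M2 \<Longrightarrow> St 0 (class_of x) = class_of x"
  using S_gen by (simp add: is_semigroup_of_def St_class_of class_of_eq_iff S_M2)

lemma St_cont: "continuous_on {0..} (\<lambda>t. St t p)"
  unfolding continuous_on_def
proof
  fix t0 :: real assume t0: "t0 \<in> {0..}"
  have "((\<lambda>t. m2_norm (m2_sub (S t (rep_of p)) (S t0 (rep_of p)))) \<longlongrightarrow> 0) (at t0 within {0..})"
    using S_gen t0 by (simp add: is_semigroup_of_def)
  then have "((\<lambda>t. norm (St t p - St t0 p)) \<longlongrightarrow> 0) (at t0 within {0..})"
  proof (rule Lim_transform_eventually)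
    show "\<forall>\<^sub>F t in at t0 within {0..}. m2_norm (m2_sub (S t (rep_of p)) (S t0 (rep_of p))) = norm (St t p - St t0 p)"
      unfolding eventually_at_filter
    proof (rule always_eventually, intro allI impI)
      fix t :: real assume "t \<in> {0..}"
      then have m: "S t (rep_of p) \<in> M2" "S t0 (rep_of p) \<in> M2" using t0 by (auto simp: S_M2)
      then have "m2_sub (S t (rep_of p)) (S t0 (rep_of p)) \<in> M2" by (simp add: m2_sub_def m2_add_M2 m2_smult_M2)
      then show "m2_norm (m2_sub (S t (rep_of p)) (S t0 (rep_of p))) = norm (St t p - St t0 p)"
        using m by (simp add: norm_class_of[symmetric] class_of_sub St_def)
    qed
  qed
  then show "((\<lambda>t. St t p) \<longlongrightarrow> St t0 p) (at t0 within {0..})"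
    by (simp add: tendsto_norm_zero_iff LIM_zero_iff)
qed

sublocale c0_family St
  by (rule c0_family.intro) (fact St_blin St_semi St_cont)+

lemma St_gen:
  assumes x: "x \<in> M2" and v: "v \<in> M2" and g: "gen_rel A A2 A3 x v"
  shows "((\<lambda>h. (1 / h) *\<^sub>R (St h (class_of x) - class_of x)) \<longlongrightarrow> class_of v) (at_right 0)"
proof -
  have "((\<lambda>h. m2_norm (m2_sub (m2_smult (complex_of_real (1 / h)) (m2_sub (S h x) x)) v)) \<longlongrightarrow> 0) (at_right 0)"
    using S_gen x v g by (simp add: is_semigroup_of_def)
  then have "((\<lambda>h. norm ((1 / h) *\<^sub>R (St h (class_of x) - class_of x) - class_of v)) \<longlongrightarrow> 0) (at_right 0)"
  proof (rule Lim_transform_eventually)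
    show "\<forall>\<^sub>F h in at_right 0. m2_norm (m2_sub (m2_smult (complex_of_real (1 / h)) (m2_sub (S h x) x)) v) = norm ((1 / h) *\<^sub>R (St h (class_of x) - class_of x) - class_of v)"
      unfolding eventually_at_filter
    proof (rule always_eventually, intro allI impI)
      fix h :: real assume "h \<in> {0<..}"
      then have h: "h \<ge> 0" by simp
      have m: "S h x \<in> M2" using x h by (simp add: S_M2)
      have m1: "m2_sub (S h x) x \<in> M2" using m x by (simp add: m2_sub_def m2_add_M2 m2_smult_M2)
      have m2: "m2_smult (complex_of_real (1 / h)) (m2_sub (S h x) x) \<in> M2" by (rule m2_smult_M2[OF m1])
      have m3: "m2_sub (m2_smult (complex_of_real (1 / h)) (m2_sub (S h x) x)) v \<in> M2" 
        using m2 v by (simp only: m2_sub_def m2_add_M2 m2_smult_M2)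
      show "m2_norm (m2_sub (m2_smult (complex_of_real (1 / h)) (m2_sub (S h x) x)) v) = norm ((1 / h) *\<^sub>R (St h (class_of x) - class_of x) - class_of v)"
        unfolding norm_class_of[OF m3, symmetric] class_of_sub[OF m2 v] class_of_smult[OF m1] class_of_sub[OF m x] St_class_of[OF h x] ..
    qed
  qed
  then show ?thesis by (simp add: tendsto_norm_zero_iff LIM_zero_iff)
qed

text \<open>For continuous \<open>g\<close> the history is differentiable in the state space and
  stays in the domain of the generator. The function components of its time derivative and of the
  generator are the same \<open>g (s + \<theta>)\<close> and cancel; only a vector input
  remains.\<close>

lemma duhamel_state_of:
  assumes g: "continuous_on UNIV g" and g0: "\<And>t. t \<le> 0 \<Longrightarrow> g t = 0" and T: "T \<ge> 0"
  shows "((\<lambda>s. St (T - s) (g s - A *v g (s - 1) - Lop A2 A3 (\<lambda>\<theta>. g (s + \<theta>)) (\<lambda>\<theta>. primitive g (s + \<theta>)), 0))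
     has_integral class_of (state_of A g T)) {0..T}"
proof -
  define L where "L s = Lop A2 A3 (\<lambda>\<theta>. g (s + \<theta>)) (\<lambda>\<theta>. primitive g (s + \<theta>))" for s
  have li: "locally_integrable g" using locally_integrable_continuous[OF g] g0 by simp
  have gs: "continuous_on UNIV (\<lambda>\<theta>. g (s + \<theta>))" for s
    by (rule continuous_on_compose2[OF g]) (auto intro!: continuous_intros)
  have gl: "l2f (\<lambda>\<theta>. indicator {-1..0} \<theta> *\<^sub>R g (s + \<theta>))" for s by (rule l2f_continuous_interval[OF gs])
  have dz: "(primitive g has_vector_derivative g t) (at t)" for t by (rule primitive_deriv[OF g]) (simp add: g0)
  have zc: "continuous_on UNIV (primitive g)"
    using dz by (auto simp: continuous_on_eq_continuous_at intro: has_vector_derivative_continuous)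
  note dom = state_of_dom[OF li gl zc, where A=A]
  define U where "U s = class_of (g s - A *v g (s - 1), \<lambda>\<theta>. g (s + \<theta>))" for s
  define V where "V s = class_of (L s, \<lambda>\<theta>. g (s + \<theta>))" for s
  have UM: "(v, \<lambda>\<theta>. g (s + \<theta>)) \<in> M2" for s and v :: "complex^'n" by (simp add: M2_iff gl)
  have zs: "l2f (\<lambda>\<theta>. indicator {-1..0} \<theta> *\<^sub>R primitive g (s + \<theta>))" for s
    using dom(2)[of s] by (simp add: M2_iff state_of_def)
  have "((\<lambda>s. St (T - s) (U s - V s)) has_integral class_of (state_of A g T)) {0..T}"
  proof (rule duhamel[OF T])
    fix s assume s: "s \<in> {0..T}"
    show "((\<lambda>h. (1 / h) *\<^sub>R (St h (class_of (state_of A g s)) - class_of (state_of A g s))) \<longlongrightarrow> V s) (at_right 0)"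
      unfolding V_def
    proof (rule St_gen[OF dom(2) UM])
      show "gen_rel A A2 A3 (state_of A g s) (L s, \<lambda>\<theta>. g (s + \<theta>))"
        unfolding gen_rel_def using dom[of s]
        by (intro conjI exI[of _ "primitive g (s - 1)"] exI[of _ "\<lambda>\<theta>. g (s + \<theta>)"])
           (auto simp: m2_equiv_def L_def state_of_def)
    qed
    show "St 0 (class_of (state_of A g s)) = class_of (state_of A g s)" by (rule St_0[OF dom(2)])
    show "St 0 (U s) = U s" unfolding U_def by (rule St_0[OF UM])
    show "((\<lambda>s. class_of (state_of A g s)) has_vector_derivative U s) (at s within {0..T})"
    proof -
      have c1: "((\<lambda>s. primitive g s - A *v primitive g (s - 1)) has_vector_derivative g s - A *v g (s - 1)) (at s within {0..T})"
      proof -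
        have "((primitive g \<circ> (\<lambda>s. s - 1)) has_vector_derivative 1 *\<^sub>R g (s - 1)) (at s)"
          by (rule vector_diff_chain_at) (auto intro!: derivative_eq_intros dz simp: dz)
        then have "((\<lambda>s. primitive g (s - 1)) has_vector_derivative g (s - 1)) (at s)" by (simp add: o_def)
        from bounded_linear.has_vector_derivative[OF blin_mv this]
        have "((\<lambda>s. primitive g s - A *v primitive g (s - 1)) has_vector_derivative g s - A *v g (s - 1)) (at s)"
          by (intro has_vector_derivative_diff dz)
        then show ?thesis by (rule has_vector_derivative_at_within)
      qed
      have c2: "((\<lambda>s. l2_class (\<lambda>\<theta>. indicator {-1..0} \<theta> *\<^sub>R primitive g (s + \<theta>))) has_vector_derivative l2_class (\<lambda>\<theta>. indicator {-1..0} \<theta> *\<^sub>R g (s + \<theta>))) (at s within {0..T})"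
        unfolding has_vector_derivative_quotient
      proof (rule tendstoI)
        fix e :: real assume e: "e > 0"
        \<comment> \<open>The interval contains s + \<theta> and y + \<theta> for all \<theta> in
          [-1, 0] as soon as |y - s| < 1.\<close>
        have "uniformly_continuous_on {s-2..s+1} g"
          by (rule compact_uniformly_continuous[OF continuous_on_subset[OF g]]) auto
        then obtain d where d: "d > 0" "\<And>x y. x \<in> {s-2..s+1} \<Longrightarrow> y \<in> {s-2..s+1} \<Longrightarrow> dist y x < d \<Longrightarrow> dist (g y) (g x) < e / 2"
          unfolding uniformly_continuous_on_def using e half_gt_zero by metis
        have "dist ((1 / (y - s)) *\<^sub>R (l2_class (\<lambda>\<theta>. indicator {-1..0} \<theta> *\<^sub>R primitive g (y + \<theta>)) - l2_class (\<lambda>\<theta>. indicator {-1..0} \<theta> *\<^sub>R primitive g (s + \<theta>))))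
             (l2_class (\<lambda>\<theta>. indicator {-1..0} \<theta> *\<^sub>R g (s + \<theta>))) < e" if y: "y \<noteq> s" "dist y s < min d 1" for y
        proof -
          define q where "q \<theta> = (1 / (y - s)) *\<^sub>R (primitive g (y + \<theta>) - primitive g (s + \<theta>)) - g (s + \<theta>)" for \<theta>
          have qc: "continuous_on UNIV q"
            unfolding q_def by (intro continuous_intros gs continuous_on_compose2[OF zc]) auto
          have qb: "norm (q \<theta>) \<le> e / 2" if th: "\<theta> \<in> {-1..0}" for \<theta>
          proof -
            have "norm (primitive g (y + \<theta>) - primitive g (s + \<theta>) - (y + \<theta> - (s + \<theta>)) *\<^sub>R g (s + \<theta>)) \<le> norm (y + \<theta> - (s + \<theta>)) * (e / 2)"
            proof (rule vector_differentiable_bound_linearization[where S="closed_segment (s + \<theta>) (y + \<theta>)"])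
              show "(primitive g has_vector_derivative g x) (at x within closed_segment (s + \<theta>) (y + \<theta>))" for x
                using dz by (rule has_vector_derivative_at_within)
              fix x assume "x \<in> closed_segment (s + \<theta>) (y + \<theta>)"
              then have "x \<in> {s-2..s+1}" "dist x (s + \<theta>) < d"
                using y th by (auto simp: closed_segment_eq_real_ivl dist_real_def split: if_splits)
              then show "norm (g x - g (s + \<theta>)) \<le> e / 2"
                using d(2)[of "s + \<theta>" x] th by (auto simp: dist_norm)
            qed auto
            then have *: "norm (primitive g (y + \<theta>) - primitive g (s + \<theta>) - (y - s) *\<^sub>R g (s + \<theta>)) \<le> \<bar>y - s\<bar> * (e / 2)" by simp
            have "q \<theta> = (1 / (y - s)) *\<^sub>R (primitive g (y + \<theta>) - primitive g (s + \<theta>) - (y - s) *\<^sub>R g (s + \<theta>))"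
              using y by (simp add: q_def scaleR_diff_right)
            then have "norm (q \<theta>) = norm (primitive g (y + \<theta>) - primitive g (s + \<theta>) - (y - s) *\<^sub>R g (s + \<theta>)) / \<bar>y - s\<bar>"
              using y by simp
            then show ?thesis using * y by (simp add: pos_divide_le_eq mult.commute)
          qed
          have "(1 / (y - s)) *\<^sub>R (l2_class (\<lambda>\<theta>. indicator {-1..0} \<theta> *\<^sub>R primitive g (y + \<theta>)) - l2_class (\<lambda>\<theta>. indicator {-1..0} \<theta> *\<^sub>R primitive g (s + \<theta>))) - l2_class (\<lambda>\<theta>. indicator {-1..0} \<theta> *\<^sub>R g (s + \<theta>))
              = l2_class (\<lambda>\<theta>. indicator {-1..0} \<theta> *\<^sub>R q \<theta>)"
            by (simp add: l2_class_diff l2_class_scaleR zs gl l2f_diff l2f_scaleR)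
               (rule arg_cong[where f=l2_class], auto simp: q_def indicator_def)
          moreover have "norm (l2_class (\<lambda>\<theta>. indicator {-1..0} \<theta> *\<^sub>R q \<theta>)) \<le> e / 2 * sqrt (0 - (-1))"
            by (rule norm_l2_class_indicator_bound[OF continuous_borel[OF qc] qb]) (use e in auto)
          ultimately show ?thesis using e by (simp add: dist_norm)
        qed
        then show "\<forall>\<^sub>F y in at s within {0..T}. dist ((1 / (y - s)) *\<^sub>R (l2_class (\<lambda>\<theta>. indicator {-1..0} \<theta> *\<^sub>R primitive g (y + \<theta>)) - l2_class (\<lambda>\<theta>. indicator {-1..0} \<theta> *\<^sub>R primitive g (s + \<theta>))))
             (l2_class (\<lambda>\<theta>. indicator {-1..0} \<theta> *\<^sub>R g (s + \<theta>))) < e"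
          unfolding eventually_at using d(1) by (intro exI[of _ "min d 1"]) auto
      qed
      show ?thesis
        using tendsto_Pair[OF c1[unfolded has_vector_derivative_quotient] c2[unfolded has_vector_derivative_quotient]]
        unfolding has_vector_derivative_quotient U_def class_of_def state_of_def by simp
    qed
  next
    have "primitive g t = 0" if "t \<le> 0" for t
      unfolding primitive_def by (rule integral_eq_zero_AE) (use that g0 in \<open>auto simp: indicator_def\<close>)
    then have "(\<lambda>\<theta>. indicat_real {-1..0} \<theta> *\<^sub>R primitive g \<theta>) = (\<lambda>\<theta>. 0)" "primitive g 0 = 0" "primitive g (-1) = 0" by (auto simp: indicator_def)
    then show "class_of (state_of A g 0) = 0" by (simp add: class_of_def state_of_def zero_prod_def zero_l2_l2_class)
  qed
  moreover have "U s - V s = (g s - A *v g (s - 1) - L s, 0)" for s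
    by (simp add: U_def V_def class_of_def)
  ultimately show ?thesis by (simp add: L_def)
qed

end

section \<open>The input map of the semigroup\<close>

text \<open>A ramp of slope k forces a polynomial to vanish up to time 0 and tends to 1 at every
  positive time. Vanishing at 0 is what makes the continuation by a zero past continuous.\<close>

lemma l2_approx_continuous_vanishing:
  fixes f :: "real \<Rightarrow> 'a::euclidean_space"
  assumes f: "l2f f" and sf: "\<And>t. t \<notin> {0..T} \<Longrightarrow> f t = 0" and T: "T \<ge> 0" and e: "e > 0"
  shows "\<exists>g. continuous_on UNIV g \<and> (\<forall>t\<le>0. g t = 0) \<and> norm (l2_class f - l2_class (\<lambda>t. indicator {0..T} t *\<^sub>R g t)) < e"
proof -
  let ?I = "indicat_real {0..T}"
  have cf: "restrict_l2 {0..T} (l2_class f) = l2_class f"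
  proof -
    have "(\<lambda>t. ?I t *\<^sub>R f t) = f" using sf by (auto simp: indicator_def)
    then show ?thesis by (simp add: restrict_l2_l2_class[OF f])
  qed
  obtain n c where "norm (restrict_l2 {0..T} (l2_class f) - l2_class (\<lambda>t. ?I t *\<^sub>R (\<Sum>i\<le>n. t ^ i *\<^sub>R c i))) < e / 2"
    using l2_poly_approx[of "e/2" 0 T "l2_class f"] e T by auto
  moreover define p where "p t = (\<Sum>i\<le>n. t ^ i *\<^sub>R c i)" for t :: real
  ultimately have p: "norm (l2_class f - l2_class (\<lambda>t. ?I t *\<^sub>R p t)) < e / 2" by (simp add: cf)
  have pc: "continuous_on UNIV p" unfolding p_def by (rule continuous_poly_sum)
  define g where "g k t = min 1 (max 0 (real k * t)) *\<^sub>R p t" for k t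
  have gc: "continuous_on UNIV (g k)" for k unfolding g_def by (intro continuous_intros pc)
  have g0: "g k t = 0" if "t \<le> 0" for k t using that by (simp add: g_def mult_nonneg_nonpos)
  have lim: "AE t in lborel. (\<lambda>k. ?I t *\<^sub>R g k t) \<longlonglongrightarrow> ?I t *\<^sub>R p t"
    using AE_lborel_singleton[of 0]
  proof eventually_elim
    case (elim t)
    show ?case
    proof (cases "t > 0")
      case True
      obtain N :: nat where N: "1 / t < real N" using reals_Archimedean2 by blast
      have "\<forall>\<^sub>F k in sequentially. ?I t *\<^sub>R g k t = ?I t *\<^sub>R p t"
        using eventually_ge_at_top[of N]
      proof eventually_elim
        case (elim k)
        have "1 / t < real k" using N elim by linarith
        then have "1 < real k * t" using True by (simp add: field_simps)
        then show ?case by (simp add: g_def)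
      qed
      then show ?thesis by (rule tendsto_eventually)
    qed (use elim in \<open>simp add: indicator_def\<close>)
  qed
  have "(\<lambda>k. l2_class (\<lambda>t. ?I t *\<^sub>R g k t)) \<longlonglongrightarrow> l2_class (\<lambda>t. ?I t *\<^sub>R p t)"
  proof (rule l2_dominated[OF l2f_continuous_interval[OF pc, of 0 T] _ _ _ lim])
    show "(\<lambda>t. ?I t *\<^sub>R g k t) \<in> borel_measurable borel" for k
      by (rule l2f_meas[OF l2f_continuous_interval[OF gc]])
    show "(\<lambda>t. ?I t *\<^sub>R p t) \<in> borel_measurable borel"
      by (rule l2f_meas[OF l2f_continuous_interval[OF pc]])
    show "norm (?I x *\<^sub>R g k x) \<le> norm (?I x *\<^sub>R p x)" for k x
      by (auto simp: g_def indicator_def intro!: mult_left_le_one_le)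
  qed
  from LIMSEQ_D[OF this, of "e/2"] e obtain k where "norm (l2_class (\<lambda>t. ?I t *\<^sub>R g k t) - l2_class (\<lambda>t. ?I t *\<^sub>R p t)) < e / 2" by auto
  then have "norm (l2_class f - l2_class (\<lambda>t. ?I t *\<^sub>R g k t)) < e"
    using p norm_triangle_ineq[of "l2_class f - l2_class (\<lambda>t. ?I t *\<^sub>R p t)" "l2_class (\<lambda>t. ?I t *\<^sub>R p t) - l2_class (\<lambda>t. ?I t *\<^sub>R g k t)"]
    by (simp add: norm_minus_commute)
  then show ?thesis using gc g0 by blast
qed

section \<open>The input map tested against states\<close>

context neutral
begin

definition neutral_op :: "real \<Rightarrow> (real \<Rightarrow> complex^'n) \<Rightarrow> real \<Rightarrow> complex^'n" where
  "neutral_op T f t = f t - A *v f (t - 1) - convol (delay_kernel_on T) f t"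

text \<open>The input map paired with one state \<open>W\<close>. Scalar integrals avoid
  vector-valued integration of inputs that are merely square integrable.\<close>

definition \<Theta> :: "real \<Rightarrow> 'n m2_class \<Rightarrow> (real \<Rightarrow> complex^'n) \<Rightarrow> real" where
  "\<Theta> T W h = (LINT s|lborel. indicator {0..T} s *\<^sub>R inner (St (T - s) (h s, 0)) W)"

lemma St_pair_lin: "t \<ge> 0 \<Longrightarrow> bounded_linear (\<lambda>v. inner (St t (v, 0)) W)"
proof -
  assume t: "t \<ge> 0"
  have "bounded_linear (\<lambda>v :: complex^'n. (v, 0 :: (complex^'n) l2))"
    by (intro bounded_linear_Pair bounded_linear_ident bounded_linear_zero)
  from bounded_linear_compose[OF St_blin[OF t] this]
  show ?thesis by (rule bounded_linear_inner_left_comp)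
qed

text \<open>In coordinates of \<open>h\<close> only the continuous orbits of basis vectors are left
  as factors.\<close>

lemma \<Theta>_meas:
  assumes h: "h \<in> borel_measurable borel"
  shows "(\<lambda>s. indicator {0..T} s *\<^sub>R inner (St (T - s) (h s, 0)) W) \<in> borel_measurable borel"
proof -
  have eq: "(\<lambda>s. indicator {0..T} s *\<^sub>R inner (St (T - s) (h s, 0)) W)
     = (\<lambda>s. \<Sum>b\<in>Basis. (h s \<bullet> b) * (indicator {0..T} s *\<^sub>R inner (St (T - s) (b, 0)) W))"
  proof
    fix s
    show "indicator {0..T} s *\<^sub>R inner (St (T - s) (h s, 0)) W = (\<Sum>b\<in>Basis. (h s \<bullet> b) * (indicator {0..T} s *\<^sub>R inner (St (T - s) (b, 0)) W))"
    proof (cases "s \<in> {0..T}")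
      case True
      then interpret bounded_linear "\<lambda>v. inner (St (T - s) (v, 0)) W" by (intro St_pair_lin) simp
      have "inner (St (T - s) (h s, 0)) W = inner (St (T - s) ((\<Sum>b\<in>Basis. (h s \<bullet> b) *\<^sub>R b), 0)) W"
        by (simp add: euclidean_representation)
      also have "\<dots> = (\<Sum>b\<in>Basis. (h s \<bullet> b) * inner (St (T - s) (b, 0)) W)"
        unfolding sum scaleR by simp
      finally show ?thesis using True by simp
    qed simp
  qed
  have "(\<lambda>s. indicator {0..T} s *\<^sub>R inner (St (T - s) (b, 0)) W) \<in> borel_measurable borel" for b
  proof (rule borel_measurable_continuous_on_indicator)
    show "continuous_on {0..T} (\<lambda>s. inner (St (T - s) (b, 0)) W)"
      by (intro continuous_intros continuous_on_compose2[OF St_cont]) auto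
  qed simp
  then show ?thesis unfolding eq using h by measurable
qed

lemma \<Theta>_int_bound:
  shows "\<exists>C\<ge>0. \<forall>h. l2f h \<longrightarrow> integrable lborel (\<lambda>s. indicator {0..T} s *\<^sub>R inner (St (T - s) (h s, 0)) W) \<and>
     \<bar>\<Theta> T W h\<bar> \<le> C * norm (l2_class (\<lambda>t. indicator {0..T} t *\<^sub>R h t))"
proof -
  obtain C where C: "C \<ge> 0" "\<And>t x. t \<in> {0..T} \<Longrightarrow> norm (St t x) \<le> C * norm x" using St_bound by blast
  let ?I = "indicat_real {0..T}"
  have b: "norm (?I s *\<^sub>R inner (St (T - s) (h s, 0)) W) \<le> C * norm W * norm (?I s *\<^sub>R h s)" for h s
  proof (cases "s \<in> {0..T}")
    case True
    have "\<bar>inner (St (T - s) (h s, 0)) W\<bar> \<le> norm (St (T - s) (h s, 0)) * norm W" by (rule Cauchy_Schwarz_ineq2)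
    also have "\<dots> \<le> (C * norm (h s, 0 :: (complex^'n) l2)) * norm W"
      using True by (intro mult_right_mono C) auto
    finally show ?thesis using True by (simp add: norm_Pair mult_ac)
  qed simp
  have int: "integrable lborel (\<lambda>s. ?I s *\<^sub>R inner (St (T - s) (h s, 0)) W)" if h: "l2f h" for h
  proof (rule Bochner_Integration.integrable_bound)
    show "integrable lborel (\<lambda>s. C * norm W * norm (?I s *\<^sub>R h s))"
      by (intro integrable_mult_right integrable_norm l2f_integrable_interval h)
    show "(\<lambda>s. ?I s *\<^sub>R inner (St (T - s) (h s, 0)) W) \<in> borel_measurable lborel" using \<Theta>_meas[OF l2f_meas[OF h]] by simp
    show "AE s in lborel. norm (?I s *\<^sub>R inner (St (T - s) (h s, 0)) W) \<le> norm (C * norm W * norm (?I s *\<^sub>R h s))"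
      using b C(1) by (auto simp: abs_mult)
  qed
  have "\<bar>\<Theta> T W h\<bar> \<le> (C * norm W * norm (l2_class ?I)) * norm (l2_class (\<lambda>t. ?I t *\<^sub>R h t))" if h: "l2f h" for h
  proof -
    have lh: "l2f (\<lambda>t. ?I t *\<^sub>R h t)" by (intro l2f_cmul_indicator h) simp
    have "norm (\<Theta> T W h) \<le> (LINT s|lborel. C * norm W * norm (?I s *\<^sub>R h s))"
      unfolding \<Theta>_def
      by (rule Bochner_Integration.integral_norm_bound_integral[OF int[OF h]])
         (intro integrable_mult_right integrable_norm l2f_integrable_interval h, rule b)
    also have "\<dots> = C * norm W * (LINT s|lborel. norm (?I s) * norm (?I s *\<^sub>R h s))"
    proof -
      have e: "norm (?I s) * norm (?I s *\<^sub>R h s) = norm (?I s *\<^sub>R h s)" for s by (simp add: indicator_def)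
      show ?thesis by (simp only: e integral_mult_right_zero)
    qed
    also have "\<dots> \<le> C * norm W * (norm (l2_class ?I) * norm (l2_class (\<lambda>t. ?I t *\<^sub>R h t)))"
      using l2f_indicator_const[of 0 T "1::real"] lh C(1)
      by (intro mult_left_mono l2_Cauchy_Schwarz) auto
    finally show ?thesis by (simp add: mult_ac)
  qed
  moreover have "C * norm W * norm (l2_class ?I) \<ge> 0" using C(1) by simp
  ultimately show ?thesis using int by blast
qed

lemma neutral_op_l2f: "l2f f \<Longrightarrow> l2f (\<lambda>t. indicator {0..T} t *\<^sub>R neutral_op T f t)"
proof -
  assume f: "l2f f"
  have "l2f (\<lambda>t. indicator {0..T} t *\<^sub>R convol (delay_kernel_on T) f t)"
    by (rule l2f_continuous_interval[OF convol_continuous[OF l2f_delay_kernel_on f]])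
  moreover have "l2f (\<lambda>t. indicator {0..T} t *\<^sub>R (f t - A *v f (t - 1)))"
    by (intro l2f_cmul_indicator l2f_diff f l2f_blin[OF _ blin_mv] l2f_shift') simp
  ultimately show ?thesis using l2f_diff unfolding neutral_op_def scaleR_diff_right by blast
qed

lemma neutral_op_diff: "l2f f \<Longrightarrow> l2f g \<Longrightarrow> neutral_op T (\<lambda>t. f t - g t) t = neutral_op T f t - neutral_op T g t"
  by (simp add: neutral_op_def convol_diff l2f_delay_kernel_on mv.diff_right)

lemma neutral_op_bound: "\<exists>C\<ge>0. \<forall>f. l2f f \<longrightarrow> norm (l2_class (\<lambda>t. indicator {0..T} t *\<^sub>R neutral_op T f t)) \<le> C * norm (l2_class f)"
proof (cases "T \<ge> 0")
  case T: True
  let ?I = "indicat_real {0..T}"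
  have "norm (l2_class (\<lambda>t. ?I t *\<^sub>R neutral_op T f t)) \<le> (1 + norm A + norm (l2_class (delay_kernel_on T)) * sqrt T) * norm (l2_class f)" if f: "l2f f" for f
  proof -
    have l1: "l2f (\<lambda>t. ?I t *\<^sub>R f t)" by (intro l2f_cmul_indicator f) simp
    have Af: "l2f (\<lambda>t. A *v f (t - 1))" by (intro l2f_blin[OF _ blin_mv] l2f_shift' f)
    have l2: "l2f (\<lambda>t. ?I t *\<^sub>R (A *v f (t - 1)))" by (intro l2f_cmul_indicator Af) simp
    have l3: "l2f (\<lambda>t. ?I t *\<^sub>R convol (delay_kernel_on T) f t)" by (rule l2f_continuous_interval[OF convol_continuous[OF l2f_delay_kernel_on f]])
    have eq: "l2_class (\<lambda>t. ?I t *\<^sub>R neutral_op T f t) = l2_class (\<lambda>t. ?I t *\<^sub>R f t) - l2_class (\<lambda>t. ?I t *\<^sub>R (A *v f (t - 1))) - l2_class (\<lambda>t. ?I t *\<^sub>R convol (delay_kernel_on T) f t)"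
      unfolding neutral_op_def scaleR_diff_right by (simp add: l2_class_diff l1 l2 l3 l2f_diff)
    have b1: "norm (l2_class (\<lambda>t. ?I t *\<^sub>R f t)) \<le> norm (l2_class f)"
      by (rule norm_l2_class_le[OF l1 f]) (simp add: indicator_def)
    have b2: "norm (l2_class (\<lambda>t. ?I t *\<^sub>R (A *v f (t - 1)))) \<le> norm A * norm (l2_class f)"
    proof -
      have "norm (l2_class (\<lambda>t. ?I t *\<^sub>R (A *v f (t - 1)))) \<le> norm (l2_class (\<lambda>t. norm A *\<^sub>R f (t - 1)))"
        by (rule norm_l2_class_le[OF l2 l2f_scaleR[OF l2f_shift'[OF f]]]) (simp add: indicator_def norm_mv_le)
      also have "l2_class (\<lambda>t. norm A *\<^sub>R f (t - 1)) = norm A *\<^sub>R shift_l2 1 (l2_class f)"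
        by (simp add: shift_l2_l2_class[OF f] l2_class_scaleR[OF l2f_shift'[OF f]])
      finally show ?thesis by simp
    qed
    have b3: "norm (l2_class (\<lambda>t. ?I t *\<^sub>R convol (delay_kernel_on T) f t)) \<le> norm (l2_class (delay_kernel_on T)) * norm (l2_class f) * sqrt (T - 0)"
      by (rule norm_l2_class_indicator_bound[OF convol_meas[OF l2f_delay_kernel_on f] convol_bound[OF l2f_delay_kernel_on f]]) (use T in auto)
    show ?thesis unfolding eq
      using b1 b2 b3 norm_triangle_ineq4[of "l2_class (\<lambda>t. ?I t *\<^sub>R f t) - l2_class (\<lambda>t. ?I t *\<^sub>R (A *v f (t - 1)))" "l2_class (\<lambda>t. ?I t *\<^sub>R convol (delay_kernel_on T) f t)"]
        norm_triangle_ineq4[of "l2_class (\<lambda>t. ?I t *\<^sub>R f t)" "l2_class (\<lambda>t. ?I t *\<^sub>R (A *v f (t - 1)))"]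
      by (simp add: algebra_simps)
  qed
  moreover have "1 + norm A + norm (l2_class (delay_kernel_on T)) * sqrt T \<ge> 0" using T by simp
  ultimately show ?thesis by blast
next
  case False
  then have e: "indicat_real {0..T} t = 0" for t by simp
  show ?thesis by (rule exI[of _ 0]) (simp add: e zero_l2_l2_class[symmetric])
qed

lemma primitive_diff:
  assumes "locally_integrable f" "locally_integrable g" shows "primitive (\<lambda>t. f t - g t) t = primitive f t - primitive g t"
  using assms unfolding primitive_def locally_integrable_def by (simp add: scaleR_diff_right)

lemma primitive_l2f: "l2f f \<Longrightarrow> (\<And>t. t < 0 \<Longrightarrow> f t = 0) \<Longrightarrow> l2f (\<lambda>\<theta>. indicator {-1..0} \<theta> *\<^sub>R primitive f (T + \<theta>))"
  by (intro l2f_continuous_interval continuous_on_compose2[OF primitive_continuous]) (auto intro!: continuous_intros)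

lemma state_of_bound:
  assumes T: "T \<ge> 0" shows "\<exists>C\<ge>0. \<forall>f. l2f f \<longrightarrow> (\<forall>t<0. f t = 0) \<longrightarrow> norm (class_of (state_of A f T)) \<le> C * norm (l2_class f)"
proof -
  have "norm (class_of (state_of A f T)) \<le> ((1 + norm A) * sqrt T + sqrt T) * norm (l2_class f)" if f: "l2f f" and f0: "\<And>t. t < 0 \<Longrightarrow> f t = 0" for f
  proof -
    have z: "norm (primitive f t) \<le> sqrt T * norm (l2_class f)" if "t \<le> T" for t by (rule primitive_bound[OF f that T])
    have "norm (primitive f T - A *v primitive f (T - 1)) \<le> norm (primitive f T) + norm A * norm (primitive f (T - 1))"
      using norm_triangle_ineq4[of "primitive f T" "A *v primitive f (T - 1)"] norm_mv_le[of A "primitive f (T - 1)"] by linarith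
    also have "\<dots> \<le> sqrt T * norm (l2_class f) + norm A * (sqrt T * norm (l2_class f))"
      by (intro add_mono mult_left_mono z) auto
    finally have 1: "norm (fst (class_of (state_of A f T))) \<le> (1 + norm A) * sqrt T * norm (l2_class f)"
      by (simp add: class_of_def state_of_def algebra_simps)
    have "continuous_on UNIV (\<lambda>\<theta>. primitive f (T + \<theta>))"
      by (intro continuous_on_compose2[OF primitive_continuous[OF f f0]]) (auto intro!: continuous_intros)
    then have "norm (snd (class_of (state_of A f T))) \<le> sqrt T * norm (l2_class f) * sqrt (0 - (-1))"
      unfolding class_of_def state_of_def snd_conv
      by (intro norm_l2_class_indicator_bound continuous_borel) (use z T in auto)
    then have 2: "norm (snd (class_of (state_of A f T))) \<le> sqrt T * norm (l2_class f)" by simp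
    have "norm (class_of (state_of A f T)) \<le> norm (fst (class_of (state_of A f T))) + norm (snd (class_of (state_of A f T)))"
      using norm_Pair_le[of "fst (class_of (state_of A f T))" "snd (class_of (state_of A f T))"] by simp
    then show ?thesis using 1 2 by (simp add: algebra_simps)
  qed
  moreover have "(1 + norm A) * sqrt T + sqrt T \<ge> 0" using T by simp
  ultimately show ?thesis by blast
qed

text \<open>The difference \<open>D\<close> of the two sides is compatible with subtraction and
  bounded by a multiple of the norm of \<open>f\<close>. On cut-offs of continuous functions
  vanishing up to time 0 it is zero by Duhamel, and these are dense.\<close>

lemma input_map_state:
  assumes f: "l2f f" and sf: "\<And>t. t \<notin> {0..T} \<Longrightarrow> f t = 0" and T: "T \<ge> 0"
  shows "\<Theta> T W (\<lambda>t. indicator {0..T} t *\<^sub>R neutral_op T f t) = inner (class_of (state_of A f T)) W"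
proof -
  let ?I = "indicat_real {0..T}"
  define D where "D f = \<Theta> T W (\<lambda>t. ?I t *\<^sub>R neutral_op T f t) - inner (class_of (state_of A f T)) W" for f
  obtain C1 where C1: "C1 \<ge> 0" "\<And>h. l2f h \<Longrightarrow> integrable lborel (\<lambda>s. ?I s *\<^sub>R inner (St (T - s) (h s, 0)) W)"
     "\<And>h. l2f h \<Longrightarrow> \<bar>\<Theta> T W h\<bar> \<le> C1 * norm (l2_class (\<lambda>t. ?I t *\<^sub>R h t))"
    using \<Theta>_int_bound[of T W] by blast
  obtain C2 where C2: "C2 \<ge> 0" "\<And>f. l2f f \<Longrightarrow> norm (l2_class (\<lambda>t. ?I t *\<^sub>R neutral_op T f t)) \<le> C2 * norm (l2_class f)"
    using neutral_op_bound by blast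
  obtain C3 where C3: "C3 \<ge> 0" "\<And>f. l2f f \<Longrightarrow> \<forall>t<0. f t = 0 \<Longrightarrow> norm (class_of (state_of A f T)) \<le> C3 * norm (l2_class f)"
    using state_of_bound[OF T] by blast
  have II: "(\<lambda>t. ?I t *\<^sub>R ?I t *\<^sub>R h t) = (\<lambda>t. ?I t *\<^sub>R h t)" for h :: "real \<Rightarrow> complex^'n"
    by (auto simp: indicator_def)
  have Db: "\<bar>D f\<bar> \<le> (C1 * C2 + C3 * norm W) * norm (l2_class f)" if f: "l2f f" "\<forall>t<0. f t = 0" for f
  proof -
    have "\<bar>\<Theta> T W (\<lambda>t. ?I t *\<^sub>R neutral_op T f t)\<bar> \<le> C1 * norm (l2_class (\<lambda>t. ?I t *\<^sub>R neutral_op T f t))"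
      using C1(3)[OF neutral_op_l2f[OF f(1)], of T] unfolding II .
    also have "\<dots> \<le> C1 * (C2 * norm (l2_class f))" by (intro mult_left_mono C2 C1(1) f)
    finally have "\<bar>\<Theta> T W (\<lambda>t. ?I t *\<^sub>R neutral_op T f t)\<bar> \<le> C1 * C2 * norm (l2_class f)" by simp
    moreover have "\<bar>inner (class_of (state_of A f T)) W\<bar> \<le> (C3 * norm (l2_class f)) * norm W"
      by (rule order_trans[OF Cauchy_Schwarz_ineq2 mult_right_mono[OF C3(2)[OF f]]]) simp
    ultimately show ?thesis unfolding D_def by (simp add: algebra_simps)
  qed
  have Dd: "D (\<lambda>t. f t - g t) = D f - D g" if f: "l2f f" "\<forall>t<0. f t = 0" and g: "l2f g" "\<forall>t<0. g t = 0" for f g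
  proof -
    have li: "locally_integrable f" "locally_integrable g" using f g by (auto intro: locally_integrable_l2f)
    have e: "?I s *\<^sub>R inner (St (T - s) (?I s *\<^sub>R (a - b), 0)) W = ?I s *\<^sub>R inner (St (T - s) (?I s *\<^sub>R a, 0)) W - ?I s *\<^sub>R inner (St (T - s) (?I s *\<^sub>R b, 0)) W" for s a b
    proof (cases "s \<in> {0..T}")
      case True
      then interpret bounded_linear "\<lambda>v. inner (St (T - s) (v, 0)) W" by (intro St_pair_lin) simp
      show ?thesis using True by (simp add: diff)
    qed simp
    have "\<Theta> T W (\<lambda>t. ?I t *\<^sub>R neutral_op T (\<lambda>t. f t - g t) t) = \<Theta> T W (\<lambda>t. ?I t *\<^sub>R neutral_op T f t) - \<Theta> T W (\<lambda>t. ?I t *\<^sub>R neutral_op T g t)"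
      unfolding \<Theta>_def neutral_op_diff[OF f(1) g(1)] e
      by (rule Bochner_Integration.integral_diff[OF C1(2)[OF neutral_op_l2f[OF f(1)]] C1(2)[OF neutral_op_l2f[OF g(1)]]])
    moreover have "class_of (state_of A (\<lambda>t. f t - g t) T) = class_of (state_of A f T) - class_of (state_of A g T)"
      using f g by (simp add: class_of_def state_of_def primitive_diff[OF li] mv.diff_right scaleR_diff_right primitive_l2f l2_class_diff)
    ultimately show ?thesis unfolding D_def by (simp add: inner_diff_left)
  qed
  have D0: "D (\<lambda>t. ?I t *\<^sub>R g t) = 0" if g: "continuous_on UNIV g" and g0: "\<And>t. t \<le> 0 \<Longrightarrow> g t = 0" for g
  proof -
    define f' where "f' t = ?I t *\<^sub>R g t" for t
    have f': "l2f f'" unfolding f'_def by (rule l2f_continuous_interval[OF g])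
    \<comment> \<open>Cutting at \<open>T\<close> is invisible up to time \<open>T\<close>: the
      equation and the final state depend on the past only.\<close>
    have fg: "f' t = g t" if "t \<le> T" for t using that g0[of t] by (cases "t \<ge> 0") (auto simp: f'_def)
    have zf: "primitive g t = primitive f' t" if "t \<le> T" for t
      unfolding primitive_def by (rule Bochner_Integration.integral_cong) (use that in \<open>auto simp: f'_def indicator_def\<close>)
    have Eg: "g s - A *v g (s - 1) - Lop A2 A3 (\<lambda>\<theta>. g (s + \<theta>)) (\<lambda>\<theta>. primitive g (s + \<theta>)) = neutral_op T f' s" if s: "s \<in> {0..T}" for s
    proof -
      have "Lop A2 A3 (\<lambda>\<theta>. g (s + \<theta>)) (\<lambda>\<theta>. primitive g (s + \<theta>)) = Lop A2 A3 (\<lambda>\<theta>. f' (s + \<theta>)) (\<lambda>\<theta>. primitive f' (s + \<theta>))"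
        unfolding Lop_def set_lebesgue_integral_def
        by (intro arg_cong2[where f="(+)"] Bochner_Integration.integral_cong) (use s fg zf in \<open>auto simp: indicator_def\<close>)
      also have "\<dots> = convol (delay_kernel_on T) f' s"
        by (rule Lop_kernel[OF f']) (use s in \<open>auto simp: f'_def\<close>)
      finally show ?thesis using s fg[of s] fg[of "s - 1"] by (simp add: neutral_op_def)
    qed
    have "class_of (state_of A g T) = class_of (state_of A f' T)"
    proof -
      have "(\<lambda>\<theta>. indicat_real {-1..0} \<theta> *\<^sub>R primitive g (T + \<theta>)) = (\<lambda>\<theta>. indicat_real {-1..0} \<theta> *\<^sub>R primitive f' (T + \<theta>))"
        by (rule ext) (use zf[of "T + _"] in \<open>auto simp: indicator_def\<close>)
      then show ?thesis using zf[of T] zf[of "T - 1"] by (simp add: class_of_def state_of_def)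
    qed
    then have "((\<lambda>s. St (T - s) (?I s *\<^sub>R neutral_op T f' s, 0)) has_integral class_of (state_of A f' T)) {0..T}"
      using duhamel_state_of[OF g g0 T] by (auto elim!: has_integral_eq[rotated] simp: Eg)
    from has_integral_linear[OF this bounded_linear_inner_left[of W]]
    have hi: "((\<lambda>s. inner (St (T - s) (?I s *\<^sub>R neutral_op T f' s, 0)) W) has_integral inner (class_of (state_of A f' T)) W) {0..T}"
      by (simp add: o_def)
    have "(LINT s:{0..T}|lborel. inner (St (T - s) (?I s *\<^sub>R neutral_op T f' s, 0)) W) = integral {0..T} (\<lambda>s. inner (St (T - s) (?I s *\<^sub>R neutral_op T f' s, 0)) W)"
      by (rule set_borel_integral_eq_integral) (use C1(2)[OF neutral_op_l2f[OF f']] in \<open>simp add: set_integrable_def\<close>)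
    then show ?thesis
      using integral_unique[OF hi] unfolding D_def \<Theta>_def set_lebesgue_integral_def f'_def[symmetric, abs_def] by simp
  qed
  define C where "C = C1 * C2 + C3 * norm W"
  have C: "C \<ge> 0" unfolding C_def using C1(1) C2(1) C3(1) by simp
  have f0: "\<forall>t<0. f t = 0" using sf by simp
  have "\<bar>D f\<bar> \<le> e" if e: "e > 0" for e
  proof -
    have "e / (C + 1) > 0" using e C by simp
    from l2_approx_continuous_vanishing[OF f sf T this] obtain g where
      g: "continuous_on UNIV g" "\<And>t. t \<le> 0 \<Longrightarrow> g t = 0" "norm (l2_class f - l2_class (\<lambda>t. ?I t *\<^sub>R g t)) < e / (C + 1)" by blast
    have gl: "l2f (\<lambda>t. ?I t *\<^sub>R g t)" by (rule l2f_continuous_interval[OF g(1)])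
    have "D f = D (\<lambda>t. f t - ?I t *\<^sub>R g t)" using Dd[OF f f0 gl] D0[OF g(1,2)] by simp
    also have "\<bar>\<dots>\<bar> \<le> C * norm (l2_class (\<lambda>t. f t - ?I t *\<^sub>R g t))"
      unfolding C_def by (rule Db) (use f0 gl f in \<open>auto intro: l2f_diff\<close>)
    also have "\<dots> \<le> C * (e / (C + 1))" using g(3) C by (intro mult_left_mono) (auto simp: l2_class_diff[OF f gl])
    also have "\<dots> \<le> e" using e C by (simp add: field_simps)
    finally show ?thesis .
  qed
  then have "\<bar>D f\<bar> \<le> 0" by (rule field_le_epsilon) simp_all
  then show ?thesis by (simp add: D_def)
qed

end

section \<open>Reachable states as end points of trajectories\<close>

lemma class_of_eqI:
  assumes x: "x \<in> M2" "x' \<in> M2" and eq: "\<And>w. w \<in> M2 \<Longrightarrow> m2_inner x w = m2_inner x' w"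
  shows "class_of x = class_of x'"
proof -
  define d where "d = class_of x - class_of x'"
  have w: "m2_sub x x' \<in> M2" using x by (simp add: m2_sub_def m2_add_M2 m2_smult_M2)
  have d: "class_of (m2_sub x x') = d" unfolding d_def by (rule class_of_sub[OF x])
  have "Re (m2_inner x (m2_sub x x')) = Re (m2_inner x' (m2_sub x x'))" using eq[OF w] by simp
  then have "inner (class_of x) d = inner (class_of x') d" by (simp add: m2_inner_class_of x w d)
  then have "inner d d = 0" unfolding d_def by (simp add: inner_diff_left)
  then show ?thesis by (simp add: d_def)
qed

context neutral
begin

lemma state_of_M2: "l2f f \<Longrightarrow> (\<And>t. t < 0 \<Longrightarrow> f t = 0) \<Longrightarrow> state_of A f s \<in> M2"
  and state_of_dom_data: "l2f f \<Longrightarrow> (\<And>t. t < 0 \<Longrightarrow> f t = 0) \<Longrightarrow> dom_data A (state_of A f s) (primitive f (s - 1)) (\<lambda>\<theta>. f (s + \<theta>))"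
proof -
  assume f: "l2f f" "\<And>t. t < 0 \<Longrightarrow> f t = 0"
  have l: "l2f (\<lambda>\<theta>. indicator {-1..0} \<theta> *\<^sub>R f (s + \<theta>))" for s
    using l2f_cmul_indicator[OF l2f_shift[OF f(1), of s], of "{-1..0}"] by (simp add: add.commute)
  show "state_of A f s \<in> M2" "dom_data A (state_of A f s) (primitive f (s - 1)) (\<lambda>\<theta>. f (s + \<theta>))"
    using state_of_dom[OF locally_integrable_l2f[OF f] l primitive_continuous[OF f]] by blast+
qed

lemma control_l2f:
  fixes B :: "complex^'r::finite^'n"
  assumes "L2on {0..T} u"
  shows "l2f (\<lambda>s. indicator {0..T} s *\<^sub>R (B *v u (T - s)))"
proof -
  have "l2f (\<lambda>t. indicator {0..T} t *\<^sub>R u t)" using assms by (simp add: L2on_iff_l2f)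
  from l2f_blin[OF l2f_reflect[OF this, of T] blin_mv[of B]]
  have "l2f (\<lambda>t. B *v (indicator {0..T} (T - t) *\<^sub>R u (T - t)))" .
  moreover have "indicat_real {0..T} (T - t) = indicator {0..T} t" for t by (auto simp: indicator_def)
  ultimately show ?thesis by (simp add: mv.scaleR_right)
qed

text \<open>In \<open>reach_set\<close> the control at time t is propagated over the time t, whereas
  along a trajectory the input at time s is propagated over T - s. The reflection t = T - s matches
  the two and explains the argument of \<open>u\<close> in \<open>eq\<close>.\<close>

lemma reach_pairing:
  fixes B :: "complex^'r::finite^'n"
  assumes u: "L2on {0..T} u" and f: "l2f f" and sf: "\<And>t. t \<notin> {0..T} \<Longrightarrow> f t = 0" and T: "T \<ge> 0"
    and eq: "AE s in lborel. s \<in> {0..T} \<longrightarrow> neutral_op T f s = B *v u (T - s)" and w: "w \<in> M2"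
  shows "(LINT t:{0..T}|lborel. m2_inner (S t (B *v u t, \<lambda>_. 0)) w) = m2_inner (state_of A f T) w"
proof -
  let ?I = "indicat_real {0..T}"
  define h where "h s = ?I s *\<^sub>R (B *v u (T - s))" for s
  have h: "l2f h" unfolding h_def by (rule control_l2f[OF u])
  have vM: "(v, \<lambda>_. 0) \<in> M2" for v :: "complex^'n" by (simp add: M2_iff l2f_zero)
  have vT: "class_of (v, \<lambda>_. 0) = (v, 0)" for v :: "complex^'n" by (simp add: class_of_def zero_l2_l2_class)
  have rI: "?I (T - t) = ?I t" for t by (auto simp: indicator_def)
  define a where "a W t = ?I t *\<^sub>R inner (St t (B *v u t, 0)) W" for W t
  have a_eq: "a W (T - s) = ?I s *\<^sub>R inner (St (T - s) (h s, 0)) W" for W s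
    by (simp add: a_def h_def rI) (simp add: indicator_def)
  obtain C where Ci: "\<And>h. l2f h \<Longrightarrow> integrable lborel (\<lambda>s. ?I s *\<^sub>R inner (St (T - s) (h s, 0)) W)" for W
    using \<Theta>_int_bound[of T] by blast
  have ai: "integrable lborel (a W)" for W
    using int_reflect[OF Ci[OF h, of W], of T] unfolding a_eq[symmetric] by simp
  have aint: "(LINT t|lborel. a W t) = inner (class_of (state_of A f T)) W" for W
  proof -
    have "(LINT t|lborel. a W t) = (LINT s|lborel. a W (T - s))" by (rule lint_reflect[symmetric])
    also have "\<dots> = \<Theta> T W (\<lambda>t. ?I t *\<^sub>R neutral_op T f t)"
      unfolding \<Theta>_def a_eq
    proof (rule integral_cong_AE)
      show "AE s in lborel. ?I s *\<^sub>R inner (St (T - s) (h s, 0)) W = ?I s *\<^sub>R inner (St (T - s) (?I s *\<^sub>R neutral_op T f s, 0)) W"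
        using eq by eventually_elim (auto simp: h_def indicator_def)
    qed (rule borel_measurable_integrable, rule Ci, rule h, rule borel_measurable_integrable, rule Ci, rule neutral_op_l2f[OF f])
    also have "\<dots> = inner (class_of (state_of A f T)) W" by (rule input_map_state[OF f sf T])
    finally show ?thesis .
  qed
  define W1 W2 where "W1 = class_of w" and "W2 = class_of (m2_smult \<i> w)"
  have "(LINT t:{0..T}|lborel. m2_inner (S t (B *v u t, \<lambda>_. 0)) w)
     = (LINT t|lborel. complex_of_real (a W1 t) + \<i> * complex_of_real (a W2 t))"
    unfolding set_lebesgue_integral_def
  proof (rule Bochner_Integration.integral_cong[OF refl])
    fix t
    show "?I t *\<^sub>R m2_inner (S t (B *v u t, \<lambda>_. 0)) w = complex_of_real (a W1 t) + \<i> * complex_of_real (a W2 t)"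
    proof (cases "t \<in> {0..T}")
      case True
      then have t: "t \<ge> 0" by simp
      have "class_of (S t (B *v u t, \<lambda>_. 0)) = St t (B *v u t, 0)" using St_class_of[OF t vM, of "B *v u t"] by (simp add: vT)
      then show ?thesis
        using True by (simp add: m2_inner_class_of[OF S_M2[OF t vM] w] a_def W1_def W2_def Complex_eq)
    qed (simp add: a_def)
  qed
  also have "\<dots> = complex_of_real (LINT t|lborel. a W1 t) + \<i> * complex_of_real (LINT t|lborel. a W2 t)"
    by (subst Bochner_Integration.integral_add)
       (intro integrable_mult_right integrable_of_real ai | simp only: integral_mult_right_zero integral_complex_of_real)+
  also have "\<dots> = m2_inner (state_of A f T) w"
    unfolding aint using w f sf by (subst m2_inner_class_of) (auto simp: W1_def W2_def Complex_eq intro!: state_of_M2)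
  finally show ?thesis .
qed

text \<open>With the weight exp(-m t) the delay acquires the factor exp(-m) and the kernel the
  factor exp(-m t), so both become small in norm for large m. The equation is then a contraction
  with constant 1/2 on all of [0, T] at once.\<close>

lemma neutral_op_solvable:
  assumes h: "l2f h" and T: "T \<ge> 0"
  shows "\<exists>f. l2f f \<and> (\<forall>t. t \<notin> {0..T} \<longrightarrow> f t = 0) \<and> (AE t in lborel. t \<in> {0..T} \<longrightarrow> neutral_op T f t = h t)"
proof -
  let ?I = "indicat_real {0..T}"
  define ek where "ek n t = exp (- (real n * t)) *\<^sub>R delay_kernel_on T t" for n :: nat and t
  have ekm: "ek n \<in> borel_measurable borel" for n unfolding ek_def using l2f_meas[OF l2f_delay_kernel_on, of T] by measurable
  have ekb: "norm (ek n t) \<le> norm (delay_kernel_on T t)" for n t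
    by (auto simp: ek_def delay_kernel_on_def indicator_def intro!: mult_left_le_one_le)
  have lim: "AE t in lborel. (\<lambda>n. ek n t) \<longlonglongrightarrow> 0"
    using AE_lborel_singleton[of 0]
  proof eventually_elim
    case (elim t)
    show ?case
    proof (cases "t > 0")
      case True
      have "(\<lambda>n. exp (- t) ^ n) \<longlonglongrightarrow> 0" by (rule LIMSEQ_power_zero) (use True in simp)
      then have "(\<lambda>n. exp (- (real n * t))) \<longlonglongrightarrow> 0" by (simp add: exp_of_nat_mult[symmetric])
      from tendsto_scaleR[OF this tendsto_const] show ?thesis by (simp add: ek_def)
    qed (use elim in \<open>simp add: ek_def delay_kernel_on_def\<close>)
  qed
  have lek: "l2f (ek n)" for n
    by (rule l2_dominated(1)[OF l2f_delay_kernel_on ekm _ ekb lim]) simp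
  have "(\<lambda>n. l2_class (ek n)) \<longlonglongrightarrow> l2_class (\<lambda>t. 0)"
    by (rule l2_dominated(3)[OF l2f_delay_kernel_on ekm _ ekb lim]) simp
  then have "(\<lambda>n. norm (l2_class (ek n))) \<longlonglongrightarrow> 0" using tendsto_norm_zero zero_l2_l2_class by metis
  moreover have "(\<lambda>n. exp (- real n)) \<longlonglongrightarrow> 0"
  proof -
    have "(\<lambda>n. exp (- 1 :: real) ^ n) \<longlonglongrightarrow> 0" by (rule LIMSEQ_power_zero) simp
    then show ?thesis by (simp add: exp_of_nat_mult[symmetric])
  qed
  ultimately have "(\<lambda>n. exp (- real n) * norm A + norm (l2_class (ek n)) * sqrt T) \<longlonglongrightarrow> 0 * norm A + 0 * sqrt T"
    by (intro tendsto_intros)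
  from LIMSEQ_D[OF this, of "1/2"] obtain n where "\<bar>exp (- real n) * norm A + norm (l2_class (ek n)) * sqrt T\<bar> < 1/2" by auto
  then have n: "exp (- real n) * norm A + norm (l2_class (ek n)) * sqrt T \<le> 1/2" by linarith
  define m where "m = real n"
  define G where "G \<phi> t = ?I t *\<^sub>R (exp (- m) *\<^sub>R (A *v \<phi> (t - 1)) + convol (ek n) \<phi> t)" for \<phi> t
  define H where "H t = ?I t *\<^sub>R (exp (- (m * t)) *\<^sub>R h t)" for t
  have lH: "l2f H"
  proof (rule l2f_bound[OF _ l2f_int[OF h]])
    show "H \<in> borel_measurable borel" unfolding H_def using l2f_meas[OF h] by measurable
    show "(norm (H t))\<^sup>2 \<le> (norm (h t))\<^sup>2" for t
      by (intro power_mono) (auto simp: H_def indicator_def m_def intro!: mult_left_le_one_le)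
  qed
  have lA: "l2f (\<lambda>t. ?I t *\<^sub>R (exp (- m) *\<^sub>R (A *v \<phi> (t - 1))))" if "l2f \<phi>" for \<phi>
    by (intro l2f_cmul_indicator l2f_scaleR l2f_blin[OF _ blin_mv] l2f_shift' that) simp
  have lC: "l2f (\<lambda>t. ?I t *\<^sub>R convol (ek n) \<phi> t)" if "l2f \<phi>" for \<phi>
    by (rule l2f_continuous_interval[OF convol_continuous[OF lek that]])
  have lG: "l2f (G \<phi>)" if "l2f \<phi>" for \<phi>
    unfolding G_def[abs_def] scaleR_add_right[of "?I _"] by (rule l2f_add[OF lA[OF that] lC[OF that]])
  have Gb: "norm (l2_class (G \<phi>)) \<le> 1/2 * norm (l2_class \<phi>)" if p: "l2f \<phi>" for \<phi>
  proof -
    have "norm (l2_class (\<lambda>t. ?I t *\<^sub>R (exp (- m) *\<^sub>R (A *v \<phi> (t - 1))))) \<le> norm (l2_class (\<lambda>t. (exp (- m) * norm A) *\<^sub>R \<phi> (t - 1)))"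
      by (rule norm_l2_class_le[OF lA[OF p] l2f_scaleR[OF l2f_shift'[OF p]]]) (simp add: indicator_def norm_mv_le mult.assoc)
    also have "l2_class (\<lambda>t. (exp (- m) * norm A) *\<^sub>R \<phi> (t - 1)) = (exp (- m) * norm A) *\<^sub>R shift_l2 1 (l2_class \<phi>)"
      by (simp add: shift_l2_l2_class[OF p] l2_class_scaleR[OF l2f_shift'[OF p]])
    finally have 1: "norm (l2_class (\<lambda>t. ?I t *\<^sub>R (exp (- m) *\<^sub>R (A *v \<phi> (t - 1))))) \<le> exp (- m) * norm A * norm (l2_class \<phi>)" by simp
    have 2: "norm (l2_class (\<lambda>t. ?I t *\<^sub>R convol (ek n) \<phi> t)) \<le> norm (l2_class (ek n)) * norm (l2_class \<phi>) * sqrt (T - 0)"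
      by (rule norm_l2_class_indicator_bound[OF convol_meas[OF lek p] convol_bound[OF lek p]]) (use T in auto)
    have "l2_class (G \<phi>) = l2_class (\<lambda>t. ?I t *\<^sub>R (exp (- m) *\<^sub>R (A *v \<phi> (t - 1)))) + l2_class (\<lambda>t. ?I t *\<^sub>R convol (ek n) \<phi> t)"
      unfolding G_def[abs_def] scaleR_add_right[of "?I _"] by (rule l2_class_add[OF lA[OF p] lC[OF p], symmetric])
    then have "norm (l2_class (G \<phi>)) \<le> (exp (- m) * norm A + norm (l2_class (ek n)) * sqrt T) * norm (l2_class \<phi>)"
      using 1 2 norm_triangle_ineq[of "l2_class (\<lambda>t. ?I t *\<^sub>R (exp (- m) *\<^sub>R (A *v \<phi> (t - 1))))" "l2_class (\<lambda>t. ?I t *\<^sub>R convol (ek n) \<phi> t)"]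
      by (simp add: algebra_simps)
    also have "\<dots> \<le> 1/2 * norm (l2_class \<phi>)" using n by (intro mult_right_mono) (auto simp: m_def)
    finally show ?thesis .
  qed
  define \<Gamma> where "\<Gamma> x = l2_class (G (l2_rep x)) + l2_class H" for x
  have "\<exists>!x. \<Gamma> x = x"
  proof (rule banach_fix_type[of "1/2"])
    show "\<forall>x y. dist (\<Gamma> x) (\<Gamma> y) \<le> 1 / 2 * dist x y"
    proof (intro allI)
      fix x y :: "(complex^'n) l2"
      have l: "l2f (\<lambda>t. l2_rep x t - l2_rep y t)" by (simp add: l2f_diff)
      have "G (\<lambda>t. l2_rep x t - l2_rep y t) = (\<lambda>t. G (l2_rep x) t - G (l2_rep y) t)"
        by (rule ext) (simp add: G_def mv.diff_right convol_diff lek algebra_simps)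
      then have "\<Gamma> x - \<Gamma> y = l2_class (G (\<lambda>t. l2_rep x t - l2_rep y t))"
        unfolding \<Gamma>_def by (simp add: l2_class_diff lG)
      also have "norm \<dots> \<le> 1/2 * norm (l2_class (\<lambda>t. l2_rep x t - l2_rep y t))" by (rule Gb[OF l])
      also have "l2_class (\<lambda>t. l2_rep x t - l2_rep y t) = x - y" using l2_class_diff[of "l2_rep x" "l2_rep y"] by simp
      finally show "dist (\<Gamma> x) (\<Gamma> y) \<le> 1 / 2 * dist x y" by (simp add: dist_norm)
    qed
  qed auto
  then obtain x where "\<Gamma> x = x" by blast
  then have "x = l2_class (\<lambda>t. G (l2_rep x) t + H t)" unfolding \<Gamma>_def by (simp add: l2_class_add lG lH)
  with AE_l2_rep_l2_class[OF l2f_add[OF lG[OF l2f_l2_rep[of x]] lH]] have ae: "AE t in lborel. l2_rep x t = G (l2_rep x) t + H t" by simp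
  \<comment> \<open>A representative that vanishes everywhere, not just almost everywhere, outside
    [0, T].\<close>
  define p where "p t = ?I t *\<^sub>R l2_rep x t" for t
  have lp: "l2f p" unfolding p_def by (intro l2f_cmul_indicator) simp_all
  have xp: "AE t in lborel. l2_rep x t = p t"
    using ae by eventually_elim (auto simp: p_def G_def H_def indicator_def)
  define f where "f t = exp (m * t) *\<^sub>R p t" for t
  have lf: "l2f f"
  proof (rule l2f_bound)
    show "f \<in> borel_measurable borel" unfolding f_def using l2f_meas[OF lp] by measurable
    show "integrable lborel (\<lambda>t. (exp (m * T))\<^sup>2 * (norm (p t))\<^sup>2)" using l2f_int[OF lp] by simp
    show "(norm (f t))\<^sup>2 \<le> (exp (m * T))\<^sup>2 * (norm (p t))\<^sup>2" for t
    proof (cases "t \<in> {0..T}")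
      case True
      then have "exp (m * t) \<le> exp (m * T)" by (simp add: m_def mult_left_mono)
      then show ?thesis by (simp add: f_def power_mult_distrib[symmetric] power_mono mult_right_mono)
    qed (simp add: f_def p_def)
  qed
  have "AE t in lborel. t \<in> {0..T} \<longrightarrow> neutral_op T f t = h t"
    using ae xp AE_shift[OF xp, of "-1"]
  proof eventually_elim
    case (elim t)
    show ?case
    proof
      assume t: "t \<in> {0..T}"
      have c1: "convol (ek n) (l2_rep x) t = convol (ek n) p t" by (rule convol_cong_right[OF lek l2f_l2_rep lp xp])
      have c2: "exp (m * t) *\<^sub>R convol (ek n) p t = convol (delay_kernel_on T) f t"
        unfolding convol_def f_def ek_def integral_scaleR_right[symmetric]
        by (rule Bochner_Integration.integral_cong[OF refl])
           (simp add: mv.scaleR_left mv.scaleR_right m_def exp_add[symmetric] algebra_simps)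
      have "f t = exp (m * t) *\<^sub>R (exp (- m) *\<^sub>R (A *v p (t - 1)) + convol (ek n) p t + exp (- (m * t)) *\<^sub>R h t)"
        using elim t by (simp add: f_def G_def H_def c1)
      also have "\<dots> = A *v f (t - 1) + convol (delay_kernel_on T) f t + h t"
        unfolding scaleR_add_right c2 by (simp add: f_def mv.scaleR_right exp_add[symmetric] algebra_simps)
      finally show "neutral_op T f t = h t" by (simp add: neutral_op_def)
    qed
  qed
  then show ?thesis using lf by (intro exI[of _ f]) (auto simp: f_def p_def)
qed

text \<open>Solvability for every control supplies the trajectory, and the pairing identity together
  with \<open>class_of_eqI\<close> identifies its end point with the reachable state.\<close>

lemma reach_iff:
  fixes B :: "complex^'r::finite^'n"
  assumes T: "T \<ge> 0"
  shows "x \<in> reach_set S B T \<longleftrightarrow> x \<in> M2 \<and> (\<exists>u f. L2on {0..T} u \<and> l2f f \<and> (\<forall>t. t \<notin> {0..T} \<longrightarrow> f t = 0) \<and>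
    (AE s in lborel. s \<in> {0..T} \<longrightarrow> neutral_op T f s = B *v u (T - s)) \<and> class_of x = class_of (state_of A f T))"
proof (rule iffI)
  assume "x \<in> reach_set S B T"
  then obtain u where x: "x \<in> M2" and u: "L2on {0..T} u"
    and p: "\<And>w. w \<in> M2 \<Longrightarrow> m2_inner x w = (LINT t:{0..T}|lborel. m2_inner (S t (B *v u t, \<lambda>_. 0)) w)"
    unfolding reach_set_def by blast
  obtain f where f: "l2f f" "\<And>t. t \<notin> {0..T} \<Longrightarrow> f t = 0" "AE t in lborel. t \<in> {0..T} \<longrightarrow> neutral_op T f t = indicator {0..T} t *\<^sub>R (B *v u (T - t))"
    using neutral_op_solvable[OF control_l2f[OF u, of B] T] by blast
  have eq: "AE s in lborel. s \<in> {0..T} \<longrightarrow> neutral_op T f s = B *v u (T - s)" using f(3) by eventually_elim auto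
  have "class_of x = class_of (state_of A f T)"
  proof (rule class_of_eqI[OF x])
    show "state_of A f T \<in> M2" using f by (intro state_of_M2) auto
    show "m2_inner x w = m2_inner (state_of A f T) w" if "w \<in> M2" for w
      using p[OF that] reach_pairing[OF u f(1,2) T eq that] by simp
  qed
  then show "x \<in> M2 \<and> (\<exists>u f. L2on {0..T} u \<and> l2f f \<and> (\<forall>t. t \<notin> {0..T} \<longrightarrow> f t = 0) \<and>
    (AE s in lborel. s \<in> {0..T} \<longrightarrow> neutral_op T f s = B *v u (T - s)) \<and> class_of x = class_of (state_of A f T))"
    using x u f(1,2) eq by blast
next
  assume "x \<in> M2 \<and> (\<exists>u f. L2on {0..T} u \<and> l2f f \<and> (\<forall>t. t \<notin> {0..T} \<longrightarrow> f t = 0) \<and>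
    (AE s in lborel. s \<in> {0..T} \<longrightarrow> neutral_op T f s = B *v u (T - s)) \<and> class_of x = class_of (state_of A f T))"
  then obtain u f where x: "x \<in> M2" and u: "L2on {0..T} u" and f: "l2f f" "\<And>t. t \<notin> {0..T} \<Longrightarrow> f t = 0"
    and eq: "AE s in lborel. s \<in> {0..T} \<longrightarrow> neutral_op T f s = B *v u (T - s)" and xe: "class_of x = class_of (state_of A f T)" by blast
  have "m2_inner x w = (LINT t:{0..T}|lborel. m2_inner (S t (B *v u t, \<lambda>_. 0)) w)" if w: "w \<in> M2" for w
  proof -
    have xM: "state_of A f T \<in> M2" using f by (auto intro: state_of_M2)
    have "m2_inner x w = m2_inner (state_of A f T) w" using x xe w xM by (simp add: m2_inner_class_of)
    then show ?thesis by (rule trans[OF _ reach_pairing[OF u f T eq w, symmetric]])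
  qed
  then show "x \<in> reach_set S B T" using x u unfolding reach_set_def by blast
qed

end

section \<open>Krylov spaces and the lower bound for the critical time\<close>

lemma mpow_Suc: "mpow A (Suc k) = A ** mpow A k" by (simp add: mpow_def)
lemma mpow_0: "mpow A 0 = mat 1" by (simp add: mpow_def)
lemma mpow_Suc_mv: "A *v (mpow A k *v x) = mpow A (Suc k) *v x"
  by (simp add: mpow_Suc matrix_vector_mul_assoc)

lemma mv_column_span:
  fixes M :: "complex^'r::finite^'n"
  assumes "\<And>j. column j M \<in> vec.span W" shows "M *v x \<in> vec.span W"
  unfolding matrix_mult_sum by (intro vec.span_sum vec.span_scale assms)

text \<open>Vectors of the displayed form are closed under complex combinations and contain every
  Krylov column, and these columns span the space.\<close>

lemma krylov_full:
  fixes A :: "complex^'n::finite^'n" and B :: "complex^'r::finite^'n"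
  assumes "krylov_rank A B \<nu> = CARD('n)"
  shows "\<exists>v. x = (\<Sum>k<\<nu>. mpow A k *v (B *v v k))"
proof -
  define S where "S = {column j (mpow A k ** B) | k j. k < \<nu>}"
  define V where "V = {x. \<exists>v. x = (\<Sum>k<\<nu>. mpow A k *v (B *v v k))}"
  have "vec.dim S = CARD('n)" using assms unfolding krylov_rank_def S_def .
  then have sp: "vec.span S = UNIV" by (simp add: vec.dim_eq_full[symmetric] vec.dimension_def card_cart_basis)
  have "vec.subspace V"
  proof (rule vec.subspaceI)
    show "0 \<in> V" unfolding V_def by (auto intro!: exI[of _ "\<lambda>_. 0"])
    fix x y c assume "x \<in> V"
    then obtain v where v: "x = (\<Sum>k<\<nu>. mpow A k *v (B *v v k))" unfolding V_def by blast
    have "c *s x = (\<Sum>k<\<nu>. mpow A k *v (B *v (c *s v k)))" unfolding v mv_scaleC by (simp add: vec.scale_sum_right)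
    then show "c *s x \<in> V" unfolding V_def by (intro CollectI exI[of _ "\<lambda>k. c *s v k"])
    assume "y \<in> V"
    then obtain w where w: "y = (\<Sum>k<\<nu>. mpow A k *v (B *v w k))" unfolding V_def by blast
    have "x + y = (\<Sum>k<\<nu>. mpow A k *v (B *v (v k + w k)))" unfolding v w mv.add_right by (simp add: sum.distrib)
    then show "x + y \<in> V" unfolding V_def by (intro CollectI exI[of _ "\<lambda>k. v k + w k"])
  qed
  moreover have "S \<subseteq> V"
  proof
    fix y assume "y \<in> S"
    then obtain k j where k: "k < \<nu>" and y: "y = column j (mpow A k ** B)" unfolding S_def by blast
    have "y = (mpow A k ** B) *v axis j 1"
      unfolding y by (simp add: vec_eq_iff column_def matrix_vector_mult_def axis_def if_distrib cong: if_cong)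
    also have "\<dots> = (\<Sum>i<\<nu>. mpow A i *v (B *v (if i = k then axis j 1 else 0)))"
      using k by (simp add: if_distrib[of "\<lambda>x. _ *v x"] matrix_vector_mul_assoc cong: if_cong)
    finally show "y \<in> V" unfolding V_def by (intro CollectI exI[of _ "\<lambda>i. if i = k then axis j 1 else 0"])
  qed
  ultimately have "vec.span S \<subseteq> V" by (intro vec.span_minimal)
  then show ?thesis using sp unfolding V_def by blast
qed

text \<open>A proper complex span is also a proper real subspace, so it lies in a real hyperplane.
  Its normal \<open>q\<close> is orthogonal for the real inner product, which suffices for the kink
  argument.\<close>

lemma krylov_deficient:
  fixes A :: "complex^'n::finite^'n" and B :: "complex^'r::finite^'n"
  assumes "krylov_rank A B \<nu> \<noteq> CARD('n)"
  shows "\<exists>q. q \<noteq> 0 \<and> (\<forall>k<\<nu>. \<forall>v. q \<bullet> (mpow A k *v (B *v v)) = 0)"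
proof -
  define S where "S = {column j (mpow A k ** B) | k j. k < \<nu>}"
  have "vec.span S \<noteq> UNIV"
  proof
    assume "vec.span S = UNIV"
    then have "vec.dim S = CARD('n)" by (metis vec.dim_span vec_dim_card)
    then show False using assms unfolding krylov_rank_def S_def by blast
  qed
  moreover have "span (vec.span S) = vec.span S"
  proof (rule span_eq_iff[THEN iffD2], rule subspaceI)
    show "c *\<^sub>R x \<in> vec.span S" if "x \<in> vec.span S" for c x
      using vec.span_scale[OF that, of "complex_of_real c"] by (simp add: of_real_smul)
  qed (auto intro: vec.span_add vec.span_zero)
  ultimately have "span (vec.span S) \<noteq> UNIV" by metis
  from span_not_univ_subset_hyperplane[OF this] obtain q where q: "q \<noteq> 0" "\<forall>x\<in>span (vec.span S). q \<bullet> x = 0" by blast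
  have "q \<bullet> (mpow A k *v (B *v v)) = 0" if k: "k < \<nu>" for k v
  proof -
    have "(mpow A k ** B) *v v \<in> vec.span S"
      by (rule mv_column_span) (use k in \<open>auto simp: S_def intro!: vec.span_base\<close>)
    then have "(mpow A k ** B) *v v \<in> span (vec.span S)" by (rule span_base)
    then show ?thesis using q(2) by (simp add: matrix_vector_mul_assoc)
  qed
  then show ?thesis using q(1) by blast
qed

section \<open>Targets missed for short times\<close>

context neutral
begin

lemma domA_cong:
  assumes "x \<in> M2" "x' \<in> M2" "class_of x = class_of x'" "x' \<in> domA A"
  shows "x \<in> domA A"
proof -
  obtain c g where d: "dom_data A x' c g" using assms(4) by (auto simp: domA_def)
  have e: "fst x = fst x'" "AE \<theta> in lborel. \<theta> \<in> {-1..0} \<longrightarrow> snd x \<theta> = snd x' \<theta>"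
    using assms by (auto simp: class_of_eq_iff m2_equiv_def)
  have "AE \<theta> in lborel. \<theta> \<in> {-1..0} \<longrightarrow> snd x' \<theta> = c + (LINT s:{-1..\<theta>}|lborel. g s)" using d by (simp add: dom_data_def)
  with e(2) have "AE \<theta> in lborel. \<theta> \<in> {-1..0} \<longrightarrow> snd x \<theta> = c + (LINT s:{-1..\<theta>}|lborel. g s)" by eventually_elim auto
  then have "dom_data A x c g" using d e(1) by (simp add: dom_data_def)
  then show ?thesis using assms(1) by (auto simp: domA_def)
qed

lemma state_of_domA: "l2f f \<Longrightarrow> (\<And>t. t < 0 \<Longrightarrow> f t = 0) \<Longrightarrow> state_of A f s \<in> domA A"
  using state_of_M2 state_of_dom_data unfolding domA_def by blast

lemma reach_subset_domA:
  fixes B :: "complex^'r::finite^'n"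
  assumes "T \<ge> 0" shows "reach_set S B T \<subseteq> domA A"
proof
  fix x assume "x \<in> reach_set S B T"
  then obtain f where x: "x \<in> M2" and f: "l2f f" "\<And>t. t < 0 \<Longrightarrow> f t = 0" and e: "class_of x = class_of (state_of A f T)"
    unfolding reach_iff[OF assms] by force
  show "x \<in> domA A" by (rule domA_cong[OF x state_of_M2[OF f] e state_of_domA[OF f]])
qed

text \<open>Each step back in time by 1 costs one factor \<open>A\<close>; on \<open>[0, m)\<close> the history is exhausted after \<open>m\<close> steps.\<close>

lemma solution_expansion:
  assumes f0: "\<And>t. t < 0 \<Longrightarrow> f t = 0" and b0: "\<And>t. t < 0 \<Longrightarrow> convol (delay_kernel_on T) f t + b t = 0"
    and eq: "AE t in lborel. t \<in> {0..T} \<longrightarrow> f t = A *v f (t - 1) + convol (delay_kernel_on T) f t + b t"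
  shows "AE t in lborel. t < real m \<and> t \<le> T \<longrightarrow> f t = (\<Sum>k<m. mpow A k *v (convol (delay_kernel_on T) f (t - real k) + b (t - real k)))"
proof (induction m)
  case 0
  show ?case using f0 by simp
next
  case (Suc m)
  from AE_shift[OF Suc, of "-1"] eq show ?case
  proof eventually_elim
    case (elim t)
    show ?case
    proof
      assume t: "t < real (Suc m) \<and> t \<le> T"
      have e: "f t = A *v f (t - 1) + convol (delay_kernel_on T) f t + b t"
        using elim(2) t f0[of t] f0[of "t - 1"] b0[of t] by (cases "t \<ge> 0") auto
      have "A *v f (t - 1) = (\<Sum>k<m. mpow A (Suc k) *v (convol (delay_kernel_on T) f (t - real (Suc k)) + b (t - real (Suc k))))"
        using elim(1) t by (simp add: mv.sum_right mpow_Suc_mv algebra_simps)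
      then show "f t = (\<Sum>k<Suc m. mpow A k *v (convol (delay_kernel_on T) f (t - real k) + b (t - real k)))"
        unfolding sum.lessThan_Suc_shift using e by (simp add: mpow_0)
    qed
  qed
qed

text \<open>The missed target is the state whose derivative jumps by \<open>q\<close> at the time \<open>t0 < \<nu>\<close>.\<close>

lemma unreachable:
  fixes B :: "complex^'r::finite^'n"
  assumes T: "T \<ge> 0" and q: "q \<noteq> 0" "\<And>k v. k < \<nu> \<Longrightarrow> q \<bullet> (mpow A k *v (B *v v)) = 0" and T\<nu>: "T - 1 < real \<nu>"
  shows "reach_set S B T \<noteq> domA A"
proof
  assume eqR: "reach_set S B T = domA A"
  \<comment> \<open>The jump must lie in the last history window (T - 1, T) and before \<nu>. The
    midpoint does, because T - 1 < \<nu>.\<close>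
  define t0 where "t0 = (T - 1 + min T (real \<nu>)) / 2"
  have t0: "T - 1 < t0" "t0 < min T (real \<nu>)" using T\<nu> unfolding t0_def by (auto simp: min_def field_simps)
  define \<theta>0 where "\<theta>0 = t0 - T"
  have th0: "-1 < \<theta>0" "\<theta>0 < 0" using t0 by (auto simp: \<theta>0_def)
  \<comment> \<open>A ready-made element of the domain: the state at time 1 of the trajectory with
    derivative \<open>q\<close> from time 1 + \<theta>0 on, so that its history has the kink at
    \<theta>0.\<close>
  define g where "g s = indicat_real {1 + \<theta>0..1} s *\<^sub>R q" for s :: real
  have lg: "l2f g" unfolding g_def by (rule l2f_indicator_const)
  have g0: "g t = 0" if "t < 0" for t using that th0 by (simp add: g_def)
  have zg: "primitive g (1 + \<theta>) = max 0 (\<theta> - \<theta>0) *\<^sub>R q" if "\<theta> \<le> 0" for \<theta>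
  proof -
    have "primitive g (1 + \<theta>) = (LINT s|lborel. indicat_real {1 + \<theta>0..1 + \<theta>} s *\<^sub>R q)"
      unfolding primitive_def g_def by (rule Bochner_Integration.integral_cong) (use that th0 in \<open>auto simp: indicator_def\<close>)
    also have "\<dots> = (LINT s|lborel. indicat_real {1 + \<theta>0..1 + \<theta>} s) *\<^sub>R q"
      by (rule integral_scaleR_left) (auto simp: integrable_indicator_iff emeasure_lborel_Icc_eq)
    also have "(LINT s|lborel. indicat_real {1 + \<theta>0..1 + \<theta>} s) = max 0 (\<theta> - \<theta>0)"
      by (auto simp: measure_def emeasure_lborel_Icc_eq max_def)
    finally show ?thesis .
  qed
  have "state_of A g 1 \<in> reach_set S B T" unfolding eqR by (rule state_of_domA[OF lg g0])
  then obtain u f where u: "L2on {0..T} u" and f: "l2f f" "\<And>t. t \<notin> {0..T} \<Longrightarrow> f t = 0"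
    and neutral_op: "AE s in lborel. s \<in> {0..T} \<longrightarrow> neutral_op T f s = B *v u (T - s)" and e: "class_of (state_of A g 1) = class_of (state_of A f T)"
    unfolding reach_iff[OF T] by blast
  have f0: "\<And>t. t < 0 \<Longrightarrow> f t = 0" using f(2) by simp
  have li: "locally_integrable f" by (rule locally_integrable_l2f[OF f(1) f0])
  have zfc: "continuous_on UNIV (primitive f)" by (rule primitive_continuous[OF f(1) f0])
  \<comment> \<open>For t < 0 the argument T - t lies beyond the control interval, and the input is
    set to 0.\<close>
  define b where "b t = B *v (if t < 0 then 0 else u (T - t))" for t
  have cneg: "convol (delay_kernel_on T) f t = 0" if "t < 0" for t
    unfolding convol_def by (rule integral_eq_zero_AE) (use that f0 in \<open>auto simp: delay_kernel_on_def indicator_def\<close>)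
  have exp: "AE t in lborel. t < real \<nu> \<and> t \<le> T \<longrightarrow> f t = (\<Sum>k<\<nu>. mpow A k *v (convol (delay_kernel_on T) f (t - real k) + b (t - real k)))"
  proof (rule solution_expansion)
    show "AE t in lborel. t \<in> {0..T} \<longrightarrow> f t = A *v f (t - 1) + convol (delay_kernel_on T) f t + b t"
      using neutral_op by eventually_elim (auto simp: neutral_op_def b_def algebra_simps)
  qed (auto simp: f0 cneg b_def)
  \<comment> \<open>Applying \<open>q\<close> to the expansion removes all control terms; the
    surviving convolutions are continuous in t.\<close>
  define \<phi> where "\<phi> t = (\<Sum>k<\<nu>. q \<bullet> (mpow A k *v convol (delay_kernel_on T) f (t - real k)))" for t
  have \<phi>c: "continuous_on UNIV \<phi>"
    unfolding \<phi>_def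
    by (intro continuous_intros mv.continuous_on continuous_on_compose2[OF convol_continuous[OF l2f_delay_kernel_on f(1)]]) auto
  have ae: "AE t in lborel. t < real \<nu> \<and> t \<le> T \<longrightarrow> q \<bullet> f t = \<phi> t"
    using exp
  proof eventually_elim
    case (elim t)
    have "q \<bullet> (mpow A k *v (convol (delay_kernel_on T) f (t - real k) + b (t - real k))) = q \<bullet> (mpow A k *v convol (delay_kernel_on T) f (t - real k))" if "k < \<nu>" for k
      using q(2)[OF that] by (simp add: mv.add_right inner_add_right b_def)
    then show ?case using elim by (auto simp: inner_sum_right \<phi>_def)
  qed
  have "AE \<theta> in lborel. \<theta> \<in> {-1..0} \<longrightarrow> primitive g (1 + \<theta>) = primitive f (T + \<theta>)"
    using iffD1[OF class_of_eq_iff[OF state_of_M2[OF lg g0] state_of_M2[OF f(1) f0]] e] by (simp add: m2_equiv_def state_of_def)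
  then have aez: "AE \<theta> in lborel. \<theta> \<in> {-1<..<0} \<longrightarrow> primitive f (T + \<theta>) = max 0 (\<theta> - \<theta>0) *\<^sub>R q"
    by eventually_elim (use zg in auto)
  \<comment> \<open>Both sides are continuous, so the set where they differ is open; being null, it
    is empty.\<close>
  have zf: "primitive f (T + \<theta>) = max 0 (\<theta> - \<theta>0) *\<^sub>R q" if th: "\<theta> \<in> {-1<..<0}" for \<theta>
  proof (rule ccontr)
    assume ne: "primitive f (T + \<theta>) \<noteq> max 0 (\<theta> - \<theta>0) *\<^sub>R q"
    have o: "open ({-1<..<0} \<inter> {\<theta>. primitive f (T + \<theta>) - max 0 (\<theta> - \<theta>0) *\<^sub>R q \<noteq> 0})"
      by (intro open_Int open_greaterThanLessThan open_Collect_neq continuous_intros continuous_on_compose2[OF zfc]) auto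
    have "{-1<..<0} \<inter> {\<theta>. primitive f (T + \<theta>) - max 0 (\<theta> - \<theta>0) *\<^sub>R q \<noteq> 0} = {}"
    proof (rule ccontr)
      let ?U = "{-1<..<0} \<inter> {\<theta>. primitive f (T + \<theta>) - max 0 (\<theta> - \<theta>0) *\<^sub>R q \<noteq> 0}"
      assume ne: "?U \<noteq> {}"
      have "AE \<theta> in lborel. \<theta> \<notin> ?U" using aez by eventually_elim auto
      moreover have "?U \<in> sets lborel" using borel_open[OF o] by simp
      ultimately have "?U \<in> null_sets lborel" by (simp only: AE_iff_null_sets)
      then have "negligible ?U" by (simp add: negligible_iff_null_sets null_sets_completionI)
      then show False using open_not_negligible[OF o ne] by blast
    qed
    then show False using ne th by auto
  qed
  \<comment> \<open>A window around t0 inside (T - 1, T) and below \<nu>, where both the expansion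
    and the prescribed history are available.\<close>
  define a' b' where "a' = (T - 1 + t0) / 2" and "b' = (t0 + min T (real \<nu>)) / 2"
  have ab: "T - 1 < a'" "a' < t0" "t0 < b'" "b' < T" "b' < real \<nu>" using t0 by (auto simp: a'_def b'_def)
  have zq: "q \<bullet> primitive f t = max 0 (t - t0) * (q \<bullet> q)" if "t \<in> {a'..b'}" for t
    using zf[of "t - T"] that ab by (simp add: \<theta>0_def)
  have int: "q \<bullet> primitive f t - q \<bullet> primitive f a' = integral {a'..t} \<phi>" if t: "t \<in> {a'..b'}" for t
  proof -
    have i: "integrable lborel (\<lambda>s. indicat_real {a'..t} s *\<^sub>R f s)" using li by (simp add: locally_integrable_def)
    have c\<phi>: "continuous_on {a'..t} \<phi>" by (rule continuous_on_subset[OF \<phi>c]) simp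
    have "q \<bullet> primitive f t - q \<bullet> primitive f a' = q \<bullet> (LINT s|lborel. indicator {a'..t} s *\<^sub>R f s)"
      using primitive_split[OF li, of a' t] t by (simp add: inner_add_right)
    also have "\<dots> = (LINT s|lborel. q \<bullet> (indicat_real {a'..t} s *\<^sub>R f s))"
      by (rule integral_inner_right[symmetric]) (use i in simp)
    also have "\<dots> = (LINT s|lborel. indicat_real {a'..t} s *\<^sub>R \<phi> s)"
    proof (rule integral_cong_AE)
      show "AE s in lborel. q \<bullet> (indicat_real {a'..t} s *\<^sub>R f s) = indicat_real {a'..t} s *\<^sub>R \<phi> s"
        using ae by eventually_elim (use t ab in \<open>auto simp: indicator_def\<close>)
      show "(\<lambda>s. q \<bullet> (indicat_real {a'..t} s *\<^sub>R f s)) \<in> borel_measurable lborel"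
        using l2f_meas[OF f(1)] by measurable
      show "(\<lambda>s. indicat_real {a'..t} s *\<^sub>R \<phi> s) \<in> borel_measurable lborel"
        using borel_measurable_continuous_on_indicator[OF _ c\<phi>] by simp
    qed
    also have "\<dots> = integral {a'..t} \<phi>"
      using set_borel_integral_eq_integral(2)[OF borel_integrable_atLeastAtMost'[OF c\<phi>]]
      by (simp add: set_lebesgue_integral_def)
    finally show ?thesis .
  qed
  have "((\<lambda>t. integral {a'..t} \<phi>) has_vector_derivative \<phi> t0) (at t0 within {a'..b'})"
    by (rule integral_has_vector_derivative[OF continuous_on_subset[OF \<phi>c]]) (use ab in auto)
  then have lim: "((\<lambda>t. (1 / (t - t0)) *\<^sub>R (integral {a'..t} \<phi> - integral {a'..t0} \<phi>)) \<longlongrightarrow> \<phi> t0) (at t0 within {a'..b'})"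
    by (simp add: has_vector_derivative_quotient)
  have qq: "(1 / (t - t0)) *\<^sub>R (integral {a'..t} \<phi> - integral {a'..t0} \<phi>) = (if t > t0 then q \<bullet> q else 0)"
    if "t \<in> {a'..b'}" "t \<noteq> t0" for t
  proof -
    have "integral {a'..t} \<phi> - integral {a'..t0} \<phi> = max 0 (t - t0) * (q \<bullet> q)"
      using int[of t] int[of t0] zq[of t] zq[of t0] that ab by simp
    then show ?thesis using that by (simp add: max_def)
  qed
  \<comment> \<open>The difference quotient of the kinked function is a step function, whose
    one-sided limits \<open>q \<bullet> q\<close> and 0 would both have to equal
    \<open>\<phi> t0\<close>.\<close>
  have "((\<lambda>t. if t > t0 then q \<bullet> q else 0) \<longlongrightarrow> \<phi> t0) (at t0 within {a'..b'})"
    by (rule Lim_transform_eventually[OF lim], unfold eventually_at_filter, rule always_eventually) (use qq in blast)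
  then have "((\<lambda>t. if t > t0 then q \<bullet> q else 0) \<longlongrightarrow> \<phi> t0) (at_right t0)" "((\<lambda>t. if t > t0 then q \<bullet> q else 0) \<longlongrightarrow> \<phi> t0) (at_left t0)"
    using ab at_within_Icc_at[of a' t0 b'] by (auto simp: filterlim_at_split)
  moreover have "((\<lambda>t. if t > t0 then q \<bullet> q else 0) \<longlongrightarrow> q \<bullet> q) (at_right t0)"
    by (rule tendsto_eventually) (simp add: eventually_at_filter)
  moreover have "((\<lambda>t. if t > t0 then q \<bullet> q else 0) \<longlongrightarrow> 0) (at_left t0)"
    by (rule tendsto_eventually) (simp add: eventually_at_filter)
  ultimately have "\<phi> t0 = q \<bullet> q" "\<phi> t0 = 0"
    using tendsto_unique[of "at_right t0"] tendsto_unique[of "at_left t0"] by (metis trivial_limit_at_right_real trivial_limit_at_left_real)+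
  then show False using q(1) by simp
qed

text \<open>The interval \<open>{0..T}\<close> is empty for T < 0, so reachable states pair to zero
  with everything, while the domain contains nonzero states.\<close>

lemma unreachable_neg:
  fixes B :: "complex^'r::finite^'n"
  assumes T: "T < 0" shows "reach_set S B T \<noteq> domA A"
proof
  assume eqR: "reach_set S B T = domA A"
  define q :: "complex^'n" where "q = axis undefined 1"
  have q: "q \<noteq> 0" by (simp add: q_def)
  define g where "g s = indicat_real {1/2..1} s *\<^sub>R q" for s :: real
  have lg: "l2f g" unfolding g_def by (rule l2f_indicator_const)
  have g0: "g t = 0" if "t < 0" for t using that by (simp add: g_def)
  \<comment> \<open>At time 3/4 the delayed term is still 0 and the trajectory has reached a quarter
    of \<open>q\<close>.\<close>
  let ?x = "state_of A g (1/2 + 1/4)"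
  have x: "?x \<in> M2" by (rule state_of_M2[OF lg g0])
  have "?x \<in> reach_set S B T" unfolding eqR by (rule state_of_domA[OF lg g0])
  then have "m2_inner ?x w = 0" if "w \<in> M2" for w
    using that T by (auto simp: reach_set_def set_lebesgue_integral_def)
  then have "Re (m2_inner ?x ?x) = 0" using x by simp
  then have "inner (class_of ?x) (class_of ?x) = 0" unfolding m2_inner_class_of[OF x x] by (simp only: complex.sel)
  then have "class_of ?x = 0" by (simp only: inner_eq_zero_iff)
  then have "fst (class_of ?x) = 0" by simp
  then have "primitive g (3/4) - A *v primitive g (-1/4) = 0" by (simp add: class_of_def state_of_def)
  then have "primitive g (3/4) = 0" by (simp add: primitive_neg)
  moreover have "primitive g (3/4) = (1/4) *\<^sub>R q"
  proof -
    have "primitive g (3/4) = (LINT s|lborel. indicat_real {1/2..3/4::real} s *\<^sub>R q)"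
      unfolding primitive_def g_def by (rule Bochner_Integration.integral_cong) (auto simp: indicator_def)
    also have "\<dots> = (LINT s|lborel. indicat_real {1/2..3/4::real} s) *\<^sub>R q"
      by (rule integral_scaleR_left) (auto simp: integrable_indicator_iff emeasure_lborel_Icc_eq)
    finally show ?thesis by simp
  qed
  ultimately show False using q by simp
qed

end

section \<open>Steering the difference equation\<close>

text \<open>Extension of an algebraic basis: \<open>R\<close> need not be closed, and the functional
  obtained carries no continuity. For the functional of interest this is recovered in
  \<open>annihilator_bounded\<close>.\<close>

lemma separating_functional:
  fixes R :: "'a::real_vector set"
  assumes R: "subspace R" and z: "z \<notin> R"
  shows "\<exists>w :: 'a \<Rightarrow> real. linear w \<and> (\<forall>x\<in>R. w x = 0) \<and> w z = 1"
proof -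
  obtain Q where Q: "Q \<subseteq> R" "independent Q" "R \<subseteq> span Q" using maximal_independent_subset[of R] by blast
  have sQ: "span Q = R" using Q R by (metis span_minimal subset_antisym)
  have zQ: "z \<notin> span Q" using z sQ by simp
  then have "independent (insert z Q)" using Q(2) by (simp add: independent_insertI)
  from linear_independent_extend[OF this, of "\<lambda>x. if x = z then 1 else 0"] obtain w :: "'a \<Rightarrow> real"
    where w: "linear w" "\<forall>x\<in>insert z Q. w x = (if x = z then 1 else 0)" by (elim exE conjE)
  have "z \<notin> Q" using zQ span_base by blast
  then have "\<And>x. x \<in> Q \<Longrightarrow> w x = 0" using w(2) by auto
  then have "\<forall>x\<in>R. w x = 0" using linear_eq_0_on_span[OF w(1)] sQ by blast
  then show ?thesis using w by auto
qed

lemma finite_dim_riesz: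
  fixes L :: "'a::euclidean_space \<Rightarrow> real"
  assumes "linear L" shows "\<exists>a. \<forall>x. L x = inner a x"
proof (intro exI allI)
  fix x
  have "L x = L (\<Sum>b\<in>Basis. (x \<bullet> b) *\<^sub>R b)" by (simp add: euclidean_representation)
  also have "\<dots> = (\<Sum>b\<in>Basis. (x \<bullet> b) * L b)" by (simp add: linear_sum[OF assms] linear_cmul[OF assms])
  also have "\<dots> = inner (\<Sum>b\<in>Basis. L b *\<^sub>R b) x" by (simp add: inner_sum_left inner_commute[of x] mult.commute)
  finally show "L x = inner (\<Sum>b\<in>Basis. L b *\<^sub>R b) x" .
qed

section \<open>Bounded operations on pairs of functions\<close>

lemma l2f_sum: "(\<And>i. i \<in> F \<Longrightarrow> l2f (f i)) \<Longrightarrow> l2f (\<lambda>t. \<Sum>i\<in>F. f i t)"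
  by (induction F rule: infinite_finite_induct) (auto intro: l2f_zero l2f_add)

lemma l2_class_sum: "(\<And>i. i \<in> F \<Longrightarrow> l2f (f i)) \<Longrightarrow> l2_class (\<lambda>t. \<Sum>i\<in>F. f i t) = (\<Sum>i\<in>F. l2_class (f i))"
  by (induction F rule: infinite_finite_induct) (auto simp: zero_l2_l2_class l2_class_add[symmetric] l2f_sum)

text \<open>Stated at the level of functions so that boundedness of the steering formulas can be
  read off term by term, by closure under sums, shifts, cuts and matrices.\<close>

definition bounded_l2 :: "((real \<Rightarrow> 'a::euclidean_space) \<Rightarrow> (real \<Rightarrow> 'b::euclidean_space) \<Rightarrow> (real \<Rightarrow> 'c::euclidean_space)) \<Rightarrow> bool" where
  "bounded_l2 F \<longleftrightarrow> (\<exists>C\<ge>0. \<forall>h g. l2f h \<longrightarrow> l2f g \<longrightarrow> l2f (F h g) \<and> norm (l2_class (F h g)) \<le> C * (norm (l2_class h) + norm (l2_class g)))"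

lemma bounded_l2_fst: "bounded_l2 (\<lambda>h g. h)" unfolding bounded_l2_def by (rule exI[of _ 1]) auto
lemma bounded_l2_snd: "bounded_l2 (\<lambda>h g. g)" unfolding bounded_l2_def by (rule exI[of _ 1]) auto

lemma bounded_l2_zero: "bounded_l2 (\<lambda>h g t. 0)"
  unfolding bounded_l2_def by (rule exI[of _ 0]) (auto simp: l2f_zero zero_l2_l2_class[symmetric])

lemma bounded_l2_add:
  assumes "bounded_l2 F" "bounded_l2 F'" shows "bounded_l2 (\<lambda>h g t. F h g t + F' h g t)"
proof -
  obtain C where C: "C \<ge> 0" "\<And>h g. l2f h \<Longrightarrow> l2f g \<Longrightarrow> l2f (F h g) \<and> norm (l2_class (F h g)) \<le> C * (norm (l2_class h) + norm (l2_class g))"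
    using assms(1) unfolding bounded_l2_def by blast
  obtain C' where C': "C' \<ge> 0" "\<And>h g. l2f h \<Longrightarrow> l2f g \<Longrightarrow> l2f (F' h g) \<and> norm (l2_class (F' h g)) \<le> C' * (norm (l2_class h) + norm (l2_class g))"
    using assms(2) unfolding bounded_l2_def by blast
  have "l2f (\<lambda>t. F h g t + F' h g t) \<and> norm (l2_class (\<lambda>t. F h g t + F' h g t)) \<le> (C + C') * (norm (l2_class h) + norm (l2_class g))"
    if "l2f h" "l2f g" for h g
    using C(2)[OF that] C'(2)[OF that] norm_triangle_ineq[of "l2_class (F h g)" "l2_class (F' h g)"]
    by (auto simp: l2f_add l2_class_add algebra_simps)
  then show ?thesis unfolding bounded_l2_def using C(1) C'(1) by (intro exI[of _ "C + C'"]) auto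
qed

lemma bounded_l2_blin:
  assumes "bounded_l2 F" and L: "bounded_linear L" shows "bounded_l2 (\<lambda>h g t. L (F h g t))"
proof -
  obtain C where C: "C \<ge> 0" "\<And>h g. l2f h \<Longrightarrow> l2f g \<Longrightarrow> l2f (F h g) \<and> norm (l2_class (F h g)) \<le> C * (norm (l2_class h) + norm (l2_class g))"
    using assms(1) unfolding bounded_l2_def by blast
  obtain K where K: "K > 0" "\<And>x. norm (L x) \<le> norm x * K" using bounded_linear.pos_bounded[OF L] by blast
  have "l2f (\<lambda>t. L (F h g t)) \<and> norm (l2_class (\<lambda>t. L (F h g t))) \<le> (K * C) * (norm (l2_class h) + norm (l2_class g))"
    if "l2f h" "l2f g" for h g
  proof
    have l: "l2f (F h g)" using C(2)[OF that] by simp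
    show ll: "l2f (\<lambda>t. L (F h g t))" by (rule l2f_blin[OF l L])
    have "norm (l2_class (\<lambda>t. L (F h g t))) \<le> norm (l2_class (\<lambda>t. K *\<^sub>R F h g t))"
      by (rule norm_l2_class_le[OF ll l2f_scaleR[OF l]]) (use K in \<open>auto simp: mult.commute\<close>)
    also have "\<dots> = K * norm (l2_class (F h g))" using l2_class_scaleR[OF l, of K] K(1) by (metis norm_scaleR abs_of_pos)
    also have "\<dots> \<le> K * (C * (norm (l2_class h) + norm (l2_class g)))" using C(2)[OF that] K(1) by (intro mult_left_mono) auto
    finally show "norm (l2_class (\<lambda>t. L (F h g t))) \<le> (K * C) * (norm (l2_class h) + norm (l2_class g))" by simp
  qed
  then show ?thesis unfolding bounded_l2_def using C(1) K(1) by (intro exI[of _ "K * C"]) auto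
qed

lemma bounded_l2_diff: "bounded_l2 F \<Longrightarrow> bounded_l2 F' \<Longrightarrow> bounded_l2 (\<lambda>h g t. F h g t - F' h g t)"
  using bounded_l2_add[OF _ bounded_l2_blin[OF _ bounded_linear_minus[OF bounded_linear_ident]]] by fastforce

lemma bounded_l2_sum: "finite I \<Longrightarrow> (\<And>i. i \<in> I \<Longrightarrow> bounded_l2 (F i)) \<Longrightarrow> bounded_l2 (\<lambda>h g t. \<Sum>i\<in>I. F i h g t)"
  by (induction I rule: finite_induct) (auto intro: bounded_l2_zero bounded_l2_add)

lemma bounded_l2_shift:
  assumes "bounded_l2 F" shows "bounded_l2 (\<lambda>h g t. F h g (t - a))"
proof -
  obtain C where C: "C \<ge> 0" "\<And>h g. l2f h \<Longrightarrow> l2f g \<Longrightarrow> l2f (F h g) \<and> norm (l2_class (F h g)) \<le> C * (norm (l2_class h) + norm (l2_class g))"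
    using assms(1) unfolding bounded_l2_def by blast
  have "l2f (\<lambda>t. F h g (t - a)) \<and> norm (l2_class (\<lambda>t. F h g (t - a))) \<le> C * (norm (l2_class h) + norm (l2_class g))"
    if "l2f h" "l2f g" for h g
    using C(2)[OF that] shift_l2_l2_class[of "F h g" a] norm_shift_l2[of a "l2_class (F h g)"] by (auto simp: l2f_shift')
  then show ?thesis unfolding bounded_l2_def using C(1) by blast
qed

lemma bounded_l2_cut:
  assumes "bounded_l2 F" "S \<in> sets borel" shows "bounded_l2 (\<lambda>h g t. indicator S t *\<^sub>R F h g t)"
proof -
  obtain C where C: "C \<ge> 0" "\<And>h g. l2f h \<Longrightarrow> l2f g \<Longrightarrow> l2f (F h g) \<and> norm (l2_class (F h g)) \<le> C * (norm (l2_class h) + norm (l2_class g))"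
    using assms(1) unfolding bounded_l2_def by blast
  have "l2f (\<lambda>t. indicator S t *\<^sub>R F h g t) \<and> norm (l2_class (\<lambda>t. indicator S t *\<^sub>R F h g t)) \<le> C * (norm (l2_class h) + norm (l2_class g))"
    if "l2f h" "l2f g" for h g
  proof -
    have l: "l2f (F h g)" using C(2)[OF that] by simp
    then show ?thesis using C(2)[OF that] restrict_l2_l2_class[OF l assms(2)] norm_restrict_l2_le[OF assms(2), of "l2_class (F h g)"]
      by (auto intro: l2f_cmul_indicator assms(2))
  qed
  then show ?thesis unfolding bounded_l2_def using C(1) by blast
qed

text \<open>The matrices \<open>G j\<close> form a right inverse of the Krylov map, and T > \<nu>
  leaves room for \<nu> unit steps inside [0, T].\<close>

locale controlled_neutral = neutral A2 A3 A S for A2 A3 :: "real \<Rightarrow> complex^'n::finite^'n" and A S +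
  fixes B :: "complex^'r::finite^'n" and \<nu> :: nat and G :: "nat \<Rightarrow> complex^'n^'r" and T :: real
  assumes GI: "\<And>x. (\<Sum>j<\<nu>. mpow A j *v (B *v (G j *v x))) = x"
    and T\<nu>: "T > real \<nu>" and \<nu>: "\<nu> \<ge> 1"
begin

text \<open>Enough unit steps to carry every time up to \<open>T\<close> below 0, so that sums over
  \<open>steps\<close> terms are complete Neumann series of the delay.\<close>

definition steps :: nat where "steps = nat \<lceil>T\<rceil> + 1"
lemma steps: "real steps > T" "steps \<ge> \<nu>"
proof -
  show "real steps > T" unfolding steps_def using real_nat_ceiling_ge[of T] by simp
  then show "steps \<ge> \<nu>" using T\<nu> by linarith
qed
lemma T1: "T > 1" using T\<nu> \<nu> by linarith

text \<open>A right inverse of \<open>x \<mapsto> (x(t) - A x(t - 1) - B u(t), x on (T - 1, T])\<close>. With zero control the recursion with input \<open>h\<close> misses the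
tail \<open>g\<close> by \<open>tail_defect\<close>; the matrices \<open>G j\<close> split this defect into control impulses applied \<open>j\<close> time units earlier, which is
possible on \<open>[0, T]\<close> because \<open>T > \<nu>\<close>.\<close>

definition tail_defect where "tail_defect h g t = indicator {T - 1<..T} t *\<^sub>R (g t - (\<Sum>k<steps. mpow A k *v h (t - real k)))"
definition steer_control where "steer_control h g t = (\<Sum>j<\<nu>. G j *v tail_defect h g (t - (- real j)))"
definition steer_input where "steer_input h g t = B *v steer_control h g t + h t"
definition steered_free where "steered_free h g t = (\<Sum>k<steps. mpow A k *v steer_input h g (t - real k))"
definition steered where "steered h g t = indicator {0..T} t *\<^sub>R steered_free h g t"

lemma bounded_l2_tail_defect: "bounded_l2 tail_defect"
  unfolding tail_defect_def[abs_def] by (intro bounded_l2_cut bounded_l2_diff bounded_l2_snd bounded_l2_sum bounded_l2_blin[OF _ blin_mv] bounded_l2_shift bounded_l2_fst) auto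
lemma bounded_l2_steer_control: "bounded_l2 steer_control"
  unfolding steer_control_def[abs_def] by (intro bounded_l2_sum bounded_l2_blin[OF _ blin_mv] bounded_l2_shift bounded_l2_tail_defect) auto
lemma bounded_l2_steer_input: "bounded_l2 steer_input"
  unfolding steer_input_def[abs_def] by (intro bounded_l2_add bounded_l2_blin[OF _ blin_mv] bounded_l2_steer_control bounded_l2_fst)
lemma bounded_l2_steered: "bounded_l2 steered"
  unfolding steered_def[abs_def] steered_free_def[abs_def] by (intro bounded_l2_cut bounded_l2_sum bounded_l2_blin[OF _ blin_mv] bounded_l2_shift bounded_l2_steer_input) auto

text \<open>A control impulse advanced by j \<le> \<nu> - 1 units acts on (T - 1 - j, T - j], which
  lies in positive times because T > \<nu>.\<close>

lemma steer_input_neg: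
  assumes "\<And>t. t < 0 \<Longrightarrow> h t = 0" "t < 0" shows "steer_input h g t = 0"
proof -
  have "tail_defect h g (t + real j) = 0" if "j < \<nu>" for j
  proof -
    have "real j \<le> real \<nu> - 1" using that by linarith
    then have "t + real j \<le> T - 1" using assms(2) T\<nu> by linarith
    then show ?thesis by (simp add: tail_defect_def)
  qed
  then show ?thesis using assms by (simp add: steer_input_def steer_control_def)
qed

text \<open>Telescoping of the sum over unit steps; the leftover term at \<open>steps\<close>
  vanishes since its argument is negative.\<close>

lemma steered_eq:
  assumes h: "\<And>t. t < 0 \<Longrightarrow> h t = 0" and t: "t \<in> {0..T}"
  shows "steered h g t - A *v steered h g (t - 1) = B *v steer_control h g t + h t"
proof -
  have X0: "steered_free h g s = 0" if "s < 0" for s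
    unfolding steered_free_def by (rule sum.neutral) (use that steer_input_neg[OF h] in auto)
  have x1: "steered h g (t - 1) = steered_free h g (t - 1)" using t X0[of "t - 1"] by (cases "t - 1 < 0") (auto simp: steered_def)
  have "A *v steered_free h g (t - 1) = (\<Sum>k<steps. mpow A (Suc k) *v steer_input h g (t - real (Suc k)))"
    unfolding steered_free_def mv.sum_right mpow_Suc_mv by (simp add: algebra_simps)
  moreover have "steered_free h g t + mpow A steps *v steer_input h g (t - real steps) = steer_input h g t + (\<Sum>k<steps. mpow A (Suc k) *v steer_input h g (t - real (Suc k)))"
    using sum.lessThan_Suc_shift[of "\<lambda>k. mpow A k *v steer_input h g (t - real k)" steps] by (simp add: steered_free_def mpow_0)
  moreover have "steer_input h g (t - real steps) = 0" by (rule steer_input_neg[OF h]) (use t steps(1) in auto)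
  ultimately have "steered_free h g t - A *v steered_free h g (t - 1) = steer_input h g t" by simp
  then show ?thesis unfolding x1 using t by (simp add: steered_def steer_input_def)
qed

lemma steered_tail:
  assumes t: "t \<in> {T - 1<..T}" shows "steered h g t = g t"
proof -
  \<comment> \<open>The half-open window (T - 1, T] has disjoint integer translates, so impulse j
    meets the expansion only in the term k = j.\<close>
  have dis: "tail_defect h g (t - real k + real j) = (if k = j then tail_defect h g t else 0)" for k j
  proof (cases "k = j")
    case False
    then have "k + 1 \<le> j \<or> j + 1 \<le> k" by linarith
    then have "real k + 1 \<le> real j \<or> real j + 1 \<le> real k" by linarith
    then have "t - real k + real j \<notin> {T - 1<..T}" using t by auto
    then show ?thesis using False by (simp add: tail_defect_def)
  qed simp
  have "(\<Sum>k<steps. mpow A k *v (B *v steer_control h g (t - real k))) = (\<Sum>k<steps. if k < \<nu> then mpow A k *v (B *v (G k *v tail_defect h g t)) else 0)"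
  proof (rule sum.cong[OF refl])
    fix k
    have "steer_control h g (t - real k) = (\<Sum>j<\<nu>. if j = k then G j *v tail_defect h g t else 0)"
      unfolding steer_control_def by (rule sum.cong) (auto simp: dis)
    also have "\<dots> = (if k < \<nu> then G k *v tail_defect h g t else 0)" by (simp add: sum.delta)
    finally show "mpow A k *v (B *v steer_control h g (t - real k)) = (if k < \<nu> then mpow A k *v (B *v (G k *v tail_defect h g t)) else 0)" by simp
  qed
  also have "\<dots> = (\<Sum>k\<in>{..<steps} \<inter> {k. k < \<nu>}. mpow A k *v (B *v (G k *v tail_defect h g t)))" by (simp add: sum.inter_restrict)
  also have "{..<steps} \<inter> {k. k < \<nu>} = {..<\<nu>}" using steps(2) by auto
  also have "(\<Sum>k<\<nu>. mpow A k *v (B *v (G k *v tail_defect h g t))) = tail_defect h g t" by (rule GI)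
  finally have "steered_free h g t = tail_defect h g t + (\<Sum>k<steps. mpow A k *v h (t - real k))"
    unfolding steered_free_def steer_input_def mv.add_right sum.distrib by simp
  then show ?thesis using t T1 by (simp add: steered_def tail_defect_def)
qed

lemma steered_supp: "t \<notin> {0..T} \<Longrightarrow> steered h g t = 0" by (simp add: steered_def)

lemma steered_diff: "steered (\<lambda>t. h t - h' t) (\<lambda>t. g t - g' t) t = steered h g t - steered h' g' t"
  by (simp add: steered_def steered_free_def steer_input_def steer_control_def tail_defect_def mv.diff_right mv.add_right sum_subtractf sum.distrib scaleR_diff_right algebra_simps)

lemma steered_l2f: "l2f h \<Longrightarrow> l2f g \<Longrightarrow> l2f (steered h g)"
  using bounded_l2_steered unfolding bounded_l2_def by blast

lemma steer_control_l2f: "l2f h \<Longrightarrow> l2f g \<Longrightarrow> l2f (steer_control h g)"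
  using bounded_l2_steer_control unfolding bounded_l2_def by blast

text \<open>The first component is the defect of the controlled equation; the other two are the data
  z(T - 1) and z' on [T - 1, T] of the final state. Reaching a state means that its data together
  with zero defect lie in this set.\<close>

definition defect_range :: "((complex^'n) l2 \<times> (complex^'n) \<times> (complex^'n) l2) set" where
  "defect_range = {(l2_class (\<lambda>t. indicator {0..T} t *\<^sub>R (neutral_op T x t - B *v u t)), primitive x (T - 1), restrict_l2 {T - 1..T} (l2_class x)) | x u.
     l2f x \<and> l2f u \<and> (\<forall>t. t \<notin> {0..T} \<longrightarrow> x t = 0)}"

lemma neutral_op_add: "l2f f \<Longrightarrow> l2f g \<Longrightarrow> neutral_op T (\<lambda>t. f t + g t) t = neutral_op T f t + neutral_op T g t"
  by (simp add: neutral_op_def convol_add l2f_delay_kernel_on mv.add_right)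
lemma neutral_op_scaleR: "neutral_op T (\<lambda>t. c *\<^sub>R f t) t = c *\<^sub>R neutral_op T f t"
  by (simp add: neutral_op_def convol_scaleR mv.scaleR_right scaleR_diff_right)
lemma primitive_add: "locally_integrable f \<Longrightarrow> locally_integrable g \<Longrightarrow> primitive (\<lambda>t. f t + g t) t = primitive f t + primitive g t"
  unfolding primitive_def locally_integrable_def by (simp add: scaleR_add_right)
lemma primitive_scaleR: "primitive (\<lambda>t. c *\<^sub>R f t) t = c *\<^sub>R primitive f t"
  unfolding primitive_def by (simp add: mult.commute flip: integral_scaleR_right)

lemma Efu_l2f: "l2f x \<Longrightarrow> l2f u \<Longrightarrow> l2f (\<lambda>t. indicator {0..T} t *\<^sub>R (neutral_op T x t - B *v u t))"
  unfolding scaleR_diff_right by (intro l2f_diff neutral_op_l2f l2f_cmul_indicator l2f_blin[OF _ blin_mv]) auto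

lemma subspace_defect_range: "subspace defect_range"
proof (rule subspaceI)
  interpret restrict_l2: bounded_linear "restrict_l2 {T - 1..T} :: (complex^'n) l2 \<Rightarrow> _" by (rule bounded_linear_restrict_l2) simp
  have e0: "neutral_op T (\<lambda>t. 0) t = 0" "primitive (\<lambda>t. 0 :: complex^'n) t = 0" for t by (simp_all add: neutral_op_def convol_def primitive_def)
  show "0 \<in> defect_range"
    unfolding defect_range_def
    by (rule CollectI, rule exI[of _ "\<lambda>t. 0"], rule exI[of _ "\<lambda>t. 0"])
       (simp add: l2f_zero e0 zero_prod_def zero_l2_l2_class[symmetric] restrict_l2.zero)
  fix p q assume p: "p \<in> defect_range" and q: "q \<in> defect_range"
  obtain x u where x: "l2f x" "l2f u" "\<And>t. t \<notin> {0..T} \<Longrightarrow> x t = 0" and pe: "p = (l2_class (\<lambda>t. indicator {0..T} t *\<^sub>R (neutral_op T x t - B *v u t)), primitive x (T - 1), restrict_l2 {T - 1..T} (l2_class x))"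
    using p unfolding defect_range_def by blast
  obtain y v where y: "l2f y" "l2f v" "\<And>t. t \<notin> {0..T} \<Longrightarrow> y t = 0" and qe: "q = (l2_class (\<lambda>t. indicator {0..T} t *\<^sub>R (neutral_op T y t - B *v v t)), primitive y (T - 1), restrict_l2 {T - 1..T} (l2_class y))"
    using q unfolding defect_range_def by blast
  have li: "locally_integrable x" "locally_integrable y" by (auto intro!: locally_integrable_l2f x y)
  have "p + q = (l2_class (\<lambda>t. indicator {0..T} t *\<^sub>R (neutral_op T (\<lambda>t. x t + y t) t - B *v (u t + v t))), primitive (\<lambda>t. x t + y t) (T - 1), restrict_l2 {T - 1..T} (l2_class (\<lambda>t. x t + y t)))"
    unfolding pe qe
    by (simp add: neutral_op_add x y primitive_add li l2_class_add[symmetric] restrict_l2.add)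
       (subst l2_class_add[OF Efu_l2f[OF x(1,2)] Efu_l2f[OF y(1,2)]], simp add: algebra_simps mv.add_right)
  then show "p + q \<in> defect_range"
    unfolding defect_range_def using x y by (intro CollectI exI[of _ "\<lambda>t. x t + y t"] exI[of _ "\<lambda>t. u t + v t"]) (auto intro: l2f_add)
  fix c :: real
  have "c *\<^sub>R p = (l2_class (\<lambda>t. indicator {0..T} t *\<^sub>R (neutral_op T (\<lambda>t. c *\<^sub>R x t) t - B *v (c *\<^sub>R u t))), primitive (\<lambda>t. c *\<^sub>R x t) (T - 1), restrict_l2 {T - 1..T} (l2_class (\<lambda>t. c *\<^sub>R x t)))"
    unfolding pe
    by (simp add: neutral_op_scaleR x primitive_scaleR l2_class_scaleR[symmetric] restrict_l2.scaleR)
       (subst l2_class_scaleR[OF Efu_l2f[OF x(1,2)]], simp add: scaleR_diff_right mv.scaleR_right mult.commute)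
  then show "c *\<^sub>R p \<in> defect_range"
    unfolding defect_range_def using x by (intro CollectI exI[of _ "\<lambda>t. c *\<^sub>R x t"] exI[of _ "\<lambda>t. c *\<^sub>R u t"]) (auto intro: l2f_scaleR)
qed

end

section \<open>Annihilators of the defect map\<close>

lemma finite_dim_bounded:
  fixes L :: "'a::euclidean_space \<Rightarrow> real"
  assumes "linear L" shows "\<exists>C\<ge>0. \<forall>x. \<bar>L x\<bar> \<le> C * norm x"
proof -
  obtain a where a: "\<And>x. L x = inner a x" using finite_dim_riesz[OF assms] by blast
  show ?thesis by (rule exI[of _ "norm a"]) (simp add: a Cauchy_Schwarz_ineq2)
qed

text \<open>With a polynomial kernel the powers of t - s split by the binomial theorem, and the
  convolution sees its argument only through these moments; hence it has finite rank.\<close>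

definition moment :: "real \<Rightarrow> nat \<Rightarrow> (real \<Rightarrow> 'a::euclidean_space) \<Rightarrow> 'a" where
  "moment T e x = (LINT s|lborel. (indicator {0..T} s * (- s) ^ e) *\<^sub>R x s)"

lemma l2f_weight: "l2f (\<lambda>s. indicat_real {0..T} s * (- s) ^ e)"
proof -
  have "continuous_on UNIV (\<lambda>s::real. (- s) ^ e)" by (intro continuous_intros)
  from l2f_continuous_interval[OF this, of 0 T] show ?thesis by simp
qed

lemma moment_integrable: "l2f x \<Longrightarrow> integrable lborel (\<lambda>s. (indicat_real {0..T} s * (- s) ^ e) *\<^sub>R x s)"
  by (rule l2f_bilinear_integrable[OF l2f_weight, where b=scaleR]) (auto simp: l2f_def)

lemma moment_bound: "l2f x \<Longrightarrow> norm (moment T e x) \<le> norm (l2_class (\<lambda>s. indicat_real {0..T} s * (- s) ^ e)) * norm (l2_class x)"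
proof -
  assume x: "l2f x"
  have "norm (moment T e x) \<le> (LINT s|lborel. norm (indicat_real {0..T} s * (- s) ^ e) * norm (x s))"
    unfolding moment_def using integral_norm_bound[of lborel "\<lambda>s. (indicat_real {0..T} s * (- s) ^ e) *\<^sub>R x s"] by simp
  also have "\<dots> \<le> norm (l2_class (\<lambda>s. indicat_real {0..T} s * (- s) ^ e)) * norm (l2_class x)"
    by (rule l2_Cauchy_Schwarz[OF l2f_weight x])
  finally show ?thesis .
qed

lemma convol_poly:
  fixes c :: "nat \<Rightarrow> complex^'n^'m"
  assumes x: "l2f x" and sx: "\<And>t. t \<notin> {0..T} \<Longrightarrow> x t = 0" and t: "t \<in> {0..T}"
  shows "convol (\<lambda>s. indicator {-T..T} s *\<^sub>R (\<Sum>i\<le>n. s ^ i *\<^sub>R c i)) x t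
    = (\<Sum>i\<le>n. \<Sum>l\<le>i. (real (i choose l) * t ^ l) *\<^sub>R (c i *v moment T (i - l) x))"
proof -
  have "convol (\<lambda>s. indicator {-T..T} s *\<^sub>R (\<Sum>i\<le>n. s ^ i *\<^sub>R c i)) x t
    = (LINT s|lborel. (\<Sum>i\<le>n. \<Sum>l\<le>i. (real (i choose l) * t ^ l) *\<^sub>R (c i *v ((indicat_real {0..T} s * (- s) ^ (i - l)) *\<^sub>R x s))))"
    unfolding convol_def
  proof (rule Bochner_Integration.integral_cong[OF refl])
    fix s
    show "(indicat_real {-T..T} (t - s) *\<^sub>R (\<Sum>i\<le>n. (t - s) ^ i *\<^sub>R c i)) *v x s
       = (\<Sum>i\<le>n. \<Sum>l\<le>i. (real (i choose l) * t ^ l) *\<^sub>R (c i *v ((indicat_real {0..T} s * (- s) ^ (i - l)) *\<^sub>R x s)))"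
    proof (cases "s \<in> {0..T}")
      case True
      then have "t - s \<in> {-T..T}" using t by auto
      moreover have "(t - s) ^ i *\<^sub>R (c i *v x s) = (\<Sum>l\<le>i. (real (i choose l) * t ^ l * (- s) ^ (i - l)) *\<^sub>R (c i *v x s))" for i
        using binomial_ring[of t "- s" i] by (simp add: scaleR_sum_left[symmetric])
      ultimately show ?thesis using True by (simp add: mv.sum_left mv.scaleR_left mv.scaleR_right mult.assoc)
    qed (simp add: sx)
  qed
  also have "\<dots> = (\<Sum>i\<le>n. \<Sum>l\<le>i. (real (i choose l) * t ^ l) *\<^sub>R (c i *v moment T (i - l) x))"
  proof -
    have i: "integrable lborel (\<lambda>s. c i *v ((indicat_real {0..T} s * (- s) ^ (i - l)) *\<^sub>R x s))" for i l
      by (rule integrable_bounded_linear[OF blin_mv moment_integrable[OF x]])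
    have e: "(LINT s|lborel. c i *v ((indicat_real {0..T} s * (- s) ^ (i - l)) *\<^sub>R x s)) = c i *v moment T (i - l) x" for i l
      unfolding moment_def by (rule integral_bounded_linear[OF blin_mv moment_integrable[OF x]])
    have i1: "integrable lborel (\<lambda>s. (real (i choose l) * t ^ l) *\<^sub>R (c i *v ((indicat_real {0..T} s * (- s) ^ (i - l)) *\<^sub>R x s)))" for i l
      by (rule integrable_scaleR_right) (rule i)
    show ?thesis
      by (subst Bochner_Integration.integral_sum, intro Bochner_Integration.integrable_sum i1)
         (rule sum.cong[OF refl], subst Bochner_Integration.integral_sum, rule i1, simp add: e)
  qed
  finally show ?thesis .
qed

context controlled_neutral
begin

text \<open>A polynomial kernel yields a finite rank operator, and on a finite dimensional space any linear functional is bounded.\<close>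

lemma functional_split_bounded:
  fixes w :: "(complex^'n) l2 \<times> (complex^'n) \<times> (complex^'n) l2 \<Rightarrow> real"
  assumes w: "linear w"
  shows "\<exists>C\<ge>0. \<forall>x. l2f x \<longrightarrow> (\<forall>t. t \<notin> {0..T} \<longrightarrow> x t = 0) \<longrightarrow>
    \<bar>w (l2_class (\<lambda>t. indicator {0..T} t *\<^sub>R convol (\<lambda>s. indicator {-T..T} s *\<^sub>R (\<Sum>i\<le>n. s ^ i *\<^sub>R c i)) x t), 0, 0) - w (0, primitive x (T - 1), 0)\<bar> \<le> C * norm (l2_class x)"
proof -
  let ?I = "indicat_real {0..T}"
  define P where "P i l t v = ?I t *\<^sub>R ((real (i choose l) * t ^ l) *\<^sub>R (v :: complex^'n))" for i l t v
  have lP: "l2f (\<lambda>t. P i l t v)" for i l v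
    unfolding P_def by (intro l2f_continuous_interval continuous_intros)
  define L where "L i l v = w (l2_class (\<lambda>t. P i l t v), 0, 0)" for i l v
  have L: "linear (L i l)" for i l
  proof (rule linearI)
    fix v v' :: "complex^'n" and r :: real
    have "(l2_class (\<lambda>t. P i l t (v + v')), 0, 0) = (l2_class (\<lambda>t. P i l t v), 0, 0) + (l2_class (\<lambda>t. P i l t v'), 0 :: complex^'n, 0 :: (complex^'n) l2)"
      by (simp add: l2_class_add lP) (simp add: P_def scaleR_add_right)
    then show "L i l (v + v') = L i l v + L i l v'" unfolding L_def using linear_add[OF w] by metis
    have "(l2_class (\<lambda>t. P i l t (r *\<^sub>R v)), 0, 0) = r *\<^sub>R (l2_class (\<lambda>t. P i l t v), 0 :: complex^'n, 0 :: (complex^'n) l2)"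
      by (simp add: l2_class_scaleR lP) (simp add: P_def mult_ac)
    then show "L i l (r *\<^sub>R v) = r *\<^sub>R L i l v" unfolding L_def using linear_cmul[OF w] by metis
  qed
  then have "\<exists>C\<ge>0. \<forall>v. \<bar>L i l v\<bar> \<le> C * norm v" for i l by (rule finite_dim_bounded)
  then obtain CL where CL: "\<And>i l. CL i l \<ge> 0" "\<And>i l v. \<bar>L i l v\<bar> \<le> CL i l * norm v" by metis
  have L2: "linear (\<lambda>v. w (0, v, 0))"
  proof (rule linearI)
    fix v v' :: "complex^'n" and r :: real
    show "w (0, v + v', 0) = w (0, v, 0) + w (0, v', 0)" using linear_add[OF w, of "(0, v, 0)" "(0, v', 0)"] by simp
    show "w (0, r *\<^sub>R v, 0) = r *\<^sub>R w (0, v, 0)" using linear_cmul[OF w, of r "(0, v, 0)"] by simp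
  qed
  obtain C2 where C2: "C2 \<ge> 0" "\<And>v. \<bar>w (0, v, 0)\<bar> \<le> C2 * norm v" using finite_dim_bounded[OF L2] by blast
  define D where "D i l = CL i l * (norm (c i) * norm (l2_class (\<lambda>s. indicat_real {0..T} s * (- s) ^ (i - l))))" for i l
  have D: "D i l \<ge> 0" for i l unfolding D_def using CL(1) by simp
  have "\<bar>w (l2_class (\<lambda>t. ?I t *\<^sub>R convol (\<lambda>s. indicator {-T..T} s *\<^sub>R (\<Sum>i\<le>n. s ^ i *\<^sub>R c i)) x t), 0, 0) - w (0, primitive x (T - 1), 0)\<bar>
      \<le> ((\<Sum>i\<le>n. \<Sum>l\<le>i. D i l) + C2 * sqrt T) * norm (l2_class x)"
    if x: "l2f x" and sx: "\<And>t. t \<notin> {0..T} \<Longrightarrow> x t = 0" for x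
  proof -
    define v where "v i l = c i *v moment T (i - l) x" for i l
    have "(\<lambda>t. ?I t *\<^sub>R convol (\<lambda>s. indicator {-T..T} s *\<^sub>R (\<Sum>i\<le>n. s ^ i *\<^sub>R c i)) x t) = (\<lambda>t. \<Sum>i\<le>n. \<Sum>l\<le>i. P i l t (v i l))"
    proof
      fix t
      show "?I t *\<^sub>R convol (\<lambda>s. indicator {-T..T} s *\<^sub>R (\<Sum>i\<le>n. s ^ i *\<^sub>R c i)) x t = (\<Sum>i\<le>n. \<Sum>l\<le>i. P i l t (v i l))"
      proof (cases "t \<in> {0..T}")
        case True
        have e: "convol (\<lambda>s. indicator {-T..T} s *\<^sub>R (\<Sum>i\<le>n. s ^ i *\<^sub>R c i)) x t = (\<Sum>i\<le>n. \<Sum>l\<le>i. (real (i choose l) * t ^ l) *\<^sub>R (c i *v moment T (i - l) x))"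
          by (rule convol_poly[OF x sx True])
        show ?thesis unfolding e using True by (simp add: P_def v_def)
      qed (simp add: P_def)
    qed
    then have "w (l2_class (\<lambda>t. ?I t *\<^sub>R convol (\<lambda>s. indicator {-T..T} s *\<^sub>R (\<Sum>i\<le>n. s ^ i *\<^sub>R c i)) x t), 0, 0)
       = w (\<Sum>i\<le>n. \<Sum>l\<le>i. (l2_class (\<lambda>t. P i l t (v i l)), 0, 0))"
      by (intro arg_cong[where f=w]) (simp add: l2_class_sum lP l2f_sum prod_eq_iff fst_sum snd_sum)
    also have "\<dots> = (\<Sum>i\<le>n. \<Sum>l\<le>i. L i l (v i l))"
      by (simp add: linear_sum[OF w] L_def)
    finally have e: "w (l2_class (\<lambda>t. ?I t *\<^sub>R convol (\<lambda>s. indicator {-T..T} s *\<^sub>R (\<Sum>i\<le>n. s ^ i *\<^sub>R c i)) x t), 0, 0) = (\<Sum>i\<le>n. \<Sum>l\<le>i. L i l (v i l))" .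
    have "\<bar>L i l (v i l)\<bar> \<le> D i l * norm (l2_class x)" for i l
    proof -
      have "norm (v i l) \<le> norm (c i) * (norm (l2_class (\<lambda>s. indicat_real {0..T} s * (- s) ^ (i - l))) * norm (l2_class x))"
        unfolding v_def by (rule order_trans[OF norm_mv_le mult_left_mono[OF moment_bound[OF x]]]) simp
      then have "CL i l * norm (v i l) \<le> D i l * norm (l2_class x)"
        unfolding D_def using mult_left_mono[OF _ CL(1)[of i l]] by (simp add: mult.assoc)
      then show ?thesis using CL(2)[of i l "v i l"] by linarith
    qed
    then have "\<bar>\<Sum>i\<le>n. \<Sum>l\<le>i. L i l (v i l)\<bar> \<le> (\<Sum>i\<le>n. \<Sum>l\<le>i. D i l * norm (l2_class x))"
      by (intro order_trans[OF sum_abs] sum_mono) auto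
    also have "\<dots> = (\<Sum>i\<le>n. \<Sum>l\<le>i. D i l) * norm (l2_class x)" by (simp add: sum_distrib_right)
    finally have 1: "\<bar>\<Sum>i\<le>n. \<Sum>l\<le>i. L i l (v i l)\<bar> \<le> (\<Sum>i\<le>n. \<Sum>l\<le>i. D i l) * norm (l2_class x)" .
    have "\<bar>w (0, primitive x (T - 1), 0)\<bar> \<le> C2 * (sqrt T * norm (l2_class x))"
      using C2(2)[of "primitive x (T - 1)"] mult_left_mono[OF primitive_bound[OF x, of "T - 1" T] C2(1)] T1 by simp
    then show ?thesis using 1 abs_triangle_ineq4[of "\<Sum>i\<le>n. \<Sum>l\<le>i. L i l (v i l)" "w (0, primitive x (T - 1), 0)"]
      unfolding e by (simp add: algebra_simps)
  qed
  moreover have "(\<Sum>i\<le>n. \<Sum>l\<le>i. D i l) + C2 * sqrt T \<ge> 0" using D C2(1) T1 by (intro add_nonneg_nonneg sum_nonneg) auto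
  ultimately show ?thesis by blast
qed

text \<open>The kernel is a polynomial plus a small remainder. For a steered trajectory
  \<open>x\<close>, annihilation becomes \<open>key\<close>: w(h, 0, g) equals w of the small part
  \<open>K' x\<close> plus a bounded term. As \<open>w\<close> is not yet known to be bounded,
  smallness cannot be used inside \<open>w\<close>. Instead \<open>h\<close> is chosen as the fixed
  point h = y + K' x; then the unknown terms cancel and w(y, 0, 0) is the bounded term.\<close>

lemma annihilator_bounded:
  fixes w :: "(complex^'n) l2 \<times> (complex^'n) \<times> (complex^'n) l2 \<Rightarrow> real"
  assumes w: "linear w" and w0: "\<And>p. p \<in> defect_range \<Longrightarrow> w p = 0"
  shows "\<exists>C. \<forall>y. \<bar>w (restrict_l2 {0..T} y, 0, 0)\<bar> \<le> C * norm y" "\<exists>C. \<forall>y. \<bar>w (0, 0, restrict_l2 {T - 1..T} y)\<bar> \<le> C * norm y"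
proof -
  let ?I = "indicat_real {0..T}"
  obtain Cx where Cx: "Cx \<ge> 0" "\<And>h g. l2f h \<Longrightarrow> l2f g \<Longrightarrow> norm (l2_class (steered h g)) \<le> Cx * (norm (l2_class h) + norm (l2_class g))"
    using bounded_l2_steered unfolding bounded_l2_def by blast
  \<comment> \<open>Chosen so that steering followed by the remainder operator has norm at most
    1/2.\<close>
  define \<epsilon> where "\<epsilon> = 1 / (2 * sqrt T * (Cx + 1))"
  have \<epsilon>: "\<epsilon> > 0" unfolding \<epsilon>_def using T1 Cx(1) by simp
  obtain n c where nc: "norm (restrict_l2 {-T..T} (l2_class (delay_kernel_on T)) - l2_class (\<lambda>t. indicator {-T..T} t *\<^sub>R (\<Sum>i\<le>n. t ^ i *\<^sub>R c i))) < \<epsilon>"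
    using l2_poly_approx[OF \<epsilon>, of "-T" T "l2_class (delay_kernel_on T)"] T1 by auto
  define p where "p s = indicator {-T..T} s *\<^sub>R (\<Sum>i\<le>n. s ^ i *\<^sub>R c i)" for s :: real
  have lp: "l2f p" unfolding p_def by (rule l2f_continuous_interval[OF continuous_poly_sum])
  define k' where "k' s = delay_kernel_on T s - p s" for s
  have lk': "l2f k'" unfolding k'_def by (rule l2f_diff[OF l2f_delay_kernel_on lp])
  have k'\<epsilon>: "norm (l2_class k') \<le> \<epsilon>"
  proof -
    have "(\<lambda>t. indicat_real {-T..T} t *\<^sub>R delay_kernel_on T t) = delay_kernel_on T" using T1 by (auto simp: delay_kernel_on_def indicator_def)
    then have "restrict_l2 {-T..T} (l2_class (delay_kernel_on T)) = l2_class (delay_kernel_on T)" by (simp add: restrict_l2_l2_class[OF l2f_delay_kernel_on])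
    then show ?thesis using nc unfolding k'_def p_def[abs_def, symmetric] by (simp add: l2_class_diff[OF l2f_delay_kernel_on lp])
  qed
  define K' where "K' x = l2_class (\<lambda>t. ?I t *\<^sub>R convol k' x t)" for x
  have lI: "l2f (\<lambda>t. ?I t *\<^sub>R convol k x t)" if "l2f k" "l2f x" for k and x :: "real \<Rightarrow> complex^'n"
    by (rule l2f_continuous_interval[OF convol_continuous[OF that]])
  have K'b: "norm (K' x) \<le> \<epsilon> * sqrt T * norm (l2_class x)" if x: "l2f x" for x
  proof -
    have "norm (K' x) \<le> norm (l2_class k') * norm (l2_class x) * sqrt (T - 0)"
      unfolding K'_def by (rule norm_l2_class_indicator_bound[OF convol_meas[OF lk' x] convol_bound[OF lk' x]]) (use T1 in auto)
    also have "\<dots> \<le> \<epsilon> * norm (l2_class x) * sqrt (T - 0)" using k'\<epsilon> T1 by (intro mult_right_mono) auto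
    finally show ?thesis by (simp add: mult_ac)
  qed
  define b where "b x = w (l2_class (\<lambda>t. ?I t *\<^sub>R convol p x t), 0, 0) - w (0, primitive x (T - 1), 0)" for x
  obtain Cb where Cb: "Cb \<ge> 0" "\<And>x. l2f x \<Longrightarrow> (\<And>t. t \<notin> {0..T} \<Longrightarrow> x t = 0) \<Longrightarrow> \<bar>b x\<bar> \<le> Cb * norm (l2_class x)"
    using functional_split_bounded[OF w, of c n] unfolding b_def p_def[abs_def, symmetric] by blast
  have key: "w (l2_class h, 0, restrict_l2 {T - 1..T} (l2_class g)) = w (K' (steered h g), 0, 0) + b (steered h g)"
    if h: "l2f h" and g: "l2f g" and shift_l2: "\<And>t. t \<notin> {0..T} \<Longrightarrow> h t = 0" for h g
  proof -
    define x where "x = steered h g"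
    have x: "l2f x" unfolding x_def by (rule steered_l2f[OF h g])
    have sx: "\<And>t. t \<notin> {0..T} \<Longrightarrow> x t = 0" unfolding x_def by (rule steered_supp)
    have u: "l2f (steer_control h g)" by (rule steer_control_l2f[OF h g])
    have h0: "\<And>t. t < 0 \<Longrightarrow> h t = 0" using shift_l2 by simp
    have e1: "?I t *\<^sub>R (neutral_op T x t - B *v steer_control h g t) = h t - ?I t *\<^sub>R convol (delay_kernel_on T) x t" for t
      by (cases "t \<in> {0..T}") (use steered_eq[where h=h and g=g and t=t, OF h0] shift_l2 in \<open>auto simp: neutral_op_def x_def algebra_simps\<close>)
    have e2: "restrict_l2 {T - 1..T} (l2_class x) = restrict_l2 {T - 1..T} (l2_class g)"
    proof -
      have "AE t in lborel. indicat_real {T - 1..T} t *\<^sub>R x t = indicat_real {T - 1..T} t *\<^sub>R g t"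
        using AE_lborel_singleton[of "T - 1"]
      proof eventually_elim
        case (elim t)
        show ?case using steered_tail[where t=t and h=h and g=g] elim by (auto simp: x_def indicator_def)
      qed
      then show ?thesis using x g by (simp add: restrict_l2_l2_class l2_class_eq_iff l2f_cmul_indicator)
    qed
    have lc: "l2f (\<lambda>t. ?I t *\<^sub>R convol (delay_kernel_on T) x t)" by (rule lI[OF l2f_delay_kernel_on x])
    have "(l2_class (\<lambda>t. h t - ?I t *\<^sub>R convol (delay_kernel_on T) x t), primitive x (T - 1), restrict_l2 {T - 1..T} (l2_class g)) \<in> defect_range"
      unfolding defect_range_def
      by (rule CollectI, rule exI[of _ x], rule exI[of _ "steer_control h g"]) (use x u sx in \<open>auto simp: e1 e2\<close>)
    from w0[OF this] have z: "w (l2_class h - l2_class (\<lambda>t. ?I t *\<^sub>R convol (delay_kernel_on T) x t), primitive x (T - 1), restrict_l2 {T - 1..T} (l2_class g)) = 0"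
      by (simp add: l2_class_diff[OF h lc])
    have ck': "convol k' x t = convol (delay_kernel_on T) x t - convol p x t" for t
      unfolding k'_def[abs_def] by (rule convol_diff_left[OF l2f_delay_kernel_on lp x])
    have "l2_class (\<lambda>t. ?I t *\<^sub>R convol (delay_kernel_on T) x t) = K' x + l2_class (\<lambda>t. ?I t *\<^sub>R convol p x t)"
      unfolding K'_def l2_class_add[OF lI[OF lk' x] lI[OF lp x]]
      by (simp add: ck' scaleR_add_right[symmetric])
    then have "(l2_class h, 0, restrict_l2 {T - 1..T} (l2_class g)) = (l2_class h - l2_class (\<lambda>t. ?I t *\<^sub>R convol (delay_kernel_on T) x t), primitive x (T - 1), restrict_l2 {T - 1..T} (l2_class g))
       + (K' x, 0, 0) + (l2_class (\<lambda>t. ?I t *\<^sub>R convol p x t), 0, 0) - (0, primitive x (T - 1), 0)"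
      by simp
    then have "w (l2_class h, 0, restrict_l2 {T - 1..T} (l2_class g)) = w (l2_class h - l2_class (\<lambda>t. ?I t *\<^sub>R convol (delay_kernel_on T) x t), primitive x (T - 1), restrict_l2 {T - 1..T} (l2_class g))
       + w (K' x, 0, 0) + w (l2_class (\<lambda>t. ?I t *\<^sub>R convol p x t), 0, 0) - w (0, primitive x (T - 1), 0)"
      by (simp only: linear_add[OF w] linear_diff[OF w])
    then show ?thesis using z by (simp add: b_def x_def)
  qed
  have ct0: "restrict_l2 S (0 :: (complex^'n) l2) = 0" if "S \<in> sets borel" for S :: "real set"
    using linear_0[OF bounded_linear.linear[OF bounded_linear_restrict_l2[OF that]]] .
  have II: "(\<lambda>t. ?I t *\<^sub>R ?I t *\<^sub>R y t) = (\<lambda>t. ?I t *\<^sub>R y t)" for y :: "real \<Rightarrow> complex^'n" by (auto simp: indicator_def)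
  have A: "\<bar>w (restrict_l2 {0..T} y, 0, 0)\<bar> \<le> (Cb * Cx * 2) * norm y" for y
  proof -
    define hh where "hh x t = ?I t *\<^sub>R l2_rep x t" for x :: "(complex^'n) l2" and t
    have lhh: "l2f (hh x)" for x unfolding hh_def by (intro l2f_cmul_indicator) auto
    have nhh: "norm (l2_class (hh x)) \<le> norm x" for x unfolding hh_def using norm_restrict_l2_le[of "{0..T}" x] by (simp add: restrict_l2_def)
    \<comment> \<open>The contraction whose fixed point absorbs the small term; the prescribed tail
      is 0 here.\<close>
    define \<Gamma> where "\<Gamma> x = restrict_l2 {0..T} y + K' (steered (hh x) (\<lambda>t. 0))" for x
    have lin: "norm (K' (steered (hh x) (\<lambda>t. 0)) - K' (steered (hh x') (\<lambda>t. 0))) \<le> 1/2 * norm (x - x')" for x x'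
    proof -
      let ?d = "\<lambda>t. hh x t - hh x' t"
      have ld: "l2f ?d" by (intro l2f_diff lhh)
      have xd: "l2f (steered ?d (\<lambda>t. 0))" by (rule steered_l2f[OF ld l2f_zero])
      have "steered ?d (\<lambda>t. 0) = (\<lambda>t. steered (hh x) (\<lambda>t. 0) t - steered (hh x') (\<lambda>t. 0) t)"
        using steered_diff[of "hh x" "hh x'" "\<lambda>t. 0" "\<lambda>t. 0"] by (auto simp: fun_eq_iff)
      then have "K' (steered (hh x) (\<lambda>t. 0)) - K' (steered (hh x') (\<lambda>t. 0)) = K' (steered ?d (\<lambda>t. 0))"
        unfolding K'_def
        by (simp add: l2_class_diff lI lk' steered_l2f lhh l2f_zero convol_diff scaleR_diff_right)
      also have "norm \<dots> \<le> \<epsilon> * sqrt T * (Cx * (norm (l2_class ?d) + norm (l2_class (\<lambda>t. 0 :: complex^'n))))"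
        by (rule order_trans[OF K'b[OF xd] mult_left_mono[OF Cx(2)[OF ld l2f_zero]]]) (use \<epsilon> T1 in auto)
      also have "\<dots> = (\<epsilon> * sqrt T * Cx) * norm (l2_class ?d)" by (simp add: zero_l2_l2_class[symmetric])
      also have "\<dots> \<le> 1/2 * norm (l2_class ?d)"
      proof (rule mult_right_mono)
        have "\<epsilon> * sqrt T * Cx = Cx / (2 * (Cx + 1))" unfolding \<epsilon>_def using T1 by simp
        also have "\<dots> \<le> 1/2" using Cx(1) by (simp add: field_simps)
        finally show "\<epsilon> * sqrt T * Cx \<le> 1/2" .
      qed simp
      also have "l2_class ?d = restrict_l2 {0..T} (x - x')"
      proof -
        interpret restrict_l2: bounded_linear "restrict_l2 {0..T} :: (complex^'n) l2 \<Rightarrow> _" by (rule bounded_linear_restrict_l2) simp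
        show ?thesis unfolding restrict_l2.diff l2_class_diff[OF lhh lhh, symmetric] by (simp add: restrict_l2_def hh_def[abs_def])
      qed
      also have "1/2 * norm (restrict_l2 {0..T} (x - x')) \<le> 1/2 * norm (x - x')" using norm_restrict_l2_le[of "{0..T}" "x - x'"] by simp
      finally show ?thesis .
    qed
    have "\<exists>!x. \<Gamma> x = x"
      by (rule banach_fix_type[of "1/2"]) (auto simp: \<Gamma>_def dist_norm intro: lin[simplified])
    then obtain h where h: "\<Gamma> h = h" by blast
    define x where "x = steered (hh h) (\<lambda>t. 0)"
    have lx: "l2f x" unfolding x_def by (rule steered_l2f[OF lhh l2f_zero])
    have h': "h = restrict_l2 {0..T} y + K' x" using h by (simp add: \<Gamma>_def x_def)
    have cy: "restrict_l2 {0..T} y = l2_class (\<lambda>t. ?I t *\<^sub>R l2_rep y t)" by (simp add: restrict_l2_def)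
    have hM: "h = l2_class (\<lambda>t. ?I t *\<^sub>R (l2_rep y t + convol k' x t))"
      unfolding h' cy K'_def scaleR_add_right by (rule l2_class_add) (auto intro!: l2f_cmul_indicator lI lk' lx)
    have lhM: "l2f (\<lambda>t. ?I t *\<^sub>R (l2_rep y t + convol k' x t))"
      unfolding scaleR_add_right by (intro l2f_add l2f_cmul_indicator l2f_l2_rep lI lk' lx) simp
    have hhh: "l2_class (hh h) = h"
    proof -
      have "l2_class (hh h) = restrict_l2 {0..T} h" by (simp add: hh_def[abs_def] restrict_l2_def)
      also have "\<dots> = h" unfolding hM restrict_l2_l2_class[OF lhM borel_closed[OF closed_atLeastAtMost]] II ..
      finally show ?thesis .
    qed
    have n1: "norm (K' x) \<le> 1/2 * norm h"
    proof -
      have z: "K' (steered (hh 0) (\<lambda>t. 0)) = 0"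
      proof -
        have "norm (l2_class (hh 0)) \<le> 0" using nhh[of 0] by simp
        then have "l2_class (steered (hh 0) (\<lambda>t. 0)) = 0"
          using Cx(2)[OF lhh[of 0] l2f_zero] by (simp add: zero_l2_l2_class[symmetric])
        then show ?thesis using K'b[OF steered_l2f[OF lhh[of 0] l2f_zero]] by simp
      qed
      show ?thesis using lin[of h 0] by (simp add: z x_def)
    qed
    have nh: "norm h \<le> 2 * norm y"
      using n1 norm_triangle_ineq[of "restrict_l2 {0..T} y" "K' x"] norm_restrict_l2_le[of "{0..T}" y] h' by simp
    have "w (h, 0, 0) = w (K' x, 0, 0) + b x"
      using key[OF lhh[of h] l2f_zero] unfolding x_def[symmetric] hhh zero_l2_l2_class[symmetric] by (simp add: ct0 hh_def)
    moreover have "w (h, 0, 0) = w (restrict_l2 {0..T} y, 0, 0) + w (K' x, 0, 0)"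
      using linear_add[OF w, of "(restrict_l2 {0..T} y, 0, 0)" "(K' x, 0, 0)"] h' by simp
    ultimately have "w (restrict_l2 {0..T} y, 0, 0) = b x" by simp
    also have "\<bar>b x\<bar> \<le> Cb * norm (l2_class x)" by (rule Cb(2)[OF lx]) (simp add: x_def steered_supp)
    also have "\<dots> \<le> Cb * (Cx * norm h)"
      using Cx(2)[OF lhh[of h] l2f_zero] Cb(1) unfolding hhh x_def[symmetric]
      by (intro mult_left_mono) (auto simp: zero_l2_l2_class[symmetric])
    also have "\<dots> \<le> Cb * (Cx * (2 * norm y))" using nh Cb(1) Cx(1) by (intro mult_left_mono) auto
    finally show ?thesis by (simp add: mult_ac)
  qed
  then show "\<exists>C. \<forall>y. \<bar>w (restrict_l2 {0..T} y, 0, 0)\<bar> \<le> C * norm y" by blast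
  \<comment> \<open>Here h = 0, and the remaining term w(K' x, 0, 0) is controlled by the bound just
    proved.\<close>
  have "\<bar>w (0, 0, restrict_l2 {T - 1..T} y)\<bar> \<le> ((Cb * Cx * 2) * (\<epsilon> * sqrt T * Cx) + Cb * Cx) * norm y" for y
  proof -
    define x where "x = steered (\<lambda>t. 0) (l2_rep y)"
    have lx: "l2f x" unfolding x_def by (intro steered_l2f l2f_zero l2f_l2_rep)
    have nx: "norm (l2_class x) \<le> Cx * norm y"
      using Cx(2)[OF l2f_zero l2f_l2_rep[of y]] by (simp add: x_def zero_l2_l2_class[symmetric])
    have e: "w (0, 0, restrict_l2 {T - 1..T} y) = w (K' x, 0, 0) + b x"
      using key[OF l2f_zero l2f_l2_rep[of y]] unfolding x_def[symmetric] zero_l2_l2_class[symmetric] by simp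
    have cK: "restrict_l2 {0..T} (K' x) = K' x"
      unfolding K'_def restrict_l2_l2_class[OF lI[OF lk' lx] borel_closed[OF closed_atLeastAtMost]] II ..
    have "\<bar>w (K' x, 0, 0)\<bar> \<le> (Cb * Cx * 2) * norm (K' x)" using A[of "K' x"] unfolding cK .
    also have "\<dots> \<le> (Cb * Cx * 2) * (\<epsilon> * sqrt T * (Cx * norm y))"
    proof (rule mult_left_mono)
      have "\<epsilon> * sqrt T * norm (l2_class x) \<le> \<epsilon> * sqrt T * (Cx * norm y)" using nx \<epsilon> T1 by (intro mult_left_mono) auto
      then show "norm (K' x) \<le> \<epsilon> * sqrt T * (Cx * norm y)" using K'b[OF lx] by linarith
    qed (use Cb(1) Cx(1) in simp)
    finally have 1: "\<bar>w (K' x, 0, 0)\<bar> \<le> (Cb * Cx * 2) * (\<epsilon> * sqrt T * (Cx * norm y))" .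
    have "\<bar>b x\<bar> \<le> Cb * norm (l2_class x)" by (rule Cb(2)[OF lx]) (simp add: x_def steered_supp)
    also have "\<dots> \<le> Cb * (Cx * norm y)" using nx Cb(1) by (rule mult_left_mono)
    finally show ?thesis using 1 unfolding e by (simp add: algebra_simps)
  qed
  then show "\<exists>C. \<forall>y. \<bar>w (0, 0, restrict_l2 {T - 1..T} y)\<bar> \<le> C * norm y" by blast
qed

end

section \<open>Conjugation, transposes and testing by orthogonality\<close>

definition conj_vec :: "complex^'n \<Rightarrow> complex^'n" where "conj_vec v = (\<chi> i. cnj (v $ i))"

lemma conj_vec_conj_vec[simp]: "conj_vec (conj_vec v) = v" by (simp add: conj_vec_def vec_eq_iff)
lemma conj_vec_add: "conj_vec (v + w) = conj_vec v + conj_vec w" by (simp add: conj_vec_def vec_eq_iff)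
lemma conj_vec_eq_0[simp]: "conj_vec v = 0 \<longleftrightarrow> v = 0" by (simp add: conj_vec_def vec_eq_iff)
lemma norm_conj_vec: "norm (conj_vec v) = norm v" by (simp add: conj_vec_def norm_vec_def)
lemma blin_conj_vec: "bounded_linear conj_vec"
  by (rule bounded_linear_intro[where K=1]) (auto simp: norm_conj_vec conj_vec_add, auto simp: conj_vec_def vec_eq_iff)
text \<open>Real inner products produce conjugate transposes. Conjugating the vector turns them into
  plain transposes, as required to meet \<Delta>(\<lambda>) with \<lambda> unconjugated.\<close>

lemma conj_vec_ctranspose: "conj_vec (ctranspose M *v v) = transpose M *v conj_vec v"
  by (simp add: conj_vec_def ctranspose_def transpose_def matrix_vector_mult_def vec_eq_iff)
lemma norm_transpose: "norm (transpose M) = norm (M :: complex^'n^'m)"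
proof -
  have "(norm (transpose M))\<^sup>2 = (norm M)\<^sup>2"
    by (simp add: power2_norm_eq_inner inner_vec_def transpose_def) (subst sum.swap, rule refl)
  then show ?thesis by simp
qed
lemma blin_transpose: "bounded_linear (transpose :: complex^'n^'m \<Rightarrow> _)"
  by (rule bounded_linear_intro[where K=1]) (auto simp: norm_transpose, auto simp: transpose_def vec_eq_iff)

lemma AE_zero_of_orthogonal:
  assumes y: "l2f y" and S: "S \<in> sets borel"
    and orth: "\<And>x. l2f x \<Longrightarrow> (\<And>t. t \<notin> S \<Longrightarrow> x t = 0) \<Longrightarrow> (LINT t|lborel. y t \<bullet> x t) = 0"
  shows "AE t in lborel. t \<in> S \<longrightarrow> y t = 0"
proof -
  define x where "x t = indicat_real S t *\<^sub>R y t" for t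
  have x: "l2f x" unfolding x_def by (rule l2f_cmul_indicator[OF y S])
  have "(LINT t|lborel. y t \<bullet> x t) = 0" by (rule orth[OF x]) (simp add: x_def)
  moreover have "(\<lambda>t. y t \<bullet> x t) = (\<lambda>t. x t \<bullet> x t)" by (auto simp: x_def indicator_def)
  ultimately have "(LINT t|lborel. x t \<bullet> x t) = 0" by simp
  then have "AE t in lborel. x t \<bullet> x t = 0"
    by (subst (asm) integral_nonneg_eq_0_iff_AE[OF l2f_inner_integrable[OF x x]]) auto
  then show ?thesis by eventually_elim (auto simp: x_def indicator_def)
qed

context controlled_neutral
begin

text \<open>The components of the annihilator are probed separately. Varying \<open>u\<close> alone
  gives the condition on \<open>B\<close>. Varying \<open>x\<close> inside [0, T - 1], where the
  tail component is blind, gives the adjoint equation, with the multiplier \<open>a0\<close> of z(T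
  - 1) as its constant. Reflection t \<mapsto> T - t turns this advanced equation into a delay
  equation.\<close>

lemma dual_function:
  assumes ns: "\<not> (\<exists>x u. l2f x \<and> l2f u \<and> (\<forall>t. t \<notin> {0..T} \<longrightarrow> x t = 0) \<and> (AE t in lborel. t \<in> {0..T} \<longrightarrow> neutral_op T x t = B *v u t)
      \<and> primitive x (T - 1) = c \<and> (AE t in lborel. t \<in> {T - 1..T} \<longrightarrow> x t = l2_rep g t))"
  shows "\<exists>r a. l2f r \<and> (\<forall>t. t \<notin> {0..T} \<longrightarrow> r t = 0) \<and> \<not> (AE t in lborel. r t = 0)
    \<and> (AE t in lborel. t \<in> {0..T} \<longrightarrow> transpose B *v r t = 0)
    \<and> (AE t in lborel. t \<in> {1..T} \<longrightarrow> r t = transpose A *v r (t - 1) + convol (\<lambda>s. transpose (delay_kernel_on T s)) r t + a)"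
proof -
  let ?I = "indicat_real {0..T}"
  let ?J = "{T - 1..T}"
  have "(0, c, restrict_l2 ?J g) \<notin> defect_range"
  proof
    assume "(0, c, restrict_l2 ?J g) \<in> defect_range"
    then obtain x u where x: "l2f x" "l2f u" "\<And>t. t \<notin> {0..T} \<Longrightarrow> x t = 0"
      and e: "0 = l2_class (\<lambda>t. ?I t *\<^sub>R (neutral_op T x t - B *v u t))" "c = primitive x (T - 1)" "restrict_l2 ?J g = restrict_l2 ?J (l2_class x)"
      unfolding defect_range_def by blast
    have "AE t in lborel. ?I t *\<^sub>R (neutral_op T x t - B *v u t) = 0"
      using e(1) unfolding zero_l2_l2_class by (subst (asm) l2_class_eq_iff[OF l2f_zero Efu_l2f[OF x(1,2)]]) (auto elim: eventually_mono)
    then have 1: "AE t in lborel. t \<in> {0..T} \<longrightarrow> neutral_op T x t = B *v u t" by eventually_elim auto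
    have "AE t in lborel. indicat_real ?J t *\<^sub>R l2_rep g t = indicat_real ?J t *\<^sub>R x t"
      using e(3) by (subst (asm) restrict_l2_def, subst (asm) restrict_l2_l2_class[OF x(1)]) (auto simp: l2_class_eq_iff l2f_cmul_indicator x)
    then have "AE t in lborel. t \<in> ?J \<longrightarrow> x t = l2_rep g t" by eventually_elim auto
    then show False using ns x e(2) 1 by blast
  qed
  from separating_functional[OF subspace_defect_range this]
  obtain w :: "(complex^'n) l2 \<times> (complex^'n) \<times> (complex^'n) l2 \<Rightarrow> real"
    where w: "linear w" and w0': "\<forall>p\<in>defect_range. w p = 0" and w1: "w (0, c, restrict_l2 ?J g) = 1" by (elim exE conjE)
  have w0: "\<And>p. p \<in> defect_range \<Longrightarrow> w p = 0" using w0' by (rule bspec)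
  obtain C1 where C1: "\<And>y. \<bar>w (restrict_l2 {0..T} y, 0, 0)\<bar> \<le> C1 * norm y" using annihilator_bounded(1)[OF w w0] by blast
  interpret ctI: bounded_linear "restrict_l2 {0..T} :: (complex^'n) l2 \<Rightarrow> _" by (rule bounded_linear_restrict_l2) simp
  have "bounded_linear (\<lambda>y. w (restrict_l2 {0..T} y, 0, 0))"
  proof (rule bounded_linear_intro)
    fix y y' :: "(complex^'n) l2" and r :: real
    show "w (restrict_l2 {0..T} (y + y'), 0, 0) = w (restrict_l2 {0..T} y, 0, 0) + w (restrict_l2 {0..T} y', 0, 0)"
      using linear_add[OF w, of "(restrict_l2 {0..T} y, 0, 0)" "(restrict_l2 {0..T} y', 0, 0)"] by (simp add: ctI.add)
    show "w (restrict_l2 {0..T} (r *\<^sub>R y), 0, 0) = r *\<^sub>R w (restrict_l2 {0..T} y, 0, 0)"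
      using linear_cmul[OF w, of r "(restrict_l2 {0..T} y, 0, 0)"] by (simp add: ctI.scaleR)
    show "norm (w (restrict_l2 {0..T} y, 0, 0)) \<le> norm y * C1" using C1[of y] by (simp add: mult.commute)
  qed
  from l2_riesz[OF this] obtain \<rho> where \<rho>: "\<And>y. w (restrict_l2 {0..T} y, 0, 0) = inner \<rho> y" by blast
  have "linear (\<lambda>v. w (0, v, 0))"
  proof (rule linearI)
    fix v v' :: "complex^'n" and r :: real
    show "w (0, v + v', 0) = w (0, v, 0) + w (0, v', 0)" using linear_add[OF w, of "(0, v, 0)" "(0, v', 0)"] by simp
    show "w (0, r *\<^sub>R v, 0) = r *\<^sub>R w (0, v, 0)" using linear_cmul[OF w, of r "(0, v, 0)"] by simp
  qed
  from finite_dim_riesz[OF this] obtain a0 where a0: "\<And>v. w (0, v, 0) = inner a0 v" by blast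
  define \<rho>' where "\<rho>' t = ?I t *\<^sub>R l2_rep \<rho> t" for t
  have l\<rho>: "l2f \<rho>'" unfolding \<rho>'_def by (intro l2f_cmul_indicator) auto
  have \<rho>0: "\<rho>' t = 0" if "t \<notin> {0..T}" for t using that by (simp add: \<rho>'_def)
  have inner\<rho>: "w (l2_class (\<lambda>t. ?I t *\<^sub>R y t), 0, 0) = (LINT t|lborel. \<rho>' t \<bullet> y t)" if y: "l2f (\<lambda>t. ?I t *\<^sub>R y t)" for y
  proof -
    have "(\<lambda>t. ?I t *\<^sub>R ?I t *\<^sub>R y t) = (\<lambda>t. ?I t *\<^sub>R y t)" by (auto simp: indicator_def)
    then have "restrict_l2 {0..T} (l2_class (\<lambda>t. ?I t *\<^sub>R y t)) = l2_class (\<lambda>t. ?I t *\<^sub>R y t)" by (simp add: restrict_l2_l2_class[OF y])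
    then have "w (l2_class (\<lambda>t. ?I t *\<^sub>R y t), 0, 0) = inner \<rho> (l2_class (\<lambda>t. ?I t *\<^sub>R y t))" using \<rho>[of "l2_class (\<lambda>t. ?I t *\<^sub>R y t)"] by simp
    also have "\<dots> = (LINT t|lborel. l2_rep \<rho> t \<bullet> (?I t *\<^sub>R y t))" using inner_l2_class[OF l2f_l2_rep[of \<rho>] y] by simp
    also have "\<dots> = (LINT t|lborel. \<rho>' t \<bullet> y t)" by (simp add: \<rho>'_def)
    finally show ?thesis .
  qed
  have orth: "(LINT t|lborel. \<rho>' t \<bullet> (neutral_op T x t - B *v u t)) + a0 \<bullet> primitive x (T - 1) + w (0, 0, restrict_l2 ?J (l2_class x)) = 0"
    if x: "l2f x" "l2f u" "\<And>t. t \<notin> {0..T} \<Longrightarrow> x t = 0" for x u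
  proof -
    let ?y = "l2_class (\<lambda>t. ?I t *\<^sub>R (neutral_op T x t - B *v u t))"
    have "w (?y, primitive x (T - 1), restrict_l2 ?J (l2_class x)) = 0" by (rule w0) (use x in \<open>auto simp: defect_range_def\<close>)
    then have "w ((?y, 0, 0) + (0, primitive x (T - 1), 0) + (0, 0, restrict_l2 ?J (l2_class x))) = 0" by simp
    then have "w (?y, 0, 0) + w (0, primitive x (T - 1), 0) + w (0, 0, restrict_l2 ?J (l2_class x)) = 0" by (simp only: linear_add[OF w])
    then show ?thesis by (simp add: inner\<rho>[OF Efu_l2f[OF x(1,2)]] a0)
  qed
  have Ef0: "neutral_op T (\<lambda>t. 0) t = 0" for t by (simp add: neutral_op_def convol_def)
  have ct0: "restrict_l2 S (0 :: (complex^'n) l2) = 0" if "S \<in> sets borel" for S :: "real set"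
    using linear_0[OF bounded_linear.linear[OF bounded_linear_restrict_l2[OF that]]] .
  have w00: "w (0, 0, 0) = 0" using linear_0[OF w] by (simp add: zero_prod_def)
  have B0: "AE t in lborel. ctranspose B *v \<rho>' t = 0"
  proof -
    have l: "l2f (\<lambda>t. ctranspose B *v \<rho>' t)" by (rule l2f_blin[OF l\<rho> blin_mv])
    have "AE t in lborel. t \<in> UNIV \<longrightarrow> ctranspose B *v \<rho>' t = 0"
    proof (rule AE_zero_of_orthogonal[OF l])
      fix u :: "real \<Rightarrow> complex^'r" assume u: "l2f u"
      have "(LINT t|lborel. \<rho>' t \<bullet> (neutral_op T (\<lambda>t. 0) t - B *v u t)) + a0 \<bullet> primitive (\<lambda>t. 0) (T - 1) + w (0, 0, restrict_l2 ?J (l2_class (\<lambda>t. 0))) = 0"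
        by (rule orth[OF l2f_zero u]) simp
      then have "(LINT t|lborel. \<rho>' t \<bullet> (B *v u t)) = 0"
        by (simp add: Ef0 primitive_def zero_l2_l2_class[symmetric] ct0 w00)
      then show "(LINT t|lborel. (ctranspose B *v \<rho>' t) \<bullet> u t) = 0" by (simp add: inner_ctranspose)
    qed simp
    then show ?thesis by simp
  qed
  define ka where "ka x = ctranspose (delay_kernel_on T (- x))" for x
  have lka: "l2f ka" unfolding ka_def using l2f_blin[OF l2f_reflect[OF l2f_delay_kernel_on[of T], of 0] blin_ctranspose] by simp
  have main: "AE s in lborel. s \<in> {0..T - 1} \<longrightarrow> \<rho>' s - ctranspose A *v \<rho>' (s + 1) - convol ka \<rho>' s + a0 = 0"
  proof -
    let ?S = "{0..T - 1}"
    define y where "y s = \<rho>' s - ctranspose A *v \<rho>' (s + 1) - indicat_real ?S s *\<^sub>R convol ka \<rho>' s + indicat_real ?S s *\<^sub>R a0" for s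
    have l2: "l2f (\<lambda>s. ctranspose A *v \<rho>' (s + 1))" by (intro l2f_blin[OF _ blin_mv] l2f_shift l\<rho>)
    have l3: "l2f (\<lambda>s. indicat_real ?S s *\<^sub>R convol ka \<rho>' s)" by (rule l2f_continuous_interval[OF convol_continuous[OF lka l\<rho>]])
    have l4: "l2f (\<lambda>s. indicat_real ?S s *\<^sub>R a0)" by (rule l2f_indicator_const)
    have ly: "l2f y" unfolding y_def by (intro l2f_add l2f_diff l\<rho> l2 l3 l4)
    have "AE s in lborel. s \<in> ?S \<longrightarrow> y s = 0"
    proof (rule AE_zero_of_orthogonal[OF ly])
      fix x :: "real \<Rightarrow> complex^'n" assume x: "l2f x" and sx: "\<And>t. t \<notin> ?S \<Longrightarrow> x t = 0"
      have sx': "\<And>t. t \<notin> {0..T} \<Longrightarrow> x t = 0" using sx by auto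
      have ix: "indicat_real ?S t *\<^sub>R x t = x t" for t using sx by (cases "t \<in> ?S") auto
      have xi: "integrable lborel x" using l2f_integrable_interval[OF x, of 0 "T - 1"] unfolding ix .
      have lAx: "l2f (\<lambda>t. A *v x (t - 1))" by (intro l2f_blin[OF _ blin_mv] l2f_shift' x)
      have lcx: "l2f (\<lambda>t. ?I t *\<^sub>R convol (delay_kernel_on T) x t)" by (rule l2f_continuous_interval[OF convol_continuous[OF l2f_delay_kernel_on x]])
      have icx: "\<rho>' t \<bullet> (?I t *\<^sub>R convol (delay_kernel_on T) x t) = \<rho>' t \<bullet> convol (delay_kernel_on T) x t" for t by (cases "t \<in> {0..T}") (auto simp: \<rho>0)
      \<comment> \<open>The support of \<open>x\<close> and the tail interval meet only in the point
        T - 1.\<close>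
      have "restrict_l2 ?J (l2_class x) = 0"
      proof -
        have "AE t in lborel. indicat_real ?J t *\<^sub>R x t = 0"
          using AE_lborel_singleton[of "T - 1"] by eventually_elim (use sx in \<open>auto simp: indicator_def\<close>)
        then show ?thesis unfolding restrict_l2_l2_class[OF x borel_closed[OF closed_atLeastAtMost]] zero_l2_l2_class
          using l2f_cmul_indicator[OF x, of ?J] by (subst l2_class_eq_iff) (auto simp: l2f_zero)
      qed
      then have o: "(LINT t|lborel. \<rho>' t \<bullet> neutral_op T x t) + a0 \<bullet> primitive x (T - 1) = 0"
        using orth[OF x l2f_zero sx'] by (simp add: w00)
      have z: "a0 \<bullet> primitive x (T - 1) = (LINT s|lborel. a0 \<bullet> x s)"
        unfolding primitive_def ix by (rule integral_inner_right[symmetric]) (use xi in simp)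
      have i1: "integrable lborel (\<lambda>t. \<rho>' t \<bullet> x t)" by (rule l2f_inner_integrable[OF l\<rho> x])
      have i2: "integrable lborel (\<lambda>t. \<rho>' t \<bullet> (A *v x (t - 1)))" by (rule l2f_inner_integrable[OF l\<rho> lAx])
      have i3: "integrable lborel (\<lambda>t. \<rho>' t \<bullet> convol (delay_kernel_on T) x t)" using l2f_inner_integrable[OF l\<rho> lcx] unfolding icx .
      have "(LINT t|lborel. \<rho>' t \<bullet> neutral_op T x t) = (LINT t|lborel. \<rho>' t \<bullet> x t) - (LINT t|lborel. \<rho>' t \<bullet> (A *v x (t - 1))) - (LINT t|lborel. \<rho>' t \<bullet> convol (delay_kernel_on T) x t)"
        unfolding neutral_op_def inner_diff_right using i1 i2 i3 by simp
      also have "(LINT t|lborel. \<rho>' t \<bullet> (A *v x (t - 1))) = (LINT s|lborel. (ctranspose A *v \<rho>' (s + 1)) \<bullet> x s)"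
        using lint_shift[of "\<lambda>t. \<rho>' t \<bullet> (A *v x (t - 1))" 1] by (simp add: inner_ctranspose)
      also have "(LINT t|lborel. \<rho>' t \<bullet> convol (delay_kernel_on T) x t) = (LINT s|lborel. convol ka \<rho>' s \<bullet> x s)"
        unfolding ka_def[abs_def] by (rule convol_adjoint[OF l2f_delay_kernel_on x xi l\<rho>])
      finally have e: "(LINT t|lborel. \<rho>' t \<bullet> x t) - (LINT s|lborel. (ctranspose A *v \<rho>' (s + 1)) \<bullet> x s) - (LINT s|lborel. convol ka \<rho>' s \<bullet> x s) + (LINT s|lborel. a0 \<bullet> x s) = 0"
        using o z by simp
      have ii: "(indicat_real ?S s *\<^sub>R v) \<bullet> x s = v \<bullet> x s" for s v by (cases "s \<in> ?S") (auto simp: sx)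
      have j2: "integrable lborel (\<lambda>s. (ctranspose A *v \<rho>' (s + 1)) \<bullet> x s)" by (rule l2f_inner_integrable[OF l2 x])
      have j3: "integrable lborel (\<lambda>s. convol ka \<rho>' s \<bullet> x s)" using l2f_inner_integrable[OF l3 x] unfolding ii .
      have j4: "integrable lborel (\<lambda>s. a0 \<bullet> x s)" using l2f_inner_integrable[OF l4 x] unfolding ii .
      show "(LINT s|lborel. y s \<bullet> x s) = 0"
        unfolding y_def inner_add_left inner_diff_left ii using e i1 j2 j3 j4 by simp
    qed simp
    then show ?thesis by eventually_elim (auto simp: y_def)
  qed
  have nz: "\<not> (AE t in lborel. \<rho>' t = 0)"
  proof
    assume "AE t in lborel. \<rho>' t = 0"
    then have z: "(LINT t|lborel. \<rho>' t \<bullet> y t) = 0" for y by (intro integral_eq_zero_AE) (auto elim: eventually_mono)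
    \<comment> \<open>If \<rho>' vanished, defects would cost nothing: this \<open>x\<close>
      realises the data \<open>c\<close> and \<open>g\<close> with no regard to the equation, and
      \<open>w\<close> would be 0 at the missed target. The constant c / (T - 1) has integral c over
      [0, T - 1].\<close>
    define x where "x t = indicat_real {0..<T - 1} t *\<^sub>R ((1 / (T - 1)) *\<^sub>R c) + indicat_real ?J t *\<^sub>R l2_rep g t" for t
    have l0: "l2f (\<lambda>t. indicat_real {0..<T - 1} t *\<^sub>R v)" for v :: "complex^'n"
    proof -
      have "(\<lambda>t. indicat_real {0..<T - 1} t *\<^sub>R indicat_real {0..T} t *\<^sub>R v) = (\<lambda>t. indicat_real {0..<T - 1} t *\<^sub>R v)"
        by (auto simp: indicator_def)
      then show ?thesis using l2f_cmul_indicator[OF l2f_indicator_const[of 0 T v], of "{0..<T - 1}"] by simp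
    qed
    have lx: "l2f x" unfolding x_def by (intro l2f_add l0 l2f_cmul_indicator l2f_l2_rep) simp
    have sx: "\<And>t. t \<notin> {0..T} \<Longrightarrow> x t = 0" using T1 by (auto simp: x_def indicator_def)
    have zx: "primitive x (T - 1) = c"
    proof -
      have "primitive x (T - 1) = (LINT s|lborel. indicat_real {0..T - 1} s *\<^sub>R ((1 / (T - 1)) *\<^sub>R c))"
        unfolding primitive_def
      proof (rule integral_cong_AE)
        show "AE s in lborel. indicat_real {0..T - 1} s *\<^sub>R x s = indicat_real {0..T - 1} s *\<^sub>R ((1 / (T - 1)) *\<^sub>R c)"
          using AE_lborel_singleton[of "T - 1"] by eventually_elim (auto simp: x_def indicator_def)
        show "(\<lambda>s. indicat_real {0..T - 1} s *\<^sub>R x s) \<in> borel_measurable lborel" using l2f_meas[OF lx] by measurable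
      qed measurable
      also have "\<dots> = (LINT s|lborel. indicat_real {0..T - 1} s) *\<^sub>R ((1 / (T - 1)) *\<^sub>R c)"
        by (rule integral_scaleR_left) (auto simp: integrable_indicator_iff emeasure_lborel_Icc_eq)
      also have "(LINT s|lborel. indicat_real {0..T - 1} s) = T - 1" using T1 by simp
      finally show ?thesis using T1 by simp
    qed
    have cx: "restrict_l2 ?J (l2_class x) = restrict_l2 ?J g"
    proof -
      have "(\<lambda>t. indicat_real ?J t *\<^sub>R x t) = (\<lambda>t. indicat_real ?J t *\<^sub>R l2_rep g t)" by (auto simp: x_def indicator_def)
      then show ?thesis using restrict_l2_l2_class[OF lx, of ?J] by (simp add: restrict_l2_def)
    qed
    have "a0 \<bullet> c + w (0, 0, restrict_l2 ?J g) = 0" using orth[OF lx l2f_zero sx] by (simp add: z zx cx)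
    moreover have "w (0, c, restrict_l2 ?J g) = a0 \<bullet> c + w (0, 0, restrict_l2 ?J g)"
      using linear_add[OF w, of "(0, c, 0)" "(0, 0, restrict_l2 ?J g)"] by (simp add: a0)
    ultimately show False using w1 by simp
  qed
  define r where "r t = conj_vec (\<rho>' (T - t))" for t
  have lr: "l2f r" unfolding r_def by (rule l2f_blin[OF l2f_reflect[OF l\<rho>] blin_conj_vec])
  have "\<forall>t. t \<notin> {0..T} \<longrightarrow> r t = 0" using \<rho>0 by (auto simp: r_def)
  moreover have "\<not> (AE t in lborel. r t = 0)"
  proof
    assume "AE t in lborel. r t = 0"
    from AE_reflect[OF this, of T] have "AE t in lborel. \<rho>' t = 0" by eventually_elim (simp add: r_def)
    then show False using nz by blast
  qed
  moreover have "AE t in lborel. t \<in> {0..T} \<longrightarrow> transpose B *v r t = 0"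
    using AE_reflect[OF B0, of T]
  proof eventually_elim
    case (elim t)
    have "transpose B *v r t = conj_vec (ctranspose B *v \<rho>' (T - t))" by (simp only: r_def conj_vec_ctranspose)
    then show ?case using elim by (simp only: conj_vec_eq_0 simp_thms)
  qed
  moreover have "AE t in lborel. t \<in> {1..T} \<longrightarrow> r t = transpose A *v r (t - 1) + convol (\<lambda>s. transpose (delay_kernel_on T s)) r t + conj_vec (- a0)"
    using AE_reflect[OF main, of T]
  proof eventually_elim
    case (elim t)
    have "conj_vec (convol ka \<rho>' (T - t)) = (LINT s|lborel. conj_vec (ka (T - t - s) *v \<rho>' s))"
      unfolding convol_def by (rule integral_bounded_linear[OF blin_conj_vec convol_integrable[OF lka l\<rho>], symmetric])
    also have "\<dots> = (LINT s|lborel. conj_vec (ka (T - t - (T - s)) *v \<rho>' (T - s)))"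
      by (rule lint_reflect[symmetric])
    also have "\<dots> = convol (\<lambda>s. transpose (delay_kernel_on T s)) r t"
      unfolding convol_def by (rule Bochner_Integration.integral_cong) (simp_all add: ka_def conj_vec_ctranspose r_def)
    finally have c: "conj_vec (convol ka \<rho>' (T - t)) = convol (\<lambda>s. transpose (delay_kernel_on T s)) r t" .
    show ?case
    proof
      assume "t \<in> {1..T}"
      then have "\<rho>' (T - t) = ctranspose A *v \<rho>' (T - t + 1) + convol ka \<rho>' (T - t) + (- a0)" using elim by (auto simp: algebra_simps)
      then have "r t = conj_vec (ctranspose A *v \<rho>' (T - t + 1) + convol ka \<rho>' (T - t) + (- a0))" by (simp add: r_def)
      also have "\<dots> = transpose A *v r (t - 1) + convol (\<lambda>s. transpose (delay_kernel_on T s)) r t + conj_vec (- a0)"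
        unfolding conj_vec_add c conj_vec_ctranspose by (simp add: r_def algebra_simps)
      finally show "r t = transpose A *v r (t - 1) + convol (\<lambda>s. transpose (delay_kernel_on T s)) r t + conj_vec (- a0)" .
    qed
  qed
  ultimately show ?thesis using lr by blast
qed

end

section \<open>The adjoint delay equation\<close>

text \<open>Gaussian elimination: a pivot solves one equation for one unknown, and the reduced
  system still has more unknowns than equations.\<close>

lemma homogeneous_system:
  fixes a :: "'i \<Rightarrow> 'j \<Rightarrow> 'f::field"
  assumes "finite I" "finite J" "card I < card J"
  shows "\<exists>c. (\<exists>j\<in>J. c j \<noteq> 0) \<and> (\<forall>i\<in>I. (\<Sum>j\<in>J. a i j * c j) = 0)"
  using assms
proof (induction I arbitrary: a J rule: finite_induct)
  case empty
  then obtain j where "j \<in> J" by (metis card_gt_0_iff all_not_in_conv card.empty)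
  then show ?case by (intro exI[of _ "\<lambda>_. 1"]) auto
next
  case (insert i I)
  show ?case
  proof (cases "\<forall>j\<in>J. a i j = 0")
    case True
    have "card I < card J" using insert by simp
    from insert.IH[OF insert.prems(1) this, of a] show ?thesis using True by auto
  next
    case False
    then obtain p where p: "p \<in> J" "a i p \<noteq> 0" by blast
    define J' where "J' = J - {p}"
    have J': "finite J'" "card I < card J'" unfolding J'_def using insert p by auto
    obtain c where c: "\<exists>j\<in>J'. c j \<noteq> 0" "\<forall>i'\<in>I. (\<Sum>j\<in>J'. (a i' j - a i' p * a i j / a i p) * c j) = 0"
      using insert.IH[OF J', of "\<lambda>i' j. a i' j - a i' p * a i j / a i p"] by blast
    define s where "s = (\<Sum>j\<in>J'. a i j * c j)"
    define c' where "c' = c(p := - s / a i p)"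
    have split: "(\<Sum>j\<in>J. a i' j * c' j) = a i' p * (- s / a i p) + (\<Sum>j\<in>J'. a i' j * c j)" for i'
    proof -
      have "(\<Sum>j\<in>J. a i' j * c' j) = a i' p * c' p + (\<Sum>j\<in>J'. a i' j * c' j)"
        unfolding J'_def by (rule sum.remove[OF insert.prems(1) p(1)])
      also have "(\<Sum>j\<in>J'. a i' j * c' j) = (\<Sum>j\<in>J'. a i' j * c j)"
        by (rule sum.cong) (auto simp: c'_def J'_def)
      finally show ?thesis by (simp add: c'_def)
    qed
    have "(\<Sum>j\<in>J. a i' j * c' j) = 0" if "i' \<in> insert i I" for i'
    proof (cases "i' = i")
      case True
      then show ?thesis unfolding split using p by (simp add: s_def)
    next
      case False
      then have "(\<Sum>j\<in>J'. (a i' j - a i' p * a i j / a i p) * c j) = 0" using c(2) that by blast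
      also have "(\<Sum>j\<in>J'. (a i' j - a i' p * a i j / a i p) * c j) = (\<Sum>j\<in>J'. a i' j * c j) - (a i' p / a i p) * s"
        unfolding s_def by (simp add: left_diff_distrib sum_subtractf sum_distrib_left mult.assoc)
      finally show ?thesis unfolding split by simp
    qed
    moreover have "\<exists>j\<in>J. c' j \<noteq> 0" using c(1) by (auto simp: c'_def J'_def)
    ultimately show ?thesis by blast
  qed
qed

text \<open>Meant for transposed data: \<open>A\<close> is the transposed delay matrix,
  \<open>B\<close> the transposed input matrix, and \<open>HI\<close> is the Krylov condition in its
  observability form.\<close>

locale adjoint_system = delay_kernels A2 A3 for A2 A3 :: "real \<Rightarrow> complex^'n::finite^'n" +
  fixes A :: "complex^'n^'n" and B :: "complex^'n^'r::finite" and \<nu> :: nat and H :: "nat \<Rightarrow> complex^'r^'n"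
  assumes HI: "\<And>x. (\<Sum>j<\<nu>. H j *v (B *v (mpow A j *v x))) = x" and \<nu>1: "\<nu> \<ge> 1"
begin

text \<open>Along a chain of at least \<open>\<nu>\<close> points the condition \<open>B *v d k = 0\<close> observes \<open>d 0\<close> up to the recursion error.\<close>

lemma recurrence_bound:
  "\<exists>C\<ge>0. \<forall>M (d :: nat \<Rightarrow> complex^'n) \<epsilon>. \<nu> \<le> Suc M \<longrightarrow> M \<le> N \<longrightarrow> \<epsilon> \<ge> 0 \<longrightarrow> (\<forall>k\<le>M. B *v d k = 0) \<longrightarrow>
    (\<forall>k<M. norm (d (Suc k) - A *v d k) \<le> \<epsilon>) \<longrightarrow> (\<forall>k\<le>M. norm (d k) \<le> C * \<epsilon>)"
proof -
  define C1 where "C1 k = (\<Sum>j<k. norm A ^ j)" for k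
  have C1S: "C1 (Suc k) = norm A * C1 k + 1" for k
    unfolding C1_def by (subst sum.lessThan_Suc_shift) (simp add: sum_distrib_left)
  have C1n: "C1 k \<ge> 0" for k unfolding C1_def by (intro sum_nonneg) simp
  define C0 where "C0 = (\<Sum>j<\<nu>. norm (H j) * (norm B * C1 j))"
  have C0n: "C0 \<ge> 0" unfolding C0_def using C1n by (intro sum_nonneg) simp
  define C where "C = (\<Sum>k\<le>N. norm (mpow A k) * C0 + C1 k)"
  have Cn: "C \<ge> 0" unfolding C_def using C0n C1n by (intro sum_nonneg add_nonneg_nonneg) auto
  have "norm (d k) \<le> C * \<epsilon>"
    if M: "\<nu> \<le> Suc M" "M \<le> N" and e: "\<epsilon> \<ge> 0" and B0: "\<And>k. k \<le> M \<Longrightarrow> B *v d k = 0"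
      and r: "\<And>k. k < M \<Longrightarrow> norm (d (Suc k) - A *v d k) \<le> \<epsilon>" and k: "k \<le> M"
    for M and d :: "nat \<Rightarrow> complex^'n" and \<epsilon> k
  proof -
    have 1: "norm (mpow A k *v d 0 - d k) \<le> C1 k * \<epsilon>" if "k \<le> M" for k
      using that
    proof (induction k)
      case 0
      show ?case by (simp add: mpow_0 C1_def)
    next
      case (Suc k)
      have "mpow A (Suc k) *v d 0 - d (Suc k) = A *v (mpow A k *v d 0 - d k) - (d (Suc k) - A *v d k)"
        by (simp add: mv.diff_right mpow_Suc_mv)
      also have "norm \<dots> \<le> norm A * norm (mpow A k *v d 0 - d k) + \<epsilon>"
        by (rule order_trans[OF norm_triangle_ineq4]) (use norm_mv_le r[of k] Suc.prems in \<open>intro add_mono; simp\<close>)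
      also have "\<dots> \<le> norm A * (C1 k * \<epsilon>) + \<epsilon>" using Suc by (intro add_right_mono mult_left_mono) auto
      finally show ?case by (simp add: C1S algebra_simps)
    qed
    have "norm (H j *v (B *v (mpow A j *v d 0))) \<le> norm (H j) * (norm B * C1 j) * \<epsilon>" if j: "j < \<nu>" for j
    proof -
      have jM: "j \<le> M" using j M by linarith
      have "B *v (mpow A j *v d 0) = B *v (mpow A j *v d 0 - d j)" using B0[OF jM] by (simp add: mv.diff_right)
      then have "norm (B *v (mpow A j *v d 0)) \<le> norm B * (C1 j * \<epsilon>)"
        using norm_mv_le[of B "mpow A j *v d 0 - d j"] mult_left_mono[OF 1[OF jM], of "norm B"] by simp
      then show ?thesis
        using norm_mv_le[of "H j" "B *v (mpow A j *v d 0)"]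
          mult_left_mono[of "norm (B *v (mpow A j *v d 0))" "norm B * (C1 j * \<epsilon>)" "norm (H j)"] by (simp add: mult.assoc)
    qed
    then have "norm (\<Sum>j<\<nu>. H j *v (B *v (mpow A j *v d 0))) \<le> (\<Sum>j<\<nu>. norm (H j) * (norm B * C1 j) * \<epsilon>)"
      by (intro sum_norm_le) auto
    then have d0: "norm (d 0) \<le> C0 * \<epsilon>" unfolding HI C0_def by (simp add: sum_distrib_right)
    have "norm (d k) \<le> norm (mpow A k *v d 0) + norm (mpow A k *v d 0 - d k)"
      using norm_triangle_ineq4[of "mpow A k *v d 0" "mpow A k *v d 0 - d k"] by simp
    also have "\<dots> \<le> norm (mpow A k) * (C0 * \<epsilon>) + C1 k * \<epsilon>"
      by (intro add_mono 1 k order_trans[OF norm_mv_le] mult_left_mono d0) simp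
    also have "\<dots> = (norm (mpow A k) * C0 + C1 k) * \<epsilon>" by (simp add: algebra_simps)
    also have "\<dots> \<le> C * \<epsilon>"
    proof (rule mult_right_mono[OF _ e])
      show "norm (mpow A k) * C0 + C1 k \<le> C"
        unfolding C_def using k M C0n C1n by (intro member_le_sum) auto
    qed
    finally show ?thesis .
  qed
  then show ?thesis using Cn by (intro exI[of _ C]) blast
qed

text \<open>The set D carries the pointwise validity of an equation known almost everywhere; for
  continuous solutions it is \<open>UNIV\<close>.\<close>

definition adjoint_eq_on :: "real set \<Rightarrow> real \<Rightarrow> complex^'n \<Rightarrow> (real \<Rightarrow> complex^'n) \<Rightarrow> bool" where
  "adjoint_eq_on D T a r \<longleftrightarrow> (\<forall>t\<in>D \<inter> {0..T}. B *v r t = 0) \<and> (\<forall>t\<in>D \<inter> {1..T}. r t = A *v r (t - 1) + convol (delay_kernel_on T) r t + a)"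

text \<open>Differences of \<open>r\<close> along a unit-spaced chain in \<open>[0, T - \<tau>]\<close> satisfy the recursion \<open>d (k + 1) = A d k\<close> up to the variation of the convolution;
such a chain has at least \<open>\<nu>\<close> points as \<open>\<tau> \<le> T - \<nu>\<close>.\<close>

lemma adjoint_modulus:
  assumes T: "T > real \<nu>"
  shows "\<exists>C\<ge>0. \<forall>D a r s \<tau>. l2f r \<longrightarrow> adjoint_eq_on D T a r \<longrightarrow> (\<forall>t\<in>D. t + 1 \<in> D \<and> t - 1 \<in> D) \<longrightarrow> 0 \<le> \<tau> \<longrightarrow> \<tau> \<le> T - real \<nu> \<longrightarrow>
    s \<in> D \<longrightarrow> s + \<tau> \<in> D \<longrightarrow> 0 \<le> s \<longrightarrow> s + \<tau> \<le> T \<longrightarrow>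
    norm (r (s + \<tau>) - r s) \<le> C * (norm (shift_l2 \<tau> (l2_class (delay_kernel_on T)) - l2_class (delay_kernel_on T)) * norm (l2_class r))"
proof -
  obtain C where C: "C \<ge> 0" and C2: "\<forall>M (d :: nat \<Rightarrow> complex^'n) \<epsilon>. \<nu> \<le> Suc M \<longrightarrow> M \<le> nat \<lceil>T\<rceil> \<longrightarrow> \<epsilon> \<ge> 0 \<longrightarrow> (\<forall>k\<le>M. B *v d k = 0) \<longrightarrow>
    (\<forall>k<M. norm (d (Suc k) - A *v d k) \<le> \<epsilon>) \<longrightarrow> (\<forall>k\<le>M. norm (d k) \<le> C * \<epsilon>)"
    using recurrence_bound[of "nat \<lceil>T\<rceil>"] by (elim exE conjE)
  have key: "norm (r (s + \<tau>) - r s) \<le> C * (norm (shift_l2 \<tau> (l2_class (delay_kernel_on T)) - l2_class (delay_kernel_on T)) * norm (l2_class r))"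
    if r: "l2f r" and adj: "adjoint_eq_on D T a r" and D: "\<And>t. t \<in> D \<Longrightarrow> t + 1 \<in> D" "\<And>t. t \<in> D \<Longrightarrow> t - 1 \<in> D"
      and \<tau>: "0 \<le> \<tau>" "\<tau> \<le> T - real \<nu>" and s: "s \<in> D" "s + \<tau> \<in> D" "0 \<le> s" "s + \<tau> \<le> T" for D a r s \<tau>
  proof -
    define \<epsilon> where "\<epsilon> = norm (shift_l2 \<tau> (l2_class (delay_kernel_on T)) - l2_class (delay_kernel_on T)) * norm (l2_class r)"
    define m where "m = nat \<lfloor>s\<rfloor>"
    \<comment> \<open>The chain starts at the fractional part of \<open>s\<close>, the lowest point
      of [0, T] at integer distance from it.\<close>
    define s0 where "s0 = s - real m"
    have ms: "real m = of_int \<lfloor>s\<rfloor>" unfolding m_def using s(3) by simp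
    have s0: "0 \<le> s0" "s0 < 1" unfolding s0_def ms using of_int_floor_le[of s] floor_correct[of s] by linarith+
    define M where "M = nat \<lfloor>T - \<tau> - s0\<rfloor>"
    \<comment> \<open>Here \<tau> \<le> T - \<nu> enters: the chain k = 0, ..., M then has at least
      \<nu> points.\<close>
    have pos: "T - \<tau> - s0 > real \<nu> - 1" using \<tau> s0 by linarith
    have MT: "real M = of_int \<lfloor>T - \<tau> - s0\<rfloor>" unfolding M_def using pos \<nu>1 by simp
    have M1: "real M \<le> T - \<tau> - s0" "T - \<tau> - s0 < real M + 1" unfolding MT using floor_correct[of "T - \<tau> - s0"] by linarith+
    have "real \<nu> < real (Suc M) + 1" using pos M1 by simp
    then have \<nu>M: "\<nu> \<le> Suc M" by linarith
    have MN: "M \<le> nat \<lceil>T\<rceil>" using M1 \<tau> s0 real_nat_ceiling_ge[of T] by linarith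
    have mM: "m \<le> M"
    proof -
      have "real m \<le> T - \<tau> - s0" using s unfolding s0_def by simp
      then have "real m < real M + 1" using M1 by linarith
      then show ?thesis by linarith
    qed
    have Dp: "t \<in> D \<Longrightarrow> t + real k \<in> D" for t k
    proof (induction k)
      case (Suc k)
      have "t + real k + 1 \<in> D" using D(1)[OF Suc.IH[OF Suc.prems]] .
      then show ?case by (simp add: algebra_simps)
    qed simp
    have Dm: "t \<in> D \<Longrightarrow> t - real k \<in> D" for t k
    proof (induction k)
      case (Suc k)
      have "t - real k - 1 \<in> D" using D(2)[OF Suc.IH[OF Suc.prems]] .
      then show ?case by (simp add: algebra_simps)
    qed simp
    have in1: "s0 + real k \<in> D" for k using Dp[OF Dm[OF s(1), of m], of k] unfolding s0_def .
    have in2: "s0 + real k + \<tau> \<in> D" for k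
      using Dp[OF Dm[OF s(2), of m], of k] unfolding s0_def by (simp add: algebra_simps)
    define d where "d k = r (s0 + real k + \<tau>) - r (s0 + real k)" for k
    have kM: "s0 + real k + \<tau> \<le> T" if "k \<le> M" for k
    proof -
      have "real k \<le> real M" using that by simp
      then show ?thesis using M1 by linarith
    qed
    have B0: "B *v d k = 0" if "k \<le> M" for k
    proof -
      have "B *v r (s0 + real k + \<tau>) = 0" "B *v r (s0 + real k) = 0"
        using adj in1[of k] in2[of k] kM[OF that] s0 \<tau> unfolding adjoint_eq_on_def by auto
      then show ?thesis by (simp add: d_def mv.diff_right)
    qed
    have rec: "norm (d (Suc k) - A *v d k) \<le> \<epsilon>" if "k < M" for k
    proof -
      have kk: "s0 + real (Suc k) + \<tau> \<le> T" by (rule kM) (use that in simp)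
      have "r (s0 + real (Suc k) + \<tau>) = A *v r (s0 + real (Suc k) + \<tau> - 1) + convol (delay_kernel_on T) r (s0 + real (Suc k) + \<tau>) + a"
        "r (s0 + real (Suc k)) = A *v r (s0 + real (Suc k) - 1) + convol (delay_kernel_on T) r (s0 + real (Suc k)) + a"
        using adj in1[of "Suc k"] in2[of "Suc k"] kk s0 \<tau> unfolding adjoint_eq_on_def by auto
      moreover have "s0 + real (Suc k) + \<tau> - 1 = s0 + real k + \<tau>" "s0 + real (Suc k) - 1 = s0 + real k" by simp_all
      \<comment> \<open>The additive constant \<open>a\<close> cancels in the difference, leaving
        only the variation of the convolution.\<close>
      ultimately have "d (Suc k) - A *v d k = convol (delay_kernel_on T) r (s0 + real (Suc k) + \<tau>) - convol (delay_kernel_on T) r (s0 + real (Suc k))"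
        by (simp add: d_def mv.diff_right add.assoc)
      also have "norm \<dots> \<le> \<epsilon>"
        using convol_diff_bound[OF l2f_delay_kernel_on r, of T "s0 + real (Suc k) + \<tau>" "s0 + real (Suc k)"] by (simp add: \<epsilon>_def)
      finally show ?thesis .
    qed
    have "norm (d m) \<le> C * \<epsilon>" by (rule C2[rule_format, where d=d, OF \<nu>M MN _ _ _ mM]) (use B0 rec in \<open>simp_all add: \<epsilon>_def\<close>)
    then show ?thesis by (simp add: d_def s0_def \<epsilon>_def)
  qed
  show ?thesis
  proof (intro exI[of _ C] conjI allI impI)
    fix D a r s \<tau>
    assume "l2f r" "adjoint_eq_on D T a r" and D: "\<forall>t\<in>D. t + 1 \<in> D \<and> t - 1 \<in> D" and "0 \<le> \<tau>" "\<tau> \<le> T - real \<nu>" "s \<in> D" "s + \<tau> \<in> D" "0 \<le> s" "s + \<tau> \<le> T"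
    then show "norm (r (s + \<tau>) - r s) \<le> C * (norm (shift_l2 \<tau> (l2_class (delay_kernel_on T)) - l2_class (delay_kernel_on T)) * norm (l2_class r))"
      by (intro key[where D=D and a=a]) (use D in simp_all)
  qed (rule C)
qed

text \<open>Written with the uncut kernel, so the formula does not mention \<open>T\<close> and
  solutions on intervals of different length can be compared.\<close>

definition causal_conv :: "(real \<Rightarrow> complex^'n) \<Rightarrow> real \<Rightarrow> complex^'n" where
  "causal_conv g t = (LINT s|lborel. indicator {0..t} s *\<^sub>R (delay_kernel (t - s) *v g s))"

lemma causal_conv_convol:
  assumes "t \<le> T" shows "convol (delay_kernel_on T) (\<lambda>s. indicator {0..T} s *\<^sub>R g s) t = causal_conv g t"
  unfolding convol_def causal_conv_def
proof (rule Bochner_Integration.integral_cong[OF refl])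
  fix s
  show "delay_kernel_on T (t - s) *v (indicat_real {0..T} s *\<^sub>R g s) = indicat_real {0..t} s *\<^sub>R (delay_kernel (t - s) *v g s)"
    using assms by (auto simp: delay_kernel_on_def indicator_def)
qed

text \<open>The additive constant is left free because shifts and integral means change it; with a
  fixed constant the family would not be stable under them.\<close>

definition adjoint_solutions :: "real \<Rightarrow> (real \<Rightarrow> complex^'n) set" where
  "adjoint_solutions T = {g. continuous_on UNIV g \<and> (\<forall>t\<in>{0..T}. B *v g t = 0) \<and> (\<exists>a. \<forall>t\<in>{1..T}. g t = A *v g (t - 1) + causal_conv g t + a)}"

lemma adjoint_solutions_adj:
  assumes "g \<in> adjoint_solutions T" shows "\<exists>a. adjoint_eq_on UNIV T a (\<lambda>s. indicator {0..T} s *\<^sub>R g s)"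
proof -
  obtain a where g: "\<forall>t\<in>{0..T}. B *v g t = 0" "\<forall>t\<in>{1..T}. g t = A *v g (t - 1) + causal_conv g t + a"
    using assms by (auto simp: adjoint_solutions_def)
  have "adjoint_eq_on UNIV T a (\<lambda>s. indicator {0..T} s *\<^sub>R g s)"
    using g unfolding adjoint_eq_on_def by (auto simp: causal_conv_convol)
  then show ?thesis by blast
qed

text \<open>At a maximum point x of the norm, the grid point just below x is closer than \<delta>.
  The modulus estimate bounds the increment between them by half of the maximum, so a solution
  vanishing on the grid is 0.\<close>

lemma adjoint_solutions_grid:
  assumes T: "T > real \<nu>"
  shows "\<exists>F. finite F \<and> (\<forall>g\<in>adjoint_solutions T. (\<forall>t\<in>F. g t = 0) \<longrightarrow> (\<forall>t\<in>{0..T}. g t = 0))"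
proof -
  have T0: "T > 0" using T \<nu>1 by linarith
  obtain C where C: "C \<ge> 0" and Cb: "\<And>a r s \<tau>. l2f r \<Longrightarrow> adjoint_eq_on UNIV T a r \<Longrightarrow> 0 \<le> \<tau> \<Longrightarrow> \<tau> \<le> T - real \<nu> \<Longrightarrow> 0 \<le> s \<Longrightarrow> s + \<tau> \<le> T \<Longrightarrow>
    norm (r (s + \<tau>) - r s) \<le> C * (norm (shift_l2 \<tau> (l2_class (delay_kernel_on T)) - l2_class (delay_kernel_on T)) * norm (l2_class r))"
    using adjoint_modulus[OF T] by (metis UNIV_I)
  \<comment> \<open>Makes C sqrt(T) e \<le> 1/2, the factor by which the maximum is compared with
    itself.\<close>
  define e where "e = 1 / (2 * (C * sqrt T + 1))"
  have e: "e > 0" unfolding e_def using C T0 by (intro divide_pos_pos mult_pos_pos add_nonneg_pos) auto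
  obtain d where d: "d > 0" "\<And>\<tau>. \<bar>\<tau>\<bar> < d \<Longrightarrow> norm (shift_l2 \<tau> (l2_class (delay_kernel_on T)) - l2_class (delay_kernel_on T)) < e"
    using l2_shift_continuous[OF e] by blast
  \<comment> \<open>Small enough for the shift estimate, and within the slack T - \<nu> allowed by
    the modulus bound.\<close>
  define \<delta> where "\<delta> = min (d / 2) (T - real \<nu>)"
  have \<delta>: "\<delta> > 0" "\<delta> < d" "\<delta> \<le> T - real \<nu>" unfolding \<delta>_def using d(1) T by auto
  define F where "F = (\<lambda>k. real k * \<delta>) ` {..nat \<lceil>T / \<delta>\<rceil>}"
  have "g t = 0" if g: "g \<in> adjoint_solutions T" and gF: "\<And>t. t \<in> F \<Longrightarrow> g t = 0" and t: "t \<in> {0..T}" for g t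
  proof -
    have gc: "continuous_on UNIV g" using g by (simp add: adjoint_solutions_def)
    have "\<exists>x\<in>{0..T}. \<forall>y\<in>{0..T}. norm (g y) \<le> norm (g x)"
      by (rule continuous_attains_sup) (use T0 in \<open>auto intro!: continuous_intros continuous_on_subset[OF gc]\<close>)
    then obtain x where x: "x \<in> {0..T}" "\<And>y. y \<in> {0..T} \<Longrightarrow> norm (g y) \<le> norm (g x)" by blast
    let ?r = "\<lambda>s. indicator {0..T} s *\<^sub>R g s"
    have lr: "l2f ?r" by (rule l2f_continuous_interval[OF gc])
    obtain a where a: "adjoint_eq_on UNIV T a ?r" using adjoint_solutions_adj[OF g] by blast
    have nr: "norm (l2_class ?r) \<le> norm (g x) * sqrt (T - 0)"
      by (rule norm_l2_class_indicator_bound[OF continuous_borel[OF gc] x(2)]) (use T0 in auto)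
    define k where "k = nat \<lfloor>x / \<delta>\<rfloor>"
    have x0: "x / \<delta> \<ge> 0" using x(1) \<delta>(1) by simp
    have kx: "real k = of_int \<lfloor>x / \<delta>\<rfloor>" unfolding k_def using x0 by simp
    have k: "real k \<le> x / \<delta>" "x / \<delta> < real k + 1" unfolding kx using floor_correct[of "x / \<delta>"] by linarith+
    define s where "s = real k * \<delta>"
    have s: "s \<le> x" "x < s + \<delta>" "s \<ge> 0" unfolding s_def using k \<delta>(1) by (auto simp: field_simps)
    have "x / \<delta> \<le> T / \<delta>" using x(1) \<delta>(1) by (simp add: divide_right_mono)
    then have "real k \<le> real (nat \<lceil>T / \<delta>\<rceil>)" using k real_nat_ceiling_ge[of "T / \<delta>"] by linarith
    then have "s \<in> F" unfolding F_def s_def by auto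
    then have gs: "g s = 0" by (rule gF)
    have "norm (?r (s + (x - s)) - ?r s) \<le> C * (norm (shift_l2 (x - s) (l2_class (delay_kernel_on T)) - l2_class (delay_kernel_on T)) * norm (l2_class ?r))"
      by (rule Cb[OF lr a]) (use s x(1) \<delta> in auto)
    also have "\<dots> \<le> C * (e * (norm (g x) * sqrt T))"
      using d(2)[of "x - s"] s \<delta> nr C e by (intro mult_left_mono mult_mono) auto
    also have "\<dots> = (C * sqrt T * e) * norm (g x)" by simp
    also have "\<dots> \<le> 1/2 * norm (g x)"
    proof (rule mult_right_mono)
      have "C * sqrt T \<ge> 0" using C T0 by simp
      then show "C * sqrt T * e \<le> 1/2" unfolding e_def by (simp add: divide_simps)
    qed simp
    finally have "norm (g x) \<le> 1/2 * norm (g x)" using x(1) s gs by simp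
    then have "norm (g x) \<le> 0" by simp
    then show ?thesis using x(2)[OF t] by simp
  qed
  moreover have "finite F" by (simp add: F_def)
  ultimately show ?thesis by blast
qed

section \<open>Closure properties of the solution spaces\<close>

lemma causal_conv_integrable:
  assumes g: "continuous_on UNIV g" shows "integrable lborel (\<lambda>s. indicator {0..t} s *\<^sub>R (delay_kernel (t - s) *v g s))"
proof -
  have "integrable lborel (\<lambda>s. delay_kernel_on t (t - s) *v (indicator {0..t} s *\<^sub>R g s))"
    by (rule convol_integrable[OF l2f_delay_kernel_on l2f_continuous_interval[OF g]])
  moreover have "(\<lambda>s. delay_kernel_on t (t - s) *v (indicator {0..t} s *\<^sub>R g s)) = (\<lambda>s. indicator {0..t} s *\<^sub>R (delay_kernel (t - s) *v g s))"
    by (auto simp: delay_kernel_on_def indicator_def)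
  ultimately show ?thesis by simp
qed

lemma causal_conv_add: "continuous_on UNIV g \<Longrightarrow> continuous_on UNIV h \<Longrightarrow> causal_conv (\<lambda>t. g t + h t) t = causal_conv g t + causal_conv h t"
  unfolding causal_conv_def by (simp add: mv.add_right scaleR_add_right causal_conv_integrable)

lemma causal_conv_smult: "continuous_on UNIV g \<Longrightarrow> causal_conv (\<lambda>t. c *s g t) t = c *s causal_conv g t"
proof -
  assume g: "continuous_on UNIV g"
  have "causal_conv (\<lambda>t. c *s g t) t = (LINT s|lborel. c *s (indicator {0..t} s *\<^sub>R (delay_kernel (t - s) *v g s)))"
    unfolding causal_conv_def mv_scaleC indicator_smul ..
  also have "\<dots> = c *s causal_conv g t"
    unfolding causal_conv_def by (rule integral_bounded_linear[OF vsmul_blin causal_conv_integrable[OF g]])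
  finally show ?thesis .
qed

lemma continuous_smult: "continuous_on UNIV g \<Longrightarrow> continuous_on UNIV (\<lambda>t. c *s (g t :: complex^'n))"
  by (rule continuous_on_compose2[OF linear_continuous_on[OF vsmul_blin]]) auto

lemma adjoint_solutions_add:
  assumes "g \<in> adjoint_solutions T" "h \<in> adjoint_solutions T" shows "(\<lambda>t. g t + h t) \<in> adjoint_solutions T"
proof -
  obtain a where g: "continuous_on UNIV g" "\<forall>t\<in>{0..T}. B *v g t = 0" "\<forall>t\<in>{1..T}. g t = A *v g (t - 1) + causal_conv g t + a"
    using assms(1) by (auto simp: adjoint_solutions_def)
  obtain b where h: "continuous_on UNIV h" "\<forall>t\<in>{0..T}. B *v h t = 0" "\<forall>t\<in>{1..T}. h t = A *v h (t - 1) + causal_conv h t + b"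
    using assms(2) by (auto simp: adjoint_solutions_def)
  have "g t + h t = A *v (g (t - 1) + h (t - 1)) + causal_conv (\<lambda>t. g t + h t) t + (a + b)" if "t \<in> {1..T}" for t
  proof -
    have "g t = A *v g (t - 1) + causal_conv g t + a" "h t = A *v h (t - 1) + causal_conv h t + b" using g(3) h(3) that by blast+
    then show ?thesis unfolding mv.add_right causal_conv_add[OF g(1) h(1)] by (simp add: algebra_simps)
  qed
  moreover have "\<forall>t\<in>{0..T}. B *v (g t + h t) = 0" using g(2) h(2) by (simp add: mv.add_right)
  ultimately show ?thesis unfolding adjoint_solutions_def using continuous_on_add[OF g(1) h(1)] by blast
qed

lemma adjoint_solutions_smult:
  assumes "g \<in> adjoint_solutions T" shows "(\<lambda>t. c *s g t) \<in> adjoint_solutions T"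
proof -
  obtain a where g: "continuous_on UNIV g" "\<forall>t\<in>{0..T}. B *v g t = 0" "\<forall>t\<in>{1..T}. g t = A *v g (t - 1) + causal_conv g t + a"
    using assms(1) by (auto simp: adjoint_solutions_def)
  have "c *s g t = A *v (c *s g (t - 1)) + causal_conv (\<lambda>t. c *s g t) t + c *s a" if "t \<in> {1..T}" for t
  proof -
    have "g t = A *v g (t - 1) + causal_conv g t + a" using g(3) that by blast
    then have "c *s g t = c *s (A *v g (t - 1) + causal_conv g t + a)" by simp
    then show ?thesis unfolding mv_scaleC causal_conv_smult[OF g(1)] vector_add_ldistrib .
  qed
  moreover have "\<forall>t\<in>{0..T}. B *v (c *s g t) = 0" using g(2) by (simp add: mv_scaleC)
  ultimately show ?thesis unfolding adjoint_solutions_def using continuous_smult[OF g(1)] by blast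
qed

lemma adjoint_solutions_zero: "(\<lambda>t. 0) \<in> adjoint_solutions T"
  unfolding adjoint_solutions_def by (auto simp: causal_conv_def)

lemma adjoint_solutions_sum: "finite I \<Longrightarrow> (\<And>i. i \<in> I \<Longrightarrow> g i \<in> adjoint_solutions T) \<Longrightarrow> (\<lambda>t. \<Sum>i\<in>I. g i t) \<in> adjoint_solutions T"
  by (induction I rule: finite_induct) (auto intro: adjoint_solutions_zero adjoint_solutions_add)

lemma adjoint_solutions_restrict: "T' \<le> T \<Longrightarrow> adjoint_solutions T \<subseteq> adjoint_solutions T'"
  unfolding adjoint_solutions_def by force

text \<open>Split the integral at \<epsilon>. On [0, \<epsilon>] the kernel argument is at least t
  \<ge> 1, where the kernel is constant, so this piece does not depend on t and joins the additive
  constant.\<close>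

lemma causal_conv_shift:
  assumes g: "continuous_on UNIV g" and t: "t \<ge> 1" and e: "\<epsilon> \<ge> 0"
  shows "causal_conv g (t + \<epsilon>) = causal_conv (\<lambda>s. g (s + \<epsilon>)) t + (LINT \<theta>|lborel. a3 \<theta>) *v (LINT s|lborel. indicator {0..\<epsilon>} s *\<^sub>R g s)"
proof -
  have gs: "continuous_on UNIV (\<lambda>s. g (s + \<epsilon>))" by (rule continuous_on_compose2[OF g]) (auto intro!: continuous_intros)
  define P where "P s = indicat_real {\<epsilon>..t + \<epsilon>} s *\<^sub>R (delay_kernel (t + \<epsilon> - s) *v g s)" for s
  define Q where "Q s = indicat_real {0..\<epsilon>} s *\<^sub>R ((LINT \<theta>|lborel. a3 \<theta>) *v g s)" for s
  have Ps: "P (s + \<epsilon>) = indicat_real {0..t} s *\<^sub>R (delay_kernel (t - s) *v g (s + \<epsilon>))" for s by (auto simp: P_def indicator_def)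
  have Pi: "integrable lborel P"
    using int_shift[of "\<lambda>s. P (s + \<epsilon>)" "-\<epsilon>"] causal_conv_integrable[OF gs, of t] unfolding Ps[symmetric] by simp
  have gi: "integrable lborel (\<lambda>s. indicat_real {0..\<epsilon>} s *\<^sub>R g s)"
    using borel_integrable_atLeastAtMost'[OF continuous_on_subset[OF g], of 0 \<epsilon>] by (simp add: set_integrable_def)
  have Qe: "Q s = (LINT \<theta>|lborel. a3 \<theta>) *v (indicat_real {0..\<epsilon>} s *\<^sub>R g s)" for s by (simp add: Q_def mv.scaleR_right)
  have Qi: "integrable lborel Q" unfolding Qe[abs_def] by (rule integrable_bounded_linear[OF blin_mv gi])
  have "causal_conv g (t + \<epsilon>) = (LINT s|lborel. P s + Q s)"
    unfolding causal_conv_def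
  proof (rule integral_cong_AE)
    show "AE s in lborel. indicat_real {0..t + \<epsilon>} s *\<^sub>R (delay_kernel (t + \<epsilon> - s) *v g s) = P s + Q s"
      using AE_lborel_singleton[of \<epsilon>]
    proof eventually_elim
      case (elim s)
      consider "s < 0" | "0 \<le> s \<and> s < \<epsilon>" | "s > \<epsilon>" using elim by linarith
      then show ?case
      proof cases
        case 2
        then have "delay_kernel (t + \<epsilon> - s) = (LINT \<theta>|lborel. a3 \<theta>)" using t by (intro delay_kernel_const) auto
        then show ?thesis using 2 t by (simp add: P_def Q_def)
      qed (use e in \<open>auto simp: P_def Q_def indicator_def\<close>)
    qed
  qed (intro borel_measurable_integrable causal_conv_integrable g Pi Qi Bochner_Integration.integrable_add)+
  also have "\<dots> = (LINT s|lborel. P s) + (LINT s|lborel. Q s)" by (rule Bochner_Integration.integral_add[OF Pi Qi])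
  also have "(LINT s|lborel. P s) = causal_conv (\<lambda>s. g (s + \<epsilon>)) t"
    using lint_shift[of P \<epsilon>] unfolding causal_conv_def Ps by simp
  also have "(LINT s|lborel. Q s) = (LINT \<theta>|lborel. a3 \<theta>) *v (LINT s|lborel. indicator {0..\<epsilon>} s *\<^sub>R g s)"
    unfolding Qe by (rule integral_bounded_linear[OF blin_mv gi])
  finally show ?thesis .
qed

lemma adjoint_solutions_shift:
  assumes "g \<in> adjoint_solutions T" "\<epsilon> \<ge> 0" shows "(\<lambda>t. g (t + \<epsilon>)) \<in> adjoint_solutions (T - \<epsilon>)"
proof -
  obtain a where g: "continuous_on UNIV g" "\<forall>t\<in>{0..T}. B *v g t = 0" "\<forall>t\<in>{1..T}. g t = A *v g (t - 1) + causal_conv g t + a"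
    using assms(1) by (auto simp: adjoint_solutions_def)
  have gs: "continuous_on UNIV (\<lambda>s. g (s + \<epsilon>))" by (rule continuous_on_compose2[OF g(1)]) (auto intro!: continuous_intros)
  let ?b = "(LINT \<theta>|lborel. a3 \<theta>) *v (LINT s|lborel. indicator {0..\<epsilon>} s *\<^sub>R g s) + a"
  have "g (t + \<epsilon>) = A *v g (t - 1 + \<epsilon>) + causal_conv (\<lambda>s. g (s + \<epsilon>)) t + ?b" if "t \<in> {1..T - \<epsilon>}" for t
    using g(3)[rule_format, of "t + \<epsilon>"] that assms(2) causal_conv_shift[OF g(1), of t \<epsilon>] by (simp add: algebra_simps)
  then show ?thesis unfolding adjoint_solutions_def using gs g(2) assms(2) by auto
qed

end

section \<open>Exponential solutions of the adjoint equation\<close>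

text \<open>Not divided by \<epsilon>, so that its derivative is exactly
  \<open>forward_difference\<close>.\<close>

definition forward_integral :: "real \<Rightarrow> (real \<Rightarrow> 'a::euclidean_space) \<Rightarrow> real \<Rightarrow> 'a" where
  "forward_integral \<epsilon> g t = (LINT \<sigma>|lborel. indicator {0..\<epsilon>} \<sigma> *\<^sub>R g (t + \<sigma>))"

definition forward_difference :: "real \<Rightarrow> (real \<Rightarrow> 'a::euclidean_space) \<Rightarrow> real \<Rightarrow> 'a" where
  "forward_difference \<epsilon> g t = g (t + \<epsilon>) - g t"

lemma continuous_translate: "continuous_on UNIV g \<Longrightarrow> continuous_on UNIV (\<lambda>s::real. g (s + a))"
  by (rule continuous_on_compose2[of UNIV g]) (auto intro!: continuous_intros)

lemma continuous_interval_integrable: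
  fixes g :: "real \<Rightarrow> 'a::euclidean_space"
  assumes "continuous_on UNIV g" shows "integrable lborel (\<lambda>s. indicat_real {a..b} s *\<^sub>R g s)"
  using borel_integrable_atLeastAtMost'[OF continuous_on_subset[OF assms], of a b] by (simp add: set_integrable_def)

lemma forward_integral_integrable:
  fixes g :: "real \<Rightarrow> 'a::euclidean_space"
  assumes "continuous_on UNIV g" shows "integrable lborel (\<lambda>\<sigma>. indicat_real {0..\<epsilon>} \<sigma> *\<^sub>R g (t + \<sigma>))"
  using continuous_interval_integrable[OF continuous_translate[OF assms, of t]] by (simp add: add.commute)

lemma forward_integral_integral:
  assumes g: "continuous_on UNIV g" shows "forward_integral \<epsilon> g t = integral {t..t + \<epsilon>} g"
proof -
  have "forward_integral \<epsilon> g t = (LINT s|lborel. indicat_real {t..t + \<epsilon>} (s + t) *\<^sub>R g (s + t))"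
    unfolding forward_integral_def by (rule Bochner_Integration.integral_cong) (auto simp: indicator_def add.commute)
  also have "\<dots> = (LINT s:{t..t + \<epsilon>}|lborel. g s)"
    unfolding set_lebesgue_integral_def by (rule lint_shift)
  also have "\<dots> = integral {t..t + \<epsilon>} g"
    by (rule set_borel_integral_eq_integral(2)[OF borel_integrable_atLeastAtMost'[OF continuous_on_subset[OF g]]]) simp
  finally show ?thesis .
qed

lemma forward_integral_deriv:
  assumes g: "continuous_on UNIV g" and e: "\<epsilon> \<ge> 0"
  shows "(forward_integral \<epsilon> g has_vector_derivative forward_difference \<epsilon> g t) (at t)"
proof -
  define a b where "a = t - 1" and "b = t + \<epsilon> + 1"
  have "continuous_on {a..b} g" by (rule continuous_on_subset[OF g]) simp
  from antiderivative_continuous[OF this] obtain \<Gamma> where \<Gamma>: "\<And>x. x \<in> {a..b} \<Longrightarrow> (\<Gamma> has_vector_derivative g x) (at x within {a..b})" by blast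
  have \<Gamma>': "(\<Gamma> has_vector_derivative g x) (at x)" if "a < x" "x < b" for x
    using \<Gamma>[of x] that at_within_Icc_at[of a x b] by simp
  have eq: "forward_integral \<epsilon> g u = \<Gamma> (u + \<epsilon>) - \<Gamma> u" if u: "u \<in> {t - 1<..<t + 1}" for u
  proof -
    have "(g has_integral \<Gamma> (u + \<epsilon>) - \<Gamma> u) {u..u + \<epsilon>}"
    proof (rule fundamental_theorem_of_calculus)
      fix x assume "x \<in> {u..u + \<epsilon>}"
      then have "a < x" "x < b" using u by (auto simp: a_def b_def)
      then show "(\<Gamma> has_vector_derivative g x) (at x within {u..u + \<epsilon>})"
        using \<Gamma>' has_vector_derivative_at_within by blast
    qed (use e in simp)
    then show ?thesis using forward_integral_integral[OF g] integral_unique by metis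
  qed
  have "((\<Gamma> \<circ> (\<lambda>u. u + \<epsilon>)) has_vector_derivative 1 *\<^sub>R g (t + \<epsilon>)) (at t)"
    by (rule vector_diff_chain_at) (use e in \<open>auto intro!: derivative_eq_intros \<Gamma>' simp: a_def b_def\<close>)
  then have "((\<lambda>u. \<Gamma> (u + \<epsilon>) - \<Gamma> u) has_vector_derivative g (t + \<epsilon>) - g t) (at t)"
    by (intro has_vector_derivative_diff \<Gamma>') (use e in \<open>auto simp: o_def a_def b_def\<close>)
  then show ?thesis unfolding forward_difference_def
    by (rule has_vector_derivative_transform_within_open[where S="{t - 1<..<t + 1}"]) (auto simp: eq)
qed

lemma forward_integral_continuous: "continuous_on UNIV g \<Longrightarrow> \<epsilon> \<ge> 0 \<Longrightarrow> continuous_on UNIV (forward_integral \<epsilon> g)"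
  by (rule continuous_at_imp_continuous_on) (blast intro: has_vector_derivative_continuous forward_integral_deriv)

lemma forward_difference_continuous: "continuous_on UNIV g \<Longrightarrow> continuous_on UNIV (forward_difference \<epsilon> g)"
  unfolding forward_difference_def[abs_def] by (intro continuous_intros continuous_translate)

lemma forward_integral_forward_difference: "continuous_on UNIV g \<Longrightarrow> forward_integral \<epsilon> (forward_difference \<epsilon> g) = forward_difference \<epsilon> (forward_integral \<epsilon> g)"
proof
  fix t assume g: "continuous_on UNIV g"
  have "forward_integral \<epsilon> (forward_difference \<epsilon> g) t = (LINT \<sigma>|lborel. indicat_real {0..\<epsilon>} \<sigma> *\<^sub>R g (t + \<epsilon> + \<sigma>) - indicat_real {0..\<epsilon>} \<sigma> *\<^sub>R g (t + \<sigma>))"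
    unfolding forward_integral_def forward_difference_def by (simp add: scaleR_diff_right algebra_simps)
  also have "\<dots> = forward_difference \<epsilon> (forward_integral \<epsilon> g) t"
    unfolding forward_integral_def forward_difference_def by (rule Bochner_Integration.integral_diff[OF forward_integral_integrable[OF g] forward_integral_integrable[OF g]])
  finally show "forward_integral \<epsilon> (forward_difference \<epsilon> g) t = forward_difference \<epsilon> (forward_integral \<epsilon> g) t" .
qed

lemma forward_integral_pow_continuous: "continuous_on UNIV g \<Longrightarrow> \<epsilon> \<ge> 0 \<Longrightarrow> continuous_on UNIV ((forward_integral \<epsilon> ^^ k) g)"
  by (induction k) (auto intro: forward_integral_continuous)
lemma forward_difference_pow_continuous: "continuous_on UNIV g \<Longrightarrow> continuous_on UNIV ((forward_difference \<epsilon> ^^ k) g)"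
  by (induction k) (auto intro: forward_difference_continuous)
lemma forward_integral_pow_forward_difference: "continuous_on UNIV g \<Longrightarrow> \<epsilon> \<ge> 0 \<Longrightarrow> (forward_integral \<epsilon> ^^ k) (forward_difference \<epsilon> g) = forward_difference \<epsilon> ((forward_integral \<epsilon> ^^ k) g)"
  by (induction k) (auto simp: forward_integral_forward_difference forward_integral_pow_continuous)

text \<open>A lower bound for the component in direction \<open>v\<close> survives each integration
  with a factor \<epsilon>; this keeps the smoothed solution from vanishing.\<close>

lemma forward_integral_pow_positive:
  assumes g: "continuous_on UNIV g" and e: "\<epsilon> \<ge> 0" and p: "\<And>t. t \<in> {t0..t1} \<Longrightarrow> c \<le> inner (g t) v"
    and t: "t \<ge> t0" "t + real k * \<epsilon> \<le> t1"
  shows "\<epsilon> ^ k * c \<le> inner ((forward_integral \<epsilon> ^^ k) g t) v"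
  using t
proof (induction k arbitrary: t)
  case (Suc k)
  let ?f = "(forward_integral \<epsilon> ^^ k) g"
  have f: "continuous_on UNIV ?f" by (rule forward_integral_pow_continuous[OF g e])
  have i: "integrable lborel (\<lambda>\<sigma>. indicat_real {0..\<epsilon>} \<sigma> *\<^sub>R ?f (t + \<sigma>))" by (rule forward_integral_integrable[OF f])
  have "\<epsilon> ^ Suc k * c = (LINT \<sigma>|lborel. indicat_real {0..\<epsilon>} \<sigma> *\<^sub>R (\<epsilon> ^ k * c))"
    using e by simp
  also have "\<dots> \<le> (LINT \<sigma>|lborel. inner (indicat_real {0..\<epsilon>} \<sigma> *\<^sub>R ?f (t + \<sigma>)) v)"
  proof (rule integral_mono)
    show "integrable lborel (\<lambda>\<sigma>. indicat_real {0..\<epsilon>} \<sigma> *\<^sub>R (\<epsilon> ^ k * c))"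
      by (rule continuous_interval_integrable) simp
    show "integrable lborel (\<lambda>\<sigma>. inner (indicat_real {0..\<epsilon>} \<sigma> *\<^sub>R ?f (t + \<sigma>)) v)" by (rule integrable_inner_left) (rule i)
    show "indicat_real {0..\<epsilon>} \<sigma> *\<^sub>R (\<epsilon> ^ k * c) \<le> inner (indicat_real {0..\<epsilon>} \<sigma> *\<^sub>R ?f (t + \<sigma>)) v" for \<sigma>
      using Suc.IH[of "t + \<sigma>"] Suc.prems by (auto simp: indicator_def algebra_simps)
  qed
  also have "\<dots> = inner (forward_integral \<epsilon> ?f t) v" unfolding forward_integral_def[of \<epsilon> ?f t] by (rule integral_inner_left) (rule i)
  finally show ?case by simp
qed (use p in auto)

section \<open>Smoothing and differencing solutions\<close>

context adjoint_system
begin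

text \<open>Integrate the equation at t + \<sigma> over \<sigma> in [0, \<epsilon>]. Fubini moves
  the integral inside the convolution, and the constants produced by the individual shifts integrate
  to a new constant.\<close>

lemma adjoint_solutions_forward_integral:
  assumes "g \<in> adjoint_solutions T" "\<epsilon> \<ge> 0" shows "forward_integral \<epsilon> g \<in> adjoint_solutions (T - \<epsilon>)"
proof -
  obtain a where g: "continuous_on UNIV g" "\<forall>t\<in>{0..T}. B *v g t = 0" "\<forall>t\<in>{1..T}. g t = A *v g (t - 1) + causal_conv g t + a"
    using assms(1) by (auto simp: adjoint_solutions_def)
  note [measurable] = continuous_borel[OF g(1)]
  let ?I = "indicat_real {0..\<epsilon>}"
  let ?K = "LINT \<theta>|lborel. a3 \<theta>"
  have fub: "(LINT \<sigma>|lborel. ?I \<sigma> *\<^sub>R causal_conv (\<lambda>s. g (s + \<sigma>)) t) = causal_conv (forward_integral \<epsilon> g) t"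
    "integrable lborel (\<lambda>\<sigma>. ?I \<sigma> *\<^sub>R causal_conv (\<lambda>s. g (s + \<sigma>)) t)" if t: "t \<ge> 0" for t
  proof -
    note [measurable] = l2f_meas[OF l2f_delay_kernel_on, of t]
    define F where "F \<sigma> s = delay_kernel_on t (t - s) *v ((indicat_real {0..t} s * ?I \<sigma>) *\<^sub>R g (s + \<sigma>))" for \<sigma> s
    have "compact (g ` {0..t + \<epsilon>})" by (intro compact_continuous_image continuous_on_subset[OF g(1)]) auto
    from compact_imp_bounded[OF this] obtain Bd where Bd: "\<forall>y\<in>g ` {0..t + \<epsilon>}. norm y \<le> Bd" unfolding bounded_iff by blast
    have Bd0: "Bd \<ge> 0" using Bd t assms(2) norm_ge_zero[of "g 0"] by (meson atLeastAtMost_iff add_nonneg_nonneg image_eqI order_refl order_trans)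
    have Fb: "norm (F \<sigma> s) \<le> ?I \<sigma> * (Bd * norm (indicat_real {0..t} s *\<^sub>R delay_kernel_on t (t - s)))" for \<sigma> s
    proof (cases "s \<in> {0..t} \<and> \<sigma> \<in> {0..\<epsilon>}")
      case True
      then have "norm (g (s + \<sigma>)) \<le> Bd" using Bd by (intro bspec[OF Bd]) auto
      then have "norm (delay_kernel_on t (t - s)) * norm (g (s + \<sigma>)) \<le> norm (delay_kernel_on t (t - s)) * Bd" by (intro mult_left_mono) auto
      then show ?thesis using True norm_mv_le[of "delay_kernel_on t (t - s)" "g (s + \<sigma>)"] by (simp add: F_def mult.commute)
    qed (auto simp: F_def)
    have Ii: "integrable lborel (\<lambda>\<sigma>. ?I \<sigma> * x)" for x :: real
      using continuous_interval_integrable[of "\<lambda>_. x" 0 \<epsilon>] by simp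
    have Fi: "integrable lborel (\<lambda>\<sigma>. F \<sigma> s)" for s
    proof (rule Bochner_Integration.integrable_bound[OF Ii[of "Bd * norm (indicat_real {0..t} s *\<^sub>R delay_kernel_on t (t - s))"]])
      show "(\<lambda>\<sigma>. F \<sigma> s) \<in> borel_measurable lborel" unfolding F_def by measurable
      show "AE \<sigma> in lborel. norm (F \<sigma> s) \<le> norm (?I \<sigma> * (Bd * norm (indicat_real {0..t} s *\<^sub>R delay_kernel_on t (t - s))))"
        using Fb[of _ s] by (auto intro: order_trans[OF _ abs_ge_self])
    qed
    have m: "(\<lambda>z. F (fst z) (snd z)) \<in> borel_measurable borel"
      unfolding F_def borel_prod[symmetric] by measurable
    have b: "(LINT \<sigma>|lborel. norm (F \<sigma> s)) \<le> \<epsilon> * (Bd * norm (indicat_real {0..t} s *\<^sub>R delay_kernel_on t (t - s)))" for s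
    proof -
      have "(LINT \<sigma>|lborel. norm (F \<sigma> s)) \<le> (LINT \<sigma>|lborel. ?I \<sigma> * (Bd * norm (indicat_real {0..t} s *\<^sub>R delay_kernel_on t (t - s))))"
        by (intro integral_mono integrable_norm Fi Ii Fb)
      also have "\<dots> = \<epsilon> * (Bd * norm (indicat_real {0..t} s *\<^sub>R delay_kernel_on t (t - s)))" using assms(2) by simp
      finally show ?thesis .
    qed
    have G: "integrable lborel (\<lambda>s. \<epsilon> * (Bd * norm (indicat_real {0..t} s *\<^sub>R delay_kernel_on t (t - s))))"
      by (intro integrable_mult_right integrable_norm l2f_integrable_interval l2f_reflect l2f_delay_kernel_on)
    have e1: "(LINT s|lborel. F \<sigma> s) = ?I \<sigma> *\<^sub>R causal_conv (\<lambda>s. g (s + \<sigma>)) t" for \<sigma>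
    proof -
      have "(LINT s|lborel. F \<sigma> s) = (LINT s|lborel. ?I \<sigma> *\<^sub>R (indicator {0..t} s *\<^sub>R (delay_kernel (t - s) *v g (s + \<sigma>))))"
        by (rule Bochner_Integration.integral_cong) (auto simp: F_def delay_kernel_on_def indicator_def)
      also have "\<dots> = ?I \<sigma> *\<^sub>R causal_conv (\<lambda>s. g (s + \<sigma>)) t" unfolding causal_conv_def by (rule integral_scaleR_right)
      finally show ?thesis .
    qed
    have e2: "(LINT \<sigma>|lborel. F \<sigma> s) = indicator {0..t} s *\<^sub>R (delay_kernel (t - s) *v forward_integral \<epsilon> g s)" for s
    proof -
      have "(LINT \<sigma>|lborel. F \<sigma> s) = (LINT \<sigma>|lborel. (indicat_real {0..t} s *\<^sub>R delay_kernel (t - s)) *v (?I \<sigma> *\<^sub>R g (s + \<sigma>)))"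
        by (rule Bochner_Integration.integral_cong) (auto simp: F_def delay_kernel_on_def indicator_def)
      also have "\<dots> = (indicat_real {0..t} s *\<^sub>R delay_kernel (t - s)) *v forward_integral \<epsilon> g s"
        unfolding forward_integral_def by (rule integral_bounded_linear[OF blin_mv forward_integral_integrable[OF g(1)]])
      finally show ?thesis by (simp add: mv.scaleR_left)
    qed
    show "(LINT \<sigma>|lborel. ?I \<sigma> *\<^sub>R causal_conv (\<lambda>s. g (s + \<sigma>)) t) = causal_conv (forward_integral \<epsilon> g) t"
      using fubini_gen(1)[OF m Fi b G] unfolding e1 e2 by (simp add: causal_conv_def)
    show "integrable lborel (\<lambda>\<sigma>. ?I \<sigma> *\<^sub>R causal_conv (\<lambda>s. g (s + \<sigma>)) t)"
      using fubini_gen(3)[OF m Fi b G] unfolding e1 .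
  qed
  \<comment> \<open>Everything in the shifted equation that is independent of t.\<close>
  define \<rho> where "\<rho> \<sigma> = ?I \<sigma> *\<^sub>R (?K *v (LINT s|lborel. indicator {0..\<sigma>} s *\<^sub>R g s) + a)" for \<sigma>
  have eq: "forward_integral \<epsilon> g t = A *v forward_integral \<epsilon> g (t - 1) + causal_conv (forward_integral \<epsilon> g) t + (LINT \<sigma>|lborel. \<rho> \<sigma>)" if t: "t \<in> {1..T - \<epsilon>}" for t
  proof -
    have t0: "t \<ge> 0" using t by simp
    have r: "?I \<sigma> *\<^sub>R g (t + \<sigma>) = A *v (?I \<sigma> *\<^sub>R g (t - 1 + \<sigma>)) + ?I \<sigma> *\<^sub>R causal_conv (\<lambda>s. g (s + \<sigma>)) t + \<rho> \<sigma>" for \<sigma>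
    proof (cases "\<sigma> \<in> {0..\<epsilon>}")
      case True
      then have "t + \<sigma> \<in> {1..T}" using t by auto
      then have "g (t + \<sigma>) = A *v g (t + \<sigma> - 1) + causal_conv g (t + \<sigma>) + a" using g(3) by blast
      also have "causal_conv g (t + \<sigma>) = causal_conv (\<lambda>s. g (s + \<sigma>)) t + ?K *v (LINT s|lborel. indicator {0..\<sigma>} s *\<^sub>R g s)"
        by (rule causal_conv_shift[OF g(1)]) (use t True in auto)
      finally show ?thesis using True by (simp add: \<rho>_def algebra_simps)
    qed (simp add: \<rho>_def)
    have i1: "integrable lborel (\<lambda>\<sigma>. ?I \<sigma> *\<^sub>R g (x + \<sigma>))" for x by (rule forward_integral_integrable[OF g(1)])
    have i2: "integrable lborel (\<lambda>\<sigma>. A *v (?I \<sigma> *\<^sub>R g (t - 1 + \<sigma>)))" by (rule integrable_bounded_linear[OF blin_mv i1])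
    have "\<rho> = (\<lambda>\<sigma>. ?I \<sigma> *\<^sub>R g (t + \<sigma>) - A *v (?I \<sigma> *\<^sub>R g (t - 1 + \<sigma>)) - ?I \<sigma> *\<^sub>R causal_conv (\<lambda>s. g (s + \<sigma>)) t)"
      using r by (auto simp: fun_eq_iff algebra_simps)
    then have i3: "integrable lborel \<rho>"
      using i1[of t] i2 fub(2)[OF t0] by (simp only: Bochner_Integration.integrable_diff)
    have "forward_integral \<epsilon> g t = (LINT \<sigma>|lborel. A *v (?I \<sigma> *\<^sub>R g (t - 1 + \<sigma>)) + ?I \<sigma> *\<^sub>R causal_conv (\<lambda>s. g (s + \<sigma>)) t + \<rho> \<sigma>)"
      unfolding forward_integral_def r[symmetric] ..
    also have "\<dots> = (LINT \<sigma>|lborel. A *v (?I \<sigma> *\<^sub>R g (t - 1 + \<sigma>))) + (LINT \<sigma>|lborel. ?I \<sigma> *\<^sub>R causal_conv (\<lambda>s. g (s + \<sigma>)) t) + (LINT \<sigma>|lborel. \<rho> \<sigma>)"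
      by (subst Bochner_Integration.integral_add[OF Bochner_Integration.integrable_add[OF i2 fub(2)[OF t0]] i3],
          subst Bochner_Integration.integral_add[OF i2 fub(2)[OF t0]]) (rule refl)
    also have "(LINT \<sigma>|lborel. A *v (?I \<sigma> *\<^sub>R g (t - 1 + \<sigma>))) = A *v forward_integral \<epsilon> g (t - 1)"
      unfolding forward_integral_def by (rule integral_bounded_linear[OF blin_mv i1])
    finally show ?thesis unfolding fub(1)[OF t0] .
  qed
  have "B *v forward_integral \<epsilon> g t = 0" if t: "t \<in> {0..T - \<epsilon>}" for t
  proof -
    have "B *v forward_integral \<epsilon> g t = (LINT \<sigma>|lborel. B *v (?I \<sigma> *\<^sub>R g (t + \<sigma>)))"
      unfolding forward_integral_def by (rule integral_bounded_linear[OF blin_mv forward_integral_integrable[OF g(1)], symmetric])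
    also have "\<dots> = (LINT \<sigma>|(lborel :: real measure). 0)"
      by (rule Bochner_Integration.integral_cong[OF refl]) (use g(2) t in \<open>auto simp: indicator_def\<close>)
    finally show ?thesis by simp
  qed
  then show ?thesis using eq forward_integral_continuous[OF g(1) assms(2)] unfolding adjoint_solutions_def by blast
qed

lemma adjoint_solutions_forward_difference:
  assumes "g \<in> adjoint_solutions T" "\<epsilon> \<ge> 0" shows "forward_difference \<epsilon> g \<in> adjoint_solutions (T - \<epsilon>)"
proof -
  have 1: "(\<lambda>t. g (t + \<epsilon>)) \<in> adjoint_solutions (T - \<epsilon>)" by (rule adjoint_solutions_shift[OF assms])
  have 2: "(\<lambda>t. (-1) *s g t) \<in> adjoint_solutions (T - \<epsilon>)"
    using adjoint_solutions_smult[OF assms(1), of "-1"] adjoint_solutions_restrict[of "T - \<epsilon>" T] assms(2) by auto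
  have "forward_difference \<epsilon> g = (\<lambda>t. g (t + \<epsilon>) + (-1) *s g t)" by (auto simp: forward_difference_def fun_eq_iff vec_eq_iff)
  then show ?thesis using adjoint_solutions_add[OF 1 2] by simp
qed

lemma adjoint_solutions_forward_difference_pow: "g \<in> adjoint_solutions T \<Longrightarrow> \<epsilon> \<ge> 0 \<Longrightarrow> (forward_difference \<epsilon> ^^ k) g \<in> adjoint_solutions (T - real k * \<epsilon>)"
proof (induction k)
  case (Suc k)
  have "forward_difference \<epsilon> ((forward_difference \<epsilon> ^^ k) g) \<in> adjoint_solutions (T - real k * \<epsilon> - \<epsilon>)" by (rule adjoint_solutions_forward_difference[OF Suc.IH[OF Suc.prems] Suc.prems(2)])
  moreover have "T - real k * \<epsilon> - \<epsilon> = T - real (Suc k) * \<epsilon>" by (simp add: algebra_simps)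
  ultimately show ?case by simp
qed simp

lemma adjoint_solutions_forward_integral_pow: "g \<in> adjoint_solutions T \<Longrightarrow> \<epsilon> \<ge> 0 \<Longrightarrow> (forward_integral \<epsilon> ^^ k) g \<in> adjoint_solutions (T - real k * \<epsilon>)"
proof (induction k)
  case (Suc k)
  have "forward_integral \<epsilon> ((forward_integral \<epsilon> ^^ k) g) \<in> adjoint_solutions (T - real k * \<epsilon> - \<epsilon>)" by (rule adjoint_solutions_forward_integral[OF Suc.IH[OF Suc.prems] Suc.prems(2)])
  moreover have "T - real k * \<epsilon> - \<epsilon> = T - real (Suc k) * \<epsilon>" by (simp add: algebra_simps)
  ultimately show ?case by simp
qed simp

lemma adjoint_solutions_cong:
  assumes "g \<in> adjoint_solutions T" "continuous_on UNIV h" "\<And>t. t \<in> {0..T} \<Longrightarrow> h t = g t" shows "h \<in> adjoint_solutions T"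
proof -
  obtain a where g: "\<forall>t\<in>{0..T}. B *v g t = 0" "\<forall>t\<in>{1..T}. g t = A *v g (t - 1) + causal_conv g t + a"
    using assms(1) by (auto simp: adjoint_solutions_def)
  have c: "causal_conv h t = causal_conv g t" if "t \<le> T" for t
    unfolding causal_conv_def by (rule Bochner_Integration.integral_cong[OF refl]) (use assms(3) that in \<open>auto simp: indicator_def\<close>)
  have "h t = A *v h (t - 1) + causal_conv h t + a" if "t \<in> {1..T}" for t
    using g(2)[rule_format, OF that] assms(3)[of t] assms(3)[of "t - 1"] c[of t] that by simp
  then show ?thesis unfolding adjoint_solutions_def using assms(2,3) g(1) by auto
qed

text \<open>The functions \<open>d 0, \<dots>, d N\<close> are too many to be independent on the grid, hence \<open>p(D) (d 0) = 0\<close> for some polynomial \<open>p\<close>.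
Peeling off the linear factors of \<open>p\<close> until the result vanishes leaves an eigenfunction of \<open>D\<close>.\<close>

lemma adjoint_solutions_chain_exponential:
  fixes d :: "nat \<Rightarrow> real \<Rightarrow> complex^'n"
  assumes F: "finite F" "\<And>g t. g \<in> adjoint_solutions T2 \<Longrightarrow> (\<And>t. t \<in> F \<Longrightarrow> g t = 0) \<Longrightarrow> t \<in> {0..T2} \<Longrightarrow> g t = 0"
    and N_def: "N = card (F \<times> (UNIV :: 'n set))"
    and dV: "\<And>k. k \<le> N \<Longrightarrow> d k \<in> adjoint_solutions T2"
    and dd: "\<And>k t. k < N \<Longrightarrow> (d k has_vector_derivative d (Suc k) t) (at t)"
    and ts2: "ts \<in> {0..T2}" and d0: "d 0 ts \<noteq> 0"
  shows "\<exists>l q. q \<noteq> 0 \<and> (\<lambda>t. exp (l * complex_of_real t) *s q) \<in> adjoint_solutions T2"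
proof -
  \<comment> \<open>\<open>comb p\<close> is p(D) applied to \<open>d 0\<close>, since
    \<open>d k\<close> is its k-th derivative.\<close>
  define comb where "comb p t = (\<Sum>k\<le>N. coeff p k *s d k t)" for p t
  have combV: "comb p \<in> adjoint_solutions T2" for p
    unfolding comb_def[abs_def] by (intro adjoint_solutions_sum adjoint_solutions_smult dV) auto
  define Z where "Z p \<longleftrightarrow> p \<noteq> 0 \<and> degree p \<le> N \<and> (\<forall>t\<in>{0..T2}. comb p t = 0)" for p
  have "\<exists>p. Z p"
  proof -
    \<comment> \<open>N + 1 unknown coefficients against N scalar conditions, one for each grid
      point and coordinate.\<close>
    have "card (F \<times> (UNIV :: 'n set)) < card {..N}" by (simp add: N_def)
    from homogeneous_system[OF _ _ this, of "\<lambda>i k. d k (fst i) $ snd i"] F(1)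
    obtain c where c: "\<exists>j\<in>{..N}. c j \<noteq> 0" "\<forall>i\<in>F \<times> UNIV. (\<Sum>j\<in>{..N}. d j (fst i) $ snd i * c j) = 0" by auto
    define p where "p = (\<Sum>k\<le>N. monom (c k) k)"
    have cp: "coeff p k = (if k \<le> N then c k else 0)" for k
      unfolding p_def coeff_sum by (simp add: coeff_monom)
    have "p \<noteq> 0"
    proof
      assume "p = 0"
      then have "coeff p k = 0" for k by simp
      then show False using c(1) cp by (metis atMost_iff)
    qed
    moreover have "degree p \<le> N" by (rule degree_le) (simp add: cp)
    moreover have "comb p t = 0" if "t \<in> {0..T2}" for t
    proof (rule F(2)[OF combV _ that])
      fix t assume "t \<in> F"
      then have "(\<Sum>j\<in>{..N}. d j t $ i * c j) = 0" for i using c(2) by force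
      then show "comb p t = 0" by (simp add: comb_def vec_eq_iff cp mult.commute)
    qed
    ultimately show ?thesis unfolding Z_def by blast
  qed
  \<comment> \<open>Minimal degree does the peeling in one go: dividing out a single linear factor
    must already leave a function that is not identically 0.\<close>
  then obtain p where Zp: "Z p" and pmin: "\<And>q. Z q \<Longrightarrow> degree p \<le> degree q"
    using ex_has_least_nat[of Z _ degree] by blast
  have "degree p \<noteq> 0"
  proof
    assume d0': "degree p = 0"
    then have "coeff p k = 0" if "k > 0" for k using that by (simp add: coeff_eq_0)
    then have "comb p ts = (\<Sum>k\<le>N. if k = 0 then coeff p 0 *s d 0 ts else 0)"
      unfolding comb_def by (intro sum.cong) auto
    then have "coeff p 0 *s d 0 ts = 0" using Zp ts2 by (simp add: Z_def)
    then have "coeff p 0 = 0" using d0 by (simp add: vector_mul_eq_0)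
    then show False using Zp d0' unfolding Z_def by (metis leading_coeff_0_iff)
  qed
  then have "\<not> constant (poly p)" by (simp add: constant_degree)
  then obtain l where l: "poly p l = 0" using fundamental_theorem_of_algebra by blast
  then obtain q where q: "p = [:- l, 1:] * q" by (auto simp: poly_eq_0_iff_dvd dvd_def)
  have q0: "q \<noteq> 0" using Zp q by (auto simp: Z_def)
  have dq: "degree p = Suc (degree q)" using q0 q degree_mult_eq[of "[:- l, 1:]" q] by simp
  define \<sigma> where "\<sigma> = comb q"
  have \<sigma>V: "\<sigma> \<in> adjoint_solutions T2" unfolding \<sigma>_def by (rule combV)
  have "\<not> Z q" using pmin[of q] dq by auto
  then obtain x where x: "x \<in> {0..T2}" "\<sigma> x \<noteq> 0" using q0 dq Zp unfolding Z_def \<sigma>_def by auto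
  \<comment> \<open>The quotient has degree below N, so differentiating its combination never calls
    for \<open>d (Suc N)\<close>.\<close>
  have qN: "coeff q N = 0" using dq Zp by (intro coeff_eq_0) (simp add: Z_def)
  have cpk: "coeff p k = (if k = 0 then 0 else coeff q (k - 1)) - l * coeff q k" for k
    unfolding q by (cases k) (simp_all add: coeff_pCons)
  have N0: "N > 0" using dq Zp by (simp add: Z_def)
  have der: "(\<sigma> has_vector_derivative l *s \<sigma> t) (at t)" if t: "t \<in> {0..T2}" for t
  proof -
    have "(\<sigma> has_vector_derivative (\<Sum>k<N. coeff q k *s d (Suc k) t)) (at t)"
    proof -
      have "\<sigma> = (\<lambda>t. \<Sum>k<N. coeff q k *s d k t)"
        unfolding \<sigma>_def comb_def[abs_def] by (rule ext, rule sum.mono_neutral_right) (auto simp: qN not_less le_antisym)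
      moreover have "((\<lambda>t. \<Sum>k<N. coeff q k *s d k t) has_vector_derivative (\<Sum>k<N. coeff q k *s d (Suc k) t)) (at t)"
        by (intro has_vector_derivative_sum bounded_linear.has_vector_derivative[OF vsmul_blin] dd) auto
      ultimately show ?thesis by simp
    qed
    moreover have "(\<Sum>k<N. coeff q k *s d (Suc k) t) = l *s \<sigma> t"
    proof -
      have "comb p t = (\<Sum>k\<le>N. (if k = 0 then 0 else coeff q (k - 1)) *s d k t) - l *s \<sigma> t"
        unfolding comb_def \<sigma>_def cpk by (simp add: vector_sub_rdistrib vec.scale_sum_right sum_subtractf vec.scale_left_diff_distrib)
      moreover have "(\<Sum>k\<le>N. (if k = 0 then 0 else coeff q (k - 1)) *s d k t) = (\<Sum>k<N. coeff q k *s d (Suc k) t)"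
        unfolding lessThan_Suc_atMost[symmetric] sum.lessThan_Suc_shift by simp
      ultimately show ?thesis using Zp t by (simp add: Z_def)
    qed
    ultimately show ?thesis by simp
  qed
  \<comment> \<open>Integrating factor: \<open>w\<close> has derivative 0 on [0, T2].\<close>
  define w where "w t = exp (- l * complex_of_real t) *s \<sigma> t" for t
  have wd: "(w has_vector_derivative 0) (at t within {0..T2})" if t: "t \<in> {0..T2}" for t
    unfolding has_vector_derivative_def has_derivative_componentwise_within[where f=w]
  proof -
    have comp: "((\<lambda>t. w t $ i) has_vector_derivative 0) (at t)" for i
    proof -
      have "((\<lambda>z. exp (- l * z)) has_field_derivative exp (- l * complex_of_real t) * (- l)) (at (complex_of_real t))"
        by (auto intro!: derivative_eq_intros)
      from has_vector_derivative_real_field[OF this]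
      have e: "((\<lambda>t. exp (- l * complex_of_real t)) has_vector_derivative exp (- l * complex_of_real t) * (- l)) (at t)" .
      have s: "((\<lambda>t. \<sigma> t $ i) has_vector_derivative (l *s \<sigma> t) $ i) (at t)"
        by (rule bounded_linear.has_vector_derivative[OF bounded_linear_vec_nth der[OF t]])
      have "((\<lambda>t. exp (- l * complex_of_real t) * \<sigma> t $ i) has_vector_derivative
          exp (- l * complex_of_real t) * (l *s \<sigma> t) $ i + exp (- l * complex_of_real t) * (- l) * \<sigma> t $ i) (at t)"
        by (rule has_vector_derivative_mult[OF e s])
      then show ?thesis by (simp add: w_def)
    qed
    then have "\<forall>i. ((\<lambda>t. w t $ i) has_derivative (\<lambda>x. 0)) (at t within {0..T2})"
      by (auto simp: has_vector_derivative_def intro: has_derivative_at_withinI)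
    then show "\<forall>b\<in>Basis. ((\<lambda>x. w x \<bullet> b) has_derivative (\<lambda>x. (x *\<^sub>R 0) \<bullet> b)) (at t within {0..T2})"
      by (auto simp: Basis_vec_def inner_axis intro!: has_derivative_inner_left derivative_eq_intros)
  qed
  have w0: "w t = w 0" if t: "t \<in> {0..T2}" for t
  proof -
    obtain c where "\<And>t. t \<in> {0..T2} \<Longrightarrow> w t = c"
      using has_vector_derivative_zero_constant[of "{0..T2}" w] wd by auto
    then show ?thesis using t by auto
  qed
  have \<sigma>e: "\<sigma> t = exp (l * complex_of_real t) *s w 0" if t: "t \<in> {0..T2}" for t
  proof -
    have "exp (l * complex_of_real t) *s w t = \<sigma> t" by (simp add: w_def vector_smult_assoc exp_minus)
    then show ?thesis by (simp only: w0[OF t])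
  qed
  have "w 0 \<noteq> 0"
  proof
    assume "w 0 = 0"
    then have "\<sigma> x = exp (l * complex_of_real x) *s 0" using \<sigma>e[OF x(1)] by (simp only:)
    then show False using x(2) by (simp only: vector_smult_rzero simp_thms)
  qed
  moreover have "(\<lambda>t. exp (l * complex_of_real t) *s w 0) \<in> adjoint_solutions T2"
  proof (rule adjoint_solutions_cong[OF \<sigma>V])
    show "continuous_on UNIV (\<lambda>t. exp (l * complex_of_real t) *s w 0)"
      unfolding vector_scalar_mult_def by (intro continuous_on_vec_lambda continuous_intros)
    show "exp (l * complex_of_real t) *s w 0 = \<sigma> t" if "t \<in> {0..T2}" for t
      by (rule \<sigma>e[OF that, symmetric])
  qed
  ultimately show ?thesis by blast
qed

text \<open>Smoothing N times provides N derivatives: exchanging one integral mean for one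
  difference is a differentiation, which gives the chain \<open>d\<close>. The grid on the shorter
  interval [0, T2] fixes N first; then \<epsilon> is taken so small that N steps cost no more than T
  - T2.\<close>

lemma adjoint_solutions_exponential:
  assumes T: "T > real \<nu>" and g: "g \<in> adjoint_solutions T" and nz: "t \<in> {0..T}" "g t \<noteq> 0"
  shows "\<exists>T2 l q. T2 > real \<nu> \<and> q \<noteq> 0 \<and> (\<lambda>t. exp (l * complex_of_real t) *s q) \<in> adjoint_solutions T2"
proof -
  have gc: "continuous_on UNIV g" using g by (simp add: adjoint_solutions_def)
  have T0: "T > 0" using T \<nu>1 by linarith
  \<comment> \<open>A nonzero value strictly before \<open>T\<close>, so that there is room for
    means to the right.\<close>
  obtain ts where ts: "0 \<le> ts" "ts < T" "g ts \<noteq> 0"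
  proof (cases "t < T")
    case True then show ?thesis using that[of t] nz by auto
  next
    case False
    then have tT: "t = T" using nz by simp
    have "open {x. g x \<noteq> 0}" by (rule open_Collect_neq[OF gc]) simp
    moreover have "T \<in> {x. g x \<noteq> 0}" using nz tT by simp
    ultimately obtain e where e: "e > 0" "ball T e \<subseteq> {x. g x \<noteq> 0}" unfolding open_contains_ball by blast
    define x where "x = max 0 (T - e / 2)"
    have "x \<in> ball T e" using e(1) T0 by (auto simp: x_def dist_real_def)
    then show ?thesis using that[of x] e T0 by (auto simp: x_def)
  qed
  \<comment> \<open>Near ts the component of \<open>g\<close> along its own value there stays above
    half the squared norm, a bound that integral means preserve up to powers of \<epsilon>.\<close>
  define v where "v = g ts"
  define c0 where "c0 = inner v v / 2"
  have c0: "c0 > 0" "c0 < inner (g ts) v" using ts(3) by (auto simp: c0_def v_def)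
  have "open {x. c0 < inner (g x) v}" by (intro open_Collect_less continuous_intros gc)
  then obtain \<eta> where \<eta>: "\<eta> > 0" "ball ts \<eta> \<subseteq> {x. c0 < inner (g x) v}"
    using c0(2) unfolding open_contains_ball by blast
  have pos: "c0 \<le> inner (g x) v" if "x \<in> {ts..ts + \<eta> / 2}" for x
  proof -
    have "x \<in> ball ts \<eta>" using that \<eta>(1) by (auto simp: dist_real_def)
    then show ?thesis using \<eta>(2) by auto
  qed
  \<comment> \<open>Above \<nu> for the grid, above ts to keep the nonzero value, below
    \<open>T\<close> to leave length for smoothing.\<close>
  define T2 where "T2 = max ((T + real \<nu>) / 2) ((ts + T) / 2)"
  have T2: "T2 > real \<nu>" "T2 < T" "ts \<le> T2" using T ts unfolding T2_def by (simp_all add: less_max_iff_disj le_max_iff_disj)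
  obtain F where F: "finite F" "\<And>g t. g \<in> adjoint_solutions T2 \<Longrightarrow> (\<And>t. t \<in> F \<Longrightarrow> g t = 0) \<Longrightarrow> t \<in> {0..T2} \<Longrightarrow> g t = 0"
    using adjoint_solutions_grid[OF T2(1)] by metis
  define N where "N = card (F \<times> (UNIV :: 'n set))"
  define \<epsilon> where "\<epsilon> = min (T - T2) (\<eta> / 2) / (real N + 1)"
  have m0: "min (T - T2) (\<eta> / 2) > 0" using T2(2) \<eta>(1) by simp
  have \<epsilon>: "\<epsilon> > 0" unfolding \<epsilon>_def using m0 by (intro divide_pos_pos) auto
  have "real N * \<epsilon> \<le> (real N + 1) * \<epsilon>" using \<epsilon> by simp
  also have "(real N + 1) * \<epsilon> = min (T - T2) (\<eta> / 2)" unfolding \<epsilon>_def by simp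
  finally have N\<epsilon>: "real N * \<epsilon> \<le> T - T2" "real N * \<epsilon> \<le> \<eta> / 2" by simp_all
  define d where "d k = (forward_integral \<epsilon> ^^ (N - k)) ((forward_difference \<epsilon> ^^ k) g)" for k
  have dV: "d k \<in> adjoint_solutions T2" if "k \<le> N" for k
  proof -
    have "d k \<in> adjoint_solutions (T - real k * \<epsilon> - real (N - k) * \<epsilon>)"
      unfolding d_def using \<epsilon> by (intro adjoint_solutions_forward_integral_pow adjoint_solutions_forward_difference_pow g) auto
    moreover have "T - real k * \<epsilon> - real (N - k) * \<epsilon> = T - real N * \<epsilon>" using that by (simp add: of_nat_diff algebra_simps)
    ultimately show ?thesis using adjoint_solutions_restrict[of T2 "T - real N * \<epsilon>"] N\<epsilon>(1) by auto
  qed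
  have dd: "(d k has_vector_derivative d (Suc k) t) (at t)" if k: "k < N" for k t
  proof -
    let ?X = "(forward_difference \<epsilon> ^^ k) g"
    have Xc: "continuous_on UNIV ?X" by (rule forward_difference_pow_continuous[OF gc])
    have "N - k = Suc (N - Suc k)" using k by simp
    then have "d k = forward_integral \<epsilon> ((forward_integral \<epsilon> ^^ (N - Suc k)) ?X)" by (simp add: d_def)
    moreover have "d (Suc k) = forward_difference \<epsilon> ((forward_integral \<epsilon> ^^ (N - Suc k)) ?X)"
      using forward_integral_pow_forward_difference[OF Xc, of \<epsilon> "N - Suc k"] \<epsilon> by (simp add: d_def)
    ultimately show ?thesis using forward_integral_deriv[OF forward_integral_pow_continuous[OF Xc]] \<epsilon> by simp
  qed
  have d0: "d 0 ts \<noteq> 0"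
  proof -
    have "\<epsilon> ^ N * c0 \<le> inner (d 0 ts) v"
    proof -
      have e0: "\<epsilon> \<ge> 0" and le: "ts + real N * \<epsilon> \<le> ts + \<eta> / 2" using \<epsilon> N\<epsilon>(2) by linarith+
      have "\<epsilon> ^ N * c0 \<le> inner ((forward_integral \<epsilon> ^^ N) g ts) v"
        by (rule forward_integral_pow_positive[OF gc e0 pos order_refl le])
      then show ?thesis by (simp add: d_def)
    qed
    moreover have "\<epsilon> ^ N * c0 > 0" using \<epsilon> c0(1) by simp
    ultimately show ?thesis by auto
  qed
  have ts2: "ts \<in> {0..T2}" using ts T2 by simp
  have "\<exists>l q. q \<noteq> 0 \<and> (\<lambda>t. exp (l * complex_of_real t) *s q) \<in> adjoint_solutions T2"
  proof (rule adjoint_solutions_chain_exponential[where d=d and F=F and N=N and ts=ts])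
    show "\<And>g t. g \<in> adjoint_solutions T2 \<Longrightarrow> (\<And>t. t \<in> F \<Longrightarrow> g t = 0) \<Longrightarrow> t \<in> {0..T2} \<Longrightarrow> g t = 0" by (rule F(2))
    show "N = card (F \<times> (UNIV :: 'n set))" by (rule N_def)
    show "\<And>k. k \<le> N \<Longrightarrow> d k \<in> adjoint_solutions T2" by (rule dV)
    show "\<And>k t. k < N \<Longrightarrow> (d k has_vector_derivative d (Suc k) t) (at t)" by (rule dd)
  qed (fact F(1) ts2 d0)+
  then show ?thesis using T2(1) by blast
qed

end

section \<open>From solutions almost everywhere to continuous solutions\<close>

lemma full_measure_meets_interval:
  fixes a b :: real
  assumes "AE t in lborel. t \<in> D" "a < b" shows "\<exists>t\<in>{a..b}. t \<in> D"
proof (rule ccontr)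
  assume "\<not> (\<exists>t\<in>{a..b}. t \<in> D)"
  then have "AE t in lborel. t \<notin> {a..b}" using assms(1) by (auto elim!: eventually_mono)
  then have "{a..b} \<in> null_sets lborel" by (subst AE_iff_null_sets) auto
  then have "emeasure lborel {a..b} = 0" by auto
  then show False using assms(2) by simp
qed

lemma full_measure_dense_interval:
  fixes a b :: real
  assumes D: "AE t in lborel. t \<in> D" and ab: "a < b" shows "{a..b} \<subseteq> closure (D \<inter> {a..b})"
proof
  fix x assume x: "x \<in> {a..b}"
  have "\<exists>y\<in>D \<inter> {a..b}. dist y x < e" if e: "e > 0" for e
  proof -
    have "max a (x - e / 2) < min b (x + e / 2)" using x ab e by auto
    from full_measure_meets_interval[OF D this] obtain t where t: "t \<in> {max a (x - e / 2)..min b (x + e / 2)}" "t \<in> D" by blast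
    have "dist t x < e" using t(1) e by (auto simp: dist_real_def abs_less_iff)
    moreover have "t \<in> {a..b}" using t(1) by simp
    ultimately show ?thesis using t(2) by (intro bexI[of _ t]) simp_all
  qed
  then show "x \<in> closure (D \<inter> {a..b})" by (simp add: closure_approachable)
qed

text \<open>Intersect all integer translates: there are countably many, so the measure stays full
  while the set becomes invariant.\<close>

lemma integer_invariant_full_measure:
  assumes "AE t in lborel. P (t :: real)"
  shows "\<exists>D. (AE t in lborel. t \<in> D) \<and> (\<forall>t\<in>D. t + 1 \<in> D \<and> t - 1 \<in> D) \<and> (\<forall>t\<in>D. P t)"
proof (intro exI conjI ballI)
  let ?D = "{t. \<forall>m::int. P (t + of_int m)}"
  show "AE t in lborel. t \<in> ?D"
    unfolding mem_Collect_eq AE_all_countable by (intro allI AE_shift assms)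
  fix t assume t: "t \<in> ?D"
  have "P (t + 1 + of_int m)" "P (t - 1 + of_int m)" for m
    using t[simplified, rule_format, of "m + 1"] t[simplified, rule_format, of "m - 1"] by (simp_all add: algebra_simps)
  then show "t + 1 \<in> ?D" "t - 1 \<in> ?D" by simp_all
  show "P t" using t[simplified, rule_format, of 0] by simp
qed

context adjoint_system
begin

text \<open>The modulus bound holds pointwise on a shift invariant set of full measure, which is
  dense. There \<open>r\<close> is uniformly continuous, so it extends to the closure, and the
  equations follow by continuity.\<close>

lemma adjoint_solutions_of_AE:
  assumes T: "T > real \<nu>" and r: "l2f r" and sr: "\<And>t. t \<notin> {0..T} \<Longrightarrow> r t = 0" and nz: "\<not> (AE t in lborel. r t = 0)"
    and B0: "AE t in lborel. t \<in> {0..T} \<longrightarrow> B *v r t = 0"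
    and eq: "AE t in lborel. t \<in> {1..T} \<longrightarrow> r t = A *v r (t - 1) + convol (delay_kernel_on T) r t + a"
  shows "\<exists>g\<in>adjoint_solutions T. \<exists>t\<in>{0..T}. g t \<noteq> 0"
proof -
  have T1: "T > 1" using T \<nu>1 by linarith
  have "AE t in lborel. (t \<in> {0..T} \<longrightarrow> B *v r t = 0) \<and> (t \<in> {1..T} \<longrightarrow> r t = A *v r (t - 1) + convol (delay_kernel_on T) r t + a)"
    using B0 eq by eventually_elim blast
  from integer_invariant_full_measure[OF this] obtain D
    where D: "AE t in lborel. t \<in> D" and D1: "\<forall>t\<in>D. t + 1 \<in> D \<and> t - 1 \<in> D"
      and DB: "\<And>t. t \<in> D \<Longrightarrow> t \<in> {0..T} \<Longrightarrow> B *v r t = 0"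
      and De: "\<And>t. t \<in> D \<Longrightarrow> t \<in> {1..T} \<Longrightarrow> r t = A *v r (t - 1) + convol (delay_kernel_on T) r t + a" by auto
  have adj: "adjoint_eq_on D T a r" unfolding adjoint_eq_on_def using DB De by blast
  define E where "E = D \<inter> {0..T}"
  obtain C where C: "C \<ge> 0" and Cb: "\<forall>D a r s \<tau>. l2f r \<longrightarrow> adjoint_eq_on D T a r \<longrightarrow> (\<forall>t\<in>D. t + 1 \<in> D \<and> t - 1 \<in> D) \<longrightarrow> 0 \<le> \<tau> \<longrightarrow> \<tau> \<le> T - real \<nu> \<longrightarrow>
    s \<in> D \<longrightarrow> s + \<tau> \<in> D \<longrightarrow> 0 \<le> s \<longrightarrow> s + \<tau> \<le> T \<longrightarrow>
    norm (r (s + \<tau>) - r s) \<le> C * (norm (shift_l2 \<tau> (l2_class (delay_kernel_on T)) - l2_class (delay_kernel_on T)) * norm (l2_class r))"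
    using adjoint_modulus[OF T] by (elim exE conjE)
  have uc: "uniformly_continuous_on E r"
    unfolding uniformly_continuous_on_def
  proof (intro allI impI)
    fix e :: real assume e: "e > 0"
    define c where "c = C * norm (l2_class r) + 1"
    have c: "c > 0" using C unfolding c_def by (intro add_nonneg_pos mult_nonneg_nonneg) simp_all
    have "e / c > 0" using e c by simp
    from l2_shift_continuous[OF this, of "l2_class (delay_kernel_on T)"] obtain d
      where d: "d > 0" "\<forall>\<tau>. \<bar>\<tau>\<bar> < d \<longrightarrow> norm (shift_l2 \<tau> (l2_class (delay_kernel_on T)) - l2_class (delay_kernel_on T)) < e / c" by (elim exE conjE)
    have key: "norm (r y - r x) < e" if xy: "x \<in> E" "y \<in> E" "x \<le> y" "y - x < min d (T - real \<nu>)" for x y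
    proof -
      have "norm (r (x + (y - x)) - r x) \<le> C * (norm (shift_l2 (y - x) (l2_class (delay_kernel_on T)) - l2_class (delay_kernel_on T)) * norm (l2_class r))"
        by (rule Cb[rule_format, where D=D and a=a, OF r adj]) (use D1 xy in \<open>simp_all add: E_def\<close>)
      also have "\<dots> \<le> C * (e / c * norm (l2_class r))"
      proof (intro mult_left_mono mult_right_mono C)
        have "\<bar>y - x\<bar> < d" using xy by simp
        then show "norm (shift_l2 (y - x) (l2_class (delay_kernel_on T)) - l2_class (delay_kernel_on T)) \<le> e / c" by (rule less_imp_le[OF d(2)[rule_format]])
      qed simp
      also have "\<dots> = e * (C * norm (l2_class r) / c)" by simp
      also have "\<dots> < e * 1" using e c by (intro mult_strict_left_mono) (simp_all add: c_def)
      finally show ?thesis by simp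
    qed
    show "\<exists>d>0. \<forall>x\<in>E. \<forall>x'\<in>E. dist x' x < d \<longrightarrow> dist (r x') (r x) < e"
    proof (intro exI conjI ballI impI)
      show "min d (T - real \<nu>) > 0" using d(1) T by simp
      fix x x' assume x: "x \<in> E" "x' \<in> E" and dx: "dist x' x < min d (T - real \<nu>)"
      show "dist (r x') (r x) < e"
      proof (cases "x \<le> x'")
        case True
        then have "x' - x < min d (T - real \<nu>)" using dx by (simp add: dist_real_def)
        then show ?thesis using key[OF x True] by (simp add: dist_norm)
      next
        case False
        then have le: "x' \<le> x" by simp
        have "x - x' < min d (T - real \<nu>)" using dx le by (simp add: dist_real_def)
        then show ?thesis using key[OF x(2,1) le] by (simp add: dist_norm norm_minus_commute)
      qed
    qed
  qed
  obtain g0 where g0: "uniformly_continuous_on (closure E) g0" "\<And>x. x \<in> E \<Longrightarrow> r x = g0 x"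
    using uniformly_continuous_on_extension_on_closure[OF uc] by metis
  have cl: "{0..T} \<subseteq> closure E" unfolding E_def by (rule full_measure_dense_interval[OF D]) (use T1 in simp)
  have cl1: "{1..T} \<subseteq> closure (D \<inter> {1..T})" by (rule full_measure_dense_interval[OF D T1])
  \<comment> \<open>Clamping the argument to [0, T] makes the extension continuous on the whole
    line.\<close>
  define g where "g t = g0 (max 0 (min T t))" for t
  have gc: "continuous_on UNIV g"
    unfolding g_def[abs_def]
    by (rule continuous_on_compose2[OF continuous_on_subset[OF uniformly_continuous_imp_continuous[OF g0(1)] cl]])
      (use T1 in \<open>auto intro!: continuous_intros\<close>)
  have gr: "g t = r t" if "t \<in> D" "t \<in> {0..T}" for t
    using g0(2)[of t] that by (simp add: g_def E_def)
  let ?r = "\<lambda>s. indicator {0..T} s *\<^sub>R g s"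
  have lr: "l2f ?r" by (rule l2f_continuous_interval[OF gc])
  have ae: "AE s in lborel. r s = ?r s"
    using D
  proof eventually_elim
    case (elim s)
    then show ?case using gr[of s] sr[of s] by (cases "s \<in> {0..T}") simp_all
  qed
  have cvr: "convol (delay_kernel_on T) r t = convol (delay_kernel_on T) ?r t" for t
    by (rule convol_cong_right[OF l2f_delay_kernel_on r lr ae])
  have cont: "continuous_on UNIV (\<lambda>t. g t - A *v g (t - 1) - convol (delay_kernel_on T) ?r t)"
  proof (intro continuous_on_diff gc convol_continuous[OF l2f_delay_kernel_on lr])
    have "continuous_on UNIV (\<lambda>t. g (t - 1))" using continuous_translate[OF gc, of "-1"] by simp
    then show "continuous_on UNIV (\<lambda>t. A *v g (t - 1))" by (rule bounded_linear.continuous_on[OF blin_mv])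
  qed
  have eqg: "g t - A *v g (t - 1) - convol (delay_kernel_on T) ?r t = a" if t: "t \<in> {1..T}" for t
  proof (rule continuous_constant_on_closure[where S="D \<inter> {1..T}"])
    show "t \<in> closure (D \<inter> {1..T})" using cl1 t by blast
    fix x assume x: "x \<in> D \<inter> {1..T}"
    then have "g x = r x" "g (x - 1) = r (x - 1)" using D1 by (auto intro!: gr)
    moreover have "r x = A *v r (x - 1) + convol (delay_kernel_on T) r x + a" by (rule De) (use x in auto)
    ultimately show "g x - A *v g (x - 1) - convol (delay_kernel_on T) ?r x = a" by (simp add: cvr)
  qed (rule continuous_on_subset[OF cont subset_UNIV])
  have Bg: "B *v g t = 0" if t: "t \<in> {0..T}" for t
  proof (rule continuous_constant_on_closure[where S=E])
    show "continuous_on (closure E) (\<lambda>t. B *v g t)"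
      by (rule bounded_linear.continuous_on[OF blin_mv continuous_on_subset[OF gc subset_UNIV]])
    show "t \<in> closure E" using cl t by blast
    show "B *v g x = 0" if "x \<in> E" for x using that DB[of x] gr[of x] by (simp add: E_def)
  qed
  have "g \<in> adjoint_solutions T"
    unfolding adjoint_solutions_def
  proof (intro CollectI conjI ballI exI[of _ a])
    fix t assume t: "t \<in> {1..T}"
    have "convol (delay_kernel_on T) ?r t = causal_conv g t" by (rule causal_conv_convol) (use t in simp)
    then show "g t = A *v g (t - 1) + causal_conv g t + a" using eqg[OF t] by (simp add: algebra_simps)
  qed (use gc Bg in auto)
  moreover have "\<exists>t\<in>{0..T}. g t \<noteq> 0"
  proof (rule ccontr)
    assume "\<not> (\<exists>t\<in>{0..T}. g t \<noteq> 0)"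
    then have z: "?r s = 0" for s by (cases "s \<in> {0..T}") auto
    have "AE s in lborel. r s = 0" using ae unfolding z .
    then show False using nz by contradiction
  qed
  ultimately show ?thesis by blast
qed

end

section \<open>Exponentials and the characteristic matrix\<close>

lemma bounded_linear_vsmul_left: "bounded_linear (\<lambda>c. c *s (q :: complex^'n))"
  by (rule bounded_linear_intro[where K="norm q"])
    (simp_all add: vec_eq_iff algebra_simps norm_vec_def flip: L2_set_right_distrib norm_mult, simp add: norm_mult L2_set_right_distrib)

text \<open>The antiderivative exp(l s) / l breaks down at l = 0. The identities recorded here hold
  in both cases and spare later arguments a case distinction.\<close>

lemma exp_primitive:
  fixes l :: complex
  shows "\<exists>\<Phi> :: real \<Rightarrow> complex. (\<forall>s. (\<Phi> has_vector_derivative exp (l * complex_of_real s)) (at s)) \<and>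
    (\<forall>s t. l * (\<Phi> t - \<Phi> s) = exp (l * complex_of_real t) - exp (l * complex_of_real s)) \<and>
    (\<forall>s t \<theta>. \<Phi> (t + \<theta>) - \<Phi> (s + \<theta>) = exp (l * complex_of_real \<theta>) * (\<Phi> t - \<Phi> s))"
proof (cases "l = 0")
  case True
  then show ?thesis
    by (intro exI[of _ complex_of_real]) (auto intro!: has_vector_derivative_eq_rhs[OF has_vector_derivative_of_real[OF DERIV_ident]] simp del: of_real_diff simp: )
next
  case False
  have d: "((\<lambda>s. exp (l * complex_of_real s) / l) has_vector_derivative exp (l * complex_of_real s)) (at s)" for s
  proof -
    have "((\<lambda>z. exp (l * z) / l) has_field_derivative exp (l * complex_of_real s)) (at (complex_of_real s))"
      using False by (auto intro!: derivative_eq_intros)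
    then show ?thesis using has_vector_derivative_real_field by blast
  qed
  show ?thesis
    by (rule exI[of _ "\<lambda>s. exp (l * complex_of_real s) / l"])
      (use False d in \<open>auto simp: field_simps simp flip: exp_add\<close>)
qed

lemma exp_moment:
  fixes M :: "real \<Rightarrow> complex^'n^'m"
  assumes M: "l2f (\<lambda>\<theta>. indicator {-1..0} \<theta> *\<^sub>R M \<theta>)"
  shows "(LINT \<theta>:{-1..0}|lborel. M \<theta> *v (exp (l * complex_of_real \<theta>) *s q)) $ i
    = (\<Sum>j\<in>UNIV. (LINT s:{-1..0}|lborel. exp (l * complex_of_real s) * M s $ i $ j) * q $ j)"
proof -
  let ?e = "\<lambda>s. exp (l * complex_of_real s)"
  have c: "continuous_on UNIV (\<lambda>\<theta>. ?e \<theta> *s (v :: complex^'n))" for v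
    by (rule bounded_linear.continuous_on[OF bounded_linear_vsmul_left]) (intro continuous_intros)
  have int: "integrable lborel (\<lambda>\<theta>. indicator {-1..0} \<theta> *\<^sub>R (M \<theta> *v (?e \<theta> *s v)))" for v
  proof -
    have "integrable lborel (\<lambda>\<theta>. (indicator {-1..0} \<theta> *\<^sub>R M \<theta>) *v (indicator {-1..0} \<theta> *\<^sub>R (?e \<theta> *s v)))"
      by (rule mv_integrable[OF M l2f_continuous_interval[OF c]])
    then show ?thesis
      by (rule Bochner_Integration.integrable_cong[THEN iffD1, rotated 2]) (auto simp: indicator_def)
  qed
  have ax: "(M \<theta> *v (?e \<theta> *s axis j 1)) $ i = ?e \<theta> * M \<theta> $ i $ j" for \<theta> j
    by (simp add: matrix_vector_mult_def axis_def if_distrib mult.commute cong: if_cong)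
  have inte: "integrable lborel (\<lambda>\<theta>. indicator {-1..0} \<theta> *\<^sub>R (?e \<theta> * M \<theta> $ i $ j))" for j
    using integrable_bounded_linear[OF bounded_linear_vec_nth int[of "axis j 1"], of i] by (simp add: ax)
  have "(LINT \<theta>:{-1..0}|lborel. M \<theta> *v (?e \<theta> *s q)) $ i
    = (LINT \<theta>|lborel. (indicator {-1..0} \<theta> *\<^sub>R (M \<theta> *v (?e \<theta> *s q))) $ i)"
    unfolding set_lebesgue_integral_def by (rule integral_bounded_linear[OF bounded_linear_vec_nth int, symmetric])
  also have "\<dots> = (LINT \<theta>|lborel. (\<Sum>j\<in>UNIV. (indicator {-1..0} \<theta> *\<^sub>R (?e \<theta> * M \<theta> $ i $ j)) * q $ j))"
    by (rule Bochner_Integration.integral_cong[OF refl])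
      (simp add: matrix_vector_mult_def scaleR_sum_right mult_ac)
  also have "\<dots> = (\<Sum>j\<in>UNIV. (LINT \<theta>|lborel. indicator {-1..0} \<theta> *\<^sub>R (?e \<theta> * M \<theta> $ i $ j)) * q $ j)"
    by (subst Bochner_Integration.integral_sum)
      (rule inte integrable_mult_left sum.cong refl Bochner_Integration.integral_mult_left)+
  finally show ?thesis unfolding set_lebesgue_integral_def .
qed

text \<open>Integrals of entries in \<open>Delta\<close> are regrouped into integrals of vectors,
  the form in which the delay terms of an exponential appear.\<close>

lemma Delta_mv:
  fixes A :: "complex^'n::finite^'n"
  assumes "l2f (\<lambda>\<theta>. indicator {-1..0} \<theta> *\<^sub>R A2 \<theta>)" "l2f (\<lambda>\<theta>. indicator {-1..0} \<theta> *\<^sub>R A3 \<theta>)"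
  shows "Delta A A2 A3 l *v q = l *s q - (l * exp (- l)) *s (A *v q)
    - l *s (LINT \<theta>:{-1..0}|lborel. A2 \<theta> *v (exp (l * complex_of_real \<theta>) *s q))
    - (LINT \<theta>:{-1..0}|lborel. A3 \<theta> *v (exp (l * complex_of_real \<theta>) *s q))"
  unfolding vec_eq_iff
proof (intro allI)
  fix i
  have "(\<Sum>j\<in>UNIV. (if i = j then l else 0) * q $ j) = l * q $ i"
    by (subst sum.remove[of _ i]) (auto intro: sum.neutral)
  then show "(Delta A A2 A3 l *v q) $ i = (l *s q - (l * exp (- l)) *s (A *v q)
    - l *s (LINT \<theta>:{-1..0}|lborel. A2 \<theta> *v (exp (l * complex_of_real \<theta>) *s q))
    - (LINT \<theta>:{-1..0}|lborel. A3 \<theta> *v (exp (l * complex_of_real \<theta>) *s q))) $ i"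
    unfolding vector_minus_component vector_smult_component exp_moment[OF assms(1)] exp_moment[OF assms(2)]
    by (simp add: Delta_def matrix_vector_mult_def left_diff_distrib sum_subtractf sum_distrib_left mult.assoc)
qed

context adjoint_system
begin

text \<open>Besides the terms of \<Delta>(l) q the equation contains the constant \<open>a\<close>
  and the value of the antiderivative at time 0. Subtracting the equation at time 1 removes both,
  and what remains is \<Phi> t - \<Phi> 1 times \<Delta>(l) q.\<close>

lemma adjoint_solutions_exponential_kernel:
  assumes T: "T > real \<nu>" and V: "(\<lambda>t. exp (l * complex_of_real t) *s q) \<in> adjoint_solutions T"
  shows "B *v q = 0" "Delta A A2 A3 l *v q = 0"
proof -
  let ?e = "\<lambda>t. exp (l * complex_of_real t)"
  have T1: "T > 1" using T \<nu>1 by linarith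
  obtain a where c: "continuous_on UNIV (\<lambda>t. ?e t *s q)" and b: "\<forall>t\<in>{0..T}. B *v (?e t *s q) = 0"
    and eq: "\<forall>t\<in>{1..T}. ?e t *s q = A *v (?e (t - 1) *s q) + causal_conv (\<lambda>t. ?e t *s q) t + a"
    using V by (auto simp: adjoint_solutions_def)
  show "B *v q = 0" using b[rule_format, of 0] T1 by simp
  obtain \<Phi> :: "real \<Rightarrow> complex" where \<Phi>d: "\<And>s. (\<Phi> has_vector_derivative ?e s) (at s)"
    and \<Phi>l: "\<And>s t. l * (\<Phi> t - \<Phi> s) = ?e t - ?e s"
    and \<Phi>s: "\<And>s t \<theta>. \<Phi> (t + \<theta>) - \<Phi> (s + \<theta>) = ?e \<theta> * (\<Phi> t - \<Phi> s)"
    using exp_primitive[of l] by blast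
  define f where "f s = indicat_real {0..T} s *\<^sub>R (?e s *s q)" for s
  have f: "l2f f" unfolding f_def by (rule l2f_continuous_interval[OF c])
  have sf: "t \<notin> {0..T} \<Longrightarrow> f t = 0" for t by (simp add: f_def)
  have zf: "primitive f x = (\<Phi> x - \<Phi> 0) *s q" if x: "x \<in> {0..T}" for x
  proof -
    have "primitive f x = (LINT s|lborel. indicator {0..x} s *\<^sub>R (?e s *s q))"
      unfolding primitive_def by (rule Bochner_Integration.integral_cong[OF refl]) (use x in \<open>auto simp: f_def indicator_def\<close>)
    also have "\<dots> = \<Phi> x *s q - \<Phi> 0 *s q"
    proof (rule integral_FTC_Icc)
      show "((\<lambda>x. \<Phi> x *s q) has_vector_derivative ?e s *s q) (at s within {0..x})" for s
        by (rule has_vector_derivative_at_within[OF bounded_linear.has_vector_derivative[OF bounded_linear_vsmul_left \<Phi>d]])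
    qed (use x c in \<open>auto intro: continuous_on_subset\<close>)
    finally show ?thesis by (simp add: vector_sub_rdistrib)
  qed
  define J2 where "J2 = (LINT \<theta>:{-1..0}|lborel. A2 \<theta> *v (?e \<theta> *s q))"
  define J3 where "J3 = (LINT \<theta>:{-1..0}|lborel. A3 \<theta> *v (?e \<theta> *s q))"
  define L3 where "L3 t = (LINT \<theta>:{-1..0}|lborel. A3 \<theta> *v primitive f (t + \<theta>))" for t
  have I3: "set_integrable lborel {-1..0} (\<lambda>\<theta>. A3 \<theta> *v primitive f (t + \<theta>))" for t
  proof -
    have "continuous_on UNIV (\<lambda>\<theta>. primitive f (\<theta> + t))"
      by (rule continuous_translate[OF primitive_continuous[OF f]]) (simp add: sf)
    then have cz: "continuous_on UNIV (\<lambda>\<theta>. primitive f (t + \<theta>))" by (simp add: add.commute)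
    have "integrable lborel (\<lambda>\<theta>. (indicator {-1..0} \<theta> *\<^sub>R A3 \<theta>) *v (indicator {-1..0} \<theta> *\<^sub>R primitive f (t + \<theta>)))"
      by (rule mv_integrable[OF A3 l2f_continuous_interval[OF cz]])
    then show ?thesis unfolding set_integrable_def
      by (rule Bochner_Integration.integrable_cong[THEN iffD1, rotated 2]) (auto simp: indicator_def)
  qed
  have smI: "(LINT \<theta>:{-1..0}|lborel. M \<theta> *v (c *s (?e \<theta> *s q))) = c *s (LINT \<theta>:{-1..0}|lborel. M \<theta> *v (?e \<theta> *s q))"
    if M: "l2f (\<lambda>\<theta>. indicator {-1..0} \<theta> *\<^sub>R M \<theta>)" for M :: "real \<Rightarrow> complex^'n^'n" and c
  proof -
    have "integrable lborel (\<lambda>\<theta>. (indicator {-1..0} \<theta> *\<^sub>R M \<theta>) *v (indicator {-1..0} \<theta> *\<^sub>R (?e \<theta> *s q)))"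
      by (rule mv_integrable[OF M l2f_continuous_interval[OF c]])
    then have i: "integrable lborel (\<lambda>\<theta>. indicator {-1..0} \<theta> *\<^sub>R (M \<theta> *v (?e \<theta> *s q)))"
      by (rule Bochner_Integration.integrable_cong[THEN iffD1, rotated 2]) (auto simp: indicator_def)
    show ?thesis unfolding set_lebesgue_integral_def mv_scaleC[of "M _" c] indicator_smul
      by (rule integral_bounded_linear[OF vsmul_blin i])
  qed
  have cct: "causal_conv (\<lambda>t. ?e t *s q) t = ?e t *s J2 + L3 t" if t: "t \<in> {1..T}" for t
  proof -
    have "causal_conv (\<lambda>t. ?e t *s q) t = convol (delay_kernel_on T) f t" unfolding f_def using causal_conv_convol[of t T] t by simp
    also have "\<dots> = (LINT \<theta>:{-1..0}|lborel. A2 \<theta> *v f (t + \<theta>)) + L3 t"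
      using Lop_kernel[of f T t] f sf t by (simp add: Lop_def L3_def)
    also have "(LINT \<theta>:{-1..0}|lborel. A2 \<theta> *v f (t + \<theta>)) = (LINT \<theta>:{-1..0}|lborel. A2 \<theta> *v (?e t *s (?e \<theta> *s q)))"
      unfolding set_lebesgue_integral_def
      by (rule Bochner_Integration.integral_cong[OF refl])
        (use t in \<open>auto simp: f_def indicator_def exp_add[symmetric] algebra_simps\<close>)
    also have "\<dots> = ?e t *s J2" unfolding J2_def by (rule smI[OF A2])
    finally show ?thesis .
  qed
  have L3d: "L3 t - L3 1 = (\<Phi> t - \<Phi> 1) *s J3" if t: "t \<in> {1..T}" for t
  proof -
    have "L3 t - L3 1 = (LINT \<theta>:{-1..0}|lborel. A3 \<theta> *v primitive f (t + \<theta>) - A3 \<theta> *v primitive f (1 + \<theta>))"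
      unfolding L3_def by (rule set_integral_diff(2)[OF I3 I3, symmetric])
    also have "\<dots> = (LINT \<theta>:{-1..0}|lborel. A3 \<theta> *v ((\<Phi> t - \<Phi> 1) *s (?e \<theta> *s q)))"
      unfolding set_lebesgue_integral_def
    proof (rule Bochner_Integration.integral_cong[OF refl])
      fix \<theta> :: real
      show "indicat_real {- 1..0} \<theta> *\<^sub>R (A3 \<theta> *v primitive f (t + \<theta>) - A3 \<theta> *v primitive f (1 + \<theta>))
        = indicat_real {- 1..0} \<theta> *\<^sub>R (A3 \<theta> *v ((\<Phi> t - \<Phi> 1) *s (?e \<theta> *s q)))"
      proof (cases "\<theta> \<in> {-1..0}")
        case True
        have "primitive f (t + \<theta>) - primitive f (1 + \<theta>) = (\<Phi> (t + \<theta>) - \<Phi> (1 + \<theta>)) *s q"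
          using True t T1 by (simp add: zf vector_sub_rdistrib)
        also have "\<dots> = (\<Phi> t - \<Phi> 1) *s (?e \<theta> *s q)" unfolding \<Phi>s by (simp add: mult.commute)
        finally show ?thesis by (simp add: mv.diff_right[symmetric])
      qed simp
    qed
    also have "\<dots> = (\<Phi> t - \<Phi> 1) *s J3" unfolding J3_def by (rule smI[OF A3])
    finally show ?thesis .
  qed
  have "(\<Phi> t - \<Phi> 1) *s (Delta A A2 A3 l *v q) = 0" if t: "t \<in> {1..T}" for t
  proof -
    have et: "?e (t - 1) = exp (- l) * ?e t" for t by (simp add: exp_add[symmetric] algebra_simps)
    have E: "?e s *s q = (exp (-l) * ?e s) *s (A *v q) + (?e s *s J2 + L3 s) + a" if "s \<in> {1..T}" for s
      using eq[rule_format, OF that] unfolding cct[OF that] et mv_scaleC .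
    have "?e t *s q - ?e 1 *s q = ((exp (-l) * ?e t) *s (A *v q) + (?e t *s J2 + L3 t) + a) - ((exp (-l) * ?e 1) *s (A *v q) + (?e 1 *s J2 + L3 1) + a)"
      using E[OF t] E[of 1] T1 by simp
    also have "\<dots> = ((exp (-l) * ?e t) *s (A *v q) - (exp (-l) * ?e 1) *s (A *v q)) + (?e t *s J2 - ?e 1 *s J2) + (L3 t - L3 1)"
      by simp
    finally have "(?e t - ?e 1) *s q = (exp (-l) * (?e t - ?e 1)) *s (A *v q) + (?e t - ?e 1) *s J2 + (\<Phi> t - \<Phi> 1) *s J3"
      unfolding L3d[OF t] by (simp add: vector_sub_rdistrib right_diff_distrib)
    \<comment> \<open>Writing differences of exponentials as l (\<Phi> t - \<Phi> 1) lets the common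
      factor be taken out also when l = 0.\<close>
    then have "(l * (\<Phi> t - \<Phi> 1)) *s q = (exp (-l) * (l * (\<Phi> t - \<Phi> 1))) *s (A *v q) + (l * (\<Phi> t - \<Phi> 1)) *s J2 + (\<Phi> t - \<Phi> 1) *s J3"
      unfolding \<Phi>l[of t 1] .
    then show ?thesis
      unfolding Delta_mv[OF A2 A3] J2_def[symmetric] J3_def[symmetric]
      by (simp add: vec_eq_iff algebra_simps)
  qed
  then have "\<Phi> t = \<Phi> 1 \<or> Delta A A2 A3 l *v q = 0" if "t \<in> {1..T}" for t
    using that by (simp add: vec.scale_eq_0_iff)
  then have alt: "(\<forall>t\<in>{1..T}. \<Phi> t = \<Phi> 1) \<or> Delta A A2 A3 l *v q = 0" by blast
  \<comment> \<open>For imaginary l \<noteq> 0 the function \<Phi> is periodic, so a single t may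
    fail; but \<Phi> is not constant on an interval, as its derivative never vanishes.\<close>
  have "\<not> (\<forall>t\<in>{1..T}. \<Phi> t = \<Phi> 1)"
  proof
    assume c1: "\<forall>t\<in>{1..T}. \<Phi> t = \<Phi> 1"
    have "((\<lambda>_. \<Phi> 1) has_vector_derivative ?e 1) (at 1 within {1..T})"
    proof (rule has_vector_derivative_transform[OF _ _ has_vector_derivative_at_within[OF \<Phi>d]])
      show "\<Phi> 1 = \<Phi> t" if "t \<in> {1..T}" for t by (rule c1[rule_format, OF that, symmetric])
    qed (use T1 in simp)
    then have "?e 1 = 0"
      using vector_derivative_unique_within_closed_interval[of 1 T 1 "\<lambda>_. \<Phi> 1" "?e 1" 0] T1 by simp
    then show False by simp
  qed
  then show "Delta A A2 A3 l *v q = 0" using alt by blast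
qed

end

section \<open>The critical time\<close>

lemma transpose_zero: "transpose (0 :: complex^'n^'m) = 0"
  by (simp add: vec_eq_iff transpose_def)

lemma mpow_transpose:
  fixes A :: "complex^'n::finite^'n"
  shows "mpow (transpose A) k = transpose (mpow A k)"
proof (induction k)
  case (Suc k)
  have "mpow A (Suc k) = mpow A k ** A" for k
    by (induction k) (simp_all add: mpow_Suc mpow_0 matrix_mul_assoc)
  then show ?case using Suc by (simp add: mpow_Suc[of "transpose A"] matrix_transpose_mul)
qed (simp add: mpow_0)

lemma Delta_transpose:
  "Delta (transpose A) (\<lambda>\<theta>. transpose (A2 \<theta>)) (\<lambda>\<theta>. transpose (A3 \<theta>)) l = transpose (Delta A A2 A3 l)"
  by (auto simp: Delta_def transpose_def vec_eq_iff)

lemma transpose_hcat_kernel: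
  fixes M :: "complex^'n::finite^'m::finite" and B :: "complex^'r::finite^'m"
  assumes "transpose M *v q = 0" "transpose B *v q = 0" shows "transpose (hcat M B) *v q = 0"
  unfolding vec_eq_iff
proof
  fix k
  show "(transpose (hcat M B) *v q) $ k = 0 $ k"
  proof (cases k)
    case (Inl j)
    have "(transpose M *v q) $ j = 0" using assms(1) by simp
    then show ?thesis using Inl by (simp add: matrix_vector_mult_def transpose_def hcat_def)
  next
    case (Inr j)
    have "(transpose B *v q) $ j = 0" using assms(2) by simp
    then show ?thesis using Inr by (simp add: matrix_vector_mult_def transpose_def hcat_def)
  qed
qed

text \<open>A nonzero \<open>q\<close> killed by the transpose is a linear relation among the rows:
  one row lies in the span of the others and the row rank drops.\<close>

lemma full_row_rank_kernel:
  fixes M :: "complex^'m::finite^'n::finite"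
  assumes rk: "rank M = CARD('n)" and q: "transpose M *v q = 0" shows "q = 0"
proof (rule ccontr)
  assume "q \<noteq> 0"
  then obtain i where i: "q $ i \<noteq> 0" by (auto simp: vec_eq_iff)
  let ?W = "(\<lambda>k. row k M) ` (UNIV - {i})"
  have "0 = (\<Sum>k\<in>UNIV. q $ k *s row k M)"
    using q by (simp add: vec_eq_iff matrix_vector_mult_def transpose_def row_def mult.commute)
  also have "\<dots> = q $ i *s row i M + (\<Sum>k\<in>UNIV - {i}. q $ k *s row k M)" by (rule sum.remove) auto
  finally have "q $ i *s row i M = - (\<Sum>k\<in>UNIV - {i}. q $ k *s row k M)" by (simp add: eq_neg_iff_add_eq_0)
  also have "\<dots> \<in> vec.span ?W" by (intro vec.span_neg vec.span_sum vec.span_scale vec.span_base) auto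
  finally have "inverse (q $ i) *s (q $ i *s row i M) \<in> vec.span ?W" by (rule vec.span_scale)
  then have "row i M \<in> vec.span ?W" using i by simp
  then have "row k M \<in> vec.span ?W" for k by (cases "k = i") (auto intro: vec.span_base)
  then have "rows M \<subseteq> vec.span ?W" by (auto simp: rows_def)
  then have "vec.dim (rows M) \<le> card ?W" by (rule vec.dim_le_card) simp
  also have "\<dots> \<le> card (UNIV - {i})" by (rule card_image_le) simp
  also have "\<dots> < CARD('n)" by (simp add: card_Diff_singleton card_gt_0_iff)
  finally show False using rk by (simp add: row_rank_def_gen)
qed

lemma l2f_matrix:
  fixes M :: "real \<Rightarrow> complex^'m::finite^'n::finite"
  assumes "\<And>i j. L2on S (\<lambda>\<theta>. M \<theta> $ i $ j)"
  shows "l2f (\<lambda>\<theta>. indicator S \<theta> *\<^sub>R M \<theta>)"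
proof -
  have ax: "bounded_linear (axis i :: 'b::euclidean_space \<Rightarrow> 'b ^ 'k::finite)" for i
    unfolding linear_conv_bounded_linear[symmetric] by (rule linearI) (auto simp: vec_eq_iff axis_def)
  have "l2f (\<lambda>\<theta>. \<Sum>i\<in>UNIV. \<Sum>j\<in>UNIV. axis i (axis j (indicator S \<theta> *\<^sub>R M \<theta> $ i $ j) :: complex^'m))"
    using assms unfolding L2on_iff_l2f by (intro l2f_sum l2f_blin[OF _ ax])
  moreover have "(\<Sum>i\<in>UNIV. \<Sum>j\<in>UNIV. axis i (axis j (indicator S \<theta> *\<^sub>R M \<theta> $ i $ j) :: complex^'m)) = indicator S \<theta> *\<^sub>R M \<theta>" for \<theta>
  proof -
    have "(\<Sum>i\<in>UNIV. \<Sum>j\<in>UNIV. axis i (axis j (X $ i $ j) :: complex^'m)) $ a $ b = X $ a $ b" for X :: "complex^'m^'n" and a b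
    proof -
      have "(\<Sum>i\<in>UNIV. \<Sum>j\<in>UNIV. axis i (axis j (X $ i $ j) :: complex^'m)) $ a $ b
          = (\<Sum>i\<in>UNIV. if i = a then (\<Sum>j\<in>UNIV. if j = b then X $ a $ b else 0) else 0)"
        unfolding sum_component by (intro sum.cong refl) (auto simp: axis_def intro!: sum.cong)
      then show ?thesis by (simp add: sum.delta)
    qed
    from this[of "indicator S \<theta> *\<^sub>R M \<theta>"] show ?thesis by (simp add: vec_eq_iff)
  qed
  ultimately show ?thesis by simp
qed

text \<open>Solve for each basis vector and take the solutions as columns.\<close>

lemma krylov_right_inverse:
  fixes A :: "complex^'n::finite^'n" and B :: "complex^'r::finite^'n"
  assumes "krylov_rank A B \<nu> = CARD('n)"
  shows "\<exists>G :: nat \<Rightarrow> complex^'n^'r. \<forall>x. (\<Sum>j<\<nu>. mpow A j *v (B *v (G j *v x))) = x"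
proof -
  have "\<forall>i :: 'n. \<exists>v. axis i 1 = (\<Sum>k<\<nu>. mpow A k *v (B *v v k))"
    by (intro allI krylov_full assms)
  then obtain V where V: "\<And>i :: 'n. axis i 1 = (\<Sum>k<\<nu>. mpow A k *v (B *v V i k))" by metis
  define G :: "nat \<Rightarrow> complex^'n^'r" where "G k = (\<chi> a i. V i k $ a)" for k
  have G: "G k *v x = (\<Sum>i\<in>UNIV. x $ i *s V i k)" for k x
    by (simp add: vec_eq_iff G_def matrix_vector_mult_def mult.commute)
  have "(\<Sum>j<\<nu>. mpow A j *v (B *v (G j *v x))) = x" for x
  proof -
    have "(\<Sum>j<\<nu>. mpow A j *v (B *v (G j *v x))) = (\<Sum>j<\<nu>. \<Sum>i\<in>UNIV. x $ i *s (mpow A j *v (B *v V i j)))"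
      unfolding G mv.sum_right mv_scaleC ..
    also have "\<dots> = (\<Sum>i\<in>UNIV. \<Sum>j<\<nu>. x $ i *s (mpow A j *v (B *v V i j)))" by (rule sum.swap)
    also have "\<dots> = (\<Sum>i\<in>UNIV. x $ i *s axis i 1)" unfolding V vec.scale_sum_right ..
    also have "\<dots> = x" by (rule basis_expansion)
    finally show ?thesis .
  qed
  then show ?thesis by blast
qed

lemma (in delay_kernels) delay_kernels_transpose: "delay_kernels (\<lambda>\<theta>. transpose (A2 \<theta>)) (\<lambda>\<theta>. transpose (A3 \<theta>))"
  using l2f_blin[OF A2 blin_transpose] l2f_blin[OF A3 blin_transpose]
  by unfold_locales (simp_all add: transpose_scalar)

text \<open>Makes the equation of \<open>dual_function\<close>, written with the transposed kernel,
  an instance of the adjoint equation for the transposed coefficients.\<close>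

lemma (in delay_kernels) delay_kernel_on_transpose:
  "delay_kernels.delay_kernel_on (\<lambda>\<theta>. transpose (A2 \<theta>)) (\<lambda>\<theta>. transpose (A3 \<theta>)) T s = transpose (delay_kernel_on T s)"
proof -
  interpret d: delay_kernels "\<lambda>\<theta>. transpose (A2 \<theta>)" "\<lambda>\<theta>. transpose (A3 \<theta>)" by (rule delay_kernels_transpose)
  have "d.K3 x = transpose (K3 x)" for x
  proof -
    have "d.K3 x = (LINT \<theta>|lborel. transpose (if - x \<le> \<theta> then a3 \<theta> else 0))"
      unfolding d.K3_def by (rule Bochner_Integration.integral_cong) (auto simp: d.a3_def a3_def transpose_scalar transpose_zero)
    also have "\<dots> = transpose (K3 x)" unfolding K3_def by (rule integral_bounded_linear[OF blin_transpose K3_int])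
    finally show ?thesis .
  qed
  moreover have "d.K2 x = transpose (K2 x)" for x
    by (simp add: d.K2_def K2_def d.a2_def a2_def transpose_scalar transpose_zero)
  ultimately show ?thesis
    by (simp add: d.delay_kernel_on_def delay_kernel_on_def d.delay_kernel_def delay_kernel_def transpose_scalar linear_add[OF bounded_linear.linear[OF blin_transpose]])
qed

text \<open>Integration of g from c recovers the state up to null sets, so steering a trajectory to
  prescribed data steers it to the prescribed state.\<close>

lemma dom_data_determines:
  assumes d: "dom_data A x c g" and d': "dom_data A x' c g'" and g: "AE \<theta> in lborel. \<theta> \<in> {-1..0} \<longrightarrow> g \<theta> = g' \<theta>"
  shows "m2_equiv x x'"
proof -
  have m: "(\<lambda>s. indicator {-1..\<theta>} s *\<^sub>R h s) \<in> borel_measurable lborel" if "L2on {-1..0} h" "\<theta> \<le> 0" for \<theta> and h :: "real \<Rightarrow> complex^'a"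
  proof -
    have "(\<lambda>s. indicator {-1..\<theta>} s *\<^sub>R (indicat_real {-1..0} s *\<^sub>R h s)) \<in> borel_measurable borel"
      using l2f_meas[OF l2f_cmul_indicator[OF that(1)[unfolded L2on_iff_l2f]], of "{-1..\<theta>}"] by simp
    moreover have "(\<lambda>s. indicator {-1..\<theta>} s *\<^sub>R (indicat_real {-1..0} s *\<^sub>R h s)) = (\<lambda>s. indicator {-1..\<theta>} s *\<^sub>R h s)"
      using that(2) by (auto simp: indicator_def)
    ultimately show ?thesis by simp
  qed
  have I: "(LINT s:{-1..\<theta>}|lborel. g s) = (LINT s:{-1..\<theta>}|lborel. g' s)" if "\<theta> \<le> 0" for \<theta>
    unfolding set_lebesgue_integral_def
  proof (rule integral_cong_AE)
    show "AE s in lborel. indicat_real {-1..\<theta>} s *\<^sub>R g s = indicat_real {-1..\<theta>} s *\<^sub>R g' s"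
      using g
    proof eventually_elim
      case (elim s)
      then show ?case using that by (cases "s \<in> {-1..\<theta>}") auto
    qed
  qed (use d d' that in \<open>auto simp: dom_data_def intro!: m[simplified]\<close>)
  have "AE \<theta> in lborel. \<theta> \<in> {-1..0} \<longrightarrow> snd x \<theta> = c + (LINT s:{-1..\<theta>}|lborel. g s)"
    "AE \<theta> in lborel. \<theta> \<in> {-1..0} \<longrightarrow> snd x' \<theta> = c + (LINT s:{-1..\<theta>}|lborel. g' s)"
    using d d' by (simp_all add: dom_data_def)
  then have "AE \<theta> in lborel. \<theta> \<in> {-1..0} \<longrightarrow> snd x \<theta> = snd x' \<theta>"
    by eventually_elim (use I in auto)
  moreover have "fst x = fst x'" using d d' I[of 0] by (simp add: dom_data_def)
  ultimately show ?thesis by (simp add: m2_equiv_def)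
qed

section \<open>Reaching the whole domain for long times\<close>

context controlled_neutral
begin

lemma adjoint_right_inverse:
  "(\<Sum>j<\<nu>. transpose (G j) *v (transpose B *v (mpow (transpose A) j *v x))) = x"
proof -
  have "(\<Sum>j<\<nu>. mpow A j ** (B ** G j)) = mat 1"
    unfolding matrix_eq by (simp add: mv.sum_left GI flip: matrix_vector_mul_assoc)
  then have "transpose (\<Sum>j<\<nu>. mpow A j ** (B ** G j)) *v x = x" by simp
  then show ?thesis
    by (simp add: linear_sum[OF bounded_linear.linear[OF blin_transpose]] mv.sum_left matrix_transpose_mul mpow_transpose
        flip: matrix_vector_mul_assoc)
qed

lemma steering_exists:
  assumes rk: "\<And>l. rank (hcat (Delta A A2 A3 l) B) = CARD('n)"
  shows "\<exists>x u. l2f x \<and> l2f u \<and> (\<forall>t. t \<notin> {0..T} \<longrightarrow> x t = 0) \<and> (AE t in lborel. t \<in> {0..T} \<longrightarrow> neutral_op T x t = B *v u t)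
      \<and> primitive x (T - 1) = c \<and> (AE t in lborel. t \<in> {T - 1..T} \<longrightarrow> x t = l2_rep g t)"
proof (rule ccontr)
  interpret d: adjoint_system "\<lambda>\<theta>. transpose (A2 \<theta>)" "\<lambda>\<theta>. transpose (A3 \<theta>)" "transpose A" "transpose B" \<nu> "\<lambda>j. transpose (G j)"
    by (intro adjoint_system.intro adjoint_system_axioms.intro delay_kernels_transpose adjoint_right_inverse \<nu>)
  assume "\<not> ?thesis"
  from dual_function[OF this] obtain r a where r: "l2f r" "\<forall>t. t \<notin> {0..T} \<longrightarrow> r t = 0" "\<not> (AE t in lborel. r t = 0)"
    "AE t in lborel. t \<in> {0..T} \<longrightarrow> transpose B *v r t = 0"
    "AE t in lborel. t \<in> {1..T} \<longrightarrow> r t = transpose A *v r (t - 1) + convol (\<lambda>s. transpose (delay_kernel_on T s)) r t + a"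
    by (elim exE conjE)
  have "(\<lambda>s. transpose (delay_kernel_on T s)) = d.delay_kernel_on T" by (simp add: delay_kernel_on_transpose fun_eq_iff)
  note r5 = r(5)[unfolded this]
  have "\<exists>g\<in>d.adjoint_solutions T. \<exists>t\<in>{0..T}. g t \<noteq> 0"
    by (rule d.adjoint_solutions_of_AE[OF T\<nu> r(1) r(2)[rule_format] r(3,4) r5])
  then obtain g t where "g \<in> d.adjoint_solutions T" "t \<in> {0..T}" "g t \<noteq> 0" by (elim bexE)
  from d.adjoint_solutions_exponential[OF T\<nu> this] obtain T2 l q
    where q: "T2 > real \<nu>" "q \<noteq> 0" "(\<lambda>t. exp (l * complex_of_real t) *s q) \<in> d.adjoint_solutions T2" by (elim exE conjE)
  have "transpose (hcat (Delta A A2 A3 l) B) *v q = 0"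
    using d.adjoint_solutions_exponential_kernel[OF q(1,3)] by (intro transpose_hcat_kernel) (simp_all add: Delta_transpose)
  then have "q = 0" by (rule full_row_rank_kernel[OF rk])
  then show False using q(2) by contradiction
qed

lemma domA_subset_reach:
  assumes rk: "\<And>l. rank (hcat (Delta A A2 A3 l) B) = CARD('n)"
  shows "domA A \<subseteq> reach_set S B T"
proof
  fix x assume "x \<in> domA A"
  then obtain c g where x: "x \<in> M2" and d: "dom_data A x c g" by (auto simp: domA_def)
  have T0: "T \<ge> 0" using T1 by simp
  \<comment> \<open>The prescribed derivative history, moved from [-1, 0] to the last unit of time
    [T - 1, T].\<close>
  define h where "h t = indicat_real {-1..0} (t - T) *\<^sub>R g (t - T)" for t
  have "l2f (\<lambda>\<theta>. indicat_real {-1..0} \<theta> *\<^sub>R g \<theta>)" using d by (simp add: dom_data_def L2on_iff_l2f)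
  then have h: "l2f h" unfolding h_def by (rule l2f_shift')
  obtain f u where f: "l2f f" and u: "l2f u" and sf: "\<forall>t. t \<notin> {0..T} \<longrightarrow> f t = 0"
    and E: "AE t in lborel. t \<in> {0..T} \<longrightarrow> neutral_op T f t = B *v u t"
    and c: "primitive f (T - 1) = c" and tail: "AE t in lborel. t \<in> {T - 1..T} \<longrightarrow> f t = l2_rep (l2_class h) t"
    using steering_exists[OF rk, of c "l2_class h"] by (elim exE conjE)
  have f0: "f t = 0" if "t < 0" for t using sf that by simp
  have "AE t in lborel. t \<in> {T - 1..T} \<longrightarrow> f t = h t"
    using tail AE_l2_rep_l2_class[OF h] by eventually_elim simp
  from AE_shift[OF this, of T] have "AE \<theta> in lborel. \<theta> \<in> {-1..0} \<longrightarrow> g \<theta> = f (T + \<theta>)"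
    by eventually_elim (simp add: h_def add.commute)
  from dom_data_determines[OF d _ this] have "m2_equiv x (state_of A f T)"
    using state_of_dom_data[OF f f0, of T] unfolding c by blast
  then have eq: "class_of x = class_of (state_of A f T)" using class_of_eq_iff[OF x state_of_M2[OF f f0]] by blast
  \<comment> \<open>\<open>reach_iff\<close> reads the control in reversed time.\<close>
  have "L2on {0..T} (\<lambda>t. u (T - t))"
    unfolding L2on_iff_l2f by (intro l2f_cmul_indicator l2f_reflect u) simp
  moreover have "AE s in lborel. s \<in> {0..T} \<longrightarrow> neutral_op T f s = B *v u (T - (T - s))" using E by simp
  ultimately show "x \<in> reach_set S B T"
    unfolding reach_iff[OF T0] using x f sf eq by (intro conjI exI[of _ "\<lambda>t. u (T - t)"] exI[of _ f]) assumption+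
qed

end

theorem theorem8:
  fixes Am1 :: "complex^'n::finite^'n"
    and B :: "complex^'r::finite^'n"
    and A2 A3 :: "real \<Rightarrow> complex^'n^'n"
    and S :: "real \<Rightarrow> 'n m2 \<Rightarrow> 'n m2"
  assumes Am1_real: "\<forall>i j. Im (Am1 $ i $ j) = 0"
    and B_real: "\<forall>i j. Im (B $ i $ j) = 0"
    and A2_L2: "\<forall>i j. L2on {-1..0} (\<lambda>\<theta>. A2 \<theta> $ i $ j)"
    and A3_L2: "\<forall>i j. L2on {-1..0} (\<lambda>\<theta>. A3 \<theta> $ i $ j)"
    and S_gen: "is_semigroup_of S Am1 A2 A3"
    and rank_i: "\<forall>lam::complex. rank (hcat (Delta Am1 A2 A3 lam) B) = CARD('n)"
    and rank_ii: "krylov_rank Am1 B CARD('n) = CARD('n)"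
  shows "(\<forall>T. T > real (ctrb_index Am1 B) \<longrightarrow> reach_set S B T = domA Am1) \<and>
         (\<forall>T. T < real (ctrb_index Am1 B) \<longrightarrow> reach_set S B T \<noteq> domA Am1)"
proof -
  interpret neutral A2 A3 Am1 S
    by unfold_locales (use A2_L2 A3_L2 S_gen in \<open>simp_all add: l2f_matrix\<close>)
  define \<nu> where "\<nu> = ctrb_index Am1 B"
  have full: "krylov_rank Am1 B \<nu> = CARD('n)"
    unfolding \<nu>_def ctrb_index_def by (rule LeastI[of _ "CARD('n)"]) (rule rank_ii)
  \<comment> \<open>The empty Krylov family has rank 0 while n \<ge> 1, so the index is at least 1
    and its predecessor is meaningful.\<close>
  have "krylov_rank Am1 B 0 = 0" by (simp add: krylov_rank_def)
  then have \<nu>1: "\<nu> \<ge> 1" using full by (cases \<nu>) simp_all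
  have less: "krylov_rank Am1 B (\<nu> - 1) \<noteq> CARD('n)"
    using not_less_Least[of "\<nu> - 1" "\<lambda>\<nu>. krylov_rank Am1 B \<nu> = CARD('n)"] \<nu>1 unfolding \<nu>_def ctrb_index_def by linarith
  obtain G :: "nat \<Rightarrow> complex^'n^'r" where G: "\<And>x. (\<Sum>j<\<nu>. mpow Am1 j *v (B *v (G j *v x))) = x"
    using krylov_right_inverse[OF full] by blast
  obtain q where q: "q \<noteq> 0" "\<And>k v. k < \<nu> - 1 \<Longrightarrow> q \<bullet> (mpow Am1 k *v (B *v v)) = 0"
    using krylov_deficient[OF less] by blast
  have "reach_set S B T = domA Am1" if T: "T > real \<nu>" for T
  proof -
    interpret controlled_neutral A2 A3 Am1 S B \<nu> G T by unfold_locales (rule G T \<nu>1)+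
    show ?thesis using domA_subset_reach reach_subset_domA[of T B] T1 rank_i by (intro equalityI) simp_all
  qed
  moreover have "reach_set S B T \<noteq> domA Am1" if T: "T < real \<nu>" for T
  proof (cases "T < 0")
    case False
    \<comment> \<open>The kink argument is applied with \<nu> - 1 in place of \<nu>: that many
      Krylov blocks are deficient, and the history reaches one unit back from
      \<open>T\<close>.\<close>
    have "T - 1 < real (\<nu> - 1)" using T \<nu>1 by (simp add: of_nat_diff)
    then show ?thesis using unreachable[OF _ q] False by simp
  qed (rule unreachable_neg)
  ultimately show ?thesis unfolding \<nu>_def by blast
qed

end
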